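(* Let $s\ge 2$. For every $u_0\in H^s(\mathbb T)$ the Cauchy problem $$\partial_t u+\partial_x^3 u=6|u|^2\partial_x u,\qquad u(0)=u_0,\qquad u(t,x)\in\mathbb C,\ x\in\mathbb T,$$ admits a unique global strong solution $u\in\mathcal C(\mathbb R,H^s(\mathbb T))$. Moreover there is a constant $C>0$, depending on $s$ and $u_0$, such that $\|u(t)\|_{H^s(\mathbb T)}\le Ce^{C|t|}$ for all $t\in\mathbb R$.
   Context: $\mathbb T=\mathbb R/(2\pi\mathbb Z)$; functions are complex valued; $H^s(\mathbb T)$ is the Sobolev space with norm $\|J^su\|_{L^2}$, where $\widehat{J^sg}(m)=(1+|m|^2)^{s/2}\hat g(m)$. $W(t)u_0(x)=\sum_{k\in\mathbb Z}\widehat{u_0}(k)e^{i(kx+tk^3)}$ is the propagator of $\partial_tv+\partial_x^3v=0$. A function $u\in\mathcal C(I,H^s(\mathbb T))$, $0\in I\subset\mathbb R$ an interval, $s>4/3$, is a strong solution if for each $t\in I$ one has $u(t)=W(t)u_0+6\int_0^tW(t-t')(|u|^2\partial_xu)(t')\,dt'$ in the sense of distributions. Uniqueness is in the whole class of strong solutions in $\mathcal C(\mathbb R,H^s(\mathbb T))$ (unconditional uniqueness). *)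

theory Defs
  imports "HOL-Analysis.Analysis"
begin

text \<open>Functions on the torus are represented by 2 pi-periodic functions on the real line.
  Elements of the function spaces below are such functions, not equivalence classes, so equality
  in these spaces is equality almost everywhere.\<close>

definition periodic :: "(real \<Rightarrow> complex) \<Rightarrow> bool" where
  "periodic f \<longleftrightarrow> (\<forall>x. f (x + 2 * pi) = f x)"

definition L1_torus :: "(real \<Rightarrow> complex) set" where
  "L1_torus = {f. periodic f \<and> f \<in> borel_measurable lebesgue \<and>
     set_integrable lebesgue {0..2 * pi} f}"

definition L2_torus :: "(real \<Rightarrow> complex) set" where
  "L2_torus = {f. periodic f \<and> f \<in> borel_measurable lebesgue \<and>
     set_integrable lebesgue {0..2 * pi} (\<lambda>x. (cmod (f x))\<^sup>2)}"

definition L2_norm :: "(real \<Rightarrow> complex) \<Rightarrow> real" where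
  "L2_norm f = sqrt (LINT x:{0..2 * pi}|lebesgue. (cmod (f x))\<^sup>2)"

definition fourier_coeff :: "(real \<Rightarrow> complex) \<Rightarrow> int \<Rightarrow> complex" where
  "fourier_coeff f k =
     complex_of_real (1 / (2 * pi)) *
       (LINT x:{0..2 * pi}|lebesgue. f x * exp (- \<i> * complex_of_real (of_int k * x)))"

text \<open>\<open>is_bessel_potential s f g\<close> says that the distribution \<open>J\<^sup>s f\<close> is the
  square integrable function \<open>g\<close>; such a \<open>g\<close> is determined up to a null set.\<close>

definition is_bessel_potential :: "real \<Rightarrow> (real \<Rightarrow> complex) \<Rightarrow> (real \<Rightarrow> complex) \<Rightarrow> bool" where
  "is_bessel_potential s f g \<longleftrightarrow> g \<in> L2_torus \<and>
     (\<forall>m. fourier_coeff g m =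
        complex_of_real ((1 + (of_int m)\<^sup>2) powr (s / 2)) * fourier_coeff f m)"

definition bessel_potential :: "real \<Rightarrow> (real \<Rightarrow> complex) \<Rightarrow> real \<Rightarrow> complex" where
  "bessel_potential s f = (SOME g. is_bessel_potential s f g)"

text \<open>Only meant for nonnegative \<open>s\<close>, where every element of the Sobolev space is a
  square integrable function.\<close>

definition sobolev :: "real \<Rightarrow> (real \<Rightarrow> complex) set" where
  "sobolev s = {f \<in> L2_torus. \<exists>g. is_bessel_potential s f g}"

definition sobolev_norm :: "real \<Rightarrow> (real \<Rightarrow> complex) \<Rightarrow> real" where
  "sobolev_norm s f = L2_norm (bessel_potential s f)"

definition continuous_into_sobolev ::
  "real \<Rightarrow> real set \<Rightarrow> (real \<Rightarrow> real \<Rightarrow> complex) \<Rightarrow> bool" where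
  "continuous_into_sobolev s I u \<longleftrightarrow>
     (\<forall>t\<in>I. u t \<in> sobolev s) \<and>
     (\<forall>t0\<in>I. ((\<lambda>t. sobolev_norm s (\<lambda>x. u t x - u t0 x)) \<longlongrightarrow> 0) (at t0 within I))"

text \<open>In the next definition, \<open>D n\<close> is the \<open>n\<close>-th derivative of the test function.\<close>

definition test_function :: "(real \<Rightarrow> complex) \<Rightarrow> bool" where
  "test_function \<phi> \<longleftrightarrow> periodic \<phi> \<and>
     (\<exists>D. D 0 = \<phi> \<and> (\<forall>n x. (D n has_vector_derivative D (Suc n) x) (at x)))"

text \<open>Distributions on the torus are given by their values on test functions; the pairing is
  bilinear (no complex conjugation).\<close>

definition pairing :: "(real \<Rightarrow> complex) \<Rightarrow> (real \<Rightarrow> complex) \<Rightarrow> complex" where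
  "pairing f \<phi> = (LINT x:{0..2 * pi}|lebesgue. f x * \<phi> x)"

definition is_weak_deriv :: "(real \<Rightarrow> complex) \<Rightarrow> (real \<Rightarrow> complex) \<Rightarrow> bool" where
  "is_weak_deriv f g \<longleftrightarrow> g \<in> L1_torus \<and>
     (\<forall>\<phi>. test_function \<phi> \<longrightarrow>
        pairing f (\<lambda>x. vector_derivative \<phi> (at x)) = - pairing g \<phi>)"

definition weak_deriv :: "(real \<Rightarrow> complex) \<Rightarrow> real \<Rightarrow> complex" where
  "weak_deriv f = (SOME g. is_weak_deriv f g)"

text \<open>The distribution \<open>W(t) g\<close>: the series of the \<open>fourier_coeff g k\<close> times
  \<open>exp (i (k x + t k\<^sup>3))\<close> converges in the sense of distributions, that is, after pairing each
  term with a test function.\<close>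

definition airy_propagator ::
  "real \<Rightarrow> (real \<Rightarrow> complex) \<Rightarrow> (real \<Rightarrow> complex) \<Rightarrow> complex" where
  "airy_propagator t g \<phi> =
     (\<Sum>\<^sub>\<infinity>k\<in>(UNIV :: int set).
        pairing (\<lambda>x. fourier_coeff g k *
                   exp (\<i> * complex_of_real (of_int k * x + t * of_int k ^ 3))) \<phi>)"

definition nonlinearity :: "(real \<Rightarrow> complex) \<Rightarrow> real \<Rightarrow> complex" where
  "nonlinearity f = (\<lambda>x. complex_of_real ((cmod (f x))\<^sup>2) * weak_deriv f x)"

text \<open>The time integral is oriented, so it also covers negative \<open>t\<close>. Its integrand is
  continuous in time whenever \<open>u\<close> is continuous with values in the Sobolev space.\<close>

definition strong_solution ::
  "real \<Rightarrow> real set \<Rightarrow> (real \<Rightarrow> complex) \<Rightarrow> (real \<Rightarrow> real \<Rightarrow> complex) \<Rightarrow> bool" where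
  "strong_solution s I u0 u \<longleftrightarrow>
     s > 4 / 3 \<and> is_interval I \<and> 0 \<in> I \<and>
     continuous_into_sobolev s I u \<and>
     (\<forall>t\<in>I. \<forall>\<phi>. test_function \<phi> \<longrightarrow>
        pairing (u t) \<phi> =
          airy_propagator t u0 \<phi> +
          6 * (LBINT t'=ereal 0..ereal t. airy_propagator (t - t') (nonlinearity (u t')) \<phi>))"

end

theory Submission imports Defs begin

text \<open>On the Fourier side the equation is the system
  c'(t,k) = i k^3 c(t,k) + 6 N(c)(t,k) with N(c) the coefficients of |u|^2 u_x. The cubic term
  loses one derivative, but it cancels in the energy estimates: differences of two solutions that
  are bounded in H^2 are controlled in L^2, which gives uniqueness, and H^s norms grow at most
  exponentially as long as the H^2 norm is bounded. Local solutions are limits of the solutions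
  of the system truncated to finitely many modes. For smooth solutions the mass and the second
  order energy of the complex modified KdV hierarchy are conserved and bound the H^2 norm for all
  time, so smooth data have global solutions; rough data are approximated by truncated ones.
  Continuity in H^s holds because the modes are continuous and the norm bound restarted at a
  given time tends to the norm at that time. Solutions of the system and strong solutions
  correspond to each other by testing the Duhamel formula.\<close>

section \<open>Weighted sequences and convolutions\<close>

text \<open>The identity behind the second order energy uses the exact equation and its
  x-derivatives, whereas solutions are first built from truncated systems. So the truncated systems
  only supply a local theory, whose lifespan and H^s growth rates depend on the H^2 norm alone.
  Hence the H^8 regularity needed to differentiate the energy lasts as long as the H^2 bound does.
  The energy in turn bounds the H^2 norm at every time by the initial one, and steps of one fixed
  length can be repeated forever. The derivative loss cancels because |u|^2 is real: its
  coefficients are Hermitian, so the pairing of u with |u|^2 u_x becomes antisymmetric on taking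
  real parts, and only a commutator of frequency weights remains. The threshold s = 2 enters through
  Cauchy-Schwarz: an H^2 bound makes (1 + |k|) |c(k)| summable, so u and u_x are bounded and all
  products fall under Young's inequality. The energy is coercive by the sign of the cubic term: its
  sextic part is nonnegative, and its indefinite quartic part is dominated by a definite
  one.\<close>

definition br :: "int \<Rightarrow> real" where
  "br k = 1 + \<bar>real_of_int k\<bar>"

definition wt :: "real \<Rightarrow> int \<Rightarrow> real" where
  "wt s k = br k powr s"

text \<open>Norms are handled through bounds on all finite partial sums, so that summability need not be
  assumed separately.\<close>

definition b1 :: "(int \<Rightarrow> real) \<Rightarrow> real \<Rightarrow> bool" where
  "b1 f A \<longleftrightarrow> (\<forall>F. finite F \<longrightarrow> sum f F \<le> A)"

definition b2 :: "(int \<Rightarrow> real) \<Rightarrow> real \<Rightarrow> bool" where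
  "b2 f A \<longleftrightarrow> (\<forall>F. finite F \<longrightarrow> L2_set f F \<le> A)"

definition rconv :: "(int \<Rightarrow> real) \<Rightarrow> (int \<Rightarrow> real) \<Rightarrow> int \<Rightarrow> real" where
  "rconv f g k = (\<Sum>\<^sub>\<infinity>j. f (k - j) * g j)"

lemma br_ge1: "1 \<le> br k" and br_pos [simp]: "0 < br k" and br_nonneg [simp]: "0 \<le> br k"
  by (auto simp: br_def)

lemma br_minus [simp]: "br (- k) = br k"
  by (simp add: br_def)

lemma abs_le_br: "\<bar>real_of_int k\<bar> \<le> br k"
  by (simp add: br_def)

lemma br_triangle: "br k \<le> br (k - j) + br j"
  by (simp add: br_def)

text \<open>This is why the weight is \<open>1 + |k|\<close> and not the square root of
  \<open>1 + k^2\<close>: it is submultiplicative without any constant, so the sequences with a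
  \<open>w1\<close> bound form an algebra with constant 1.\<close>

lemma br_mult: "br k \<le> br (k - j) * br j"
proof -
  have "\<bar>real_of_int k\<bar> \<le> \<bar>real_of_int (k - j)\<bar> + \<bar>real_of_int j\<bar>"
    by (metis abs_triangle_ineq diff_add_cancel of_int_add)
  moreover have "0 \<le> \<bar>real_of_int (k - j)\<bar> * \<bar>real_of_int j\<bar>" by simp
  ultimately show ?thesis unfolding br_def by (simp only: distrib_left distrib_right mult_1 mult_1_right)
qed

lemma br_neq0 [simp]: "br k \<noteq> 0"
  by (metis br_pos less_irrefl)

lemma wt_pos [simp]: "0 < wt s k" and wt_nonneg [simp]: "0 \<le> wt s k"
  by (simp_all add: wt_def)

lemma wt_minus [simp]: "wt s (- k) = wt s k"
  by (simp add: wt_def)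

lemma wt_0 [simp]: "wt 0 k = 1"
  by (simp add: wt_def)

lemma wt_1 [simp]: "wt 1 k = br k"
  by (simp add: wt_def)

lemma wt_2: "wt 2 k = (br k)\<^sup>2"
  by (simp add: wt_def)

lemma wt_mono: "s \<le> t \<Longrightarrow> wt s k \<le> wt t k"
  unfolding wt_def by (intro powr_mono) (auto simp: br_ge1)

lemma wt_add: "wt (s + t) k = wt s k * wt t k"
  by (simp add: wt_def powr_add)

text \<open>The larger of \<open>br (k - j)\<close> and \<open>br j\<close> is at least half of
  \<open>br k\<close>. Having a sum on the right, and not a product, is what makes
  \<open>hb_conv\<close> linear in the high norms.\<close>

lemma wt_triangle:
  assumes "0 \<le> s"
  shows "wt s k \<le> 2 powr s * (wt s (k - j) + wt s j)"
proof -
  have "br k \<le> 2 * max (br (k - j)) (br j)"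
    using br_triangle[of k j] by linarith
  hence "wt s k \<le> (2 * max (br (k - j)) (br j)) powr s"
    unfolding wt_def using assms by (intro powr_mono2) auto
  also have "\<dots> = 2 powr s * max (br (k - j)) (br j) powr s"
    by (simp add: powr_mult)
  also have "max (br (k - j)) (br j) powr s \<le> wt s (k - j) + wt s j"
    unfolding wt_def by (auto simp: max_def)
  finally show ?thesis by (simp add: mult_left_mono)
qed

lemma b1_nonneg: "b1 f A \<Longrightarrow> 0 \<le> A"
  unfolding b1_def by (metis finite.emptyI sum.empty)

lemma b2_nonneg: "b2 f A \<Longrightarrow> 0 \<le> A"
  unfolding b2_def by (metis finite.emptyI L2_set_empty)

lemma b1_D: "b1 f A \<Longrightarrow> finite F \<Longrightarrow> sum f F \<le> A"
  by (simp add: b1_def)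

lemma b2_D: "b2 f A \<Longrightarrow> finite F \<Longrightarrow> L2_set f F \<le> A"
  by (simp add: b2_def)

lemma b2_sum: "b2 f A \<Longrightarrow> finite F \<Longrightarrow> (\<Sum>k\<in>F. (f k)\<^sup>2) \<le> A\<^sup>2"
  unfolding b2_def L2_set_def
  by (metis real_sqrt_le_iff real_sqrt_unique sqrt_le_D)

lemma b2_I: "0 \<le> A \<Longrightarrow> (\<And>F. finite F \<Longrightarrow> (\<Sum>k\<in>F. (f k)\<^sup>2) \<le> A\<^sup>2) \<Longrightarrow> b2 f A"
  unfolding b2_def L2_set_def by (auto intro!: real_le_lsqrt sum_nonneg)

lemma b1_pointwise:
  assumes "b1 f A" shows "f k \<le> A"
  using b1_D[OF assms, of "{k}"] by simp

lemma b2_pointwise: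
  assumes "b2 f A" shows "\<bar>f k\<bar> \<le> A"
  using b2_D[OF assms, of "{k}"] by (simp add: L2_set_def)

lemma b1_mono:
  assumes "b1 f A" "\<And>k. g k \<le> f k" "A \<le> B" shows "b1 g B"
  unfolding b1_def using assms(1)[unfolded b1_def] assms(2,3) by (meson order_trans sum_mono)

lemma b2_mono:
  assumes "b2 f A" "\<And>k. \<bar>g k\<bar> \<le> \<bar>f k\<bar>" "A \<le> B" shows "b2 g B"
proof (rule b2_I)
  show "0 \<le> B" using b2_nonneg[OF assms(1)] assms(3) by simp
  fix F :: "int set" assume F: "finite F"
  have "(\<Sum>k\<in>F. (g k)\<^sup>2) \<le> (\<Sum>k\<in>F. (f k)\<^sup>2)"
    by (intro sum_mono) (metis assms(2) abs_le_square_iff)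
  also have "\<dots> \<le> A\<^sup>2" by (rule b2_sum[OF assms(1) F])
  also have "\<dots> \<le> B\<^sup>2" using b2_nonneg[OF assms(1)] assms(3) by (simp add: power_mono)
  finally show "(\<Sum>k\<in>F. (g k)\<^sup>2) \<le> B\<^sup>2" .
qed

lemma b2_add:
  assumes "b2 f A" "b2 g B" shows "b2 (\<lambda>k. f k + g k) (A + B)"
  unfolding b2_def
proof (intro allI impI)
  fix F :: "int set" assume "finite F"
  thus "L2_set (\<lambda>k. f k + g k) F \<le> A + B"
    using L2_set_triangle_ineq[of f g F] b2_D[OF assms(1)] b2_D[OF assms(2)] by fastforce
qed

lemma b2_cmult: "b2 f A \<Longrightarrow> 0 \<le> c \<Longrightarrow> b2 (\<lambda>k. c * f k) (c * A)"
  unfolding b2_def by (simp add: L2_set_right_distrib[symmetric] mult_left_mono)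

lemma b1_cmult: "b1 f A \<Longrightarrow> 0 \<le> c \<Longrightarrow> b1 (\<lambda>k. c * f k) (c * A)"
  unfolding b1_def by (simp add: sum_distrib_left[symmetric] mult_left_mono)

lemma b1_summable:
  assumes "b1 f A" "\<And>k. 0 \<le> f k"
  shows "f summable_on UNIV"
  by (rule nonneg_bdd_above_summable_on)
     (use assms in \<open>auto simp: b1_def bdd_above_def\<close>)

lemma b1_infsum:
  assumes "b1 f A" "\<And>k. 0 \<le> f k"
  shows "infsum f UNIV \<le> A"
  by (rule infsum_le_finite_sums[OF b1_summable[OF assms]]) (use assms in \<open>auto simp: b1_def\<close>)

lemma b1_reflect:
  assumes "b1 f A" shows "b1 (\<lambda>j. f (k - j)) A"
  unfolding b1_def
proof (intro allI impI)
  fix F :: "int set" assume F: "finite F"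
  have "(\<Sum>j\<in>F. f (k - j)) = sum f ((\<lambda>j. k - j) ` F)"
    by (subst sum.reindex) (auto simp: inj_on_def)
  also have "\<dots> \<le> A" using assms F by (simp add: b1_def)
  finally show "(\<Sum>j\<in>F. f (k - j)) \<le> A" .
qed

lemma b1_minus: "b1 f A \<Longrightarrow> b1 (\<lambda>j. f (- j)) A"
  using b1_reflect[of f A 0] by simp

lemma b2_minus:
  assumes "b2 f A" shows "b2 (\<lambda>j. f (- j)) A"
proof (rule b2_I[OF b2_nonneg[OF assms]])
  fix F :: "int set" assume F: "finite F"
  have "(\<Sum>j\<in>F. (f (- j))\<^sup>2) = (\<Sum>j\<in>uminus ` F. (f j)\<^sup>2)"
    by (subst sum.reindex) (auto simp: inj_on_def)
  also have "\<dots> \<le> A\<^sup>2" using assms F by (intro b2_sum) auto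
  finally show "(\<Sum>j\<in>F. (f (- j))\<^sup>2) \<le> A\<^sup>2" .
qed

text \<open>Schur's argument: \<open>f\<close> is split into two square roots, one for each of
  \<open>x\<close> and \<open>y\<close>. Cauchy-Schwarz on the pairs \<open>(k, j)\<close> then
  leaves row and column sums of \<open>f\<close>, each at most \<open>A\<close>.\<close>

lemma young_finite:
  fixes f x y :: "int \<Rightarrow> real"
  assumes f: "b1 f A" "\<And>k. 0 \<le> f k" and F: "finite F" "finite G"
  shows "(\<Sum>k\<in>F. \<Sum>j\<in>G. f (k - j) * x k * y j) \<le> A * L2_set x F * L2_set y G"
proof -
  have A0: "0 \<le> A" by (rule b1_nonneg[OF f(1)])
  let ?a = "\<lambda>p. sqrt (f (fst p - snd p)) * x (fst p)"
  let ?b = "\<lambda>p. sqrt (f (fst p - snd p)) * y (snd p)"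
  have key: "f (k - j) * x k * y j = sqrt (f (k - j)) * x k * (sqrt (f (k - j)) * y j)" for k j
  proof -
    have "sqrt (f (k - j)) * x k * (sqrt (f (k - j)) * y j) =
      (sqrt (f (k - j)) * sqrt (f (k - j))) * x k * y j" by (simp only: mult_ac)
    thus ?thesis using f(2) by simp
  qed
  have "(\<Sum>k\<in>F. \<Sum>j\<in>G. f (k - j) * x k * y j) = (\<Sum>p\<in>F\<times>G. ?a p * ?b p)"
    unfolding sum.cartesian_product by (intro sum.cong refl) (simp only: case_prod_beta key)
  also have "\<dots> \<le> (\<Sum>p\<in>F\<times>G. \<bar>?a p\<bar> * \<bar>?b p\<bar>)"
    by (intro sum_mono) (metis abs_ge_self abs_mult)
  also have "\<dots> \<le> L2_set ?a (F\<times>G) * L2_set ?b (F\<times>G)"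
    by (rule L2_set_mult_ineq)
  also have "L2_set ?a (F\<times>G) \<le> sqrt A * L2_set x F"
  proof -
    have "(\<Sum>p\<in>F\<times>G. (?a p)\<^sup>2) = (\<Sum>k\<in>F. \<Sum>j\<in>G. f (k - j) * (x k)\<^sup>2)"
      unfolding sum.cartesian_product by (intro sum.cong refl) (auto simp: power_mult_distrib f(2))
    also have "\<dots> = (\<Sum>k\<in>F. (\<Sum>j\<in>G. f (k - j)) * (x k)\<^sup>2)"
      by (simp add: sum_distrib_right)
    also have "\<dots> \<le> (\<Sum>k\<in>F. A * (x k)\<^sup>2)"
      by (intro sum_mono mult_right_mono b1_D[OF b1_reflect[OF f(1)] F(2)]) auto
    also have "\<dots> = A * (\<Sum>k\<in>F. (x k)\<^sup>2)" by (simp add: sum_distrib_left)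
    finally show ?thesis unfolding L2_set_def by (simp only: real_sqrt_mult[symmetric] real_sqrt_le_mono)
  qed
  also have "L2_set ?b (F\<times>G) \<le> sqrt A * L2_set y G"
  proof -
    have "(\<Sum>p\<in>F\<times>G. (?b p)\<^sup>2) = (\<Sum>k\<in>F. \<Sum>j\<in>G. f (k - j) * (y j)\<^sup>2)"
      unfolding sum.cartesian_product by (intro sum.cong refl) (auto simp: power_mult_distrib f(2))
    also have "\<dots> = (\<Sum>j\<in>G. \<Sum>k\<in>F. f (k - j) * (y j)\<^sup>2)" by (rule sum.swap)
    also have "\<dots> = (\<Sum>j\<in>G. (\<Sum>k\<in>F. f (k - j)) * (y j)\<^sup>2)"
      by (simp add: sum_distrib_right)
    also have "\<dots> \<le> (\<Sum>j\<in>G. A * (y j)\<^sup>2)"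
    proof (intro sum_mono mult_right_mono)
      fix j
      have "(\<Sum>k\<in>F. f (k - j)) = sum f ((\<lambda>k. k - j) ` F)"
        by (subst sum.reindex) (auto simp: inj_on_def)
      also have "\<dots> \<le> A" using f(1) F by (simp add: b1_def)
      finally show "(\<Sum>k\<in>F. f (k - j)) \<le> A" .
    qed auto
    also have "\<dots> = A * (\<Sum>j\<in>G. (y j)\<^sup>2)" by (simp add: sum_distrib_left)
    finally show ?thesis unfolding L2_set_def by (simp only: real_sqrt_mult[symmetric] real_sqrt_le_mono)
  qed
  finally have "(\<Sum>k\<in>F. \<Sum>j\<in>G. f (k - j) * x k * y j)
      \<le> (sqrt A * L2_set x F) * (sqrt A * L2_set y G)"
    by (simp add: mult_left_mono mult_right_mono L2_set_nonneg A0)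
  also have "\<dots> = (sqrt A * sqrt A) * L2_set x F * L2_set y G" by (simp only: mult_ac)
  finally show ?thesis using A0 by simp
qed

lemma b1_mult_bounded:
  assumes "b1 f A" "\<And>k. 0 \<le> f k" "\<And>k. 0 \<le> g k" "\<And>k. g k \<le> B"
  shows "b1 (\<lambda>j. f (k - j) * g j) (A * B)"
proof -
  have B: "0 \<le> B" using assms(3,4) order_trans by blast
  have "b1 (\<lambda>j. B * f (k - j)) (B * A)"
    by (intro b1_cmult b1_reflect assms B)
  thus ?thesis by (rule b1_mono) (use assms in \<open>auto simp: mult.commute[of B] mult_left_mono\<close>)
qed

lemma rconv_summable:
  assumes "b1 f A" "\<And>k. 0 \<le> f k" "\<And>k. 0 \<le> g k" "\<And>k. g k \<le> B"
  shows "(\<lambda>j. f (k - j) * g j) summable_on UNIV"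
  by (rule b1_summable[OF b1_mult_bounded[OF assms]]) (use assms in auto)

lemma rconv_nonneg: "(\<And>k. 0 \<le> f k) \<Longrightarrow> (\<And>k. 0 \<le> g k) \<Longrightarrow> 0 \<le> rconv f g k"
  unfolding rconv_def by (intro infsum_nonneg) auto

lemma rconv_bound:
  assumes "b1 f A" "\<And>k. 0 \<le> f k" "\<And>k. 0 \<le> g k" "\<And>k. g k \<le> B"
  shows "rconv f g k \<le> A * B"
  unfolding rconv_def by (rule b1_infsum[OF b1_mult_bounded[OF assms]]) (use assms in auto)

text \<open>Lets the inner sum of a finite bilinear estimate grow to the whole convolution, so that
  every convolution bound can be proved on finite sets.\<close>

lemma rconv_finite_limit:
  fixes z :: "int \<Rightarrow> real"
  assumes fg: "b1 f A" "\<And>k. 0 \<le> f k" "\<And>k. 0 \<le> g k" "\<And>k. g k \<le> B"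
    and F: "finite F"
    and le: "\<And>G. finite G \<Longrightarrow> (\<Sum>k\<in>F. \<Sum>j\<in>G. f (k - j) * z k * g j) \<le> M"
  shows "(\<Sum>k\<in>F. z k * rconv f g k) \<le> M"
proof (rule tendsto_upperbound)
  show "((\<lambda>G. \<Sum>k\<in>F. z k * (\<Sum>j\<in>G. f (k - j) * g j)) \<longlongrightarrow> (\<Sum>k\<in>F. z k * rconv f g k))
      (finite_subsets_at_top UNIV)"
    unfolding rconv_def
    by (intro tendsto_intros infsum_tendsto rconv_summable[OF fg])
  show "\<forall>\<^sub>F G in finite_subsets_at_top UNIV. (\<Sum>k\<in>F. z k * (\<Sum>j\<in>G. f (k - j) * g j)) \<le> M"
    using le by (auto intro!: eventually_finite_subsets_at_top_weakI simp: sum_distrib_left mult_ac)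
qed simp

text \<open>Young's inequality by duality: the convolution is tested against itself, and one factor
  of its own norm is cancelled at the end.\<close>

lemma rconv_b2:
  assumes "b1 f A" "\<And>k. 0 \<le> f k" "b2 g B" "\<And>k. 0 \<le> g k"
  shows "b2 (rconv f g) (A * B)"
  unfolding b2_def
proof (intro allI impI)
  fix F :: "int set" assume F: "finite F"
  have gB: "g k \<le> B" for k using b2_pointwise[OF assms(3), of k] by simp
  note A0 = b1_nonneg[OF assms(1)] and B0 = b2_nonneg[OF assms(3)]
  let ?z = "rconv f g"
  have "(\<Sum>k\<in>F. ?z k * rconv f g k) \<le> A * L2_set ?z F * B"
  proof (rule rconv_finite_limit[OF assms(1,2,4) gB F])
    fix G :: "int set" assume G: "finite G"
    have "(\<Sum>k\<in>F. \<Sum>j\<in>G. f (k - j) * ?z k * g j) \<le> A * L2_set ?z F * L2_set g G"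
      by (rule young_finite[OF assms(1,2) F G])
    also have "\<dots> \<le> A * L2_set ?z F * B"
      by (intro mult_left_mono b2_D[OF assms(3) G]) (auto simp: A0 L2_set_nonneg)
    finally show "(\<Sum>k\<in>F. \<Sum>j\<in>G. f (k - j) * ?z k * g j) \<le> A * L2_set ?z F * B" .
  qed
  moreover have "(\<Sum>k\<in>F. ?z k * rconv f g k) = (L2_set ?z F)\<^sup>2"
    unfolding L2_set_def by (simp add: sum_nonneg power2_eq_square)
  ultimately have "L2_set ?z F * L2_set ?z F \<le> (A * B) * L2_set ?z F"
    by (simp add: power2_eq_square mult_ac)
  thus "L2_set ?z F \<le> A * B"
    by (metis A0 B0 L2_set_nonneg linorder_not_le mult_nonneg_nonneg mult_right_le_imp_le order_le_less)
qed

lemma rconv_b1: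
  assumes "b1 f A" "\<And>k. 0 \<le> f k" "b1 g B" "\<And>k. 0 \<le> g k"
  shows "b1 (rconv f g) (A * B)"
  unfolding b1_def
proof (intro allI impI)
  fix F :: "int set" assume F: "finite F"
  have gB: "g k \<le> B" for k using b1_pointwise[OF assms(3), of k] by simp
  note A0 = b1_nonneg[OF assms(1)] and B0 = b1_nonneg[OF assms(3)]
  have "(\<Sum>k\<in>F. 1 * rconv f g k) \<le> A * B"
  proof (rule rconv_finite_limit[OF assms(1,2,4) gB F])
    fix G :: "int set" assume G: "finite G"
    have "(\<Sum>k\<in>F. \<Sum>j\<in>G. f (k - j) * 1 * g j) = (\<Sum>j\<in>G. (\<Sum>k\<in>F. f (k - j)) * g j)"
      by (subst sum.swap) (simp add: sum_distrib_right)
    also have "\<dots> \<le> (\<Sum>j\<in>G. A * g j)"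
    proof (intro sum_mono mult_right_mono assms)
      fix j
      have "(\<Sum>k\<in>F. f (k - j)) = sum f ((\<lambda>k. k - j) ` F)"
        by (subst sum.reindex) (auto simp: inj_on_def)
      also have "\<dots> \<le> A" using assms(1) F by (simp add: b1_def)
      finally show "(\<Sum>k\<in>F. f (k - j)) \<le> A" .
    qed
    also have "\<dots> \<le> A * B" using b1_D[OF assms(3) G] A0 
      by (simp add: sum_distrib_left[symmetric] mult_left_mono)
    finally show "(\<Sum>k\<in>F. \<Sum>j\<in>G. f (k - j) * 1 * g j) \<le> A * B" .
  qed
  thus "sum (rconv f g) F \<le> A * B" by simp
qed

lemma infsum_reflect:
  fixes f :: "int \<Rightarrow> 'a::{comm_monoid_add,t2_space}"
  shows "(\<Sum>\<^sub>\<infinity>j. f (k - j)) = (\<Sum>\<^sub>\<infinity>j. f j)"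
  by (rule infsum_reindex_bij_witness[of _ "\<lambda>j. k - j" "\<lambda>j. k - j"]) auto

lemma rconv_comm: "rconv f g k = rconv g f k"
  unfolding rconv_def using infsum_reflect[of "\<lambda>j. f (k - j) * g j" k]
  by (simp add: mult.commute)

lemma sum_inverse_br_squared: "b2 (\<lambda>k. inverse (br k)) 2"
proof (rule b2_I)
  fix F :: "int set" assume F: "finite F"
  obtain n :: nat where n: "F \<subseteq> {- int n..int n}"
  proof -
    have N: "\<And>k. k \<in> F \<Longrightarrow> \<bar>k\<bar> \<le> Max (abs ` F)" using F by simp
    define N where "N = Max (abs ` F)"
    note N = N[folded N_def]
    have "F \<subseteq> {- int (nat N)..int (nat N)}" using N by (force simp: abs_le_iff)
    thus ?thesis using that by blast
  qed
  have "(\<Sum>k\<in>F. (inverse (br k))\<^sup>2) \<le> (\<Sum>k\<in>{- int n..int n}. (inverse (br k))\<^sup>2)"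
    by (intro sum_mono2 n) auto
  \<comment> \<open>Telescoping bound: 1/(n+2)^2 is at most 1/(n+1) - 1/(n+2), and each such term
    occurs for two signs. The total 3 is rounded up to 4, which makes the norm 2.\<close>
  also have "\<dots> \<le> 3 - 2 / (real n + 1)"
  proof (induction n)
    case 0 show ?case by (simp add: br_def)
  next
    case (Suc n)
    have eq: "{- int (Suc n)..int (Suc n)} = insert (- int (Suc n)) (insert (int (Suc n)) {- int n..int n})"
      by auto
    have "(\<Sum>k\<in>{- int (Suc n)..int (Suc n)}. (inverse (br k))\<^sup>2) =
      2 * (inverse (2 + real n))\<^sup>2 + (\<Sum>k\<in>{- int n..int n}. (inverse (br k))\<^sup>2)"
      unfolding eq by (subst sum.insert, simp, simp, subst sum.insert, simp, simp) (simp add: br_def)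
    moreover have "(inverse (2 + real n))\<^sup>2 \<le> 1 / (real n + 1) - 1 / (real n + 2)"
    proof -
      have "1 / (real n + 1) - 1 / (real n + 2) = 1 / ((real n + 1) * (real n + 2))"
        by (simp add: divide_simps)
      moreover have "1 / ((real n + 2) * (real n + 2)) \<le> 1 / ((real n + 1) * (real n + 2))"
        by (intro divide_left_mono mult_right_mono mult_pos_pos) auto
      moreover have "(inverse (2 + real n))\<^sup>2 = 1 / ((real n + 2) * (real n + 2))"
        by (simp add: power2_eq_square field_simps)
      ultimately show ?thesis by simp
    qed
    moreover have "3 - 2 / (real (Suc n) + 1) = 3 - 2 / (real n + 2)" by (simp add: add.commute)
    ultimately show ?case using Suc by linarith
  qed
  also have "\<dots> \<le> 2\<^sup>2" by (simp add: field_simps)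
  finally show "(\<Sum>k\<in>F. (inverse (br k))\<^sup>2) \<le> 2\<^sup>2" .
qed simp

text \<open>Cauchy-Schwarz against \<open>inverse (br k)\<close>. This is the embedding of H^1 into
  the absolutely convergent Fourier series and the origin of every factor 2 in bounds such as
  \<open>2 * K\<close>.\<close>

lemma b2_to_b1:
  assumes "b2 (\<lambda>k. br k * g k) B" "\<And>k. 0 \<le> g k"
  shows "b1 g (2 * B)"
  unfolding b1_def
proof (intro allI impI)
  fix F :: "int set" assume F: "finite F"
  have "sum g F = (\<Sum>k\<in>F. \<bar>inverse (br k)\<bar> * \<bar>br k * g k\<bar>)"
    by (intro sum.cong) (auto simp: abs_mult assms field_simps)
  also have "\<dots> \<le> L2_set (\<lambda>k. inverse (br k)) F * L2_set (\<lambda>k. br k * g k) F"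
    by (rule L2_set_mult_ineq)
  also have "\<dots> \<le> 2 * B"
    by (intro mult_mono b2_D sum_inverse_br_squared assms F) (auto simp: L2_set_nonneg)
  finally show "sum g F \<le> 2 * B" .
qed

section \<open>Fourier coefficients of products and of the cubic term\<close>

definition conv :: "(int \<Rightarrow> complex) \<Rightarrow> (int \<Rightarrow> complex) \<Rightarrow> int \<Rightarrow> complex" where
  "conv a b k = (\<Sum>\<^sub>\<infinity>j. a (k - j) * b j)"

definition ct :: "(int \<Rightarrow> complex) \<Rightarrow> int \<Rightarrow> complex" where
  "ct c j = cnj (c (- j))"

definition Dx :: "(int \<Rightarrow> complex) \<Rightarrow> int \<Rightarrow> complex" where
  "Dx c j = \<i> * of_int j * c j"

text \<open>The coefficients of |u|^2, as \<open>ct\<close> gives those of the complex conjugate of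
  u.\<close>

definition gg :: "(int \<Rightarrow> complex) \<Rightarrow> int \<Rightarrow> complex" where
  "gg c = conv c (ct c)"

definition nl :: "(int \<Rightarrow> complex) \<Rightarrow> int \<Rightarrow> complex" where
  "nl c = conv (gg c) (Dx c)"

definition hb :: "real \<Rightarrow> (int \<Rightarrow> complex) \<Rightarrow> real \<Rightarrow> bool" where
  "hb s c K \<longleftrightarrow> b2 (\<lambda>k. wt s k * cmod (c k)) K"

text \<open>Wiener algebra norms: \<open>a1\<close> bounds the function uniformly, \<open>w1\<close>
  also its derivative, while \<open>hb s\<close> is the H^s norm up to equivalence. Working in
  \<open>w1\<close> replaces all sup norm estimates for products.\<close>

definition w1 :: "(int \<Rightarrow> complex) \<Rightarrow> real \<Rightarrow> bool" where
  "w1 c A \<longleftrightarrow> b1 (\<lambda>k. br k * cmod (c k)) A"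

definition a1 :: "(int \<Rightarrow> complex) \<Rightarrow> real \<Rightarrow> bool" where
  "a1 c A \<longleftrightarrow> b1 (\<lambda>k. cmod (c k)) A"

lemma hb_nonneg: "hb s c K \<Longrightarrow> 0 \<le> K" by (auto simp: hb_def b2_nonneg)
lemma w1_nonneg: "w1 c K \<Longrightarrow> 0 \<le> K" by (auto simp: w1_def b1_nonneg)
lemma hb0: "hb 0 c K \<longleftrightarrow> b2 (\<lambda>k. cmod (c k)) K" by (simp add: hb_def)

lemma hb_mono: "hb s c K \<Longrightarrow> t \<le> s \<Longrightarrow> K \<le> L \<Longrightarrow> hb t c L"
  unfolding hb_def by (erule b2_mono) (auto simp: abs_mult wt_mono mult_right_mono)

lemma hb_pointwise: "hb s c K \<Longrightarrow> wt s k * cmod (c k) \<le> K"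
  unfolding hb_def by (metis abs_le_D1 b2_pointwise)

lemma hb_pointwise0:
  assumes "hb s c K" "0 \<le> s" shows "cmod (c k) \<le> K"
  using hb_pointwise[OF hb_mono[OF assms order_refl], of k] by simp

lemma w1_a1: "w1 c A \<Longrightarrow> a1 c A"
  unfolding w1_def a1_def
  by (erule b1_mono) (use br_ge1 mult_right_mono[of 1] in \<open>auto intro: mult_right_mono simp: mult_le_cancel_right1\<close>)

lemma cmod_Dx: "cmod (Dx c j) = \<bar>real_of_int j\<bar> * cmod (c j)"
  by (simp add: Dx_def norm_mult)

lemma cmod_ct: "cmod (ct c j) = cmod (c (- j))"
  by (simp add: ct_def)

lemma w1_Dx: "w1 c A \<Longrightarrow> a1 (Dx c) A"
  unfolding w1_def a1_def by (erule b1_mono) (auto simp: cmod_Dx abs_le_br mult_right_mono)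

lemma a1_ct: "a1 c A \<Longrightarrow> a1 (ct c) A"
  unfolding a1_def cmod_ct by (rule b1_minus)

lemma w1_ct: "w1 c A \<Longrightarrow> w1 (ct c) A"
  unfolding w1_def cmod_ct using b1_minus by fastforce

lemma hb_ct: "hb s c A \<Longrightarrow> hb s (ct c) A"
  unfolding hb_def cmod_ct using b2_minus by fastforce

text \<open>One of the two powers of the H^2 weight pays for summability, the other is kept. This is
  where regularity 2 is consumed: it makes u_x a bounded factor.\<close>

lemma hb_w1: "hb 2 c K \<Longrightarrow> w1 c (2 * K)"
  unfolding hb_def w1_def
  by (rule b2_to_b1) (auto simp: wt_2 power2_eq_square mult_ac elim: b2_mono)

lemma hb_triangle:
  assumes "hb s a A" "hb s b B" "\<And>k. cmod (c k) \<le> cmod (a k) + cmod (b k)"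
  shows "hb s c (A + B)"
proof -
  have "b2 (\<lambda>k. wt s k * cmod (a k) + wt s k * cmod (b k)) (A + B)"
    using assms by (intro b2_add) (auto simp: hb_def)
  thus ?thesis unfolding hb_def
    by (rule b2_mono) (use assms(3) in \<open>auto simp: distrib_left[symmetric] abs_mult intro!: mult_left_mono\<close>)
qed

lemma hb_diff: "hb s a A \<Longrightarrow> hb s b B \<Longrightarrow> hb s (\<lambda>k. a k - b k) (A + B)"
  by (erule hb_triangle) (auto simp: norm_triangle_ineq4)

lemma conv_summable:
  assumes "a1 a A" "\<And>k. cmod (b k) \<le> B"
  shows "(\<lambda>j. cmod (a (k - j) * b j)) summable_on UNIV"
  using rconv_summable[of "\<lambda>k. cmod (a k)" A "\<lambda>k. cmod (b k)" B k] assms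
  by (simp add: a1_def norm_mult)

lemma conv_norm:
  assumes "a1 a A" "\<And>k. cmod (b k) \<le> B"
  shows "cmod (conv a b k) \<le> rconv (\<lambda>k. cmod (a k)) (\<lambda>k. cmod (b k)) k"
  unfolding conv_def rconv_def
  using norm_infsum_bound[OF conv_summable[OF assms, of k]] by (simp add: norm_mult)

lemma conv_comm: "conv a b k = conv b a k"
  unfolding conv_def using infsum_reflect[of "\<lambda>j. a (k - j) * b j" k] by (simp add: mult.commute)

lemma conv_finite:
  assumes "finite F" "\<And>j. j \<notin> F \<Longrightarrow> b j = 0"
  shows "conv a b k = (\<Sum>j\<in>F. a (k - j) * b j)"
proof -
  have "conv a b k = (\<Sum>\<^sub>\<infinity>j\<in>F. a (k - j) * b j)"
    unfolding conv_def by (rule infsum_cong_neutral) (use assms in auto)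
  thus ?thesis using assms by simp
qed

lemma conv_diff_right:
  assumes "a1 a A" "\<And>k. cmod (b k) \<le> B" "\<And>k. cmod (c k) \<le> C"
  shows "conv a (\<lambda>k. b k - c k) k = conv a b k - conv a c k"
  unfolding conv_def
  using infsum_add[OF abs_summable_summable[OF conv_summable[of a A b B k, OF assms(1,2)]]
    summable_on_uminus[THEN iffD2, OF abs_summable_summable[OF conv_summable[of a A c C k, OF assms(1,3)]]]]
  unfolding infsum_uminus right_diff_distrib by simp

lemma conv_diff_left:
  assumes "a1 a A" "\<And>k. cmod (b k) \<le> B" "\<And>k. cmod (c k) \<le> C"
  shows "conv (\<lambda>k. b k - c k) a k = conv b a k - conv c a k"
  unfolding conv_comm[of _ a] by (rule conv_diff_right[OF assms])

lemma a1_bound: "a1 a A \<Longrightarrow> cmod (a k) \<le> A"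
  unfolding a1_def using b1_pointwise by fastforce

lemma conv_bound:
  assumes "a1 a A" "\<And>k. cmod (b k) \<le> B"
  shows "cmod (conv a b k) \<le> A * B"
  using conv_norm[of a A b B k, OF assms] rconv_bound[of "\<lambda>k. cmod (a k)" A "\<lambda>k. cmod (b k)" B k] assms
  by (simp add: a1_def)

lemma hb0_conv:
  assumes "a1 a A" "hb 0 b B" shows "hb 0 (conv a b) (A * B)"
proof -
  have "b2 (rconv (\<lambda>k. cmod (a k)) (\<lambda>k. cmod (b k))) (A * B)"
    using assms by (intro rconv_b2) (auto simp: a1_def hb0)
  thus ?thesis unfolding hb0
    by (rule b2_mono)
       (simp_all add: order_trans[OF conv_norm[OF assms(1) hb_pointwise0[OF assms(2) order_refl]] abs_ge_self])
qed

text \<open>\<open>w\<close> is the weight at the output frequency \<open>k\<close>; the hypothesis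
  \<open>le\<close> says how it is shared between the two factors.\<close>

lemma conv_norm_weighted:
  assumes a: "a1 a A" and b: "\<And>k. cmod (b k) \<le> B"
    and f: "b1 f A'" "\<And>k. 0 \<le> f k" "\<And>k. 0 \<le> g k" "\<And>k. g k \<le> B'"
    and le: "\<And>j. w * (cmod (a (k - j)) * cmod (b j)) \<le> f (k - j) * g j" and w: "0 \<le> w"
  shows "w * cmod (conv a b k) \<le> rconv f g k"
proof -
  have s: "(\<lambda>j. cmod (a (k - j)) * cmod (b j)) summable_on UNIV"
    using conv_summable[OF a b, of k] by (simp add: norm_mult)
  have "w * cmod (conv a b k) \<le> w * rconv (\<lambda>k. cmod (a k)) (\<lambda>k. cmod (b k)) k"
    by (intro mult_left_mono conv_norm[OF a b] w)
  also have "\<dots> = (\<Sum>\<^sub>\<infinity>j. w * (cmod (a (k - j)) * cmod (b j)))"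
    unfolding rconv_def by (rule infsum_cmult_right'[symmetric])
  also have "\<dots> \<le> rconv f g k"
    unfolding rconv_def
    by (rule infsum_mono[OF summable_on_cmult_right[OF s] rconv_summable[OF f]]) (rule le)
  finally show ?thesis .
qed

lemma w1_conv:
  assumes "w1 a A" "w1 b B" shows "w1 (conv a b) (A * B)"
proof -
  let ?f = "\<lambda>k. br k * cmod (a k)" and ?g = "\<lambda>k. br k * cmod (b k)"
  have "br k * cmod (conv a b k) \<le> rconv ?f ?g k" for k
  proof (rule conv_norm_weighted[OF w1_a1[OF assms(1)] a1_bound[OF w1_a1[OF assms(2)]]])
    show "b1 ?f A" using assms by (simp add: w1_def)
    show "?g k \<le> B" for k using b1_pointwise assms(2) unfolding w1_def by fastforce
    show "br k * (cmod (a (k - j)) * cmod (b j)) \<le> br (k - j) * cmod (a (k - j)) * (br j * cmod (b j))" for j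
      using mult_right_mono[OF br_mult[of k j], of "cmod (a (k - j)) * cmod (b j)"] by (simp add: mult_ac)
  qed auto
  moreover have "b1 (rconv ?f ?g) (A * B)"
    using assms by (intro rconv_b1) (auto simp: w1_def)
  ultimately show ?thesis unfolding w1_def by (auto elim: b1_mono)
qed

lemma hb1_conv:
  assumes "w1 a A" "hb 1 b B" shows "hb 1 (conv a b) (A * B)"
proof -
  let ?f = "\<lambda>k. br k * cmod (a k)" and ?g = "\<lambda>k. br k * cmod (b k)"
  have "br k * cmod (conv a b k) \<le> rconv ?f ?g k" for k
  proof (rule conv_norm_weighted[OF w1_a1[OF assms(1)] hb_pointwise0[OF assms(2)]])
    show "b1 ?f A" using assms by (simp add: w1_def)
    show "?g k \<le> B" for k using hb_pointwise[OF assms(2)] by simp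
    show "br k * (cmod (a (k - j)) * cmod (b j)) \<le> br (k - j) * cmod (a (k - j)) * (br j * cmod (b j))" for j
      using mult_right_mono[OF br_mult[of k j], of "cmod (a (k - j)) * cmod (b j)"] by (simp add: mult_ac)
  qed auto
  note le = this
  have "b2 (rconv ?f ?g) (A * B)"
    using assms by (intro rconv_b2) (auto simp: w1_def hb_def)
  thus ?thesis unfolding hb_def
    by (rule b2_mono) (simp_all add: abs_mult order_trans[OF le abs_ge_self])
qed

text \<open>A tame product estimate: by \<open>wt_triangle\<close> the weight falls on one factor at
  a time, and the other factor is measured in \<open>a1\<close> only. Linearity in the high norms is
  what later makes H^s growth rates depend on the H^2 norm alone.\<close>

lemma hb_conv:
  assumes "0 \<le> s" "a1 a A" "hb s a A'" "a1 b B" "hb s b B'"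
  shows "hb s (conv a b) (2 powr s * (A' * B + A * B'))"
proof -
  let ?f = "\<lambda>k. cmod (a k)" and ?g = "\<lambda>k. cmod (b k)"
  let ?F = "\<lambda>k. wt s k * cmod (a k)" and ?G = "\<lambda>k. wt s k * cmod (b k)"
  have f: "b1 ?f A" and g: "b1 ?g B" and F: "b2 ?F A'" and G: "b2 ?G B'"
    using assms by (auto simp: a1_def hb_def)
  have FB: "?F k \<le> A'" and GB: "?G k \<le> B'" for k
    using hb_pointwise assms by auto
  have s: "(\<lambda>j. ?f (k - j) * ?g j) summable_on UNIV" for k
    by (rule rconv_summable[OF f _ _ a1_bound[OF assms(4)]]) auto
  have s1: "(\<lambda>j. ?f (k - j) * ?G j) summable_on UNIV" for k
    by (rule rconv_summable[OF f _ _ GB]) auto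
  have s2: "(\<lambda>j. ?g (k - j) * ?F j) summable_on UNIV" for k
    by (rule rconv_summable[OF g _ _ FB]) auto
  have s3: "(\<lambda>j. ?F (k - j) * ?g j) summable_on UNIV" for k
    using summable_on_reindex_bij_witness[of UNIV "\<lambda>j. k - j" "\<lambda>j. k - j" UNIV
       "\<lambda>j. ?g (k - j) * ?F j" "\<lambda>j. ?F (k - j) * ?g j"] s2[of k] by (simp add: mult.commute)
  have le: "wt s k * cmod (conv a b k) \<le> 2 powr s * (rconv ?g ?F k + rconv ?f ?G k)" for k
  proof -
    have "wt s k * cmod (conv a b k) \<le> wt s k * rconv ?f ?g k"
      by (intro mult_left_mono conv_norm[OF assms(2) a1_bound[OF assms(4)]]) auto
    also have "\<dots> = (\<Sum>\<^sub>\<infinity>j. wt s k * (?f (k - j) * ?g j))"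
      unfolding rconv_def by (rule infsum_cmult_right'[symmetric])
    also have "\<dots> \<le> (\<Sum>\<^sub>\<infinity>j. 2 powr s * (?F (k - j) * ?g j + ?f (k - j) * ?G j))"
    proof (rule infsum_mono)
      show "(\<lambda>j. wt s k * (?f (k - j) * ?g j)) summable_on UNIV"
        by (intro summable_on_cmult_right s)
      show "(\<lambda>j. 2 powr s * (?F (k - j) * ?g j + ?f (k - j) * ?G j)) summable_on UNIV"
        by (intro summable_on_cmult_right summable_on_add s1 s3)
      show "wt s k * (?f (k - j) * ?g j) \<le> 2 powr s * (?F (k - j) * ?g j + ?f (k - j) * ?G j)" for j
        using mult_right_mono[OF wt_triangle[OF assms(1), of k j], of "?f (k - j) * ?g j"]
        by (simp add: algebra_simps)
    qed
    also have "\<dots> = 2 powr s * (rconv ?F ?g k + rconv ?f ?G k)"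
      unfolding rconv_def infsum_cmult_right' by (subst infsum_add[OF s3 s1]) simp
    finally show ?thesis by (simp only: rconv_comm[of ?F ?g])
  qed
  have "b2 (\<lambda>k. 2 powr s * (rconv ?g ?F k + rconv ?f ?G k)) (2 powr s * (B * A' + A * B'))"
    by (intro b2_cmult b2_add rconv_b2 f g F G) auto
  thus ?thesis unfolding hb_def
  proof (rule b2_mono)
    fix k
    have "0 \<le> wt s k * cmod (conv a b k)" by simp
    thus "\<bar>wt s k * cmod (conv a b k)\<bar> \<le> \<bar>2 powr s * (rconv ?g ?F k + rconv ?f ?G k)\<bar>"
      using le[of k] by linarith
  qed (simp add: mult.commute)
qed

text \<open>At a fixed output frequency the derivative can be moved away from \<open>w\<close>:
  \<open>|j|\<close> is at most \<open>br (k - j) * br k\<close>, where the first factor goes to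
  \<open>g\<close> and the second is a constant. So a sup bound on \<open>w\<close>
  suffices.\<close>

lemma conv_Dx_bound:
  assumes "w1 g A" "\<And>k. cmod (w k) \<le> W"
  shows "cmod (conv g (Dx w) k) \<le> br k * (A * W)" "(\<lambda>j. cmod (g (k - j) * Dx w j)) summable_on UNIV"
proof -
  let ?f = "\<lambda>k. br k * cmod (g k)"
  have f: "b1 ?f A" using assms by (simp add: w1_def)
  have s: "(\<lambda>j. ?f (k - j) * cmod (w j)) summable_on UNIV"
    by (rule rconv_summable[OF f _ _ assms(2)]) auto
  have le: "cmod (g (k - j) * Dx w j) \<le> br k * (?f (k - j) * cmod (w j))" for j
  proof -
    have "\<bar>real_of_int j\<bar> \<le> br (j - k) * br k"
      using br_mult[of j k] abs_le_br[of j] by linarith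
    also have "br (j - k) = br (k - j)" using br_minus[of "k - j"] by simp
    finally show ?thesis
      using mult_right_mono[of "\<bar>real_of_int j\<bar>" "br (k - j) * br k" "cmod (g (k - j)) * cmod (w j)"]
      by (simp add: norm_mult cmod_Dx mult_ac)
  qed
  show 1: "(\<lambda>j. cmod (g (k - j) * Dx w j)) summable_on UNIV"
    by (rule summable_on_comparison_test[OF summable_on_cmult_right[OF s]]) (use le in auto)
  have "cmod (conv g (Dx w) k) \<le> (\<Sum>\<^sub>\<infinity>j. cmod (g (k - j) * Dx w j))"
    unfolding conv_def by (rule norm_infsum_bound[OF 1])
  also have "\<dots> \<le> (\<Sum>\<^sub>\<infinity>j. br k * (?f (k - j) * cmod (w j)))"
    by (rule infsum_mono[OF 1 summable_on_cmult_right[OF s]]) (use le in auto)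
  also have "\<dots> = br k * rconv ?f (\<lambda>j. cmod (w j)) k"
    unfolding rconv_def by (rule infsum_cmult_right')
  also have "\<dots> \<le> br k * (A * W)"
    by (intro mult_left_mono rconv_bound[OF f _ _ assms(2)]) auto
  finally show "cmod (conv g (Dx w) k) \<le> br k * (A * W)" .
qed

lemma w1_gg: "w1 c A \<Longrightarrow> w1 (gg c) (A * A)"
  unfolding gg_def by (intro w1_conv w1_ct)

text \<open>The Fourier form of |u|^2 being real valued; the antisymmetry used in all energy
  estimates comes from it.\<close>

lemma gg_hermitian: "gg c (- m) = cnj (gg c m)"
proof -
  have "cnj (gg c m) = (\<Sum>\<^sub>\<infinity>j. cnj (c (m - j) * ct c j))"
    unfolding gg_def conv_def by (simp only: infsum_cnj)
  also have "\<dots> = (\<Sum>\<^sub>\<infinity>j. c (- m - j) * ct c j)"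
    by (rule infsum_reindex_bij_witness[of _ "\<lambda>j. j + m" "\<lambda>j. j - m"])
       (auto simp: ct_def algebra_simps)
  finally show ?thesis unfolding gg_def conv_def by simp
qed

lemma nl_hb1:
  assumes "hb 2 c K" shows "hb 1 (nl c) (4 * K ^ 3)"
proof -
  have "hb 1 (Dx c) K"
    using assms unfolding hb_def
    by (rule b2_mono) (auto simp: abs_mult cmod_Dx wt_2 power2_eq_square mult.assoc
        intro!: mult_left_mono mult_right_mono abs_le_br)
  from hb1_conv[OF w1_gg[OF hb_w1[OF assms]] this]
  show ?thesis unfolding nl_def by (simp add: power3_eq_cube algebra_simps)
qed

lemma gg_diff:
  assumes "w1 u A" "w1 v A"
  shows "gg u k - gg v k = conv (\<lambda>k. u k - v k) (ct u) k + conv v (ct (\<lambda>k. u k - v k)) k"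
proof -
  note bu = a1_bound[OF w1_a1[OF assms(1)]] and bv = a1_bound[OF w1_a1[OF assms(2)]]
  have "conv (\<lambda>k. u k - v k) (ct u) k = conv u (ct u) k - conv v (ct u) k"
    by (rule conv_diff_left[OF w1_a1[OF w1_ct[OF assms(1)]] bu bv])
  moreover have "conv v (ct (\<lambda>k. u k - v k)) k = conv v (ct u) k - conv v (ct v) k"
  proof -
    have "ct (\<lambda>k. u k - v k) = (\<lambda>k. ct u k - ct v k)" by (simp add: ct_def fun_eq_iff)
    moreover have "cmod (ct u k) \<le> A" "cmod (ct v k) \<le> A" for k using bu bv by (auto simp: cmod_ct)
    ultimately show ?thesis
      using conv_diff_right[of v A "ct u" A "ct v" A k, OF w1_a1[OF assms(2)]] by simp
  qed
  ultimately show ?thesis by (simp add: gg_def)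
qed

text \<open>The splitting is chosen so that the derivative hits the difference only next to the
  Hermitian factor \<open>gg u\<close>, where symmetrization applies. In the other term it hits
  \<open>v\<close>, for which \<open>w1\<close> bounds it.\<close>

lemma nl_diff:
  assumes "w1 u A" "w1 v A"
  shows "nl u k - nl v k = conv (gg u) (Dx (\<lambda>k. u k - v k)) k + conv (\<lambda>k. gg u k - gg v k) (Dx v) k"
proof -
  note gu = w1_a1[OF w1_gg[OF assms(1)]] and gv = w1_a1[OF w1_gg[OF assms(2)]]
  note du = w1_Dx[OF assms(1)] and dv = w1_Dx[OF assms(2)]
  have "conv (gg u) (Dx (\<lambda>k. u k - v k)) k = conv (gg u) (Dx u) k - conv (gg u) (Dx v) k"
  proof -
    have "Dx (\<lambda>k. u k - v k) = (\<lambda>k. Dx u k - Dx v k)" by (simp add: Dx_def fun_eq_iff algebra_simps)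
    thus ?thesis using conv_diff_right[OF gu a1_bound[OF du] a1_bound[OF dv]] by simp
  qed
  moreover have "conv (\<lambda>k. gg u k - gg v k) (Dx v) k = conv (gg u) (Dx v) k - conv (gg v) (Dx v) k"
    by (rule conv_diff_left[OF dv a1_bound[OF gu] a1_bound[OF gv]])
  ultimately show ?thesis by (simp add: nl_def)
qed

text \<open>A Lipschitz bound mode by mode, with a constant growing like \<open>br k\<close>. It
  makes the truncated vector fields Lipschitz and lets each mode of the nonlinearity pass to limits.
  The 3 counts one \<open>A^2\<close> from the first term of \<open>nl_diff\<close> and two from the
  second.\<close>

lemma nl_diff_pointwise:
  assumes "w1 u A" "w1 v A" and W: "\<And>k. cmod (u k - v k) \<le> W"
  shows "cmod (nl u k - nl v k) \<le> 3 * A\<^sup>2 * br k * W"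
proof -
  have W0: "0 \<le> W" using W[of 0] norm_ge_zero order_trans by blast
  have g: "cmod (gg u k - gg v k) \<le> 2 * A * W" for k
  proof -
    have "cmod (conv (\<lambda>k. u k - v k) (ct u) k) \<le> A * W"
      unfolding conv_comm[of _ "ct u"] by (rule conv_bound[OF w1_a1[OF w1_ct[OF assms(1)]] W])
    moreover have "cmod (conv v (ct (\<lambda>k. u k - v k)) k) \<le> A * W"
      by (rule conv_bound[OF w1_a1[OF assms(2)]]) (simp add: cmod_ct W)
    ultimately show ?thesis unfolding gg_diff[OF assms(1,2)]
      using norm_triangle_ineq[of "conv (\<lambda>k. u k - v k) (ct u) k" "conv v (ct (\<lambda>k. u k - v k)) k"] by linarith
  qed
  have 1: "cmod (conv (gg u) (Dx (\<lambda>k. u k - v k)) k) \<le> br k * (A * A * W)"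
    by (rule conv_Dx_bound(1)[OF w1_gg[OF assms(1)] W])
  have "cmod (conv (\<lambda>k. gg u k - gg v k) (Dx v) k) \<le> A * (2 * A * W)"
    unfolding conv_comm[of _ "Dx v"] by (rule conv_bound[OF w1_Dx[OF assms(2)] g])
  also have "\<dots> \<le> br k * (A * (2 * A * W))"
    using mult_right_mono[OF br_ge1[of k], of "A * (2 * A * W)"] W0 w1_nonneg[OF assms(1)] by simp
  finally show ?thesis unfolding nl_diff[OF assms(1,2)] using 1
    norm_triangle_ineq[of "conv (gg u) (Dx (\<lambda>k. u k - v k)) k" "conv (\<lambda>k. gg u k - gg v k) (Dx v) k"]
    by (simp add: power2_eq_square algebra_simps)
qed

text \<open>Integration by parts on the Fourier side: \<open>X k j\<close> changes sign when
  \<open>k\<close> and \<open>j\<close> are swapped, so averaging the double sum with its transpose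
  leaves the commutator of the weight \<open>\<rho>\<close> with the derivative. For constant weight
  the commutator is \<open>j - k\<close>, a derivative on \<open>g\<close>.\<close>

lemma energy_symmetrization:
  fixes \<rho> :: "int \<Rightarrow> real" and g w :: "int \<Rightarrow> complex"
  assumes g: "\<And>m. g (- m) = cnj (g m)"
  shows "\<bar>2 * Re (\<Sum>k\<in>F. \<Sum>j\<in>F. of_real (\<rho> k) * (cnj (w k) * (g (k - j) * Dx w j)))\<bar>
    \<le> (\<Sum>k\<in>F. \<Sum>j\<in>F. \<bar>\<rho> k * real_of_int j - \<rho> j * real_of_int k\<bar> *
          (cmod (g (k - j)) * (cmod (w k) * cmod (w j))))" (is "\<bar>2 * Re ?S\<bar> \<le> _")
proof -
  define X where "X k j = Re (\<i> * (cnj (w k) * g (k - j) * w j))" for k j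
  have Xsym: "X j k = - X k j" for k j
  proof -
    have 1: "cnj (w j) * g (j - k) * w k = cnj (cnj (w k) * g (k - j) * w j)"
      using g[of "k - j"] by (simp add: mult_ac)
    have 2: "Re (\<i> * cnj z) = - Re (\<i> * z)" for z by simp
    show ?thesis unfolding X_def 1 2 ..
  qed
  have Re_scale: "Re (of_real a * z) = a * Re z" for a :: real and z by simp
  have 1: "Re ?S = (\<Sum>k\<in>F. \<Sum>j\<in>F. \<rho> k * real_of_int j * X k j)"
    unfolding Re_sum
  proof (intro sum.cong refl)
    fix k j
    have *: "of_real (\<rho> k) * (cnj (w k) * (g (k - j) * Dx w j)) =
      of_real (\<rho> k * real_of_int j) * (\<i> * (cnj (w k) * g (k - j) * w j))"
      by (simp add: Dx_def mult_ac)
    show "Re (of_real (\<rho> k) * (cnj (w k) * (g (k - j) * Dx w j))) = \<rho> k * real_of_int j * X k j"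
      unfolding X_def * Re_scale ..
  qed
  have "(\<Sum>k\<in>F. \<Sum>j\<in>F. \<rho> k * real_of_int j * X k j) = (\<Sum>k\<in>F. \<Sum>j\<in>F. \<rho> j * real_of_int k * X j k)"
    by (rule sum.swap)
  also have "\<dots> = (\<Sum>k\<in>F. \<Sum>j\<in>F. - (\<rho> j * real_of_int k * X k j))"
    by (intro sum.cong refl) (subst Xsym, simp)
  finally have 2: "2 * Re ?S = (\<Sum>k\<in>F. \<Sum>j\<in>F. (\<rho> k * real_of_int j - \<rho> j * real_of_int k) * X k j)"
    using 1 by (simp add: left_diff_distrib sum_subtractf sum_negf)
  show ?thesis unfolding 2
  proof (rule order_trans[OF sum_abs], intro sum_mono, rule order_trans[OF sum_abs], intro sum_mono)
    fix k j
    have "\<bar>X k j\<bar> \<le> cmod (\<i> * (cnj (w k) * g (k - j) * w j))" unfolding X_def by (rule abs_Re_le_cmod)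
    also have "\<dots> = cmod (g (k - j)) * (cmod (w k) * cmod (w j))" by (simp add: norm_mult)
    finally show "\<bar>(\<rho> k * real_of_int j - \<rho> j * real_of_int k) * X k j\<bar> \<le>
       \<bar>\<rho> k * real_of_int j - \<rho> j * real_of_int k\<bar> * (cmod (g (k - j)) * (cmod (w k) * cmod (w j)))"
      by (simp add: abs_mult mult_left_mono)
  qed
qed

section \<open>Energy estimates\<close>

lemma powr_diff_le:
  fixes x y p :: real
  assumes "0 < x" "x \<le> y" "1 \<le> p"
  shows "y powr p - x powr p \<le> p * y powr (p - 1) * (y - x)"
proof (cases "x = y")
  case False
  hence "x < y" using assms by simp
  obtain z where z: "x < z" "z < y" "y powr p - x powr p = (y - x) * (p * z powr (p - 1))"
    using MVT2[OF \<open>x < y\<close>, of "\<lambda>z. z powr p" "\<lambda>z. p * z powr (p - 1)"]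
    by (force intro!: derivative_eq_intros has_real_derivative_powr simp: assms(1) dest: less_le_trans[OF assms(1)])
  have "p * z powr (p - 1) \<le> p * y powr (p - 1)"
    using z assms by (intro mult_left_mono powr_mono2) auto
  thus ?thesis unfolding z(3) using \<open>x < y\<close> by (simp add: mult_right_mono mult.commute)
qed simp

lemma wt_square: "(wt s k)\<^sup>2 = br k powr (2 * s)"
  by (simp add: wt_def power2_eq_square powr_add[symmetric])

text \<open>For comparable frequencies the summand 1 pays for replacing one weight by the other, and
  \<open>2 * s\<close> comes from the mean value theorem for the power \<open>2 * s\<close>.\<close>

definition commC :: "real \<Rightarrow> real" where "commC s = 2 powr s * (1 + 2 * s)"

text \<open>This is what makes the loss of one derivative in the nonlinearity harmless in energy
  estimates.\<close>

lemma weight_commutator: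
  assumes s: "1 \<le> s"
  shows "\<bar>(wt s k)\<^sup>2 * real_of_int j - (wt s j)\<^sup>2 * real_of_int k\<bar> \<le>
    commC s * (br (k - j) * wt s k * wt s j + wt s k * wt s (k - j) * br j + wt s j * wt s (k - j) * br k)"
proof -
  have C2: "2 \<le> 2 powr s"
    using powr_mono[of 1 s "2::real"] s by simp
  have C3: "2 powr s \<le> commC s" "2 \<le> commC s"
    using C2 s by (auto simp: commC_def algebra_simps intro: order_trans[of 2 "2 powr s"])
  \<comment> \<open>Widely different frequencies need no cancellation: \<open>br k\<close> is at
    most \<open>2 * br (k - j)\<close>, so a full weight can be charged to the coefficient of
    \<open>g\<close>.\<close>
  have far: "\<bar>(wt s k)\<^sup>2 * real_of_int j - (wt s j)\<^sup>2 * real_of_int k\<bar> \<le>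
    commC s * (br (k - j) * wt s k * wt s j + wt s k * wt s (k - j) * br j)"
    if "2 * br j < br k" for k j
  proof -
    have le: "br k \<le> 2 * br (k - j)" using br_triangle[of k j] that by linarith
    have "wt s k \<le> (2 * br (k - j)) powr s"
      unfolding wt_def using s le by (intro powr_mono2) auto
    hence w: "wt s k \<le> 2 powr s * wt s (k - j)" by (simp add: wt_def powr_mult)
    have "br j \<le> br k" using that br_pos[of j] by linarith
    hence wj: "wt s j \<le> wt s k" unfolding wt_def using s by (intro powr_mono2) auto
    have "\<bar>(wt s k)\<^sup>2 * real_of_int j\<bar> = wt s k * wt s k * \<bar>real_of_int j\<bar>"
      by (simp add: abs_mult power2_eq_square)
    also have "\<dots> \<le> wt s k * (2 powr s * wt s (k - j)) * br j"
      by (intro mult_mono mult_left_mono w abs_le_br) auto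
    also have "\<dots> \<le> commC s * (wt s k * wt s (k - j) * br j)"
      using mult_right_mono[OF C3(1), of "wt s k * wt s (k - j) * br j"] by (simp add: mult_ac)
    finally have 1: "\<bar>(wt s k)\<^sup>2 * real_of_int j\<bar> \<le> commC s * (wt s k * wt s (k - j) * br j)" .
    have "\<bar>(wt s j)\<^sup>2 * real_of_int k\<bar> = wt s j * wt s j * \<bar>real_of_int k\<bar>"
      by (simp add: abs_mult power2_eq_square)
    also have "\<dots> \<le> wt s k * wt s j * (2 * br (k - j))"
      by (intro mult_mono wj order_trans[OF abs_le_br le]) auto
    also have "\<dots> \<le> commC s * (br (k - j) * wt s k * wt s j)"
      using mult_right_mono[OF C3(2), of "wt s k * wt s j * br (k - j)"] by (simp add: mult_ac)
    finally show ?thesis using 1 by (simp add: distrib_left)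
  qed
  consider "2 * br j < br k" | "2 * br k < br j" | "br k \<le> 2 * br j" "br j \<le> 2 * br k" by linarith
  thus ?thesis
  proof cases
    case 1
    have "0 \<le> commC s * (wt s j * wt s (k - j) * br k)" using C3 by simp
    thus ?thesis using far[OF 1] by (simp add: distrib_left)
  next
    case 2
    have e: "br (j - k) = br (k - j)" "wt s (j - k) = wt s (k - j)"
      using br_minus[of "k - j"] wt_minus[of s "k - j"] by simp_all
    have "0 \<le> commC s * (wt s k * wt s (k - j) * br j)" using C3 by simp
    thus ?thesis using far[OF 2] unfolding e by (simp add: distrib_left abs_minus_commute mult_ac)
  next
    case 3
    \<comment> \<open>Comparable frequencies: the difference of the squared weights gains a factor
      \<open>br (k - j)\<close> over the derivative of the power. The common derivative factor
      \<open>y\<close> then restores two weights of order \<open>s\<close>.\<close>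
    have near: "\<bar>real_of_int k\<bar> * \<bar>(wt s k)\<^sup>2 - (wt s j)\<^sup>2\<bar> \<le> 2 * s * 2 powr s * (br (k - j) * wt s k * wt s j)"
    proof -
      define x y where "x = min (br k) (br j)" and "y = max (br k) (br j)"
      have xy: "0 < x" "x \<le> y" "y \<le> 2 * x" using 3 by (auto simp: x_def y_def)
      have "y powr (2 * s) - x powr (2 * s) \<le> 2 * s * y powr (2 * s - 1) * (y - x)"
        by (rule powr_diff_le) (use xy s in auto)
      moreover have "\<bar>(wt s k)\<^sup>2 - (wt s j)\<^sup>2\<bar> = y powr (2 * s) - x powr (2 * s)"
      proof -
        have "x powr (2 * s) \<le> y powr (2 * s)" using xy s by (intro powr_mono2) auto
        thus ?thesis unfolding wt_square x_def y_def by (auto simp: min_def max_def)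
      qed
      moreover have "y - x \<le> br (k - j)"
        by (auto simp: x_def y_def min_def max_def br_def)
      ultimately have d: "\<bar>(wt s k)\<^sup>2 - (wt s j)\<^sup>2\<bar> \<le> 2 * s * y powr (2 * s - 1) * br (k - j)"
        using s xy by (smt (verit, best) mult_left_mono mult_nonneg_nonneg powr_ge_zero)
      have "\<bar>real_of_int k\<bar> * \<bar>(wt s k)\<^sup>2 - (wt s j)\<^sup>2\<bar> \<le> y * (2 * s * y powr (2 * s - 1) * br (k - j))"
        using abs_le_br[of k] xy s by (intro mult_mono d) (auto simp: y_def)
      also have "\<dots> = 2 * s * (y powr 1 * y powr (2 * s - 1)) * br (k - j)"
        using xy by simp
      also have "y powr 1 * y powr (2 * s - 1) = y powr s * y powr s"
        by (simp only: powr_add[symmetric]) simp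
      also have "y powr s * y powr s \<le> y powr s * (2 powr s * x powr s)"
      proof -
        have "y powr s \<le> (2 * x) powr s" using xy s by (intro powr_mono2) auto
        thus ?thesis using xy by (simp add: powr_mult mult_left_mono)
      qed
      also have "\<dots> = 2 powr s * (wt s k * wt s j)"
        unfolding wt_def x_def y_def by (auto simp: min_def max_def)
      finally show ?thesis using s by (simp add: mult_ac mult_left_mono mult_right_mono)
    qed
    have "(wt s k)\<^sup>2 * real_of_int j - (wt s j)\<^sup>2 * real_of_int k =
      - ((wt s k)\<^sup>2 * real_of_int (k - j)) + real_of_int k * ((wt s k)\<^sup>2 - (wt s j)\<^sup>2)"
      by (simp add: algebra_simps)
    hence "\<bar>(wt s k)\<^sup>2 * real_of_int j - (wt s j)\<^sup>2 * real_of_int k\<bar> \<le>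
       (wt s k)\<^sup>2 * \<bar>real_of_int (k - j)\<bar> + \<bar>real_of_int k\<bar> * \<bar>(wt s k)\<^sup>2 - (wt s j)\<^sup>2\<bar>"
      using abs_triangle_ineq[of "- ((wt s k)\<^sup>2 * real_of_int (k - j))" "real_of_int k * ((wt s k)\<^sup>2 - (wt s j)\<^sup>2)"]
      by (simp add: abs_mult)
    moreover have "(wt s k)\<^sup>2 * \<bar>real_of_int (k - j)\<bar> \<le> 2 powr s * (br (k - j) * wt s k * wt s j)"
    proof -
      have "wt s k \<le> (2 * br j) powr s"
        unfolding wt_def using s 3 by (intro powr_mono2) auto
      hence "wt s k \<le> 2 powr s * wt s j" by (simp add: wt_def powr_mult)
      hence "wt s k * wt s k * \<bar>real_of_int (k - j)\<bar> \<le> wt s k * (2 powr s * wt s j) * br (k - j)"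
        by (intro mult_mono mult_left_mono abs_le_br) auto
      thus ?thesis by (simp add: power2_eq_square mult_ac)
    qed
    ultimately have "\<bar>(wt s k)\<^sup>2 * real_of_int j - (wt s j)\<^sup>2 * real_of_int k\<bar> \<le>
      commC s * (br (k - j) * wt s k * wt s j)"
      using near by (simp add: commC_def algebra_simps)
    moreover have "0 \<le> commC s * (wt s k * wt s (k - j) * br j)" "0 \<le> commC s * (wt s j * wt s (k - j) * br k)"
      using C3 by simp_all
    ultimately show ?thesis by (simp add: distrib_left)
  qed
qed

lemma conv_commute: "conv a b = conv b a"
  using conv_comm by blast

lemma conv_pairing_bound:
  assumes "hb 0 h H" "finite F"
  shows "\<bar>\<Sum>k\<in>F. Re (cnj (w k) * h k)\<bar> \<le> L2_set (\<lambda>k. cmod (w k)) F * H"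
proof -
  have "\<bar>\<Sum>k\<in>F. Re (cnj (w k) * h k)\<bar> \<le> (\<Sum>k\<in>F. \<bar>cmod (w k)\<bar> * \<bar>cmod (h k)\<bar>)"
    by (rule order_trans[OF sum_abs], intro sum_mono)
       (metis abs_Re_le_cmod abs_norm_cancel complex_mod_cnj norm_mult)
  also have "\<dots> \<le> L2_set (\<lambda>k. cmod (w k)) F * L2_set (\<lambda>k. cmod (h k)) F"
    by (rule L2_set_mult_ineq)
  also have "\<dots> \<le> L2_set (\<lambda>k. cmod (w k)) F * H"
    using assms by (intro mult_left_mono b2_D) (auto simp: hb0 L2_set_nonneg)
  finally show ?thesis .
qed

lemma hb_finite_support:
  assumes "finite F" "\<And>k. k \<notin> F \<Longrightarrow> c k = 0"
  shows "hb s c (L2_set (\<lambda>k. wt s k * cmod (c k)) F)"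
  unfolding hb_def b2_def
proof (intro allI impI)
  fix G :: "int set" assume G: "finite G"
  have "L2_set (\<lambda>k. wt s k * cmod (c k)) G = L2_set (\<lambda>k. wt s k * cmod (c k)) (G \<inter> F)"
    unfolding L2_set_def using assms G by (intro arg_cong[of _ _ sqrt] sum.mono_neutral_right) auto
  also have "\<dots> \<le> L2_set (\<lambda>k. wt s k * cmod (c k)) F"
    unfolding L2_set_def using assms by (intro real_sqrt_le_mono sum_mono2) auto
  finally show "L2_set (\<lambda>k. wt s k * cmod (c k)) G \<le> L2_set (\<lambda>k. wt s k * cmod (c k)) F" .
qed

text \<open>The first commutator term is Young's inequality with \<open>g\<close> in
  \<open>w1\<close>, contributing \<open>4 * K^2\<close>. In the other two the weight sits on
  \<open>g\<close>, whose \<open>hb s\<close> norm is linear in that of \<open>c\<close> by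
  \<open>hb_conv\<close>; each contributes \<open>16 * 2 powr s * K^2\<close> after the two factors
  \<open>2 * K\<close> and \<open>4 * K\<close>, doubled. The halving at the end undoes the factor 2
  of symmetrization.\<close>

lemma sobolev_energy:
  assumes s: "1 \<le> s" and F: "finite F" and supp: "\<And>k. k \<notin> F \<Longrightarrow> c k = 0" and K: "hb 2 c K"
  shows "\<bar>\<Sum>k\<in>F. (wt s k)\<^sup>2 * Re (cnj (c k) * nl c k)\<bar> \<le>
    commC s * (2 + 8 * 2 powr s) * K\<^sup>2 * (\<Sum>k\<in>F. (wt s k * cmod (c k))\<^sup>2)"
proof -
  define X where "X = (\<lambda>k. wt s k * cmod (c k))"
  define Y where "Y = L2_set X F"
  define g where "g = gg c"
  define f where "f = (\<lambda>k. br k * cmod (c k))"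
  define q where "q = (\<lambda>k. wt s k * cmod (g k))"
  note w = hb_w1[OF K]
  have K0: "0 \<le> K" by (rule hb_nonneg[OF K])
  have Y0: "0 \<le> Y" by (simp add: Y_def L2_set_nonneg)
  have cY: "hb s c Y" unfolding Y_def X_def by (rule hb_finite_support[OF F supp])
  have C0: "0 \<le> commC s" using s by (simp add: commC_def)
  have f1: "b1 f (2 * K)" using w by (simp add: w1_def f_def)
  have q2: "b2 q (2 powr s * (4 * K * Y))"
    using hb_conv[OF _ w1_a1[OF w] cY w1_a1[OF w1_ct[OF w]] hb_ct[OF cY]] s
    unfolding hb_def q_def g_def gg_def by (simp add: algebra_simps)
  have p1: "b1 (\<lambda>k. br k * cmod (g k)) (4 * K\<^sup>2)"
    using w1_gg[OF w] by (simp add: w1_def g_def power2_eq_square)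
  have fq: "\<bar>\<Sum>k\<in>F. X k * rconv f q k\<bar> \<le> Y * (2 * K * (2 powr s * (4 * K * Y)))"
  proof -
    have "\<bar>\<Sum>k\<in>F. X k * rconv f q k\<bar> \<le> (\<Sum>k\<in>F. \<bar>X k\<bar> * \<bar>rconv f q k\<bar>)"
      by (rule order_trans[OF sum_abs]) (simp add: abs_mult)
    also have "\<dots> \<le> L2_set X F * L2_set (rconv f q) F" by (rule L2_set_mult_ineq)
    also have "\<dots> \<le> Y * (2 * K * (2 powr s * (4 * K * Y)))"
      unfolding Y_def[symmetric]
      by (intro mult_left_mono b2_D[OF rconv_b2[OF f1 _ q2]] F Y0) (auto simp: f_def q_def)
    finally show ?thesis .
  qed
  have part: "(\<Sum>k\<in>F. \<Sum>j\<in>F. X k * (q (k - j) * f j)) \<le> Y * (2 * K * (2 powr s * (4 * K * Y)))"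
  proof -
    have "(\<Sum>j\<in>F. q (k - j) * f j) \<le> rconv f q k" for k
    proof -
      have "(\<lambda>j. q (k - j) * f j) summable_on UNIV"
      proof -
        have "(\<lambda>j. f (k - j) * q j) summable_on UNIV"
          by (rule rconv_summable[OF f1, of _ "2 powr s * (4 * K * Y)"])
             (use b2_pointwise[OF q2] in \<open>auto simp: f_def q_def\<close>)
        thus ?thesis
          using summable_on_reindex_bij_witness[of UNIV "\<lambda>j. k - j" "\<lambda>j. k - j" UNIV
            "\<lambda>j. f (k - j) * q j" "\<lambda>j. q (k - j) * f j"] by (simp add: mult.commute)
      qed
      hence "(\<Sum>j\<in>F. q (k - j) * f j) \<le> rconv q f k" unfolding rconv_def
        by (intro finite_sum_le_infsum F) (auto simp: f_def q_def)
      thus ?thesis by (simp only: rconv_comm)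
    qed
    hence "(\<Sum>k\<in>F. \<Sum>j\<in>F. X k * (q (k - j) * f j)) \<le> (\<Sum>k\<in>F. X k * rconv f q k)"
      unfolding sum_distrib_left[symmetric] by (intro sum_mono mult_left_mono) (auto simp: X_def)
    thus ?thesis using fq by linarith
  qed
  \<comment> \<open>The mirror image of \<open>part\<close>: the modulus of a Hermitian sequence is
    even, so swapping the two indices changes nothing.\<close>
  have part': "(\<Sum>k\<in>F. \<Sum>j\<in>F. X j * (q (k - j) * f k)) \<le> Y * (2 * K * (2 powr s * (4 * K * Y)))"
  proof -
    have "q (- m) = q m" for m unfolding q_def g_def by (simp add: gg_hermitian)
    hence "q (k - j) = q (j - k)" for k j by (metis minus_diff_eq)
    hence "(\<Sum>k\<in>F. \<Sum>j\<in>F. X j * (q (k - j) * f k)) = (\<Sum>k\<in>F. \<Sum>j\<in>F. X j * (q (j - k) * f k))" by simp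
    also have "\<dots> = (\<Sum>j\<in>F. \<Sum>k\<in>F. X j * (q (j - k) * f k))" by (rule sum.swap)
    finally show ?thesis using part by simp
  qed
  have nlF: "nl c k = (\<Sum>j\<in>F. g (k - j) * Dx c j)" for k
    unfolding nl_def g_def by (rule conv_finite[OF F]) (simp add: Dx_def supp)
  have eq: "(\<Sum>k\<in>F. (wt s k)\<^sup>2 * Re (cnj (c k) * nl c k)) =
     Re (\<Sum>k\<in>F. \<Sum>j\<in>F. of_real ((wt s k)\<^sup>2) * (cnj (c k) * (g (k - j) * Dx c j)))"
  proof -
    have "(\<Sum>j\<in>F. of_real ((wt s k)\<^sup>2) * (cnj (c k) * (g (k - j) * Dx c j))) =
       of_real ((wt s k)\<^sup>2) * (cnj (c k) * nl c k)" for k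
      unfolding nlF by (simp only: sum_distrib_left)
    moreover have "Re (of_real a * z) = a * Re z" for a :: real and z by simp
    ultimately show ?thesis by (simp only: Re_sum)
  qed
  have "\<bar>2 * Re (\<Sum>k\<in>F. \<Sum>j\<in>F. of_real ((wt s k)\<^sup>2) * (cnj (c k) * (g (k - j) * Dx c j)))\<bar>
     \<le> (\<Sum>k\<in>F. \<Sum>j\<in>F. \<bar>(wt s k)\<^sup>2 * real_of_int j - (wt s j)\<^sup>2 * real_of_int k\<bar> *
          (cmod (g (k - j)) * (cmod (c k) * cmod (c j))))"
    by (rule energy_symmetrization) (simp add: g_def gg_hermitian)
  also have "\<dots> \<le> (\<Sum>k\<in>F. \<Sum>j\<in>F. commC s *
      (br (k - j) * cmod (g (k - j)) * X k * X j + X k * (q (k - j) * f j) + X j * (q (k - j) * f k)))"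
  proof (intro sum_mono)
    fix k j
    have "\<bar>(wt s k)\<^sup>2 * real_of_int j - (wt s j)\<^sup>2 * real_of_int k\<bar> * (cmod (g (k - j)) * (cmod (c k) * cmod (c j)))
      \<le> commC s * (br (k - j) * wt s k * wt s j + wt s k * wt s (k - j) * br j + wt s j * wt s (k - j) * br k)
        * (cmod (g (k - j)) * (cmod (c k) * cmod (c j)))"
      by (intro mult_right_mono weight_commutator s) auto
    also have "\<dots> = commC s * (br (k - j) * cmod (g (k - j)) * X k * X j + X k * (q (k - j) * f j) + X j * (q (k - j) * f k))"
      by (simp add: X_def q_def f_def algebra_simps)
    finally show "\<bar>(wt s k)\<^sup>2 * real_of_int j - (wt s j)\<^sup>2 * real_of_int k\<bar> * (cmod (g (k - j)) * (cmod (c k) * cmod (c j)))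
      \<le> \<dots>" .
  qed
  also have "\<dots> = commC s * ((\<Sum>k\<in>F. \<Sum>j\<in>F. br (k - j) * cmod (g (k - j)) * X k * X j)
      + (\<Sum>k\<in>F. \<Sum>j\<in>F. X k * (q (k - j) * f j)) + (\<Sum>k\<in>F. \<Sum>j\<in>F. X j * (q (k - j) * f k)))"
    by (simp only: sum_distrib_left[symmetric] sum.distrib)
  also have "\<dots> \<le> commC s * (4 * K\<^sup>2 * Y * Y + Y * (2 * K * (2 powr s * (4 * K * Y)))
      + Y * (2 * K * (2 powr s * (4 * K * Y))))"
    using young_finite[OF p1 _ F F, of X X] part part' C0
    by (intro mult_left_mono add_mono) (auto simp: Y_def)
  also have "\<dots> = 2 * (commC s * (2 + 8 * 2 powr s) * K\<^sup>2 * Y\<^sup>2)"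
    by (simp add: power2_eq_square algebra_simps)
  also have "Y\<^sup>2 = (\<Sum>k\<in>F. (wt s k * cmod (c k))\<^sup>2)"
    unfolding Y_def L2_set_def X_def by (simp add: sum_nonneg)
  finally show ?thesis unfolding eq by simp
qed

definition seg :: "nat \<Rightarrow> int set" where "seg n = {- int n..int n}"

lemma finite_seg [simp]: "finite (seg n)" by (simp add: seg_def)

lemma finite_subset_seg:
  assumes "finite F" obtains n where "F \<subseteq> seg n"
proof -
  have "F \<subseteq> seg (nat (Max (abs ` F)))"
  proof
    fix k assume "k \<in> F"
    hence "\<bar>k\<bar> \<le> Max (abs ` F)" using assms by simp
    thus "k \<in> seg (nat (Max (abs ` F)))" by (auto simp: seg_def)
  qed
  thus ?thesis by (rule that)
qed

lemma seg_outside_br: "k \<notin> seg n \<Longrightarrow> real n + 1 \<le> br k"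
  by (auto simp: seg_def br_def)

text \<open>The factor \<open>D\<^sub>x w\<close> in the first part of the difference is not bounded in terms of the
  norm of \<open>w\<close>; only its truncation is handled by symmetrization, and the tail is paid for
  with the \<open>H\<^sup>2\<close> bound.\<close>

lemma nl_diff_energy:
  assumes u: "w1 u A" and v: "w1 v A" and K: "hb 2 (\<lambda>k. u k - v k) K"
  shows "\<bar>\<Sum>k\<in>seg n. Re (cnj (u k - v k) * (nl u k - nl v k))\<bar> \<le>
    A\<^sup>2 * (4 * (\<Sum>k\<in>seg n. (cmod (u k - v k))\<^sup>2) + 2 * (K / (real n + 1))\<^sup>2)"
proof -
  define w where "w k = u k - v k" for k
  define p where "p k = (if k \<in> seg n then w k else 0)" for k
  define r where "r k = (if k \<in> seg n then 0 else w k)" for k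
  define S where "S = L2_set (\<lambda>k. cmod (w k)) (seg n)"
  define \<delta> where "\<delta> = K / (real n + 1)"
  define g where "g = gg u"
  have K': "hb 2 w K" using K by (simp add: w_def[abs_def])
  have K0: "0 \<le> K" by (rule hb_nonneg[OF K])
  have A0: "0 \<le> A" by (rule w1_nonneg[OF u])
  have S0: "0 \<le> S" by (simp add: S_def L2_set_nonneg)
  have d0: "0 \<le> \<delta>" using K0 by (simp add: \<delta>_def)
  \<comment> \<open>Outside \<open>seg n\<close> one power of the H^2 weight exceeds
    \<open>n + 1\<close>, and the other absorbs the derivative.\<close>
  have Dr: "hb 0 (Dx r) \<delta>"
  proof -
    have "b2 (\<lambda>k. (1 / (real n + 1)) * (wt 2 k * cmod (w k))) ((1 / (real n + 1)) * K)"
      using K' by (intro b2_cmult) (auto simp: hb_def)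
    thus ?thesis unfolding hb0
    proof (rule b2_mono)
      fix k
      show "\<bar>cmod (Dx r k)\<bar> \<le> \<bar>(1 / (real n + 1)) * (wt 2 k * cmod (w k))\<bar>"
      proof (cases "k \<in> seg n")
        case False
        have "(real n + 1) * \<bar>real_of_int k\<bar> \<le> br k * br k"
          using seg_outside_br[OF False] by (intro mult_mono abs_le_br) auto
        hence "(real n + 1) * \<bar>real_of_int k\<bar> * cmod (w k) \<le> br k * br k * cmod (w k)"
          by (intro mult_right_mono) auto
        thus ?thesis using False by (simp add: cmod_Dx r_def wt_2 power2_eq_square field_simps)
      qed (simp add: r_def cmod_Dx)
    qed (simp add: \<delta>_def)
  qed
  have r0: "hb 0 r \<delta>"
  proof -
    have "\<bar>cmod (r k)\<bar> \<le> \<bar>cmod (Dx r k)\<bar>" for k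
    proof (cases "k \<in> seg n")
      case False
      hence "1 \<le> \<bar>real_of_int k\<bar>" by (auto simp: seg_def)
      thus ?thesis using mult_right_mono[of 1 "\<bar>real_of_int k\<bar>" "cmod (r k)"] by (simp add: cmod_Dx)
    qed (simp add: r_def)
    thus ?thesis using Dr unfolding hb0 by (meson b2_mono order_refl)
  qed
  have p0: "hb 0 p S"
    using hb_finite_support[of "seg n" p 0] by (simp add: p_def S_def cong: L2_set_cong)
  have w0: "hb 0 w (S + \<delta>)"
    by (rule hb_triangle[OF p0 r0]) (simp add: p_def r_def)
  have gA: "w1 g (A * A)" unfolding g_def by (rule w1_gg[OF u])
  have Dxw: "Dx w j = Dx p j + Dx r j" for j by (simp add: Dx_def p_def r_def)
  have wb: "cmod (w k) \<le> K" for k by (rule hb_pointwise0[OF K']) simp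
  have c1: "conv g (Dx w) k = (\<Sum>j\<in>seg n. g (k - j) * Dx w j) + conv g (Dx r) k" for k
  proof -
    have pb: "cmod (p k) \<le> K" and rb: "cmod (r k) \<le> K" for k using wb[of k] K0 by (auto simp: p_def r_def)
    have "conv g (Dx w) k = (\<Sum>\<^sub>\<infinity>j. g (k - j) * Dx p j + g (k - j) * Dx r j)"
      unfolding conv_def Dxw by (simp only: distrib_left)
    also have "\<dots> = conv g (Dx p) k + conv g (Dx r) k"
      unfolding conv_def
      by (rule infsum_add[OF abs_summable_summable[OF conv_Dx_bound(2)[of g _ p K k, OF gA pb]]
            abs_summable_summable[OF conv_Dx_bound(2)[of g _ r K k, OF gA rb]]])
    also have "conv g (Dx p) k = (\<Sum>j\<in>seg n. g (k - j) * Dx p j)"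
      by (rule conv_finite) (auto simp: Dx_def p_def)
    also have "\<dots> = (\<Sum>j\<in>seg n. g (k - j) * Dx w j)"
      by (intro sum.cong) (auto simp: Dx_def p_def)
    finally show ?thesis .
  qed
  define h where "h = conv (\<lambda>k. gg u k - gg v k) (Dx v)"
  have hH: "hb 0 h (A * (2 * A * (S + \<delta>)))"
  proof -
    have 1: "hb 0 (conv w (ct u)) (A * (S + \<delta>))"
      unfolding conv_commute[of w] by (rule hb0_conv[OF w1_a1[OF w1_ct[OF u]] w0])
    have 2: "hb 0 (conv v (ct w)) (A * (S + \<delta>))"
      by (rule hb0_conv[OF w1_a1[OF v] hb_ct[OF w0]])
    have "hb 0 (\<lambda>k. gg u k - gg v k) (A * (S + \<delta>) + A * (S + \<delta>))"
      by (rule hb_triangle[OF 1 2])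
         (simp add: gg_diff[OF u v] w_def[abs_def, symmetric] norm_triangle_ineq)
    hence "hb 0 (conv (Dx v) (\<lambda>k. gg u k - gg v k)) (A * (A * (S + \<delta>) + A * (S + \<delta>)))"
      by (rule hb0_conv[OF w1_Dx[OF v]])
    thus ?thesis unfolding h_def conv_commute[of _ "Dx v"] by (simp add: algebra_simps)
  qed
  have t2: "\<bar>\<Sum>k\<in>seg n. Re (cnj (w k) * conv g (Dx r) k)\<bar> \<le> S * (A * A * \<delta>)"
    unfolding S_def by (rule conv_pairing_bound[OF hb0_conv[OF w1_a1[OF gA] Dr]]) simp
  have t3: "\<bar>\<Sum>k\<in>seg n. Re (cnj (w k) * h k)\<bar> \<le> S * (A * (2 * A * (S + \<delta>)))"
    unfolding S_def by (rule conv_pairing_bound) (use hH in \<open>simp_all add: S_def\<close>)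
  have t1: "2 * \<bar>\<Sum>k\<in>seg n. Re (cnj (w k) * (\<Sum>j\<in>seg n. g (k - j) * Dx w j))\<bar> \<le> A * A * S * S"
  proof -
    have "(\<Sum>k\<in>seg n. Re (cnj (w k) * (\<Sum>j\<in>seg n. g (k - j) * Dx w j))) =
      Re (\<Sum>k\<in>seg n. \<Sum>j\<in>seg n. of_real 1 * (cnj (w k) * (g (k - j) * Dx w j)))"
      by (simp add: sum_distrib_left)
    hence "2 * \<bar>\<Sum>k\<in>seg n. Re (cnj (w k) * (\<Sum>j\<in>seg n. g (k - j) * Dx w j))\<bar> =
      \<bar>2 * Re (\<Sum>k\<in>seg n. \<Sum>j\<in>seg n. of_real 1 * (cnj (w k) * (g (k - j) * Dx w j)))\<bar>"
      by (simp only: abs_mult abs_numeral)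
    also have "\<dots> \<le> (\<Sum>k\<in>seg n. \<Sum>j\<in>seg n. \<bar>1 * real_of_int j - 1 * real_of_int k\<bar> *
          (cmod (g (k - j)) * (cmod (w k) * cmod (w j))))"
      by (rule energy_symmetrization) (simp add: g_def gg_hermitian)
    also have "\<dots> \<le> (\<Sum>k\<in>seg n. \<Sum>j\<in>seg n. (br (k - j) * cmod (g (k - j))) * cmod (w k) * cmod (w j))"
    proof (intro sum_mono)
      fix k j
      have "\<bar>1 * real_of_int j - 1 * real_of_int k\<bar> \<le> br (k - j)" by (simp add: br_def)
      from mult_right_mono[OF this, of "cmod (g (k - j)) * (cmod (w k) * cmod (w j))"]
      show "\<bar>1 * real_of_int j - 1 * real_of_int k\<bar> * (cmod (g (k - j)) * (cmod (w k) * cmod (w j)))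
        \<le> (br (k - j) * cmod (g (k - j))) * cmod (w k) * cmod (w j)" by (simp add: mult_ac)
    qed
    also have "\<dots> \<le> A * A * S * S"
      unfolding S_def using gA by (intro young_finite) (auto simp: w1_def)
    finally show ?thesis .
  qed
  have split: "Re (cnj (u k - v k) * (nl u k - nl v k)) =
     Re (cnj (w k) * (\<Sum>j\<in>seg n. g (k - j) * Dx w j)) + Re (cnj (w k) * conv g (Dx r) k) + Re (cnj (w k) * h k)" for k
  proof -
    have "nl u k - nl v k = (\<Sum>j\<in>seg n. g (k - j) * Dx w j) + conv g (Dx r) k + h k"
      unfolding nl_diff[OF u v] h_def c1[symmetric] by (simp add: g_def w_def[abs_def])
    thus ?thesis by (simp only: w_def[symmetric] distrib_left plus_complex.sel)
  qed
  have "\<bar>\<Sum>k\<in>seg n. Re (cnj (u k - v k) * (nl u k - nl v k))\<bar> \<le>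
     \<bar>\<Sum>k\<in>seg n. Re (cnj (w k) * (\<Sum>j\<in>seg n. g (k - j) * Dx w j))\<bar> +
     \<bar>\<Sum>k\<in>seg n. Re (cnj (w k) * conv g (Dx r) k)\<bar> + \<bar>\<Sum>k\<in>seg n. Re (cnj (w k) * h k)\<bar>"
    unfolding split sum.distrib by linarith
  also have "\<dots> \<le> A * A * S * S / 2 + S * (A * A * \<delta>) + S * (A * (2 * A * (S + \<delta>)))"
    using t1 t2 t3 by linarith
  also have "\<dots> = A\<^sup>2 * (5 / 2 * S\<^sup>2 + 3 * (S * \<delta>))"
    by (simp add: power2_eq_square algebra_simps)
  \<comment> \<open>The mixed term is absorbed by
    \<open>2 * S * \<delta> \<le> S^2 + \<delta>^2\<close>: 5/2 + 3/2 gives the coefficient 4, and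
    3/2 is rounded up to 2.\<close>
  also have "\<dots> \<le> A\<^sup>2 * (4 * S\<^sup>2 + 2 * \<delta>\<^sup>2)"
  proof (rule mult_left_mono)
    have "0 \<le> (S - \<delta>)\<^sup>2" by simp
    hence "2 * (S * \<delta>) \<le> S\<^sup>2 + \<delta>\<^sup>2" by (simp add: power2_eq_square algebra_simps)
    thus "5 / 2 * S\<^sup>2 + 3 * (S * \<delta>) \<le> 4 * S\<^sup>2 + 2 * \<delta>\<^sup>2" using zero_le_power2[of \<delta>] by linarith
  qed simp
  also have "S\<^sup>2 = (\<Sum>k\<in>seg n. (cmod (u k - v k))\<^sup>2)"
    unfolding S_def L2_set_def w_def by (simp add: sum_nonneg)
  finally show ?thesis by (simp add: \<delta>_def)
qed

section \<open>Galerkin approximation\<close>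

lemma nonincreasing_within:
  fixes f :: "real \<Rightarrow> real"
  assumes "a \<le> b" and "\<And>t. t \<in> {a..b} \<Longrightarrow> (f has_real_derivative f' t) (at t within {a..b})"
    and "\<And>t. t \<in> {a..b} \<Longrightarrow> f' t \<le> 0"
  shows "f b \<le> f a"
proof -
  obtain t where "t \<in> {a..b}" "f b - f a = f' t * (b - a)"
    using mvt_very_simple[of a b f "\<lambda>t h. f' t * h"] assms by (auto simp: has_field_derivative_def)
  thus ?thesis using assms by (smt (verit) mult_nonpos_nonneg)
qed

text \<open>The integrating factor turns the inequality into monotonicity. It is at most 1 to the
  right of \<open>a\<close>, so the constant term costs at most
  \<open>\<epsilon> * (t - a)\<close>.\<close>

lemma gronwall_right:
  fixes f :: "real \<Rightarrow> real"
  assumes "a \<le> b" and d: "\<And>t. t \<in> {a..b} \<Longrightarrow> (f has_real_derivative f' t) (at t within {a..b})"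
    and le: "\<And>t. t \<in> {a..b} \<Longrightarrow> f' t \<le> C * f t + \<epsilon>" and "0 \<le> C" "0 \<le> \<epsilon>"
  shows "f b \<le> exp (C * (b - a)) * (f a + \<epsilon> * (b - a))"
proof -
  define g where "g t = exp (- (C * (t - a))) * f t - \<epsilon> * (t - a)" for t
  have "g b \<le> g a"
  proof (rule nonincreasing_within[OF \<open>a \<le> b\<close>])
    fix t assume t: "t \<in> {a..b}"
    show "(g has_real_derivative exp (- (C * (t - a))) * (f' t - C * f t) - \<epsilon>) (at t within {a..b})"
      unfolding g_def by (rule derivative_eq_intros d[OF t] refl | simp)+ (simp add: algebra_simps)
    have "exp (- (C * (t - a))) * (f' t - C * f t) \<le> exp (- (C * (t - a))) * \<epsilon>"
      using le[OF t] by (intro mult_left_mono) auto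
    also have "\<dots> \<le> 1 * \<epsilon>" using t assms by (intro mult_right_mono) auto
    finally show "exp (- (C * (t - a))) * (f' t - C * f t) - \<epsilon> \<le> 0" by simp
  qed
  hence "exp (- (C * (b - a))) * f b \<le> f a + \<epsilon> * (b - a)" by (simp add: g_def)
  hence "exp (C * (b - a)) * (exp (- (C * (b - a))) * f b) \<le> exp (C * (b - a)) * (f a + \<epsilon> * (b - a))"
    by (intro mult_left_mono) auto
  thus ?thesis by (simp add: mult.assoc[symmetric] exp_add[symmetric])
qed

text \<open>Reduces estimates forwards and backwards from \<open>a\<close> to one starting at time
  0, through \<open>r \<mapsto> a + r\<close> and \<open>r \<mapsto> a - r\<close>. Reversal flips
  the sign of the derivative, so \<open>P\<close> is required for both signs. \<open>Start\<close>,
  \<open>P\<close> and \<open>Q\<close> stand for the initial condition, the differential inequality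
  and the conclusion.\<close>

lemma interval_cases_within:
  fixes f :: "real \<Rightarrow> real" and P :: "real \<Rightarrow> real \<Rightarrow> real \<Rightarrow> bool"
  assumes "is_interval I" "a \<in> I" "t \<in> I"
    and d: "\<And>t. t \<in> I \<Longrightarrow> (f has_real_derivative f' t) (at t within I)"
    and right: "\<And>b g g'. (\<And>r. r \<in> {0..b} \<Longrightarrow> (g has_real_derivative g' r) (at r within {0..b})) \<Longrightarrow>
        (\<And>r. r \<in> {0..b} \<Longrightarrow> P r (g r) (g' r)) \<Longrightarrow> Start (g 0) \<Longrightarrow> 0 \<le> b \<Longrightarrow> b \<le> abs (t - a) \<Longrightarrow> Q b (g b)"
    and P: "\<And>r. r \<in> I \<Longrightarrow> abs (r - a) \<le> abs (t - a) \<Longrightarrow> P (abs (r - a)) (f r) (f' r)"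
      "\<And>r. r \<in> I \<Longrightarrow> abs (r - a) \<le> abs (t - a) \<Longrightarrow> P (abs (r - a)) (f r) (- f' r)"
    and "Start (f a)"
  shows "Q (abs (t - a)) (f t)"
proof (cases "a \<le> t")
  case True
  have sub: "a + r \<in> I" if "r \<in> {0..t - a}" for r
    using that True by (intro mem_is_interval_1_I[OF assms(1-3)]) auto
  have "Q (t - a) ((\<lambda>r. f (a + r)) (t - a))"
  proof (rule right[where g = "\<lambda>r. f (a + r)" and g' = "\<lambda>r. f' (a + r)"])
    fix r assume r: "r \<in> {0..t - a}"
    have "((\<lambda>r. f (a + r)) has_real_derivative f' (a + r) * 1) (at r within {0..t - a})"
    proof (rule DERIV_image_chain[of f "f' (a + r)" "\<lambda>r. a + r" r "{0..t - a}" 1, unfolded o_def])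
      show "((\<lambda>r. a + r) has_real_derivative 1) (at r within {0..t - a})"
        by (auto intro!: derivative_eq_intros)
      show "(f has_real_derivative f' (a + r)) (at (a + r) within (\<lambda>r. a + r) ` {0..t - a})"
        by (rule has_field_derivative_subset[OF d[OF sub[OF r]]]) (rule image_subsetI, rule sub)
    qed
    thus "((\<lambda>r. f (a + r)) has_real_derivative f' (a + r)) (at r within {0..t - a})" by simp
    show "P r (f (a + r)) (f' (a + r))"
      using P(1)[OF sub[OF r]] r True by simp
  qed (use True assms in auto)
  thus ?thesis using True by simp
next
  case False
  have sub: "a - r \<in> I" if "r \<in> {0..a - t}" for r
    using that False by (intro mem_is_interval_1_I[OF assms(1,3,2)]) auto
  have "Q (a - t) ((\<lambda>r. f (a - r)) (a - t))"
  proof (rule right[where g = "\<lambda>r. f (a - r)" and g' = "\<lambda>r. - f' (a - r)"])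
    fix r assume r: "r \<in> {0..a - t}"
    have "((\<lambda>r. f (a - r)) has_real_derivative f' (a - r) * (- 1)) (at r within {0..a - t})"
    proof (rule DERIV_image_chain[of f "f' (a - r)" "\<lambda>r. a - r" r "{0..a - t}" "- 1", unfolded o_def])
      show "((\<lambda>r. a - r) has_real_derivative - 1) (at r within {0..a - t})"
        by (auto intro!: derivative_eq_intros)
      show "(f has_real_derivative f' (a - r)) (at (a - r) within (\<lambda>r. a - r) ` {0..a - t})"
        by (rule has_field_derivative_subset[OF d[OF sub[OF r]]]) (rule image_subsetI, rule sub)
    qed
    thus "((\<lambda>r. f (a - r)) has_real_derivative - f' (a - r)) (at r within {0..a - t})" by simp
    show "P r (f (a - r)) (- f' (a - r))"
      using P(2)[OF sub[OF r]] r False by simp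
  qed (use False assms in auto)
  thus ?thesis using False by simp
qed

lemma gronwall:
  fixes f :: "real \<Rightarrow> real"
  assumes "is_interval I" "a \<in> I" "t \<in> I"
    and d: "\<And>t. t \<in> I \<Longrightarrow> (f has_real_derivative f' t) (at t within I)"
    and le: "\<And>t. t \<in> I \<Longrightarrow> \<bar>f' t\<bar> \<le> C * f t + \<epsilon>" and "0 \<le> C" "0 \<le> \<epsilon>"
  shows "f t \<le> exp (C * \<bar>t - a\<bar>) * (f a + \<epsilon> * \<bar>t - a\<bar>)"
proof (rule interval_cases_within[where Q = "\<lambda>r y. y \<le> exp (C * r) * (f a + \<epsilon> * r)"
      and P = "\<lambda>r y y'. y' \<le> C * y + \<epsilon>" and Start = "\<lambda>y. y = f a", OF assms(1-3) d])
  fix b g g'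
  assume "\<And>t. t \<in> {0..b} \<Longrightarrow> (g has_real_derivative g' t) (at t within {0..b})"
    "\<And>t. t \<in> {0..b} \<Longrightarrow> g' t \<le> C * g t + \<epsilon>" "g 0 = f a" "0 \<le> b"
  thus "g b \<le> exp (C * b) * (f a + \<epsilon> * b)"
    using gronwall_right[of 0 b g g' C \<epsilon>] assms by simp
qed (use le in \<open>fastforce\<close>)+

text \<open>Comparison with the Riccati equation y' = C y^2. The time span is chosen so that the
  reciprocal falls by at most half of its initial lower bound.\<close>

lemma quadratic_growth:
  fixes f :: "real \<Rightarrow> real"
  assumes "is_interval I" "a \<in> I" "t \<in> I"
    and d: "\<And>t. t \<in> I \<Longrightarrow> (f has_real_derivative f' t) (at t within I)"
    and le: "\<And>t. t \<in> I \<Longrightarrow> \<bar>f' t\<bar> \<le> C * (f t)\<^sup>2" and pos: "\<And>t. t \<in> I \<Longrightarrow> 0 \<le> f t"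
    and K: "f a \<le> K" "0 < K" "0 < C" and T: "\<bar>t - a\<bar> \<le> 1 / (4 * C * K)"
  shows "f t \<le> 4 * K"
proof (rule interval_cases_within[where Q = "\<lambda>r y. y \<le> 4 * K"
      and P = "\<lambda>r y y'. y' \<le> C * y\<^sup>2 \<and> 0 \<le> y" and Start = "\<lambda>y. y \<le> K", OF assms(1-3) d])
  fix b g g'
  assume g: "\<And>t. t \<in> {0..b} \<Longrightarrow> (g has_real_derivative g' t) (at t within {0..b})"
    "\<And>t. t \<in> {0..b} \<Longrightarrow> g' t \<le> C * (g t)\<^sup>2 \<and> 0 \<le> g t" "g 0 \<le> K" "0 \<le> b" "b \<le> \<bar>t - a\<bar>"
  \<comment> \<open>The shift by \<open>K\<close> keeps the reciprocal defined where
    \<open>g\<close> vanishes. Initially it is at least \<open>1 / (2 * K)\<close> and it loses at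
    most \<open>1 / (4 * K)\<close>.\<close>
  define \<phi> where "\<phi> r = - inverse (g r + K) - C * r" for r
  have "\<phi> b \<le> \<phi> 0"
  proof (rule nonincreasing_within[OF g(4)])
    fix r assume r: "r \<in> {0..b}"
    have nz: "0 < g r + K" using g(2)[OF r] K by linarith
    show "(\<phi> has_real_derivative g' r * (inverse (g r + K))\<^sup>2 - C) (at r within {0..b})"
      unfolding \<phi>_def using nz
      by (auto intro!: derivative_eq_intros g(1)[OF r] simp: power2_eq_square)
    have "g' r \<le> C * (g r + K)\<^sup>2"
    proof -
      have "(g r)\<^sup>2 \<le> (g r + K)\<^sup>2" using g(2)[OF r] K by (intro power_mono) auto
      hence "C * (g r)\<^sup>2 \<le> C * (g r + K)\<^sup>2" using K by (intro mult_left_mono) auto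
      thus ?thesis using g(2)[OF r] by linarith
    qed
    hence "g' r * (inverse (g r + K))\<^sup>2 \<le> C * (g r + K)\<^sup>2 * (inverse (g r + K))\<^sup>2"
      by (intro mult_right_mono) auto
    also have "\<dots> = C * ((g r + K) * inverse (g r + K))\<^sup>2" by (simp only: power_mult_distrib mult_ac)
    also have "\<dots> = C" using nz by simp
    finally show "g' r * (inverse (g r + K))\<^sup>2 - C \<le> 0" by simp
  qed
  have p0: "0 < g 0 + K" and pb: "0 < g b + K" using g(2)[of 0] g(2)[of b] g(4) K by auto
  have "inverse (2 * K) \<le> inverse (g 0 + K)"
    using p0 g(3) by (intro le_imp_inverse_le) auto
  moreover have "C * b \<le> inverse (4 * K)"
  proof -
    have "C * b \<le> C * (1 / (4 * C * K))" using g(5) T K by (intro mult_left_mono) auto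
    thus ?thesis using K by (simp add: field_simps)
  qed
  moreover have "inverse (2 * K) = 2 * inverse (4 * K)" by simp
  ultimately have "inverse (4 * K) \<le> inverse (g b + K)"
    using \<open>\<phi> b \<le> \<phi> 0\<close> by (simp add: \<phi>_def)
  hence "g b + K \<le> 4 * K" by (rule inverse_le_imp_le) (use K in simp)
  thus "g b \<le> 4 * K" using K by simp
qed (use le pos K in \<open>force simp: abs_le_iff\<close>)+

section \<open>Ordinary differential equations with a globally Lipschitz field\<close>

definition oint :: "(real \<Rightarrow> 'a::banach) \<Rightarrow> real \<Rightarrow> 'a" where
  "oint f t = (if 0 \<le> t then integral {0..t} f else - integral {t..0} f)"

lemma oint_deriv:
  assumes "continuous_on UNIV f"
  shows "(oint f has_vector_derivative f t) (at t)"
proof -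
  define T where "T = \<bar>t\<bar> + 1"
  have int: "f integrable_on {a..b}" for a b
    by (intro integrable_continuous_real continuous_on_subset[OF assms]) auto
  have "((\<lambda>u. integral {- T..u} f) has_vector_derivative f t) (at t within {- T..T})"
    by (rule integral_has_vector_derivative[OF continuous_on_subset[OF assms]]) (auto simp: T_def)
  hence "((\<lambda>u. integral {- T..u} f) has_vector_derivative f t) (at t)"
    by (subst (asm) at_within_interior) (auto simp: T_def)
  hence "((\<lambda>u. integral {- T..u} f - integral {- T..0} f) has_vector_derivative f t - 0) (at t)"
    by (intro has_vector_derivative_diff) auto
  hence "((\<lambda>u. integral {- T..u} f - integral {- T..0} f) has_vector_derivative f t) (at t)" by simp
  thus ?thesis
  proof (rule has_vector_derivative_transform_within_open[of _ _ _ "{- T<..<T}"])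
    fix u assume u: "u \<in> {- T<..<T}"
    show "integral {- T..u} f - integral {- T..0} f = oint f u"
    proof (cases "0 \<le> u")
      case True
      have "integral {- T..0} f + integral {0..u} f = integral {- T..u} f"
        by (rule Henstock_Kurzweil_Integration.integral_combine) (use True int in \<open>auto simp: T_def\<close>)
      thus ?thesis using True by (simp add: oint_def algebra_simps)
    next
      case False
      have "integral {- T..u} f + integral {u..0} f = integral {- T..0} f"
        by (rule Henstock_Kurzweil_Integration.integral_combine) (use False u int in auto)
      thus ?thesis using False by (simp add: oint_def algebra_simps)
    qed
  qed (auto simp: T_def)
qed

text \<open>Integrating the weight \<open>exp (2 * L * |r|)\<close> gains
  \<open>1 / (2 * L)\<close>. Against the Lipschitz constant \<open>L\<close> this leaves the
  contraction factor 1/2, which is why the exponent is twice \<open>L\<close>.\<close>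

lemma oint_bound:
  assumes c: "continuous_on UNIV f" and le: "\<And>r. norm (f r) \<le> M * exp (2 * L * \<bar>r\<bar>)" and L: "0 < L"
  shows "norm (oint f t) \<le> M * exp (2 * L * \<bar>t\<bar>) / (2 * L)"
proof -
  have M: "0 \<le> M" using le[of 0] by (simp add: order_trans[OF norm_ge_zero])
  have int: "f integrable_on {a..b}" for a b
    by (intro integrable_continuous_real continuous_on_subset[OF c]) auto
  have e: "M * exp (2 * L * b) / (2 * L) - M * exp (2 * L * a) / (2 * L) \<le> M * exp (2 * L * b) / (2 * L)" for a b
    using M L by simp
  show ?thesis
  proof (cases "0 \<le> t")
    case True
    have h: "((\<lambda>r. M * exp (2 * L * r)) has_integral
        (M * exp (2 * L * t) / (2 * L) - M * exp (2 * L * 0) / (2 * L))) {0..t}"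
      by (rule fundamental_theorem_of_calculus[OF True])
         (use L in \<open>auto intro!: derivative_eq_intros simp: has_real_derivative_iff_has_vector_derivative[symmetric]\<close>)
    have "norm (integral {0..t} f) \<le> integral {0..t} (\<lambda>r. M * exp (2 * L * r))"
      by (rule integral_norm_bound_integral[OF int]) (use h le in \<open>auto simp: has_integral_iff\<close>, metis abs_of_nonneg)
    thus ?thesis using True e[of t 0] integral_unique[OF h] by (simp add: oint_def)
  next
    case False
    have h: "((\<lambda>r. M * exp (2 * L * (- r))) has_integral
        (- (M * exp (2 * L * (- 0)) / (2 * L)) - (- (M * exp (2 * L * (- t)) / (2 * L))))) {t..0}"
      by (rule fundamental_theorem_of_calculus)
         (use L False in \<open>auto intro!: derivative_eq_intros simp: has_real_derivative_iff_has_vector_derivative[symmetric]\<close>)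
    have "norm (integral {t..0} f) \<le> integral {t..0} (\<lambda>r. M * exp (2 * L * (- r)))"
      by (rule integral_norm_bound_integral[OF int]) (use h le in \<open>auto simp: has_integral_iff\<close>, metis abs_of_nonpos mult_minus_right)
    thus ?thesis using False e[of "- t" 0] integral_unique[OF h] by (simp add: oint_def)
  qed
qed

lemma oint_diff:
  assumes "continuous_on UNIV f" "continuous_on UNIV g"
  shows "oint f t - oint g t = oint (\<lambda>r. f r - g r) t"
proof -
  have "f integrable_on {a..b}" "g integrable_on {a..b}" for a b
    by (intro integrable_continuous_real continuous_on_subset[OF assms(1)] continuous_on_subset[OF assms(2)]; simp)+
  thus ?thesis by (simp add: oint_def integral_diff)
qed

text \<open>Bielecki's weight turns the Picard map of a globally Lipschitz field into a contraction on
  the whole time axis.\<close>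

lemma picard_global:
  fixes F :: "'a::banach \<Rightarrow> 'a"
  assumes L: "0 < L" "\<And>x y. norm (F x - F y) \<le> L * norm (x - y)"
  obtains x where "x 0 = x0" "\<And>t. (x has_vector_derivative F (x t)) (at t)"
proof -
  have cF: "continuous_on UNIV F"
  proof -
    have "L-lipschitz_on UNIV F" using L by (intro lipschitz_onI) (auto simp: dist_norm)
    thus ?thesis by (rule lipschitz_on_continuous_on)
  qed
  \<comment> \<open>The unknown \<open>\<psi>\<close> is the displacement from \<open>x0\<close>
    divided by the weight; it ranges over bounded continuous functions, and \<open>y \<psi>\<close>
    is the field along the corresponding curve.\<close>
  define y where "y \<psi> r = F (x0 + exp (2 * L * \<bar>r\<bar>) *\<^sub>R apply_bcontfun \<psi> r)" for \<psi> :: "real \<Rightarrow>\<^sub>C 'a" and r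
  have cy: "continuous_on UNIV (y \<psi>)" for \<psi>
    unfolding y_def by (intro continuous_on_compose2[OF cF] continuous_intros) auto
  define M where "M \<psi> = norm (F x0) + L * norm \<psi>" for \<psi> :: "real \<Rightarrow>\<^sub>C 'a"
  have yb: "norm (y \<psi> r) \<le> M \<psi> * exp (2 * L * \<bar>r\<bar>)" for \<psi> r
  proof -
    have "norm (y \<psi> r) \<le> norm (F x0) + norm (y \<psi> r - F x0)" by norm
    also have "norm (y \<psi> r - F x0) \<le> L * norm (exp (2 * L * \<bar>r\<bar>) *\<^sub>R apply_bcontfun \<psi> r)"
      unfolding y_def using L(2)[of "x0 + exp (2 * L * \<bar>r\<bar>) *\<^sub>R apply_bcontfun \<psi> r" x0] by simp
    also have "\<dots> \<le> L * (exp (2 * L * \<bar>r\<bar>) * norm \<psi>)"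
      using L norm_bounded[of \<psi> r] by (auto intro!: mult_left_mono)
    also have "norm (F x0) \<le> norm (F x0) * exp (2 * L * \<bar>r\<bar>)"
      using L by (simp add: mult_le_cancel_left1)
    finally show ?thesis by (simp add: M_def algebra_simps)
  qed
  define G where "G \<psi> t = exp (- (2 * L * \<bar>t\<bar>)) *\<^sub>R oint (y \<psi>) t" for \<psi> t
  have G: "G \<psi> \<in> bcontfun" for \<psi>
  proof (rule bcontfun_normI)
    have "continuous_on UNIV (oint (y \<psi>))"
      using oint_deriv[OF cy] by (intro continuous_at_imp_continuous_on) (auto intro: has_vector_derivative_continuous)
    thus "continuous_on UNIV (G \<psi>)" unfolding G_def by (intro continuous_intros)
    fix t
    have "norm (G \<psi> t) \<le> exp (- (2 * L * \<bar>t\<bar>)) * (M \<psi> * exp (2 * L * \<bar>t\<bar>) / (2 * L))"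
      using mult_left_mono[OF oint_bound[OF cy yb L(1), of \<psi> t], of "exp (- (2 * L * \<bar>t\<bar>))"]
      by (simp add: G_def)
    also have "\<dots> = M \<psi> / (2 * L)" by (simp add: exp_minus field_simps)
    finally show "norm (G \<psi> t) \<le> M \<psi> / (2 * L)" .
  qed
  have "\<exists>!\<psi>. Bcontfun (G \<psi>) = \<psi>"
  proof (rule banach_fix_type[of "1/2"])
    show "\<forall>\<psi> \<theta>. dist (Bcontfun (G \<psi>)) (Bcontfun (G \<theta>)) \<le> 1 / 2 * dist \<psi> \<theta>"
    proof (intro allI dist_bound)
      fix \<psi> \<theta> t
      have "norm (y \<psi> r - y \<theta> r) \<le> (L * norm (\<psi> - \<theta>)) * exp (2 * L * \<bar>r\<bar>)" for r
      proof -
        have "norm (y \<psi> r - y \<theta> r) \<le> L * norm (exp (2 * L * \<bar>r\<bar>) *\<^sub>R apply_bcontfun (\<psi> - \<theta>) r)"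
          unfolding y_def using L(2)[of "x0 + exp (2 * L * \<bar>r\<bar>) *\<^sub>R apply_bcontfun \<psi> r" "x0 + exp (2 * L * \<bar>r\<bar>) *\<^sub>R apply_bcontfun \<theta> r"]
          by (simp add: minus_bcontfun.rep_eq scaleR_diff_right)
        also have "\<dots> \<le> L * (exp (2 * L * \<bar>r\<bar>) * norm (\<psi> - \<theta>))"
          using L norm_bounded[of "\<psi> - \<theta>" r] by (auto intro!: mult_left_mono)
        finally show ?thesis by (simp add: mult_ac)
      qed
      hence "norm (oint (\<lambda>r. y \<psi> r - y \<theta> r) t) \<le> (L * norm (\<psi> - \<theta>)) * exp (2 * L * \<bar>t\<bar>) / (2 * L)"
        by (intro oint_bound continuous_intros cy L)
      hence "norm (oint (y \<psi>) t - oint (y \<theta>) t) \<le> norm (\<psi> - \<theta>) / 2 * exp (2 * L * \<bar>t\<bar>)"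
        unfolding oint_diff[OF cy cy] using L by (simp add: field_simps)
      hence "exp (- (2 * L * \<bar>t\<bar>)) * norm (oint (y \<psi>) t - oint (y \<theta>) t) \<le> exp (- (2 * L * \<bar>t\<bar>)) * (norm (\<psi> - \<theta>) / 2 * exp (2 * L * \<bar>t\<bar>))"
        by (intro mult_left_mono) auto
      also have "\<dots> = norm (\<psi> - \<theta>) / 2" by (simp add: exp_minus field_simps)
      finally show "dist (apply_bcontfun (Bcontfun (G \<psi>)) t) (apply_bcontfun (Bcontfun (G \<theta>)) t) \<le> 1 / 2 * dist \<psi> \<theta>"
        unfolding Bcontfun_inverse[OF G] by (simp add: G_def dist_norm scaleR_diff_right[symmetric])
    qed
  qed auto
  then obtain \<psi> where "Bcontfun (G \<psi>) = \<psi>" by blast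
  hence \<psi>: "apply_bcontfun \<psi> t = G \<psi> t" for t using Bcontfun_inverse[OF G] by metis
  define x where "x t = x0 + oint (y \<psi>) t" for t
  have yx: "y \<psi> t = F (x t)" for t
  proof -
    have "y \<psi> t = F (x0 + exp (2 * L * \<bar>t\<bar>) *\<^sub>R G \<psi> t)" by (simp only: y_def \<psi>)
    moreover have "exp (2 * L * \<bar>t\<bar>) *\<^sub>R G \<psi> t = oint (y \<psi>) t"
      unfolding G_def by (simp add: exp_add[symmetric])
    ultimately show ?thesis by (simp add: x_def)
  qed
  show ?thesis
  proof (rule that[of x])
    show "x 0 = x0" by (simp add: x_def oint_def)
    have "(x has_vector_derivative 0 + y \<psi> t) (at t)" for t
      unfolding x_def[abs_def] by (intro has_vector_derivative_add oint_deriv cy) auto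
    thus "(x has_vector_derivative F (x t)) (at t)" for t by (simp add: yx)
  qed
qed

text \<open>All sequences are continuous for this discrete metric, so the bounded continuous
  functions from \<open>int\<close> to \<open>complex\<close> are the bounded sequences. With the
  metric they form a Banach space on which \<open>picard_global\<close> can run.\<close>

instantiation int :: metric_space
begin

definition dist_int :: "int \<Rightarrow> int \<Rightarrow> real" where
  "dist_int a b = real_of_int \<bar>a - b\<bar>"

definition uniformity_int :: "(int \<times> int) filter" where
  "uniformity_int = (INF e\<in>{0 <..}. principal {(x, y). dist x y < e})"

instance
proof
  show "uniformity = (INF e\<in>{0 <..}. principal {(x :: int, y). dist x y < e})"
    by (rule uniformity_int_def)
  fix U :: "int set"
  have "\<forall>\<^sub>F (x', y) in uniformity. x' = x \<longrightarrow> y \<in> U" if "x \<in> U" for x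
    unfolding uniformity_int_def
  proof (rule eventually_INF1[of 1])
    show "\<forall>\<^sub>F (x', y) in principal {(x, y). dist x y < (1 :: real)}. x' = x \<longrightarrow> y \<in> U"
    proof -
      have "a = b" if "\<bar>real_of_int a - real_of_int b\<bar> < 1" for a b
        using that by linarith
      thus ?thesis using that by (auto simp: eventually_principal dist_int_def)
    qed
  qed simp
  thus "open U \<longleftrightarrow> (\<forall>x\<in>U. \<forall>\<^sub>F (x', y) in uniformity. x' = x \<longrightarrow> y \<in> U)"
    by (simp add: open_discrete)
qed (auto simp: dist_int_def)

end

instance bcontfun :: (metric_space, banach) banach ..

section \<open>Radial retraction and truncated systems\<close>

definition retr :: "real \<Rightarrow> 'a::real_normed_vector \<Rightarrow> real" where
  "retr R x = (if norm x \<le> R then 1 else R / norm x)"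

lemma retr_range: "0 < R \<Longrightarrow> 0 < retr R x \<and> retr R x \<le> 1"
  by (auto simp: retr_def divide_simps)

lemma retr_norm: "0 < R \<Longrightarrow> norm (retr R x *\<^sub>R x) \<le> R"
  by (auto simp: retr_def)

text \<open>In a general norm the radial projection is Lipschitz with constant 2. One unit comes
  from \<open>x - y\<close> scaled by a factor at most 1, the other from the change of the factor
  itself, which multiplied by \<open>norm y\<close> is at most
  \<open>norm y - norm x\<close>.\<close>

lemma retr_lipschitz:
  assumes R: "0 < R"
  shows "norm (retr R x *\<^sub>R x - retr R y *\<^sub>R y) \<le> 2 * norm (x - y)"
proof -
  have *: "norm (retr R x *\<^sub>R x - retr R y *\<^sub>R y) \<le> 2 * norm (x - y)" if le: "norm x \<le> norm y" for x y :: 'a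
  proof (cases "norm y \<le> R")
    case True
    thus ?thesis using le by (simp add: retr_def)
  next
    case False
    have y: "norm (x - retr R y *\<^sub>R y) \<le> norm (x - y) + (1 - retr R y) * norm y"
    proof -
      have e: "norm (x - retr R y *\<^sub>R y) = norm ((x - y) + (1 - retr R y) *\<^sub>R y)"
        by (simp add: algebra_simps)
      show ?thesis unfolding e using norm_triangle_ineq[of "x - y" "(1 - retr R y) *\<^sub>R y"] retr_range[OF R, of y] by simp
    qed
    have d: "norm y - norm x \<le> norm (x - y)" by (metis norm_minus_commute norm_triangle_ineq2)
    show ?thesis
    proof (cases "norm x \<le> R")
      case True
      have "(1 - retr R y) * norm y = norm y - R" using False R by (cases "y = 0") (simp_all add: retr_def field_simps)
      hence "norm (x - retr R y *\<^sub>R y) \<le> 2 * norm (x - y)" using y d True by linarith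
      thus ?thesis using True by (simp add: retr_def)
    next
      case x: False
      have xp: "0 < norm x" and yp: "0 < norm y" using x False R by linarith+
      have e: "norm (retr R x *\<^sub>R x - retr R y *\<^sub>R y) =
          norm (retr R x *\<^sub>R (x - y) + (retr R x - retr R y) *\<^sub>R y)"
        by (simp add: algebra_simps)
      have "norm (retr R x *\<^sub>R x - retr R y *\<^sub>R y) \<le> retr R x * norm (x - y) + \<bar>retr R x - retr R y\<bar> * norm y"
        unfolding e using norm_triangle_ineq[of "retr R x *\<^sub>R (x - y)" "(retr R x - retr R y) *\<^sub>R y"] retr_range[OF R, of x] by simp
      also have "\<bar>retr R x - retr R y\<bar> * norm y = (R / norm x) * (norm y - norm x)"
      proof -
        have "0 \<le> R / norm x - R / norm y"
          using le xp R by (simp add: frac_le)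
        hence "\<bar>retr R x - retr R y\<bar> = R / norm x - R / norm y" using x False by (simp add: retr_def)
        thus ?thesis using xp yp by (simp add: field_simps)
      qed
      also have "\<dots> \<le> 1 * (norm y - norm x)"
        using x xp le by (intro mult_right_mono) auto
      also have "retr R x * norm (x - y) \<le> 1 * norm (x - y)"
        using retr_range[OF R, of x] by (intro mult_right_mono) auto
      finally show ?thesis using d by simp
    qed
  qed
  show ?thesis
  proof (cases "norm x \<le> norm y")
    case False
    thus ?thesis using *[of y x] by (simp add: norm_minus_commute)
  qed (rule *)
qed

text \<open>\<open>e\<close> is a forcing term. A truncated solution is a solution forced by minus
  the discarded modes of the nonlinearity, so one stability estimate serves both uniqueness and the
  limit of the approximations.\<close>

definition asol :: "real set \<Rightarrow> (real \<Rightarrow> int \<Rightarrow> complex) \<Rightarrow> (real \<Rightarrow> int \<Rightarrow> complex) \<Rightarrow> bool" where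
  "asol I e c \<longleftrightarrow> (\<forall>t\<in>I. \<forall>k. ((\<lambda>t. c t k) has_vector_derivative
     (\<i> * of_int k ^ 3 * c t k + 6 * nl (c t) k + e t k)) (at t within I))"

lemma asolD:
  assumes "asol I e c" "t \<in> I"
  shows "((\<lambda>t. c t k) has_vector_derivative
     (\<i> * of_int k ^ 3 * c t k + 6 * nl (c t) k + e t k)) (at t within I)"
  using assms by (auto simp: asol_def)

lemma cmod_squared_deriv:
  assumes "(c has_vector_derivative c') (at t within I)"
  shows "((\<lambda>t. (cmod (c t))\<^sup>2) has_real_derivative 2 * Re (cnj (c t) * c')) (at t within I)"
proof -
  have r: "((\<lambda>t. Re (c t)) has_real_derivative Re c') (at t within I)"
    and i: "((\<lambda>t. Im (c t)) has_real_derivative Im c') (at t within I)"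
    using bounded_linear.has_vector_derivative[OF bounded_linear_Re assms]
      bounded_linear.has_vector_derivative[OF bounded_linear_Im assms]
    by (simp_all add: has_real_derivative_iff_has_vector_derivative)
  show ?thesis
    using DERIV_add[OF DERIV_power[OF r, of 2] DERIV_power[OF i, of 2]]
    by (simp add: cmod_power2 algebra_simps)
qed

text \<open>The dispersive term only rotates each mode and leaves its modulus alone, so
  \<open>h\<close> is all that contributes.\<close>

lemma weighted_energy_deriv:
  assumes "\<And>k. k \<in> F \<Longrightarrow> ((\<lambda>t. c t k) has_vector_derivative (\<i> * of_int k ^ 3 * c t k + h k)) (at t within I)"
  shows "((\<lambda>t. \<Sum>k\<in>F. (wt s k * cmod (c t k))\<^sup>2) has_real_derivative
     (\<Sum>k\<in>F. 2 * (wt s k)\<^sup>2 * Re (cnj (c t k) * h k))) (at t within I)"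
proof (rule DERIV_sum)
  fix k assume k: "k \<in> F"
  have "Re (cnj z * (\<i> * of_int k ^ 3 * z + y)) = Re (cnj z * y)" for z y
  proof -
    have "\<i> * of_int k ^ 3 * z = \<i> * of_real (real_of_int k ^ 3) * z" by simp
    hence "cnj z * (\<i> * of_int k ^ 3 * z) = of_real (real_of_int k ^ 3) * (\<i> * (z * cnj z))"
      by (simp only: mult_ac)
    also have "Re \<dots> = 0" unfolding complex_norm_square[symmetric] by simp
    finally show ?thesis by (simp only: distrib_left plus_complex.sel)
  qed
  hence "((\<lambda>t. (cmod (c t k))\<^sup>2) has_real_derivative 2 * Re (cnj (c t k) * h k)) (at t within I)"
    using cmod_squared_deriv[OF assms[OF k]] by simp
  moreover define q where "q = Re (cnj (c t k) * h k)"
  ultimately have "((\<lambda>t. (cmod (c t k))\<^sup>2) has_real_derivative 2 * q) (at t within I)" by simp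
  from DERIV_cmult[OF this, of "(wt s k)\<^sup>2"]
  show "((\<lambda>t. (wt s k * cmod (c t k))\<^sup>2) has_real_derivative 2 * (wt s k)\<^sup>2 * Re (cnj (c t k) * h k)) (at t within I)"
    unfolding q_def[symmetric] by (simp add: power_mult_distrib mult_ac)
qed

lemma apply_bcontfun_bounded_linear: "bounded_linear (\<lambda>x. apply_bcontfun x k)"
  by (rule bounded_linear_intro[of _ 1])
     (auto simp: plus_bcontfun.rep_eq scaleR_bcontfun.rep_eq norm_bounded)

lemma finite_support_bcontfun: "(\<lambda>k::int. if k \<in> seg n then f k else (0::complex)) \<in> bcontfun"
proof (rule bcontfun_normI)
  show "norm (if k \<in> seg n then f k else 0) \<le> (\<Sum>k\<in>seg n. norm (f k))" for k
    using member_le_sum[of k "seg n" "\<lambda>k. norm (f k)"] by (auto intro: sum_nonneg)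
qed simp

lemma w1_finite_support:
  assumes "\<And>k. k \<notin> seg n \<Longrightarrow> c k = 0" "\<And>k. cmod (c k) \<le> R"
  shows "w1 c (\<Sum>k\<in>seg n. br k * R)"
  unfolding w1_def b1_def
proof (intro allI impI)
  fix G :: "int set" assume G: "finite G"
  have "(\<Sum>k\<in>G. br k * cmod (c k)) = (\<Sum>k\<in>G \<inter> seg n. br k * cmod (c k))"
    using assms G by (intro sum.mono_neutral_right) auto
  also have "\<dots> \<le> (\<Sum>k\<in>seg n. br k * cmod (c k))" by (intro sum_mono2) auto
  also have "\<dots> \<le> (\<Sum>k\<in>seg n. br k * R)" by (intro sum_mono mult_left_mono assms) auto
  finally show "(\<Sum>k\<in>G. br k * cmod (c k)) \<le> (\<Sum>k\<in>seg n. br k * R)" .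
qed

text \<open>The retraction makes the truncated field globally Lipschitz; it is a multiplication by a
  scalar, so it does not spoil the energy estimates.\<close>

lemma truncated_flow:
  assumes R: "0 < R"
  shows "\<exists>(c :: real \<Rightarrow> int \<Rightarrow> complex) \<mu>.
    (\<forall>k. c 0 k = (if k \<in> seg n then c0 k else 0)) \<and>
    (\<forall>t k. k \<notin> seg n \<longrightarrow> c t k = 0) \<and>
    (\<forall>t k. k \<in> seg n \<longrightarrow> ((\<lambda>t. c t k) has_vector_derivative
        (\<i> * of_int k ^ 3 * c t k + 6 * nl (\<lambda>k. of_real (\<mu> t) * c t k) k)) (at t)) \<and>
    (\<forall>t. 0 < \<mu> t \<and> \<mu> t \<le> 1) \<and> (\<forall>t. (\<forall>k. cmod (c t k) \<le> R) \<longrightarrow> \<mu> t = (1::real))"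
proof -
  define tr where "tr x k = (if k \<in> seg n then apply_bcontfun x k else 0)" for x :: "int \<Rightarrow>\<^sub>C complex" and k
  define P where "P x = retr R x *\<^sub>R x" for x :: "int \<Rightarrow>\<^sub>C complex"
  define f where "f x k = \<i> * of_int k ^ 3 * apply_bcontfun x k + 6 * nl (tr (P x)) k" for x and k :: int
  define F where "F x = Bcontfun (\<lambda>k. if k \<in> seg n then f x k else 0)" for x
  have F: "apply_bcontfun (F x) k = (if k \<in> seg n then f x k else 0)" for x k
    unfolding F_def by (subst Bcontfun_inverse[OF finite_support_bcontfun]) rule
  define A where "A = (\<Sum>k\<in>seg n. br k * R)"
  \<comment> \<open>\<open>n^3\<close> bounds the dispersive term on \<open>seg n\<close>. The 36 is
    the 6 of the equation, times the 3 of \<open>nl_diff_pointwise\<close>, times the 2 of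
    \<open>retr_lipschitz\<close>; the final 1 makes \<open>L\<close> positive.\<close>
  define L where "L = real n ^ 3 + 36 * A\<^sup>2 * (real n + 1) + 1"
  have L0: "0 < L" by (simp add: L_def add_pos_nonneg add_nonneg_pos)
  have trb: "cmod (tr x k) \<le> norm x" for x k using norm_bounded[of x k] by (simp add: tr_def)
  have wA: "w1 (tr (P x)) A" for x
    unfolding A_def
    by (rule w1_finite_support)
       (use order_trans[OF trb retr_norm[OF R]] in \<open>auto simp: tr_def P_def\<close>)
  have lip: "norm (F x - F y) \<le> L * norm (x - y)" for x y
  proof (rule norm_bound)
    fix k
    show "norm (apply_bcontfun (F x - F y) k) \<le> L * norm (x - y)"
    proof (cases "k \<in> seg n")
      case True
      have k: "\<bar>real_of_int k\<bar> \<le> real n" "br k \<le> real n + 1" using True by (auto simp: seg_def br_def)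
      have d: "cmod (tr (P x) j - tr (P y) j) \<le> 2 * norm (x - y)" for j
      proof -
        have "tr (P x) j - tr (P y) j = tr (P x - P y) j" by (simp add: tr_def minus_bcontfun.rep_eq)
        thus ?thesis using trb[of "P x - P y" j] retr_lipschitz[OF R, of x y] by (simp add: P_def)
      qed
      have "cmod (nl (tr (P x)) k - nl (tr (P y)) k) \<le> 3 * A\<^sup>2 * br k * (2 * norm (x - y))"
        by (rule nl_diff_pointwise[OF wA wA d])
      also have "\<dots> \<le> 3 * A\<^sup>2 * (real n + 1) * (2 * norm (x - y))"
        by (intro mult_right_mono mult_left_mono k) auto
      finally have 1: "cmod (6 * (nl (tr (P x)) k - nl (tr (P y)) k)) \<le> 36 * A\<^sup>2 * (real n + 1) * norm (x - y)"
        unfolding norm_mult by (simp add: mult_ac)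
      have "cmod (\<i> * of_int k ^ 3 * apply_bcontfun (x - y) k) = \<bar>real_of_int k\<bar> ^ 3 * cmod (apply_bcontfun (x - y) k)"
        by (simp add: norm_mult norm_power)
      also have "\<dots> \<le> real n ^ 3 * norm (x - y)"
        by (intro mult_mono power_mono k norm_bounded) auto
      finally have 2: "cmod (\<i> * of_int k ^ 3 * apply_bcontfun (x - y) k) \<le> real n ^ 3 * norm (x - y)" .
      have "apply_bcontfun (F x - F y) k = \<i> * of_int k ^ 3 * apply_bcontfun (x - y) k + 6 * (nl (tr (P x)) k - nl (tr (P y)) k)"
        using True by (simp add: F f_def minus_bcontfun.rep_eq algebra_simps)
      hence "norm (apply_bcontfun (F x - F y) k) \<le> real n ^ 3 * norm (x - y) + 36 * A\<^sup>2 * (real n + 1) * norm (x - y)"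
        using norm_triangle_ineq[of "\<i> * of_int k ^ 3 * apply_bcontfun (x - y) k" "6 * (nl (tr (P x)) k - nl (tr (P y)) k)"] 1 2
        by simp
      also have "\<dots> \<le> L * norm (x - y)" by (simp add: L_def distrib_right)
      finally show ?thesis .
    qed (use L0 in \<open>simp add: F minus_bcontfun.rep_eq\<close>)
  qed
  define x0 where "x0 = Bcontfun (\<lambda>k. if k \<in> seg n then c0 k else 0)"
  have x0: "apply_bcontfun x0 k = (if k \<in> seg n then c0 k else 0)" for k
    unfolding x0_def by (subst Bcontfun_inverse[OF finite_support_bcontfun]) rule
  obtain x where x: "x 0 = x0" "\<And>t. (x has_vector_derivative F (x t)) (at t)"
    using picard_global[of L F x0, OF L0 lip] by blast
  define c where "c t k = apply_bcontfun (x t) k" for t k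
  define \<mu> where "\<mu> t = retr R (x t)" for t
  have cd: "((\<lambda>t. c t k) has_vector_derivative apply_bcontfun (F (x t)) k) (at t)" for t k
    unfolding c_def by (rule bounded_linear.has_vector_derivative[OF apply_bcontfun_bounded_linear x(2)])
  \<comment> \<open>Modes outside \<open>seg n\<close> have zero velocity and start at zero.\<close>
  have c_out: "c t k = 0" if "k \<notin> seg n" for t k
  proof -
    have "((\<lambda>t. c t k) has_vector_derivative 0) (at t within UNIV)" for t
      using cd[of k t] that by (simp add: F)
    then obtain a where "\<And>t. c t k = a"
      using has_vector_derivative_zero_constant[of UNIV "\<lambda>t. c t k"] by auto
    moreover have "c 0 k = 0" using that by (simp add: c_def x x0)
    ultimately show ?thesis by metis
  qed
  have "tr (P (x t)) = (\<lambda>k. of_real (\<mu> t) * c t k)" for t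
    using c_out by (auto simp: tr_def P_def c_def \<mu>_def scaleR_bcontfun.rep_eq scaleR_conv_of_real fun_eq_iff)
  hence "((\<lambda>t. c t k) has_vector_derivative
      (\<i> * of_int k ^ 3 * c t k + 6 * nl (\<lambda>k. of_real (\<mu> t) * c t k) k)) (at t)" if "k \<in> seg n" for t k
    using cd[of k t] that by (simp add: F f_def c_def)
  moreover have "c 0 k = (if k \<in> seg n then c0 k else 0)" for k by (simp add: c_def x x0)
  moreover have "0 < \<mu> t \<and> \<mu> t \<le> 1" for t unfolding \<mu>_def by (rule retr_range[OF R])
  moreover have "\<mu> t = 1" if "\<forall>k. cmod (c t k) \<le> R" for t
    using norm_bound[of "x t" R] that by (auto simp: \<mu>_def retr_def c_def)
  ultimately show ?thesis using c_out by (intro exI[of _ c] exI[of _ \<mu>]) blast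
qed

definition Ces :: "real \<Rightarrow> real" where "Ces s = commC s * (2 + 8 * 2 powr s)"

text \<open>The time of \<open>quadratic_growth\<close> for the squared H^2 norm, which starts below
  \<open>K^2\<close> and whose growth constant is \<open>12 * Ces 2\<close>. The 12 is the 6 of the
  equation times the 2 from differentiating a square.\<close>

definition lifespan :: "real \<Rightarrow> real" where "lifespan K = 1 / (4 * (12 * Ces 2) * K\<^sup>2)"

text \<open>Within the lifespan the H^2 norm is at most \<open>2 * K\<close>, so the squared H^s
  norm grows at rate \<open>12 * Ces s * (2 * K)^2\<close>; the norm itself grows at half that
  rate.\<close>

definition growth :: "real \<Rightarrow> real \<Rightarrow> real" where "growth s K = 24 * Ces s * K\<^sup>2"

lemma Ces_pos: "0 \<le> s \<Longrightarrow> 0 < Ces s"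
  unfolding Ces_def commC_def by (intro mult_pos_pos add_pos_nonneg) auto

lemma lifespan_pos: "0 < K \<Longrightarrow> 0 < lifespan K"
  using Ces_pos[of 2] by (simp add: lifespan_def)

lemma hb_of_sum:
  assumes "finite F" "\<And>k. k \<notin> F \<Longrightarrow> c k = 0" "(\<Sum>k\<in>F. (wt s k * cmod (c k))\<^sup>2) \<le> K\<^sup>2" "0 \<le> K"
  shows "hb s c K"
proof -
  have "L2_set (\<lambda>k. wt s k * cmod (c k)) F \<le> K"
    unfolding L2_set_def using assms by (intro real_le_lsqrt) (auto intro: sum_nonneg)
  thus ?thesis using hb_finite_support[of F c s, OF assms(1,2)] hb_mono[of s c _ s K] by auto
qed

text \<open>The retraction has radius \<open>2 * K\<close> in the sup norm of the modes. The H^2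
  bound \<open>2 * K\<close> dominates that norm, so the retraction is inactive and the modified
  system is the genuine truncated one on the whole lifespan.\<close>

lemma galerkin:
  assumes K: "hb 2 c0 K" "0 < K"
  obtains c :: "real \<Rightarrow> int \<Rightarrow> complex" where
    "\<And>k. c 0 k = (if k \<in> seg n then c0 k else 0)"
    "asol {- lifespan K..lifespan K} (\<lambda>t k. if k \<in> seg n then 0 else - 6 * nl (c t) k) c"
    "\<And>t. t \<in> {- lifespan K..lifespan K} \<Longrightarrow> hb 2 (c t) (2 * K)"
    "\<And>s M t. 1 \<le> s \<Longrightarrow> hb s c0 M \<Longrightarrow> t \<in> {- lifespan K..lifespan K} \<Longrightarrow>
       hb s (c t) (M * exp (growth s K * \<bar>t\<bar>))"
proof -
  have R: "0 < 2 * K" using K by simp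
  obtain c \<mu> where c0: "\<And>k. c 0 k = (if k \<in> seg n then c0 k else 0)"
    and out: "\<And>t k. k \<notin> seg n \<Longrightarrow> c t k = 0"
    and d: "\<And>t k. k \<in> seg n \<Longrightarrow> ((\<lambda>t. c t k) has_vector_derivative
        (\<i> * of_int k ^ 3 * c t k + 6 * nl (\<lambda>k. of_real (\<mu> t) * c t k) k)) (at t)"
    and mu: "\<And>t. 0 < \<mu> t \<and> \<mu> t \<le> 1" and mu1: "\<And>t. (\<And>k. cmod (c t k) \<le> 2 * K) \<Longrightarrow> \<mu> t = 1"
    using truncated_flow[OF R, of n c0] by blast
  define y where "y s t = (\<Sum>k\<in>seg n. (wt s k * cmod (c t k))\<^sup>2)" for s t
  define y' where "y' s t = (\<Sum>k\<in>seg n. 2 * (wt s k)\<^sup>2 * Re (cnj (c t k) * (6 * nl (\<lambda>k. of_real (\<mu> t) * c t k) k)))" for s t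
  have y0: "0 \<le> y s t" for s t unfolding y_def by (intro sum_nonneg) auto
  have yd: "(y s has_real_derivative y' s t) (at t within I)" for s t I
    unfolding y_def y'_def by (rule weighted_energy_deriv) (rule has_vector_derivative_at_within[OF d])
  \<comment> \<open>This must hold before the retraction is known to be inactive. Applied to
    \<open>\<mu> * c\<close>, \<open>sobolev_energy\<close> has one factor \<open>\<mu>\<close> on
    the left and four on the right; after cancelling, the cube that remains is at most 1.\<close>
  have yle: "\<bar>y' s t\<bar> \<le> 12 * Ces s * H\<^sup>2 * y s t" if s: "1 \<le> s" and H: "hb 2 (c t) H" for s t H
  proof -
    define v where "v k = of_real (\<mu> t) * c t k" for k
    have m: "0 < \<mu> t" "\<mu> t \<le> 1" using mu by auto
    have "hb 2 v (\<mu> t * H)"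
      using b2_cmult[of "\<lambda>k. wt 2 k * cmod (c t k)" H "\<mu> t"] H m
      by (simp add: hb_def v_def norm_mult mult_ac)
    from sobolev_energy[OF s finite_seg[of n] _ this]
    have "\<bar>\<Sum>k\<in>seg n. (wt s k)\<^sup>2 * Re (cnj (v k) * nl v k)\<bar> \<le>
       Ces s * (\<mu> t * H)\<^sup>2 * (\<Sum>k\<in>seg n. (wt s k * cmod (v k))\<^sup>2)"
      unfolding Ces_def using out by (simp add: v_def)
    also have "(\<Sum>k\<in>seg n. (wt s k * cmod (v k))\<^sup>2) = (\<mu> t)\<^sup>2 * y s t"
      unfolding y_def v_def sum_distrib_left by (intro sum.cong) (auto simp: norm_mult power_mult_distrib)
    also have "(\<Sum>k\<in>seg n. (wt s k)\<^sup>2 * Re (cnj (v k) * nl v k)) = \<mu> t * y' s t / 12"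
    proof -
      have "Re (cnj (v k) * nl v k) = \<mu> t * Re (cnj (c t k) * nl v k)" for k
      proof -
        have "cnj (v k) * nl v k = of_real (\<mu> t) * (cnj (c t k) * nl v k)" by (simp add: v_def mult_ac)
        moreover have "Re (of_real a * z) = a * Re z" for a :: real and z by simp
        ultimately show ?thesis by metis
      qed
      moreover have "Re (cnj (c t k) * (6 * nl v k)) = 6 * Re (cnj (c t k) * nl v k)" for k
      proof -
        have "cnj (c t k) * (6 * nl v k) = of_real 6 * (cnj (c t k) * nl v k)" by (simp add: mult_ac)
        moreover have "Re (of_real a * z) = a * Re z" for a :: real and z by simp
        ultimately show ?thesis by metis
      qed
      ultimately show ?thesis
        unfolding y'_def v_def[abs_def, symmetric] sum_distrib_left sum_divide_distrib
        by (intro sum.cong refl) simp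
    qed
    finally have "\<mu> t * \<bar>y' s t\<bar> \<le> \<mu> t * ((\<mu> t)^3 * (12 * Ces s * H\<^sup>2 * y s t))"
      using m by (simp add: abs_mult power2_eq_square power3_eq_cube mult_ac)
    hence "\<bar>y' s t\<bar> \<le> (\<mu> t)^3 * (12 * Ces s * H\<^sup>2 * y s t)"
      using m by (simp only: mult_le_cancel_left_pos)
    also have "\<dots> \<le> 1 * (12 * Ces s * H\<^sup>2 * y s t)"
      using m Ces_pos[of s] s y0[of s t] by (intro mult_right_mono power_le_one) auto
    finally show ?thesis by simp
  qed
  define I where "I = {- lifespan K..lifespan K}"
  have I: "is_interval I" "0 \<in> I" using lifespan_pos[OF K(2)] by (auto simp: I_def is_interval_cc)
  have ini: "y s 0 \<le> M\<^sup>2" if "hb s c0 M" for s M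
  proof -
    have "y s 0 = (\<Sum>k\<in>seg n. (wt s k * cmod (c0 k))\<^sup>2)"
      unfolding y_def by (intro sum.cong) (auto simp: c0)
    thus ?thesis using that b2_sum[of _ M "seg n"] by (simp add: hb_def)
  qed
  have H2: "hb 2 (c t) (2 * K)" if t: "t \<in> I" for t
  proof (rule hb_of_sum[OF finite_seg[of n]])
    have "y 2 t \<le> 4 * K\<^sup>2"
    proof (rule quadratic_growth[OF I t yd])
      fix r assume "r \<in> I"
      have "hb 2 (c r) (sqrt (y 2 r))"
        by (rule hb_of_sum[OF finite_seg[of n]]) (use out y0 in \<open>auto simp: y_def\<close>)
      from yle[of 2 r, OF _ this] show "\<bar>y' 2 r\<bar> \<le> 12 * Ces 2 * (y 2 r)\<^sup>2"
        using y0[of 2 r] by (simp add: power2_eq_square mult_ac)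
    qed (use y0 ini[OF K(1)] K t Ces_pos[of 2] in \<open>auto simp: I_def lifespan_def\<close>)
    thus "(\<Sum>k\<in>seg n. (wt 2 k * cmod (c t k))\<^sup>2) \<le> (2 * K)\<^sup>2" by (simp add: y_def power_mult_distrib)
  qed (use out K in auto)
  have one: "\<mu> t = 1" if "t \<in> I" for t
    by (rule mu1) (use hb_pointwise0[OF H2[OF that]] in auto)
  show ?thesis
  proof (rule that[of c])
    show "c 0 k = (if k \<in> seg n then c0 k else 0)" for k by (rule c0)
    show "hb 2 (c t) (2 * K)" if "t \<in> {- lifespan K..lifespan K}" for t
      using H2 that by (simp add: I_def)
    show "asol {- lifespan K..lifespan K} (\<lambda>t k. if k \<in> seg n then 0 else - 6 * nl (c t) k) c"
      unfolding asol_def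
    proof (intro ballI allI)
      fix t k assume t: "t \<in> {- lifespan K..lifespan K}"
      show "((\<lambda>t. c t k) has_vector_derivative \<i> * of_int k ^ 3 * c t k + 6 * nl (c t) k +
          (if k \<in> seg n then 0 else - 6 * nl (c t) k)) (at t within {- lifespan K..lifespan K})"
      proof (cases "k \<in> seg n")
        case True
        thus ?thesis using has_vector_derivative_at_within[OF d[OF True, of t]] one[of t] t by (simp add: I_def)
      qed (simp add: out)
    qed
    fix s M t assume s: "1 \<le> s" "hb s c0 M" and t: "t \<in> {- lifespan K..lifespan K}"
    have t: "t \<in> I" using t by (simp add: I_def)
    have M: "0 \<le> M" by (rule hb_nonneg[OF s(2)])
    have "y s t \<le> exp (48 * Ces s * K\<^sup>2 * \<bar>t - 0\<bar>) * (y s 0 + 0 * \<bar>t - 0\<bar>)"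
    proof (rule gronwall[OF I t yd])
      fix r assume "r \<in> I"
      from yle[OF s(1) H2[OF this]] show "\<bar>y' s r\<bar> \<le> 48 * Ces s * K\<^sup>2 * y s r + 0"
        by (simp add: power_mult_distrib mult_ac)
    qed (use Ces_pos[of s] s in auto)
    also have "\<dots> \<le> exp (48 * Ces s * K\<^sup>2 * \<bar>t\<bar>) * M\<^sup>2"
      using ini[OF s(2)] by simp
    also have "\<dots> = (M * exp (growth s K * \<bar>t\<bar>))\<^sup>2"
      by (simp add: growth_def power_mult_distrib exp_double[symmetric] mult_ac)
    finally show "hb s (c t) (M * exp (growth s K * \<bar>t\<bar>))"
      by (intro hb_of_sum[OF finite_seg[of n]]) (use out M in \<open>auto simp: y_def\<close>)
  qed
qed

section \<open>Stability and local existence\<close>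

lemma hb_zero: "hb s (\<lambda>k. 0) 0"
  by (simp add: hb_def b2_def L2_set_def)

text \<open>192 is 2 from the square, 6 from the equation, 4 from \<open>nl_diff_energy\<close> and
  4 from \<open>(2 * K)^2\<close>. The 1 pays for pairing the difference with the forcing.\<close>

definition stabC :: "real \<Rightarrow> real" where "stabC K = 192 * K\<^sup>2 + 1"

lemma over_Suc_tendsto_0: "(\<lambda>n. K / (real n + 1)) \<longlonglongrightarrow> 0"
  using tendsto_mult_left[OF LIMSEQ_inverse_real_of_nat, of K]
  by (simp add: inverse_eq_divide add.commute)

text \<open>Only the energy of the modes in \<open>seg n\<close> is differentiated, so no infinite
  sum is. The remaining modes act as an extra error of order \<open>K / (n + 1)\<close> inside
  \<open>\<eta> n\<close>, and letting \<open>n\<close> grow removes it.\<close>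

lemma stability:
  assumes I: "is_interval I" "a \<in> I" "t \<in> I" and u: "asol I e u" and v: "asol I f v"
    and K: "\<And>r. r \<in> I \<Longrightarrow> hb 2 (u r) K" "\<And>r. r \<in> I \<Longrightarrow> hb 2 (v r) K"
    and ef: "\<And>r. r \<in> I \<Longrightarrow> hb 0 (\<lambda>k. e r k - f r k) \<epsilon>"
    and D: "hb 0 (\<lambda>k. u a k - v a k) D"
  shows "hb 0 (\<lambda>k. u t k - v t k) (sqrt (exp (stabC K * \<bar>t - a\<bar>) * (D\<^sup>2 + \<epsilon>\<^sup>2 * \<bar>t - a\<bar>)))"
proof -
  define w where "w r k = u r k - v r k" for r k
  define y where "y n r = (\<Sum>k\<in>seg n. (wt 0 k * cmod (w r k))\<^sup>2)" for n r
  define h where "h r k = 6 * (nl (u r) k - nl (v r) k) + (e r k - f r k)" for r k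
  define y' where "y' n r = (\<Sum>k\<in>seg n. 2 * (wt 0 k)\<^sup>2 * Re (cnj (w r k) * h r k))" for n r
  define \<eta> where "\<eta> n = 96 * K\<^sup>2 * (2 * K / (real n + 1))\<^sup>2 * 2 + \<epsilon>\<^sup>2" for n :: nat
  have K0: "0 \<le> K" using hb_nonneg[OF K(1)[OF I(3)]] .
  have yd: "(y n has_real_derivative y' n r) (at r within I)" if r: "r \<in> I" for n r
    unfolding y_def y'_def
  proof (rule weighted_energy_deriv)
    fix k
    have "((\<lambda>t. w t k) has_vector_derivative ((\<i> * of_int k ^ 3 * u r k + 6 * nl (u r) k + e r k) -
        (\<i> * of_int k ^ 3 * v r k + 6 * nl (v r) k + f r k))) (at r within I)"
      unfolding w_def by (rule has_vector_derivative_diff[OF asolD[OF u r] asolD[OF v r]])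
    also have "(\<i> * of_int k ^ 3 * u r k + 6 * nl (u r) k + e r k) - (\<i> * of_int k ^ 3 * v r k + 6 * nl (v r) k + f r k)
      = \<i> * of_int k ^ 3 * w r k + h r k" by (simp add: w_def h_def algebra_simps)
    finally show "((\<lambda>t. w t k) has_vector_derivative (\<i> * of_int k ^ 3 * w r k + h r k)) (at r within I)" .
  qed
  have yle: "\<bar>y' n r\<bar> \<le> stabC K * y n r + \<eta> n" if r: "r \<in> I" for n r
  proof -
    have y2: "y n r = (\<Sum>k\<in>seg n. (cmod (u r k - v r k))\<^sup>2)" by (simp add: y_def w_def)
    have Y: "(L2_set (\<lambda>k. cmod (w r k)) (seg n))\<^sup>2 = y n r"
      by (simp add: L2_set_def y_def sum_nonneg)
    have 1: "\<bar>\<Sum>k\<in>seg n. Re (cnj (w r k) * (nl (u r) k - nl (v r) k))\<bar> \<le>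
        (2 * K)\<^sup>2 * (4 * y n r + 2 * ((K + K) / (real n + 1))\<^sup>2)"
      unfolding y2 w_def
      by (rule nl_diff_energy[OF hb_w1[OF K(1)[OF r]] hb_w1[OF K(2)[OF r]] hb_diff[OF K(1)[OF r] K(2)[OF r]]])
    have "\<bar>\<Sum>k\<in>seg n. Re (cnj (w r k) * (e r k - f r k))\<bar> \<le> L2_set (\<lambda>k. cmod (w r k)) (seg n) * \<epsilon>"
      by (rule conv_pairing_bound[OF ef[OF r]]) simp
    moreover have "2 * (L2_set (\<lambda>k. cmod (w r k)) (seg n) * \<epsilon>) \<le> y n r + \<epsilon>\<^sup>2"
      using zero_le_power2[of "L2_set (\<lambda>k. cmod (w r k)) (seg n) - \<epsilon>"] Y
      by (simp add: power2_eq_square algebra_simps)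
    ultimately have 2: "2 * \<bar>\<Sum>k\<in>seg n. Re (cnj (w r k) * (e r k - f r k))\<bar> \<le> y n r + \<epsilon>\<^sup>2" by linarith
    have "y' n r = 12 * (\<Sum>k\<in>seg n. Re (cnj (w r k) * (nl (u r) k - nl (v r) k)))
        + 2 * (\<Sum>k\<in>seg n. Re (cnj (w r k) * (e r k - f r k)))"
    proof -
      have "Re (cnj z * (6 * x + y)) = 6 * Re (cnj z * x) + Re (cnj z * y)" for x y z by (simp add: algebra_simps)
      thus ?thesis by (simp only: y'_def h_def wt_0 sum_distrib_left sum.distrib[symmetric])
          (intro sum.cong refl, simp)
    qed
    hence "\<bar>y' n r\<bar> \<le> 12 * ((2 * K)\<^sup>2 * (4 * y n r + 2 * ((K + K) / (real n + 1))\<^sup>2)) + (y n r + \<epsilon>\<^sup>2)"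
      using 1 2 by linarith
    also have "\<dots> \<le> stabC K * y n r + \<eta> n"
      by (simp add: stabC_def \<eta>_def power_mult_distrib algebra_simps)
    finally show ?thesis .
  qed
  have main: "y n t \<le> exp (stabC K * \<bar>t - a\<bar>) * (D\<^sup>2 + \<eta> n * \<bar>t - a\<bar>)" for n
  proof -
    have "y n t \<le> exp (stabC K * \<bar>t - a\<bar>) * (y n a + \<eta> n * \<bar>t - a\<bar>)"
      by (rule gronwall[OF I yd yle]) (auto simp: stabC_def \<eta>_def)
    moreover have "y n a \<le> D\<^sup>2"
      using b2_sum[of _ D "seg n"] D by (simp add: y_def w_def hb_def)
    ultimately show ?thesis by (smt (verit) exp_gt_zero mult_left_mono)
  qed
  have \<eta>: "\<eta> \<longlonglongrightarrow> \<epsilon>\<^sup>2"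
  proof -
    have "(\<lambda>n. 96 * K\<^sup>2 * (2 * K / (real n + 1))\<^sup>2 * 2 + \<epsilon>\<^sup>2) \<longlonglongrightarrow> 96 * K\<^sup>2 * 0\<^sup>2 * 2 + \<epsilon>\<^sup>2"
      by (intro tendsto_intros over_Suc_tendsto_0)
    thus ?thesis by (simp add: \<eta>_def[abs_def])
  qed
  have fin: "(\<Sum>k\<in>F. (cmod (w t k))\<^sup>2) \<le> exp (stabC K * \<bar>t - a\<bar>) * (D\<^sup>2 + \<epsilon>\<^sup>2 * \<bar>t - a\<bar>)" if F: "finite F" for F
  proof (rule tendsto_lowerbound)
    show "(\<lambda>n. exp (stabC K * \<bar>t - a\<bar>) * (D\<^sup>2 + \<eta> n * \<bar>t - a\<bar>)) \<longlonglongrightarrow> exp (stabC K * \<bar>t - a\<bar>) * (D\<^sup>2 + \<epsilon>\<^sup>2 * \<bar>t - a\<bar>)"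
      by (intro tendsto_intros \<eta>)
    obtain N where N: "F \<subseteq> seg N" using finite_subset_seg[OF F] by blast
    show "\<forall>\<^sub>F n in sequentially. (\<Sum>k\<in>F. (cmod (w t k))\<^sup>2) \<le> exp (stabC K * \<bar>t - a\<bar>) * (D\<^sup>2 + \<eta> n * \<bar>t - a\<bar>)"
    proof (rule eventually_sequentiallyI[of N])
      fix n assume "N \<le> n"
      hence "F \<subseteq> seg n" using N by (auto simp: seg_def)
      hence "(\<Sum>k\<in>F. (cmod (w t k))\<^sup>2) \<le> y n t" unfolding y_def by (simp add: sum_mono2)
      thus "(\<Sum>k\<in>F. (cmod (w t k))\<^sup>2) \<le> exp (stabC K * \<bar>t - a\<bar>) * (D\<^sup>2 + \<eta> n * \<bar>t - a\<bar>)"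
        using main[of n] by linarith
    qed
  qed simp
  show ?thesis unfolding hb0 b2_def L2_set_def using fin by (auto simp: w_def intro: real_sqrt_le_mono)
qed

lemma uniqueness:
  assumes I: "is_interval I" "a \<in> I" "t \<in> I" and u: "asol I (\<lambda>_ _. 0) u" and v: "asol I (\<lambda>_ _. 0) v"
    and K: "\<And>r. r \<in> I \<Longrightarrow> hb 2 (u r) K" "\<And>r. r \<in> I \<Longrightarrow> hb 2 (v r) K" and "u a = v a"
  shows "u t = v t"
proof
  fix k
  have "hb 0 (\<lambda>k. u t k - v t k) (sqrt (exp (stabC K * \<bar>t - a\<bar>) * (0\<^sup>2 + 0\<^sup>2 * \<bar>t - a\<bar>)))"
    by (rule stability[OF I u v K]) (use hb_zero \<open>u a = v a\<close> in auto)
  from hb_pointwise0[OF this, of k] show "u t k = v t k" by simp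
qed

text \<open>A bound on all finite sums survives pointwise limits; this plays the role of weak lower
  semicontinuity of the norm.\<close>

lemma hb_limit:
  assumes "\<And>n. hb s (c n) (M n)" "M \<longlonglongrightarrow> M'" "\<And>k. (\<lambda>n. c n k) \<longlonglongrightarrow> c' k"
  shows "hb s c' M'"
  unfolding hb_def b2_def
proof (intro allI impI)
  fix F :: "int set" assume F: "finite F"
  show "L2_set (\<lambda>k. wt s k * cmod (c' k)) F \<le> M'"
  proof (rule tendsto_le[OF _ assms(2)])
    show "(\<lambda>n. L2_set (\<lambda>k. wt s k * cmod (c n k)) F) \<longlonglongrightarrow> L2_set (\<lambda>k. wt s k * cmod (c' k)) F"
      unfolding L2_set_def by (intro tendsto_intros assms)
    show "\<forall>\<^sub>F n in sequentially. L2_set (\<lambda>k. wt s k * cmod (c n k)) F \<le> M n"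
      using assms(1) F by (auto simp: hb_def b2_def)
  qed simp
qed

text \<open>\<open>stability\<close> makes every mode Cauchy uniformly in time. The uniform H^2
  bound then makes the right-hand sides converge uniformly in time for each fixed mode, and so the
  limit may be differentiated.\<close>

lemma approximation_limit:
  assumes I: "is_interval I" "0 \<in> I" "\<And>t. t \<in> I \<Longrightarrow> \<bar>t\<bar> \<le> T"
    and c: "\<And>n. asol I (e n) (c n)" "\<And>n t. t \<in> I \<Longrightarrow> hb 2 (c n t) K"
    and e: "\<And>n t. t \<in> I \<Longrightarrow> hb 0 (e n t) (\<epsilon> n)" "\<epsilon> \<longlonglongrightarrow> 0"
    and D: "\<And>n. hb 0 (\<lambda>k. c n 0 k - c0 k) (D n)" "D \<longlonglongrightarrow> 0"
  shows "\<exists>c'. c' 0 = c0 \<and> asol I (\<lambda>_ _. 0) c' \<and> (\<forall>t\<in>I. \<forall>k. (\<lambda>n. c n t k) \<longlonglongrightarrow> c' t k)"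
proof -
  have T0: "0 \<le> T" using I(3)[OF I(2)] by simp
  define E where "E = exp (stabC K * T)"
  define \<delta> where "\<delta> n m = sqrt (E * ((D n + D m)\<^sup>2 + (\<epsilon> n + \<epsilon> m)\<^sup>2 * T))" for n m
  define \<delta>' where "\<delta>' n = sqrt (E * ((D n + 0)\<^sup>2 + (\<epsilon> n + 0)\<^sup>2 * T))" for n
  have d: "cmod (c n t k - c m t k) \<le> \<delta> n m" if t: "t \<in> I" for n m t k
  proof -
    have "hb 0 (\<lambda>k. c n t k - c m t k) (sqrt (exp (stabC K * \<bar>t - 0\<bar>) * ((D n + D m)\<^sup>2 + (\<epsilon> n + \<epsilon> m)\<^sup>2 * \<bar>t - 0\<bar>)))"
    proof (rule stability[OF I(1,2) t c(1) c(1) c(2) c(2)])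
      show "hb 0 (\<lambda>k. e n r k - e m r k) (\<epsilon> n + \<epsilon> m)" if "r \<in> I" for r
        by (intro hb_diff e(1) that)
      have "hb 0 (\<lambda>k. (c n 0 k - c0 k) - (c m 0 k - c0 k)) (D n + D m)" by (intro hb_diff D(1))
      thus "hb 0 (\<lambda>k. c n 0 k - c m 0 k) (D n + D m)" by simp
    qed
    from hb_pointwise0[OF this, of k]
    have "cmod (c n t k - c m t k) \<le> sqrt (exp (stabC K * \<bar>t\<bar>) * ((D n + D m)\<^sup>2 + (\<epsilon> n + \<epsilon> m)\<^sup>2 * \<bar>t\<bar>))" by simp
    also have "\<dots> \<le> \<delta> n m"
      unfolding \<delta>_def E_def using I(3)[OF t]
      by (intro real_sqrt_le_mono mult_mono add_left_mono mult_left_mono iffD2[OF exp_le_cancel_iff]) (auto simp: stabC_def T0)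
    finally show ?thesis .
  qed
  have dlim: "(\<lambda>m. \<delta> n m) \<longlonglongrightarrow> \<delta>' n" for n
    unfolding \<delta>_def \<delta>'_def by (intro tendsto_intros e(2) D(2))
  have d'lim: "\<delta>' \<longlonglongrightarrow> 0"
  proof -
    have "\<delta>' \<longlonglongrightarrow> sqrt (E * ((0 + 0)\<^sup>2 + (0 + 0)\<^sup>2 * T))"
      unfolding \<delta>'_def by (intro tendsto_intros e(2) D(2))
    thus ?thesis by simp
  qed
  have conv: "convergent (\<lambda>n. c n t k)" if t: "t \<in> I" for t k
  proof -
    have "Cauchy (\<lambda>n. c n t k)"
    proof (rule CauchyI)
      fix r :: real assume r: "0 < r"
      have "\<forall>\<^sub>F n in sequentially. \<delta>' n < r / 2" using d'lim r by (intro order_tendstoD) auto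
      then obtain N where N: "\<delta>' N < r / 2" by (auto simp: eventually_sequentially)
      have "\<forall>\<^sub>F m in sequentially. \<delta> N m < r / 2" using dlim N by (rule order_tendstoD)
      then obtain M where M: "\<And>m. M \<le> m \<Longrightarrow> \<delta> N m < r / 2" by (auto simp: eventually_sequentially)
      show "\<exists>M. \<forall>m\<ge>M. \<forall>n\<ge>M. norm (c m t k - c n t k) < r"
      proof (intro exI allI impI)
        fix m n assume mn: "M \<le> m" "M \<le> n"
        have "norm (c m t k - c n t k) \<le> norm (c N t k - c m t k) + norm (c N t k - c n t k)"
          using norm_triangle_ineq4[of "c N t k - c n t k" "c N t k - c m t k"] by simp
        also have "\<dots> < r" using d[OF t, of N k m] d[OF t, of N k n] M[OF mn(1)] M[OF mn(2)] by linarith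
        finally show "norm (c m t k - c n t k) < r" .
      qed
    qed
    thus ?thesis by (rule Cauchy_convergent)
  qed
  define c' where "c' t k = lim (\<lambda>n. c n t k)" for t k
  have lim: "(\<lambda>n. c n t k) \<longlonglongrightarrow> c' t k" if "t \<in> I" for t k
    using conv[OF that] unfolding c'_def by (simp add: convergent_LIMSEQ_iff)
  have dl: "cmod (c n t k - c' t k) \<le> \<delta>' n" if t: "t \<in> I" for n t k
  proof (rule tendsto_le[OF _ dlim])
    show "(\<lambda>m. cmod (c n t k - c m t k)) \<longlonglongrightarrow> cmod (c n t k - c' t k)" by (intro tendsto_intros lim t)
  qed (use d[OF t] in auto)
  have K': "hb 2 (c' t) K" if "t \<in> I" for t
    by (rule hb_limit[OF c(2)[OF that] tendsto_const lim[OF that]])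
  have c0: "c' 0 = c0"
  proof
    fix k
    have "(\<lambda>n. c n 0 k - c0 k) \<longlonglongrightarrow> 0"
    proof (rule Lim_null_comparison[OF _ D(2)])
      show "\<forall>\<^sub>F n in sequentially. norm (c n 0 k - c0 k) \<le> D n"
        using hb_pointwise0[OF D(1)] by auto
    qed
    hence "(\<lambda>n. c n 0 k) \<longlonglongrightarrow> c0 k" by (rule LIM_zero_cancel)
    thus "c' 0 k = c0 k" using lim[OF I(2)] LIMSEQ_unique by blast
  qed
  have "asol I (\<lambda>_ _. 0) c'"
    unfolding asol_def
  proof (intro ballI allI)
    fix t k assume t: "t \<in> I"
    define q where "q n r = \<i> * of_int k ^ 3 * c n r k + 6 * nl (c n r) k + e n r k" for n r
    define q' where "q' r = \<i> * of_int k ^ 3 * c' r k + 6 * nl (c' r) k + 0" for r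
    define B where "B n = \<bar>real_of_int k\<bar> ^ 3 * \<delta>' n + 18 * (2 * K)\<^sup>2 * br k * \<delta>' n + \<epsilon> n" for n
    have Blim: "B \<longlonglongrightarrow> 0"
    proof -
      have "B \<longlonglongrightarrow> \<bar>real_of_int k\<bar> ^ 3 * 0 + 18 * (2 * K)\<^sup>2 * br k * 0 + 0"
        unfolding B_def by (intro tendsto_intros d'lim e(2))
      thus ?thesis by simp
    qed
    have qq: "norm (q n r - q' r) \<le> B n" if r: "r \<in> I" for n r
    proof -
      have "q n r - q' r = \<i> * of_int k ^ 3 * (c n r k - c' r k) + 6 * (nl (c n r) k - nl (c' r) k) + e n r k"
        by (simp add: q_def q'_def algebra_simps)
      hence "norm (q n r - q' r) \<le> norm (\<i> * of_int k ^ 3 * (c n r k - c' r k)) + norm (6 * (nl (c n r) k - nl (c' r) k)) + norm (e n r k)"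
        using norm_triangle_ineq[of "\<i> * of_int k ^ 3 * (c n r k - c' r k) + 6 * (nl (c n r) k - nl (c' r) k)" "e n r k"]
          norm_triangle_ineq[of "\<i> * of_int k ^ 3 * (c n r k - c' r k)" "6 * (nl (c n r) k - nl (c' r) k)"]
        by simp
      moreover have "norm (\<i> * of_int k ^ 3 * (c n r k - c' r k)) \<le> \<bar>real_of_int k\<bar> ^ 3 * \<delta>' n"
        using dl[OF r, of n k] by (simp add: norm_mult norm_power mult_left_mono)
      moreover have "norm (6 * (nl (c n r) k - nl (c' r) k)) \<le> 18 * (2 * K)\<^sup>2 * br k * \<delta>' n"
        using nl_diff_pointwise[OF hb_w1[OF c(2)[OF r]] hb_w1[OF K'[OF r]] dl[OF r], of n k]
        unfolding norm_mult by (simp add: mult_ac)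
      moreover have "norm (e n r k) \<le> \<epsilon> n" using hb_pointwise0[OF e(1)[OF r]] by simp
      ultimately show ?thesis by (simp add: B_def)
    qed
    \<comment> \<open>The derivatives \<open>q n\<close> converge to \<open>q'\<close> uniformly on
      \<open>I\<close> with error \<open>B n\<close>, which is all that differentiating the limit
      requires. The function \<open>g\<close> found here is then identified with the mode of
      \<open>c'\<close>.\<close>
    have "\<exists>g. \<forall>r\<in>I. (\<lambda>n. c n r k) \<longlonglongrightarrow> g r \<and> (g has_derivative (\<lambda>h. h *\<^sub>R q' r)) (at r within I)"
    proof (rule has_derivative_sequence[where f = "\<lambda>n r. c n r k" and f' = "\<lambda>n r h. h *\<^sub>R q n r" and ?x0.0 = 0])
      show "convex I" using I(1) by (simp add: is_interval_convex_1)
      show "((\<lambda>r. c n r k) has_derivative (\<lambda>h. h *\<^sub>R q n r)) (at r within I)" if "r \<in> I" for n r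
        using asolD[OF c(1) that] unfolding has_vector_derivative_def q_def .
      show "0 \<in> I" by fact
      show "(\<lambda>n. c n 0 k) \<longlonglongrightarrow> c' 0 k" by (rule lim[OF I(2)])
      fix \<eta> :: real assume "0 < \<eta>"
      hence "\<forall>\<^sub>F n in sequentially. B n < \<eta>" using Blim by (intro order_tendstoD) auto
      thus "\<forall>\<^sub>F n in sequentially. \<forall>r\<in>I. \<forall>h. norm (h *\<^sub>R q n r - h *\<^sub>R q' r) \<le> \<eta> * norm h"
      proof (rule eventually_mono, intro ballI allI)
        fix n r and h :: real assume "B n < \<eta>" "r \<in> I"
        hence "norm (q n r - q' r) \<le> \<eta>" using qq[of r n] by simp
        hence "\<bar>h\<bar> * norm (q n r - q' r) \<le> \<bar>h\<bar> * \<eta>" by (intro mult_left_mono) auto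
        thus "norm (h *\<^sub>R q n r - h *\<^sub>R q' r) \<le> \<eta> * norm h"
          by (simp add: scaleR_diff_right[symmetric] mult.commute)
      qed
    qed
    then obtain g where g: "\<And>r. r \<in> I \<Longrightarrow> (\<lambda>n. c n r k) \<longlonglongrightarrow> g r"
      "\<And>r. r \<in> I \<Longrightarrow> (g has_derivative (\<lambda>h. h *\<^sub>R q' r)) (at r within I)" by blast
    have eq: "c' r k = g r" if "r \<in> I" for r using g(1)[OF that] lim[OF that] LIMSEQ_unique by blast
    have "((\<lambda>r. c' r k) has_derivative (\<lambda>h. h *\<^sub>R q' t)) (at t within I)"
      by (rule has_derivative_transform[OF t _ g(2)[OF t]]) (rule eq)
    thus "((\<lambda>t. c' t k) has_vector_derivative \<i> * of_int k ^ 3 * c' t k + 6 * nl (c' t) k + 0) (at t within I)"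
      unfolding has_vector_derivative_def q'_def .
  qed
  thus ?thesis using c0 lim by blast
qed

lemma hb_tail:
  assumes "hb (s + 1) c K" shows "hb s (\<lambda>k. if k \<in> seg n then 0 else c k) (K / (real n + 1))"
proof -
  have "b2 (\<lambda>k. (1 / (real n + 1)) * (wt (s + 1) k * cmod (c k))) ((1 / (real n + 1)) * K)"
    using assms by (intro b2_cmult) (auto simp: hb_def)
  thus ?thesis unfolding hb_def
  proof (rule b2_mono)
    fix k
    show "\<bar>wt s k * cmod (if k \<in> seg n then 0 else c k)\<bar> \<le> \<bar>(1 / (real n + 1)) * (wt (s + 1) k * cmod (c k))\<bar>"
    proof (cases "k \<in> seg n")
      case False
      have "(real n + 1) * (wt s k * cmod (c k)) \<le> br k * (wt s k * cmod (c k))"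
        by (intro mult_right_mono seg_outside_br False) auto
      thus ?thesis using False by (simp add: wt_add field_simps)
    qed simp
  qed simp
qed

lemma local_existence:
  assumes K: "hb 2 c0 K" "0 < K"
  shows "\<exists>c. c 0 = c0 \<and> asol {- lifespan K..lifespan K} (\<lambda>_ _. 0) c \<and>
    (\<forall>t \<in> {- lifespan K..lifespan K}. hb 2 (c t) (2 * K)) \<and>
    (\<forall>s M t. 1 \<le> s \<longrightarrow> hb s c0 M \<longrightarrow> t \<in> {- lifespan K..lifespan K} \<longrightarrow>
       hb s (c t) (M * exp (growth s K * \<bar>t\<bar>)))"
proof -
  define I where "I = {- lifespan K..lifespan K}"
  define P where "P n c \<longleftrightarrow> (\<forall>k. c 0 k = (if k \<in> seg n then c0 k else 0)) \<and>
      asol I (\<lambda>t k. if k \<in> seg n then 0 else - 6 * nl (c t) k) c \<and>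
      (\<forall>t\<in>I. hb 2 (c t) (2 * K)) \<and>
      (\<forall>s M t. 1 \<le> s \<longrightarrow> hb s c0 M \<longrightarrow> t \<in> I \<longrightarrow> hb s (c t) (M * exp (growth s K * \<bar>t\<bar>)))" for n c
  have "\<exists>c. P n c" for n
    unfolding I_def P_def by (rule galerkin[OF K, of n]) blast
  hence "\<exists>c. \<forall>n. P n (c n)" by (intro choice allI)
  then obtain c where P: "\<And>n. P n (c n)" by blast
  have c: "\<And>n k. c n 0 k = (if k \<in> seg n then c0 k else 0)"
      "\<And>n. asol I (\<lambda>t k. if k \<in> seg n then 0 else - 6 * nl (c n t) k) (c n)"
      "\<And>n t. t \<in> I \<Longrightarrow> hb 2 (c n t) (2 * K)"
      "\<And>n s M t. 1 \<le> s \<Longrightarrow> hb s c0 M \<Longrightarrow> t \<in> I \<Longrightarrow> hb s (c n t) (M * exp (growth s K * \<bar>t\<bar>))"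
    using P unfolding P_def by blast+
  have "\<exists>c'. c' 0 = c0 \<and> asol I (\<lambda>_ _. 0) c' \<and> (\<forall>t\<in>I. \<forall>k. (\<lambda>n. c n t k) \<longlonglongrightarrow> c' t k)"
  proof (rule approximation_limit[where T = "lifespan K" and K = "2 * K"
        and \<epsilon> = "\<lambda>n. 6 * (4 * (2 * K) ^ 3) / (real n + 1)" and D = "\<lambda>n. K / (real n + 1)"])
    show "is_interval I" "0 \<in> I" "\<And>t. t \<in> I \<Longrightarrow> \<bar>t\<bar> \<le> lifespan K"
      using lifespan_pos[OF K(2)] by (auto simp: I_def is_interval_cc)
    show "asol I (\<lambda>t k. if k \<in> seg n then 0 else - 6 * nl (c n t) k) (c n)" for n by (rule c(2))
    show "hb 2 (c n t) (2 * K)" if "t \<in> I" for n t by (rule c(3)[OF that])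
    \<comment> \<open>The discarded modes are small because the nonlinearity of an H^2 sequence lies
      in H^1, one power of the weight above the L^2 norm used in \<open>stability\<close>.\<close>
    show "hb 0 (\<lambda>k. if k \<in> seg n then 0 else - 6 * nl (c n t) k) (6 * (4 * (2 * K) ^ 3) / (real n + 1))" if "t \<in> I" for n t
    proof (rule hb_tail)
      show "hb (0 + 1) (\<lambda>k. - 6 * nl (c n t) k) (6 * (4 * (2 * K) ^ 3))"
        using b2_cmult[of "\<lambda>k. wt 1 k * cmod (nl (c n t) k)" "4 * (2 * K) ^ 3" 6] nl_hb1[OF c(3)[OF that, of n]]
        by (simp add: hb_def norm_mult mult_ac)
    qed
    show "(\<lambda>n. 6 * (4 * (2 * K) ^ 3) / (real n + 1)) \<longlonglongrightarrow> 0" by (rule over_Suc_tendsto_0)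
    show "(\<lambda>n. K / (real n + 1)) \<longlonglongrightarrow> 0" by (rule over_Suc_tendsto_0)
    show "hb 0 (\<lambda>k. c n 0 k - c0 k) (K / (real n + 1))" for n
    proof -
      have "hb 0 (\<lambda>k. if k \<in> seg n then 0 else c0 k) (K / (real n + 1))"
        by (rule hb_tail) (rule hb_mono[OF K(1)], auto)
      thus ?thesis unfolding hb_def by (rule b2_mono) (auto simp: c(1))
    qed
  qed
  then obtain c' where c': "c' 0 = c0" "asol I (\<lambda>_ _. 0) c'" "\<And>t k. t \<in> I \<Longrightarrow> (\<lambda>n. c n t k) \<longlonglongrightarrow> c' t k" by blast
  have "hb 2 (c' t) (2 * K)" if "t \<in> I" for t
    by (rule hb_limit[OF c(3)[OF that] tendsto_const c'(3)[OF that]])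
  moreover have "hb s (c' t) (M * exp (growth s K * \<bar>t\<bar>))" if "1 \<le> s" "hb s c0 M" "t \<in> I" for s M t
    by (rule hb_limit[OF c(4)[OF that] tendsto_const c'(3)[OF that(3)]])
  ultimately show ?thesis using c'(1,2) unfolding I_def by blast
qed

lemma asol_shift:
  assumes "asol I (\<lambda>_ _. 0) c" shows "asol ((\<lambda>t. t + a) ` I) (\<lambda>_ _. 0) (\<lambda>t. c (t - a))"
  unfolding asol_def
proof (intro ballI allI)
  fix t k assume "t \<in> (\<lambda>t. t + a) ` I"
  hence t: "t - a \<in> I" by auto
  have "((\<lambda>r. c r k) has_vector_derivative (\<i> * of_int k ^ 3 * c (t - a) k + 6 * nl (c (t - a)) k + 0))
      (at (t - a) within (\<lambda>r. r - a) ` (\<lambda>t. t + a) ` I)"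
    using asolD[OF assms t, of k] by (simp add: image_image)
  moreover have "((\<lambda>r. r - a) has_vector_derivative 1) (at t within (\<lambda>t. t + a) ` I)"
    by (auto intro!: derivative_eq_intros simp: has_real_derivative_iff_has_vector_derivative[symmetric])
  ultimately show "((\<lambda>t. c (t - a) k) has_vector_derivative \<i> * of_int k ^ 3 * c (t - a) k + 6 * nl (c (t - a)) k + 0)
      (at t within (\<lambda>t. t + a) ` I)"
    using vector_diff_chain_within[of "\<lambda>r. r - a" 1 t "(\<lambda>t. t + a) ` I" "\<lambda>r. c r k"] by (simp add: o_def)
qed

lemma asol_subset: "asol I e c \<Longrightarrow> J \<subseteq> I \<Longrightarrow> asol J e c"
  unfolding asol_def by (meson has_vector_derivative_within_subset subsetD)

text \<open>The velocity is a function of the current state, so agreement of the states at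
  \<open>b\<close> makes the two one-sided derivatives agree.\<close>

lemma asol_glue:
  assumes c: "asol {a..b} (\<lambda>_ _. 0) c" and d: "asol {b..r} (\<lambda>_ _. 0) d" and "c b = d b" "a \<le> b" "b \<le> r"
  shows "asol {a..r} (\<lambda>_ _. 0) (\<lambda>t. if t \<in> {a..b} then c t else d t)"
  unfolding asol_def
proof (intro ballI allI)
  fix t k assume t: "t \<in> {a..r}"
  define q where "q c t = \<i> * of_int k ^ 3 * c k + 6 * nl c k + 0" for c and t :: real
  have "((\<lambda>t. if t \<in> {a..b} then c t k else d t k) has_vector_derivative
      (if t \<in> {a..b} then q (c t) t else q (d t) t)) (at t within {a..r})"
    by (rule has_vector_derivative_If_within_closures[where T = "{b..r}"])
       (use assms asolD[OF c] asolD[OF d] t in \<open>auto simp: q_def insert_absorb ivl_disj_un\<close>)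
  thus "((\<lambda>t. (if t \<in> {a..b} then c t else d t) k) has_vector_derivative \<i> * of_int k ^ 3 * (if t \<in> {a..b} then c t else d t) k +
       6 * nl (if t \<in> {a..b} then c t else d t) k + 0) (at t within {a..r})"
    by (auto simp: q_def if_distrib[of "\<lambda>f. f k"] cong: if_cong)
qed

section \<open>Fourier series\<close>

definition ser :: "(int \<Rightarrow> complex) \<Rightarrow> real \<Rightarrow> complex" where
  "ser c x = (\<Sum>\<^sub>\<infinity>k. c k * cis (of_int k * x))"

lemma filterlim_seg: "filterlim seg (finite_subsets_at_top UNIV) sequentially"
  unfolding filterlim_finite_subsets_at_top
proof (intro allI impI)
  fix X :: "int set" assume "finite X \<and> X \<subseteq> UNIV"
  then obtain N where N: "X \<subseteq> seg N" using finite_subset_seg by blast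
  show "\<forall>\<^sub>F n in sequentially. finite (seg n) \<and> X \<subseteq> seg n \<and> seg n \<subseteq> UNIV"
  proof (rule eventually_sequentiallyI[of N])
    fix n assume "N \<le> n"
    hence "seg N \<subseteq> seg n" by (auto simp: seg_def)
    thus "finite (seg n) \<and> X \<subseteq> seg n \<and> seg n \<subseteq> UNIV" using N by auto
  qed
qed

lemma infsum_seg_limit:
  fixes f :: "int \<Rightarrow> 'a::{comm_monoid_add,t2_space}"
  assumes "f summable_on UNIV" shows "(\<lambda>n. sum f (seg n)) \<longlonglongrightarrow> infsum f UNIV"
  using filterlim_compose[OF infsum_tendsto[OF assms] filterlim_seg] .

lemma dominated_summable:
  fixes f :: "int \<Rightarrow> complex"
  assumes "M summable_on UNIV" "\<And>k. cmod (f k) \<le> M k"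
  shows "(\<lambda>k. cmod (f k)) summable_on UNIV" "f summable_on UNIV"
proof -
  show "(\<lambda>k. cmod (f k)) summable_on UNIV"
    by (rule summable_on_comparison_test[OF assms(1)]) (use assms(2) in auto)
  thus "f summable_on UNIV" by (rule abs_summable_summable)
qed

definition tl_sum :: "(int \<Rightarrow> real) \<Rightarrow> nat \<Rightarrow> real" where
  "tl_sum M n = infsum M UNIV - sum M (seg n)"

lemma tl_sum_tendsto: "M summable_on UNIV \<Longrightarrow> tl_sum M \<longlonglongrightarrow> 0"
  unfolding tl_sum_def using tendsto_diff[OF tendsto_const infsum_seg_limit, of M "infsum M UNIV"] by simp

lemma dominated_tail:
  fixes f :: "int \<Rightarrow> complex"
  assumes M: "M summable_on UNIV" "\<And>k. cmod (f k) \<le> M k"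
  shows "cmod (infsum f UNIV - sum f (seg n)) \<le> tl_sum M n"
proof -
  note s = dominated_summable[of M f, OF assms]
  have split: "infsum g UNIV - sum g (seg n) = infsum g (- seg n)" if "g summable_on UNIV" for g :: "int \<Rightarrow> 'b::{banach}"
  proof -
    have "infsum g (seg n \<union> - seg n) = infsum g (seg n) + infsum g (- seg n)"
      by (rule infsum_Un_disjoint) (use that in \<open>auto intro: summable_on_subset_banach\<close>)
    thus ?thesis by simp
  qed
  have "cmod (infsum f (- seg n)) \<le> infsum (\<lambda>k. cmod (f k)) (- seg n)"
    by (rule norm_infsum_bound) (rule summable_on_subset_banach[OF s(1)], simp)
  also have "\<dots> \<le> infsum M (- seg n)"
    by (rule infsum_mono) (use assms(2) in \<open>auto intro: summable_on_subset_banach[OF s(1)] summable_on_subset_banach[OF M(1)]\<close>)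
  finally show ?thesis unfolding tl_sum_def split[OF s(2)] split[OF M(1)] .
qed

lemma series_continuous:
  fixes f :: "int \<Rightarrow> 'a::topological_space \<Rightarrow> complex"
  assumes M: "M summable_on UNIV" and c: "\<And>k. continuous_on S (f k)"
    and le: "\<And>k x. x \<in> S \<Longrightarrow> cmod (f k x) \<le> M k"
  shows "continuous_on S (\<lambda>x. \<Sum>\<^sub>\<infinity>k. f k x)"
proof (rule uniform_limit_theorem[where F = sequentially])
  show "\<forall>\<^sub>F n in sequentially. continuous_on S (\<lambda>x. \<Sum>k\<in>seg n. f k x)"
    by (intro always_eventually allI continuous_intros c)
  show "uniform_limit S (\<lambda>n x. \<Sum>k\<in>seg n. f k x) (\<lambda>x. \<Sum>\<^sub>\<infinity>k. f k x) sequentially"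
  proof (rule uniform_limitI)
    fix e :: real assume "0 < e"
    hence "\<forall>\<^sub>F n in sequentially. tl_sum M n < e" using tl_sum_tendsto[OF M] by (intro order_tendstoD) auto
    thus "\<forall>\<^sub>F n in sequentially. \<forall>x\<in>S. dist (\<Sum>k\<in>seg n. f k x) (\<Sum>\<^sub>\<infinity>k. f k x) < e"
    proof (rule eventually_mono, intro ballI)
      fix n x assume "tl_sum M n < e" "x \<in> S"
      thus "dist (\<Sum>k\<in>seg n. f k x) (\<Sum>\<^sub>\<infinity>k. f k x) < e"
        using dominated_tail[of M "\<lambda>k. f k x" n, OF M le] by (simp add: dist_norm norm_minus_commute)
    qed
  qed
qed simp

text \<open>The Weierstrass test for the terms and for their derivatives, with a single majorant and
  along the symmetric partial sums over \<open>seg n\<close>.\<close>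

lemma series_deriv:
  fixes f :: "int \<Rightarrow> real \<Rightarrow> complex"
  assumes S: "convex S" "x \<in> S" and M: "M summable_on UNIV"
    and d: "\<And>k x. x \<in> S \<Longrightarrow> (f k has_vector_derivative f' k x) (at x within S)"
    and le: "\<And>k x. x \<in> S \<Longrightarrow> cmod (f k x) \<le> M k" "\<And>k x. x \<in> S \<Longrightarrow> cmod (f' k x) \<le> M k"
  shows "((\<lambda>x. \<Sum>\<^sub>\<infinity>k. f k x) has_vector_derivative (\<Sum>\<^sub>\<infinity>k. f' k x)) (at x within S)"
proof -
  have lim: "(\<lambda>n. \<Sum>k\<in>seg n. f k r) \<longlonglongrightarrow> (\<Sum>\<^sub>\<infinity>k. f k r)" if "r \<in> S" for r
    by (rule infsum_seg_limit[OF dominated_summable(2)[of M "\<lambda>k. f k r", OF M le(1)[OF that]]])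
  have "\<exists>g. \<forall>r\<in>S. (\<lambda>n. \<Sum>k\<in>seg n. f k r) \<longlonglongrightarrow> g r \<and>
     (g has_derivative (\<lambda>h. h *\<^sub>R (\<Sum>\<^sub>\<infinity>k. f' k r))) (at r within S)"
  proof (rule has_derivative_sequence[where f' = "\<lambda>n r h. h *\<^sub>R (\<Sum>k\<in>seg n. f' k r)" and ?x0.0 = x])
    show "((\<lambda>r. \<Sum>k\<in>seg n. f k r) has_derivative (\<lambda>h. h *\<^sub>R (\<Sum>k\<in>seg n. f' k r))) (at r within S)"
      if "r \<in> S" for n r
      using has_vector_derivative_sum[of "seg n" f "\<lambda>k. f' k r" "at r within S"] d[OF that]
      by (simp add: has_vector_derivative_def)
    show "(\<lambda>n. \<Sum>k\<in>seg n. f k x) \<longlonglongrightarrow> (\<Sum>\<^sub>\<infinity>k. f k x)" by (rule lim[OF S(2)])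
    fix e :: real assume "0 < e"
    hence "\<forall>\<^sub>F n in sequentially. tl_sum M n < e" using tl_sum_tendsto[OF M] by (intro order_tendstoD) auto
    thus "\<forall>\<^sub>F n in sequentially. \<forall>r\<in>S. \<forall>h. norm (h *\<^sub>R (\<Sum>k\<in>seg n. f' k r) - h *\<^sub>R (\<Sum>\<^sub>\<infinity>k. f' k r)) \<le> e * norm h"
    proof (rule eventually_mono, intro ballI allI)
      fix n r and h :: real assume "tl_sum M n < e" "r \<in> S"
      hence "norm ((\<Sum>k\<in>seg n. f' k r) - (\<Sum>\<^sub>\<infinity>k. f' k r)) \<le> e"
        using dominated_tail[of M "\<lambda>k. f' k r" n, OF M le(2)] by (simp add: norm_minus_commute)
      hence "\<bar>h\<bar> * norm ((\<Sum>k\<in>seg n. f' k r) - (\<Sum>\<^sub>\<infinity>k. f' k r)) \<le> \<bar>h\<bar> * e" by (intro mult_left_mono) auto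
      thus "norm (h *\<^sub>R (\<Sum>k\<in>seg n. f' k r) - h *\<^sub>R (\<Sum>\<^sub>\<infinity>k. f' k r)) \<le> e * norm h"
        unfolding scaleR_diff_right[symmetric] norm_scaleR by (simp add: mult.commute)
    qed
  qed (use S in auto)
  then obtain g where g: "\<And>r. r \<in> S \<Longrightarrow> (\<lambda>n. \<Sum>k\<in>seg n. f k r) \<longlonglongrightarrow> g r"
    "\<And>r. r \<in> S \<Longrightarrow> (g has_derivative (\<lambda>h. h *\<^sub>R (\<Sum>\<^sub>\<infinity>k. f' k r))) (at r within S)" by blast
  have eq: "(\<Sum>\<^sub>\<infinity>k. f k r) = g r" if "r \<in> S" for r using g(1)[OF that] lim[OF that] LIMSEQ_unique by blast
  show ?thesis unfolding has_vector_derivative_def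
    by (rule has_derivative_transform[OF S(2) _ g(2)[OF S(2)]]) (rule eq)
qed

lemma cis_deriv: "((\<lambda>x. cis (r * x)) has_vector_derivative \<i> * of_real r * cis (r * x)) (at x within S)"
proof -
  have "((\<lambda>x. r * x) has_real_derivative r) (at x within S)" by (auto intro!: derivative_eq_intros)
  hence 1: "((\<lambda>x. r * x) has_vector_derivative r) (at x within S)"
    by (simp add: has_real_derivative_iff_has_vector_derivative)
  have "((\<lambda>y. cis y) has_vector_derivative \<i> * cis y) (at y within T)" for y T
    unfolding cis_conv_exp
    by (rule has_vector_derivative_real_field[of "\<lambda>z. exp (\<i> * z)" "\<i> * exp (\<i> * of_real y)" y, THEN has_vector_derivative_at_within])
       (auto intro!: derivative_eq_intros)
  from vector_diff_chain_within[OF 1 this] show ?thesis by (simp add: o_def scaleR_conv_of_real mult_ac)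
qed

lemma a1_summable: "a1 c A \<Longrightarrow> (\<lambda>k. cmod (c k)) summable_on UNIV"
  unfolding a1_def by (erule b1_summable) simp

lemma w1_summable: "w1 c A \<Longrightarrow> (\<lambda>k. br k * cmod (c k)) summable_on UNIV"
  unfolding w1_def by (erule b1_summable) simp

lemma ser_deriv:
  assumes "w1 c A" shows "(ser c has_vector_derivative ser (Dx c) x) (at x within S)"
proof -
  have "((\<lambda>x. \<Sum>\<^sub>\<infinity>k. c k * cis (of_int k * x)) has_vector_derivative
      (\<Sum>\<^sub>\<infinity>k. c k * (\<i> * of_real (of_int k) * cis (of_int k * x)))) (at x within UNIV)"
  proof (rule series_deriv[OF _ _ w1_summable[OF assms]])
    fix k r
    show "((\<lambda>x. c k * cis (of_int k * x)) has_vector_derivative c k * (\<i> * of_real (of_int k) * cis (of_int k * r))) (at r within UNIV)"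
      by (rule has_vector_derivative_mult_right[OF cis_deriv])
    show "cmod (c k * cis (of_int k * r)) \<le> br k * cmod (c k)"
      using mult_right_mono[OF br_ge1[of k], of "cmod (c k)"] by (simp add: norm_mult)
    show "cmod (c k * (\<i> * of_real (of_int k) * cis (of_int k * r))) \<le> br k * cmod (c k)"
      using mult_right_mono[OF abs_le_br[of k], of "cmod (c k)"] by (simp add: norm_mult mult_ac)
  qed auto
  moreover have "(\<Sum>\<^sub>\<infinity>k. c k * (\<i> * of_real (of_int k) * cis (of_int k * x))) = ser (Dx c) x"
    unfolding ser_def Dx_def by (simp add: mult_ac)
  moreover have "ser c = (\<lambda>x. \<Sum>\<^sub>\<infinity>k. c k * cis (of_int k * x))" by (simp add: ser_def fun_eq_iff)
  ultimately show ?thesis by (simp add: has_vector_derivative_at_within)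
qed

lemma ser_bound: assumes "a1 c A" shows "cmod (ser c x) \<le> A"
proof -
  have "cmod (ser c x) \<le> (\<Sum>\<^sub>\<infinity>k. cmod (c k * cis (of_int k * x)))"
    unfolding ser_def by (rule norm_infsum_bound) (simp add: norm_mult a1_summable[OF assms])
  also have "\<dots> = (\<Sum>\<^sub>\<infinity>k. cmod (c k))" by (simp add: norm_mult)
  also have "\<dots> \<le> A" using assms unfolding a1_def by (rule b1_infsum) simp
  finally show ?thesis .
qed

lemma ser_continuous: "a1 c A \<Longrightarrow> continuous_on S (ser c)"
  unfolding ser_def[abs_def]
  by (rule series_continuous[OF a1_summable]) (auto simp: norm_mult intro!: continuous_intros)

lemma cis_period: "cis (of_int k * (x + 2 * pi)) = cis (of_int k * x)"
proof -
  have "cis (of_int k * (x + 2 * pi)) = cis (of_int k * x) * cis (2 * pi * of_int k)"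
    by (simp add: cis_mult algebra_simps)
  also have "cis (2 * pi * of_int k) = 1" by (rule cis_multiple_2pi) simp
  finally show ?thesis by simp
qed

lemma ser_periodic: "ser c (x + 2 * pi) = ser c x"
  unfolding ser_def by (simp only: cis_period)

lemma ser_ct: "ser (ct c) x = cnj (ser c x)"
proof -
  have "cnj (ser c x) = (\<Sum>\<^sub>\<infinity>k. cnj (c k * cis (of_int k * x)))" unfolding ser_def by (simp only: infsum_cnj)
  also have "\<dots> = ser (ct c) x" unfolding ser_def
    by (rule infsum_reindex_bij_witness[of _ uminus uminus]) (auto simp: ct_def cis_cnj)
  finally show ?thesis by simp
qed

lemma infsum_conv:
  assumes "a1 f A" "a1 g B" shows "(\<Sum>\<^sub>\<infinity>m. conv f g m) = infsum f UNIV * infsum g UNIV"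
proof -
  have s: "(\<lambda>p. cmod ((\<lambda>(m, j). f (m - j) * g j) p)) summable_on UNIV \<times> UNIV"
  proof (rule Infinite_Sum.abs_summable_on_Sigma_iff[THEN iffD2], intro conjI ballI)
    show "(\<lambda>y. cmod ((\<lambda>(m, j). f (m - j) * g j) (m, y))) summable_on UNIV" for m
      using conv_summable[OF assms(1) a1_bound[OF assms(2)], of m] by simp
    have "b1 (rconv (\<lambda>k. cmod (f k)) (\<lambda>k. cmod (g k))) (A * B)"
      using assms by (intro rconv_b1) (auto simp: a1_def)
    hence "rconv (\<lambda>k. cmod (f k)) (\<lambda>k. cmod (g k)) summable_on UNIV"
      by (rule b1_summable) (auto intro: rconv_nonneg)
    moreover have "norm (\<Sum>\<^sub>\<infinity>y. cmod ((\<lambda>(m, j). f (m - j) * g j) (m, y))) = rconv (\<lambda>k. cmod (f k)) (\<lambda>k. cmod (g k)) m" for m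
      unfolding rconv_def by (simp add: norm_mult infsum_nonneg)
    ultimately show "(\<lambda>x. norm (\<Sum>\<^sub>\<infinity>y. cmod ((\<lambda>(m, j). f (m - j) * g j) (x, y)))) summable_on UNIV"
      by simp
  qed
  have "(\<Sum>\<^sub>\<infinity>m. conv f g m) = (\<Sum>\<^sub>\<infinity>m. \<Sum>\<^sub>\<infinity>j. f (m - j) * g j)" by (simp add: conv_def)
  also have "\<dots> = (\<Sum>\<^sub>\<infinity>j. \<Sum>\<^sub>\<infinity>m. f (m - j) * g j)"
    by (rule infsum_swap_banach) (rule abs_summable_summable[OF s])
  also have "\<dots> = (\<Sum>\<^sub>\<infinity>j. infsum f UNIV * g j)"
  proof (rule infsum_cong)
    fix j
    have "(\<Sum>\<^sub>\<infinity>m. f (m - j)) = infsum f UNIV"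
      by (rule infsum_reindex_bij_witness[of _ "\<lambda>m. m + j" "\<lambda>m. m - j"]) auto
    thus "(\<Sum>\<^sub>\<infinity>m. f (m - j) * g j) = infsum f UNIV * g j" by (simp add: infsum_cmult_left')
  qed
  finally show ?thesis by (simp add: infsum_cmult_right')
qed

lemma ser_conv:
  assumes "a1 a A" "a1 b B" shows "ser (conv a b) x = ser a x * ser b x"
proof -
  define e where "e c k = c k * cis (of_int k * x)" for c :: "int \<Rightarrow> complex" and k
  have e: "a1 (e a) A" "a1 (e b) B" using assms by (auto simp: a1_def e_def norm_mult)
  have "conv a b m * cis (of_int m * x) = conv (e a) (e b) m" for m
  proof -
    have "conv a b m * cis (of_int m * x) = (\<Sum>\<^sub>\<infinity>j. a (m - j) * b j * cis (of_int m * x))"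
      unfolding conv_def by (rule infsum_cmult_left'[symmetric])
    also have "\<dots> = conv (e a) (e b) m"
      unfolding conv_def
    proof (rule infsum_cong)
      fix j
      have "cis (of_int m * x) = cis (of_int (m - j) * x) * cis (of_int j * x)"
        by (simp add: cis_mult algebra_simps)
      thus "a (m - j) * b j * cis (of_int m * x) = e a (m - j) * e b j" by (simp add: e_def mult_ac)
    qed
    finally show ?thesis .
  qed
  hence "ser (conv a b) x = (\<Sum>\<^sub>\<infinity>m. conv (e a) (e b) m)" by (simp add: ser_def)
  also have "\<dots> = infsum (e a) UNIV * infsum (e b) UNIV" by (rule infsum_conv[OF e])
  finally show ?thesis by (simp add: ser_def e_def[abs_def])
qed

text \<open>No exchange of sum and integral: the nonzero modes have the antiderivative with
  coefficients \<open>c k / (i k)\<close>, whose endpoint values agree by periodicity. Dividing by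
  \<open>k\<close> gains just the weight that \<open>ser_deriv\<close> needs, hence
  \<open>a1\<close> is enough.\<close>

lemma ser_integral:
  assumes "a1 c A" shows "(ser c has_integral (2 * of_real pi * c 0)) {0..2 * pi}"
proof -
  define d where "d k = (if k = 0 then 0 else c k / (\<i> * of_int k))" for k :: int
  define p where "p k = (if k = 0 then 0 else c k)" for k :: int
  have d: "w1 d (2 * A)"
  proof -
    have "b1 (\<lambda>k. 2 * cmod (c k)) (2 * A)" using assms by (intro b1_cmult) (auto simp: a1_def)
    thus ?thesis unfolding w1_def
    proof (rule b1_mono)
      fix k :: int
      show "br k * cmod (d k) \<le> 2 * cmod (c k)"
      proof (cases "k = 0")
        case False
        hence "1 \<le> \<bar>real_of_int k\<bar>" by linarith
        hence "br k / \<bar>real_of_int k\<bar> \<le> 2" by (simp add: br_def field_simps)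
        from mult_right_mono[OF this, of "cmod (c k)"] show ?thesis
          using False by (simp add: d_def norm_divide norm_mult)
      qed (simp add: d_def)
    qed simp
  qed
  have Dd: "Dx d = p" by (auto simp: Dx_def d_def p_def fun_eq_iff)
  have p: "ser c x = c 0 + ser p x" for x
  proof -
    have pa: "a1 p A" using assms unfolding a1_def by (rule b1_mono) (auto simp: p_def)
    have 1: "(\<lambda>k::int. if k = 0 then c 0 else 0) summable_on UNIV"
      using summable_on_cong_neutral[of UNIV "{0::int}" "\<lambda>k. if k = 0 then c 0 else 0" "\<lambda>k. c 0"] by simp
    have "ser c x = (\<Sum>\<^sub>\<infinity>k. (if k = 0 then c 0 else 0) + p k * cis (of_int k * x))"
      unfolding ser_def by (intro infsum_cong) (auto simp: p_def)
    also have "\<dots> = (\<Sum>\<^sub>\<infinity>k::int. if k = 0 then c 0 else 0) + ser p x"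
      unfolding ser_def
      by (rule infsum_add[OF 1]) (rule dominated_summable(2)[OF a1_summable[OF pa]], simp add: norm_mult)
    also have "(\<Sum>\<^sub>\<infinity>k::int. if k = 0 then c 0 else 0) = (\<Sum>\<^sub>\<infinity>k\<in>{0::int}. c 0)"
      by (rule infsum_cong_neutral) auto
    finally show ?thesis by simp
  qed
  have "((\<lambda>x. c 0 + ser p x) has_integral ((of_real (2 * pi) * c 0 + ser d (2 * pi)) - (of_real 0 * c 0 + ser d 0))) {0..2 * pi}"
  proof (rule fundamental_theorem_of_calculus)
    fix x :: real
    have "((\<lambda>x. of_real x * c 0 + ser d x) has_vector_derivative (1 * c 0 + ser (Dx d) x)) (at x within {0..2 * pi})"
      by (intro has_vector_derivative_add has_vector_derivative_mult_left ser_deriv[OF d] has_vector_derivative_of_real)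
         (auto intro!: derivative_eq_intros)
    thus "((\<lambda>x. of_real x * c 0 + ser d x) has_vector_derivative (c 0 + ser p x)) (at x within {0..2 * pi})"
      by (simp add: Dd)
  qed simp
  moreover have "ser d (2 * pi) = ser d 0" using ser_periodic[of d 0] by simp
  moreover have "ser c = (\<lambda>x. c 0 + ser p x)" using p by auto
  ultimately show ?thesis by simp
qed

lemma gg_0:
  assumes "a1 c A"
  shows "(\<lambda>j. (cmod (c (- j)))\<^sup>2) summable_on UNIV" "Re (gg c 0) = (\<Sum>\<^sub>\<infinity>j. (cmod (c (- j)))\<^sup>2)"
proof -
  have "(\<lambda>j. cmod (c (0 - j) * ct c j)) summable_on UNIV"
    using conv_summable[OF assms(1), of "ct c" A 0] a1_bound[OF a1_ct[OF assms(1)]] by blast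
  thus s: "(\<lambda>j. (cmod (c (- j)))\<^sup>2) summable_on UNIV"
    by (simp add: norm_mult cmod_ct power2_eq_square)
  have "c (0 - j) * ct c j = of_real ((cmod (c (- j)))\<^sup>2)" for j
    unfolding complex_norm_square by (simp add: ct_def)
  hence "gg c 0 = (\<Sum>\<^sub>\<infinity>j. of_real ((cmod (c (- j)))\<^sup>2))"
    unfolding gg_def conv_def by (intro infsum_cong) blast
  moreover have "((\<lambda>j. of_real ((cmod (c (- j)))\<^sup>2)) has_sum (of_real (\<Sum>\<^sub>\<infinity>j. (cmod (c (- j)))\<^sup>2) :: complex)) UNIV"
    by (intro has_sum_of_real has_sum_infsum s)
  ultimately show "Re (gg c 0) = (\<Sum>\<^sub>\<infinity>j. (cmod (c (- j)))\<^sup>2)" by (metis infsumI Re_complex_of_real)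
qed

lemma gg_0_sum:
  assumes "a1 c A" "finite F" shows "(\<Sum>k\<in>F. (cmod (c k))\<^sup>2) \<le> Re (gg c 0)"
proof -
  have "(\<Sum>k\<in>F. (cmod (c k))\<^sup>2) = (\<Sum>k\<in>uminus ` F. (cmod (c (- k)))\<^sup>2)"
    by (subst sum.reindex) (auto simp: inj_on_def)
  also have "\<dots> \<le> (\<Sum>\<^sub>\<infinity>j. (cmod (c (- j)))\<^sup>2)"
    by (rule finite_sum_le_infsum[OF gg_0(1)[OF assms(1)]]) (use assms in auto)
  finally show ?thesis by (simp add: gg_0(2)[OF assms(1)])
qed

lemma gg_0_le:
  assumes "a1 c A" "hb 0 c K" shows "Re (gg c 0) \<le> K\<^sup>2"
proof -
  have "b1 (\<lambda>j. (cmod (c (- j)))\<^sup>2) (K\<^sup>2)"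
    using b2_sum[OF b2_minus[of "\<lambda>k. cmod (c k)" K]] assms(2) by (simp add: b1_def hb0)
  from b1_infsum[OF this] show ?thesis unfolding gg_0(2)[OF assms(1)] by simp
qed

lemma a1_conv:
  assumes "a1 a A" "a1 b B" shows "a1 (conv a b) (A * B)"
proof -
  have "b1 (rconv (\<lambda>k. cmod (a k)) (\<lambda>k. cmod (b k))) (A * B)"
    using assms by (intro rconv_b1) (auto simp: a1_def)
  thus ?thesis unfolding a1_def
    by (rule b1_mono[OF _ conv_norm[of a A b B, OF assms(1) a1_bound[OF assms(2)]] order_refl])
qed

text \<open>Parseval's identity for absolutely convergent series: the mean of |u|^2 is its
  coefficient at 0.\<close>

lemma ser_norm_squared_integral:
  assumes "a1 c A"
  shows "((\<lambda>x. ser c x * cnj (ser c x)) has_integral (2 * of_real pi * gg c 0)) {0..2 * pi}"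
proof -
  have "ser (gg c) = (\<lambda>x. ser c x * cnj (ser c x))"
    unfolding gg_def by (rule ext) (simp add: ser_conv[OF assms a1_ct[OF assms]] ser_ct)
  moreover have "a1 (gg c) (A * A)"
    unfolding gg_def by (rule a1_conv[OF assms a1_ct[OF assms]])
  ultimately show ?thesis using ser_integral[of "gg c" "A * A"] by simp
qed

section \<open>Conservation laws\<close>

text \<open>The third conserved density of the hierarchy and its flux. The arguments \<open>u\<^sub>j\<close> and \<open>v\<^sub>j\<close>
  stand for the \<open>j\<close>-th derivatives of the solution and of its conjugate; the coefficients come from solving
  the linear system that makes the time derivative of the density an exact derivative.\<close>

definition edens :: "complex \<Rightarrow> complex \<Rightarrow> complex \<Rightarrow> complex \<Rightarrow> complex \<Rightarrow> complex \<Rightarrow> complex" where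
  "edens u0 u1 u2 v0 v1 v2 =
     (1) * (u2 * v2) + (8) * (u0 * v0 * u1 * v1) + (1) * (u0 * u0 * v1 * v1) + (1) * (v0 * v0 * u1 *
     u1) + (2) * (u0 * u0 * u0 * v0 * v0 * v0)"

text \<open>The formal product rule derivative of \<open>edens\<close>, with \<open>ut\<close> and
  \<open>vt\<close> in the place of the time derivatives. Together with the formal
  \<open>flux_x\<close> it reduces conservation to an identity between polynomials.\<close>

definition edens_t :: "complex \<Rightarrow> complex \<Rightarrow> complex \<Rightarrow> complex \<Rightarrow> complex \<Rightarrow> complex \<Rightarrow> complex \<Rightarrow> complex \<Rightarrow> complex \<Rightarrow> complex \<Rightarrow> complex \<Rightarrow> complex \<Rightarrow> complex" where
  "edens_t u0 u1 u2 v0 v1 v2 ut0 ut1 ut2 vt0 vt1 vt2 =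
     (1) * (ut2 * v2) + (1) * (u2 * vt2) + (8) * (ut0 * v0 * u1 * v1) + (8) * (u0 * vt0 * u1 * v1) +
     (8) * (u0 * v0 * ut1 * v1) + (8) * (u0 * v0 * u1 * vt1) + (1) * (ut0 * u0 * v1 * v1) + (1)
     * (u0 * ut0 * v1 * v1) + (1) * (u0 * u0 * vt1 * v1) + (1) * (u0 * u0 * v1 * vt1) + (1) *
     (vt0 * v0 * u1 * u1) + (1) * (v0 * vt0 * u1 * u1) + (1) * (v0 * v0 * ut1 * u1) + (1) * (v0
     * v0 * u1 * ut1) + (2) * (ut0 * u0 * u0 * v0 * v0 * v0) + (2) * (u0 * ut0 * u0 * v0 * v0 *
     v0) + (2) * (u0 * u0 * ut0 * v0 * v0 * v0) + (2) * (u0 * u0 * u0 * vt0 * v0 * v0) + (2) *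
     (u0 * u0 * u0 * v0 * vt0 * v0) + (2) * (u0 * u0 * u0 * v0 * v0 * vt0)"

definition flux :: "complex \<Rightarrow> complex \<Rightarrow> complex \<Rightarrow> complex \<Rightarrow> complex \<Rightarrow> complex \<Rightarrow> complex \<Rightarrow> complex \<Rightarrow> complex \<Rightarrow> complex \<Rightarrow> complex" where
  "flux u0 u1 u2 u3 u4 v0 v1 v2 v3 v4 =
     (- 1) * (u2 * v4) + (1) * (u3 * v3) + (- 1) * (u4 * v2) + (- 2) * (u0 * u0 * v1 * v3) + (1) *
     (u0 * u0 * v2 * v2) + (- 8) * (u0 * u1 * v0 * v3) + (4) * (u0 * u1 * v1 * v2) + (14) * (u0
     * u2 * v0 * v2) + (6) * (u0 * u2 * v1 * v1) + (- 8) * (u0 * u3 * v0 * v1) + (6) * (u1 * u1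
     * v0 * v2) + (1) * (u1 * u1 * v1 * v1) + (4) * (u1 * u2 * v0 * v1) + (- 2) * (u1 * u3 * v0
     * v0) + (1) * (u2 * u2 * v0 * v0) + (- 6) * (u0 * u0 * u0 * v0 * v0 * v2) + (12) * (u0 *
     u0 * u0 * v0 * v1 * v1) + (66) * (u0 * u0 * u1 * v0 * v0 * v1) + (- 6) * (u0 * u0 * u2 *
     v0 * v0 * v0) + (12) * (u0 * u1 * u1 * v0 * v0 * v0) + (9) * (u0 * u0 * u0 * u0 * v0 * v0
     * v0 * v0)"

definition flux_x :: "complex \<Rightarrow> complex \<Rightarrow> complex \<Rightarrow> complex \<Rightarrow> complex \<Rightarrow> complex \<Rightarrow> complex \<Rightarrow> complex \<Rightarrow> complex \<Rightarrow> complex \<Rightarrow> complex \<Rightarrow> complex \<Rightarrow> complex" where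
  "flux_x u0 u1 u2 u3 u4 u5 v0 v1 v2 v3 v4 v5 =
     (- 1) * (u3 * v4) + (- 1) * (u2 * v5) + (1) * (u4 * v3) + (1) * (u3 * v4) + (- 1) * (u5 * v2) +
     (- 1) * (u4 * v3) + (- 2) * (u1 * u0 * v1 * v3) + (- 2) * (u0 * u1 * v1 * v3) + (- 2) *
     (u0 * u0 * v2 * v3) + (- 2) * (u0 * u0 * v1 * v4) + (1) * (u1 * u0 * v2 * v2) + (1) * (u0
     * u1 * v2 * v2) + (1) * (u0 * u0 * v3 * v2) + (1) * (u0 * u0 * v2 * v3) + (- 8) * (u1 * u1
     * v0 * v3) + (- 8) * (u0 * u2 * v0 * v3) + (- 8) * (u0 * u1 * v1 * v3) + (- 8) * (u0 * u1
     * v0 * v4) + (4) * (u1 * u1 * v1 * v2) + (4) * (u0 * u2 * v1 * v2) + (4) * (u0 * u1 * v2 *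
     v2) + (4) * (u0 * u1 * v1 * v3) + (14) * (u1 * u2 * v0 * v2) + (14) * (u0 * u3 * v0 * v2)
     + (14) * (u0 * u2 * v1 * v2) + (14) * (u0 * u2 * v0 * v3) + (6) * (u1 * u2 * v1 * v1) +
     (6) * (u0 * u3 * v1 * v1) + (6) * (u0 * u2 * v2 * v1) + (6) * (u0 * u2 * v1 * v2) + (- 8)
     * (u1 * u3 * v0 * v1) + (- 8) * (u0 * u4 * v0 * v1) + (- 8) * (u0 * u3 * v1 * v1) + (- 8)
     * (u0 * u3 * v0 * v2) + (6) * (u2 * u1 * v0 * v2) + (6) * (u1 * u2 * v0 * v2) + (6) * (u1
     * u1 * v1 * v2) + (6) * (u1 * u1 * v0 * v3) + (1) * (u2 * u1 * v1 * v1) + (1) * (u1 * u2 *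
     v1 * v1) + (1) * (u1 * u1 * v2 * v1) + (1) * (u1 * u1 * v1 * v2) + (4) * (u2 * u2 * v0 *
     v1) + (4) * (u1 * u3 * v0 * v1) + (4) * (u1 * u2 * v1 * v1) + (4) * (u1 * u2 * v0 * v2) +
     (- 2) * (u2 * u3 * v0 * v0) + (- 2) * (u1 * u4 * v0 * v0) + (- 2) * (u1 * u3 * v1 * v0) +
     (- 2) * (u1 * u3 * v0 * v1) + (1) * (u3 * u2 * v0 * v0) + (1) * (u2 * u3 * v0 * v0) + (1)
     * (u2 * u2 * v1 * v0) + (1) * (u2 * u2 * v0 * v1) + (- 6) * (u1 * u0 * u0 * v0 * v0 * v2)
     + (- 6) * (u0 * u1 * u0 * v0 * v0 * v2) + (- 6) * (u0 * u0 * u1 * v0 * v0 * v2) + (- 6) *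
     (u0 * u0 * u0 * v1 * v0 * v2) + (- 6) * (u0 * u0 * u0 * v0 * v1 * v2) + (- 6) * (u0 * u0 *
     u0 * v0 * v0 * v3) + (12) * (u1 * u0 * u0 * v0 * v1 * v1) + (12) * (u0 * u1 * u0 * v0 * v1
     * v1) + (12) * (u0 * u0 * u1 * v0 * v1 * v1) + (12) * (u0 * u0 * u0 * v1 * v1 * v1) + (12)
     * (u0 * u0 * u0 * v0 * v2 * v1) + (12) * (u0 * u0 * u0 * v0 * v1 * v2) + (66) * (u1 * u0 *
     u1 * v0 * v0 * v1) + (66) * (u0 * u1 * u1 * v0 * v0 * v1) + (66) * (u0 * u0 * u2 * v0 * v0
     * v1) + (66) * (u0 * u0 * u1 * v1 * v0 * v1) + (66) * (u0 * u0 * u1 * v0 * v1 * v1) + (66)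
     * (u0 * u0 * u1 * v0 * v0 * v2) + (- 6) * (u1 * u0 * u2 * v0 * v0 * v0) + (- 6) * (u0 * u1
     * u2 * v0 * v0 * v0) + (- 6) * (u0 * u0 * u3 * v0 * v0 * v0) + (- 6) * (u0 * u0 * u2 * v1
     * v0 * v0) + (- 6) * (u0 * u0 * u2 * v0 * v1 * v0) + (- 6) * (u0 * u0 * u2 * v0 * v0 * v1)
     + (12) * (u1 * u1 * u1 * v0 * v0 * v0) + (12) * (u0 * u2 * u1 * v0 * v0 * v0) + (12) * (u0
     * u1 * u2 * v0 * v0 * v0) + (12) * (u0 * u1 * u1 * v1 * v0 * v0) + (12) * (u0 * u1 * u1 *
     v0 * v1 * v0) + (12) * (u0 * u1 * u1 * v0 * v0 * v1) + (9) * (u1 * u0 * u0 * u0 * v0 * v0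
     * v0 * v0) + (9) * (u0 * u1 * u0 * u0 * v0 * v0 * v0 * v0) + (9) * (u0 * u0 * u1 * u0 * v0
     * v0 * v0 * v0) + (9) * (u0 * u0 * u0 * u1 * v0 * v0 * v0 * v0) + (9) * (u0 * u0 * u0 * u0
     * v1 * v0 * v0 * v0) + (9) * (u0 * u0 * u0 * u0 * v0 * v1 * v0 * v0) + (9) * (u0 * u0 * u0
     * u0 * v0 * v0 * v1 * v0) + (9) * (u0 * u0 * u0 * u0 * v0 * v0 * v0 * v1)"

lemma edens_deriv:
  fixes u0 u1 u2 v0 v1 v2 :: "real \<Rightarrow> complex"
  assumes "(u0 has_vector_derivative ut0) (at t within S)"
    "(u1 has_vector_derivative ut1) (at t within S)"
    "(u2 has_vector_derivative ut2) (at t within S)"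
    "(v0 has_vector_derivative vt0) (at t within S)"
    "(v1 has_vector_derivative vt1) (at t within S)"
    "(v2 has_vector_derivative vt2) (at t within S)"
  shows "((\<lambda>r. edens (u0 r) (u1 r) (u2 r) (v0 r) (v1 r) (v2 r)) has_vector_derivative
     edens_t (u0 t) (u1 t) (u2 t) (v0 t) (v1 t) (v2 t) ut0 ut1 ut2 vt0 vt1 vt2) (at t within S)"
  unfolding edens_def edens_t_def
  by (rule has_vector_derivative_eq_rhs,
      (rule has_vector_derivative_add has_vector_derivative_mult has_vector_derivative_const assms)+, algebra)

lemma flux_deriv:
  fixes u0 u1 u2 u3 u4 v0 v1 v2 v3 v4 :: "real \<Rightarrow> complex"
  assumes "(u0 has_vector_derivative u1 t) (at t within S)"
    "(u1 has_vector_derivative u2 t) (at t within S)"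
    "(u2 has_vector_derivative u3 t) (at t within S)"
    "(u3 has_vector_derivative u4 t) (at t within S)"
    "(u4 has_vector_derivative u5) (at t within S)"
    "(v0 has_vector_derivative v1 t) (at t within S)"
    "(v1 has_vector_derivative v2 t) (at t within S)"
    "(v2 has_vector_derivative v3 t) (at t within S)"
    "(v3 has_vector_derivative v4 t) (at t within S)"
    "(v4 has_vector_derivative v5) (at t within S)"
  shows "((\<lambda>r. flux (u0 r) (u1 r) (u2 r) (u3 r) (u4 r) (v0 r) (v1 r) (v2 r) (v3 r) (v4 r)) has_vector_derivative
     flux_x (u0 t) (u1 t) (u2 t) (u3 t) (u4 t) u5 (v0 t) (v1 t) (v2 t) (v3 t) (v4 t) v5) (at t within S)"
  unfolding flux_def flux_x_def
  by (rule has_vector_derivative_eq_rhs,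
      (rule has_vector_derivative_add has_vector_derivative_mult has_vector_derivative_const assms)+, algebra)

text \<open>The substituted arguments are the equation, its first two x-derivatives, and their
  conjugates. Since \<open>u\<close> and \<open>v\<close> are treated as independent variables,
  conservation is a polynomial identity here.\<close>

lemma edens_t_eq_flux_x:
  "edens_t u0 u1 u2 v0 v1 v2
     (- u3 + 6 * (u0 * v0 * u1))
     (- u4 + 6 * (u1 * v0 * u1 + u0 * v1 * u1 + u0 * v0 * u2))
     (- u5 + 6 * (3 * u1 * u2 * v0 + 2 * u1 * u1 * v1 + 2 * u0 * u2 * v1 + u0 * v2 * u1 + u0 * v0 * u3))
     (- v3 + 6 * (u0 * v0 * v1))
     (- v4 + 6 * (v1 * u0 * v1 + v0 * u1 * v1 + v0 * u0 * v2))
     (- v5 + 6 * (3 * v1 * v2 * u0 + 2 * v1 * v1 * u1 + 2 * v0 * v2 * u1 + v0 * u2 * v1 + v0 * u0 * v3)) =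
   flux_x u0 u1 u2 u3 u4 u5 v0 v1 v2 v3 v4 v5"
  unfolding edens_t_def flux_x_def by algebra


text \<open>\<open>Q\<close> is the flux: its x-derivative is the time derivative of the density,
  and over a full period its boundary terms cancel.\<close>

lemma conserved_integral:
  fixes e e' Q :: "real \<Rightarrow> real \<Rightarrow> complex"
  assumes I: "convex I" "a \<in> I" "t \<in> I"
    and et: "\<And>t x. t \<in> I \<Longrightarrow> ((\<lambda>t. e t x) has_vector_derivative e' t x) (at t within I)"
    and ec: "\<And>t. t \<in> I \<Longrightarrow> continuous_on {0..2 * pi} (e t)"
    and e'c: "continuous_on (I \<times> {0..2 * pi}) (\<lambda>(t, x). e' t x)"
    and Q: "\<And>t x. t \<in> I \<Longrightarrow> (Q t has_vector_derivative e' t x) (at x)" "\<And>t. t \<in> I \<Longrightarrow> Q t (2 * pi) = Q t 0"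
  shows "integral {0..2 * pi} (e t) = integral {0..2 * pi} (e a)"
proof -
  have 0: "integral {0..2 * pi} (e' r) = 0" if r: "r \<in> I" for r
  proof -
    have "(e' r has_integral (Q r (2 * pi) - Q r 0)) {0..2 * pi}"
      by (rule fundamental_theorem_of_calculus) (auto intro: has_vector_derivative_at_within Q(1)[OF r])
    thus ?thesis using Q(2)[OF r] by (simp add: integral_unique)
  qed
  have "((\<lambda>t. integral (cbox 0 (2 * pi)) (e t)) has_vector_derivative integral (cbox 0 (2 * pi)) (e' r)) (at r within I)"
    if r: "r \<in> I" for r
    by (rule leibniz_rule_vector_derivative[OF et _ _ r I(1)])
       (use ec e'c in \<open>auto intro: integrable_continuous_real\<close>)
  hence D: "((\<lambda>t. integral {0..2 * pi} (e t)) has_vector_derivative integral {0..2 * pi} (e' r)) (at r within I)"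
    if "r \<in> I" for r using that by simp
  have "((\<lambda>t. integral {0..2 * pi} (e t)) has_vector_derivative 0) (at r within I)" if "r \<in> I" for r
    using D[OF that] unfolding 0[OF that] .
  then obtain z where "\<And>t. t \<in> I \<Longrightarrow> integral {0..2 * pi} (e t) = z"
    using has_vector_derivative_zero_constant[OF I(1), of "\<lambda>t. integral {0..2 * pi} (e t)"] by blast
  thus ?thesis using I by simp
qed

section \<open>Space and time derivatives of smooth solutions\<close>

lemma cmod_Dx_pow: "cmod ((Dx ^^ j) c k) = \<bar>real_of_int k\<bar> ^ j * cmod (c k)"
  by (induction j) (simp_all add: cmod_Dx)

lemma Dx_pow: "(Dx ^^ j) c k = (\<i> * of_int k) ^ j * c k"
  by (induction j) (simp_all add: Dx_def)

lemma inverse_br_squared_b1: "b1 (\<lambda>k. C * (inverse (br k))\<^sup>2) (C * 4)" if "0 \<le> C"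
proof -
  have "b1 (\<lambda>k. (inverse (br k))\<^sup>2) (2\<^sup>2)"
    using b2_sum[OF sum_inverse_br_squared] by (simp add: b1_def)
  from b1_cmult[OF this that] show ?thesis by simp
qed

lemma inverse_br_squared_summable: "0 \<le> C \<Longrightarrow> (\<lambda>k. C * (inverse (br k))\<^sup>2) summable_on UNIV"
  using b1_summable[OF inverse_br_squared_b1] by simp

lemma decay_Dx_pow:
  assumes "\<And>k. br k ^ n * cmod (c k) \<le> C" "j + m \<le> n"
  shows "br k ^ m * cmod ((Dx ^^ j) c k) \<le> C"
proof -
  have "br k ^ m * cmod ((Dx ^^ j) c k) = br k ^ m * \<bar>real_of_int k\<bar> ^ j * cmod (c k)"
    by (simp add: cmod_Dx_pow)
  also have "\<dots> \<le> br k ^ m * br k ^ j * cmod (c k)"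
    by (intro mult_right_mono mult_left_mono power_mono abs_le_br) auto
  also have "\<dots> = br k ^ (m + j) * cmod (c k)" by (simp add: power_add)
  also have "\<dots> \<le> br k ^ n * cmod (c k)"
    by (intro mult_right_mono power_increasing) (use assms(2) br_ge1 in auto)
  also have "\<dots> \<le> C" by (rule assms(1))
  finally show ?thesis .
qed

lemma decay_bound:
  assumes "br k ^ 2 * z \<le> C" shows "z \<le> C * (inverse (br k))\<^sup>2"
proof -
  have "(inverse (br k))\<^sup>2 * (br k ^ 2 * z) \<le> (inverse (br k))\<^sup>2 * C" using assms by (intro mult_left_mono) auto
  also have "(inverse (br k))\<^sup>2 * (br k ^ 2 * z) = (inverse (br k) * br k)\<^sup>2 * z"
    by (simp only: power_mult_distrib mult_ac)
  finally show ?thesis by (simp add: mult.commute)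
qed

lemma decay_w1:
  assumes "\<And>k. br k ^ 3 * cmod (c k) \<le> C" shows "w1 c (C * 4)"
proof -
  have C: "0 \<le> C" using assms[of 0] by (rule order_trans[rotated]) simp
  show ?thesis unfolding w1_def
  proof (rule b1_mono[OF inverse_br_squared_b1[OF C]])
    show "br k * cmod (c k) \<le> C * (inverse (br k))\<^sup>2" for k
      by (rule decay_bound) (use assms[of k] in \<open>simp add: power3_eq_cube power2_eq_square mult.assoc\<close>)
  qed simp
qed

lemma wt_nat: "wt (real n) k = br k ^ n"
  by (simp add: wt_def powr_realpow)

text \<open>Four powers allow two x-derivatives of the cubic term with absolutely summable
  coefficients. The constant depends on \<open>M\<close> only, hence is uniform in time along a
  solution bounded in H^8.\<close>

lemma nl_decay: "\<exists>C. \<forall>c. hb 8 c M \<longrightarrow> (\<forall>k. br k ^ 4 * cmod (nl c k) \<le> C)"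
proof (intro exI allI impI)
  fix c k assume c: "hb 8 c M"
  have c4: "hb 4 c M" by (rule hb_mono[OF c]) auto
  have c2: "w1 c (2 * M)" by (rule hb_w1[OF hb_mono[OF c]]) auto
  have D4: "hb 4 (Dx c) M"
    using hb_mono[OF c, of 5 M] unfolding hb_def
    by (simp, elim b2_mono)
       (auto simp: abs_mult cmod_Dx wt_nat[of 4, simplified] wt_nat[of 5, simplified] power_Suc2[of _ 4, simplified]
          mult.assoc intro!: mult_left_mono mult_right_mono abs_le_br)
  have "hb 4 (gg c) (2 powr 4 * (M * (2 * M) + 2 * M * M))"
    unfolding gg_def by (rule hb_conv[OF _ w1_a1[OF c2] c4 w1_a1[OF w1_ct[OF c2]] hb_ct[OF c4]]) simp
  from hb_conv[OF _ w1_a1[OF w1_gg[OF c2]] this w1_Dx[OF c2] D4]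
  have "hb 4 (nl c) (2 powr 4 * (2 powr 4 * (M * (2 * M) + 2 * M * M) * (2 * M) + 2 * M * (2 * M) * M))"
    unfolding nl_def by simp
  from hb_pointwise[OF this, of k]
  show "br k ^ 4 * cmod (nl c k) \<le> 2 powr 4 * (2 powr 4 * (M * (2 * M) + 2 * M * M) * (2 * M) + 2 * M * (2 * M) * M)"
    using wt_nat[of 4 k] by simp
qed

lemma ser_nl: assumes "w1 c A" shows "ser (nl c) x = ser c x * cnj (ser c x) * ser (Dx c) x"
  unfolding nl_def gg_def
  by (simp add: ser_conv[OF a1_conv[OF w1_a1[OF assms] a1_ct[OF w1_a1[OF assms]]] w1_Dx[OF assms]]
    ser_conv[OF w1_a1[OF assms] a1_ct[OF w1_a1[OF assms]]] ser_ct)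

lemma ser_add_scaled:
  assumes "a1 a A" "a1 b B" shows "ser (\<lambda>k. - a k + 6 * b k) x = - ser a x + 6 * ser b x"
proof -
  have s: "(\<lambda>k. a k * cis (of_int k * x)) summable_on UNIV" "(\<lambda>k. b k * cis (of_int k * x)) summable_on UNIV"
    by (rule dominated_summable(2)[OF a1_summable[OF assms(1)]], simp add: norm_mult)
       (rule dominated_summable(2)[OF a1_summable[OF assms(2)]], simp add: norm_mult)
  have "ser (\<lambda>k. - a k + 6 * b k) x = (\<Sum>\<^sub>\<infinity>k. - (a k * cis (of_int k * x)) + 6 * (b k * cis (of_int k * x)))"
    unfolding ser_def by (simp add: algebra_simps)
  also have "\<dots> = (\<Sum>\<^sub>\<infinity>k. - (a k * cis (of_int k * x))) + (\<Sum>\<^sub>\<infinity>k. 6 * (b k * cis (of_int k * x)))"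
    by (rule infsum_add) (auto intro: summable_on_cmult_right s simp: summable_on_uminus)
  also have "\<dots> = - ser a x + 6 * ser b x"
    unfolding ser_def by (simp only: infsum_uminus infsum_cmult_right')
  finally show ?thesis .
qed

lemma vector_derivative_unique:
  assumes "((f :: real \<Rightarrow> complex) has_vector_derivative a) (at x)" "(f has_vector_derivative b) (at x)" shows "a = b"
  using assms by (metis vector_derivative_at)

definition jet :: "(real \<Rightarrow> int \<Rightarrow> complex) \<Rightarrow> nat \<Rightarrow> real \<Rightarrow> real \<Rightarrow> complex" where
  "jet c j t = ser ((Dx ^^ j) (c t))"

text \<open>The number 8 is 5 + 3: derivatives up to order 5 occur in the energy identity, and
  \<open>decay_w1\<close> asks for three spare powers of the weight. The last three claims are the
  equation and its first two x-derivatives in physical space.\<close>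

lemma smooth_solution_jets:
  assumes I: "is_interval I" and c: "asol I (\<lambda>_ _. 0) c" and M: "\<forall>t\<in>I. hb 8 (c t) M"
    and C: "\<forall>t\<in>I. \<forall>k. br k ^ 4 * cmod (nl (c t) k) \<le> C"
  shows "\<And>j t x. t \<in> I \<Longrightarrow> j \<le> 5 \<Longrightarrow> (jet c j t has_vector_derivative jet c (Suc j) t x) (at x)"
    and "\<And>j. j \<le> 5 \<Longrightarrow> continuous_on (I \<times> UNIV) (\<lambda>(t, x). jet c j t x)"
    and "\<And>t x. t \<in> I \<Longrightarrow> ((\<lambda>t. jet c 0 t x) has_vector_derivative
        - jet c 3 t x + 6 * (jet c 0 t x * cnj (jet c 0 t x) * jet c 1 t x)) (at t within I)"
    and "\<And>t x. t \<in> I \<Longrightarrow> ((\<lambda>t. jet c 1 t x) has_vector_derivative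
        - jet c 4 t x + 6 * (jet c 1 t x * cnj (jet c 0 t x) * jet c 1 t x + jet c 0 t x * cnj (jet c 1 t x) * jet c 1 t x
          + jet c 0 t x * cnj (jet c 0 t x) * jet c 2 t x)) (at t within I)"
    and "\<And>t x. t \<in> I \<Longrightarrow> ((\<lambda>t. jet c 2 t x) has_vector_derivative
        - jet c 5 t x + 6 * (3 * jet c 1 t x * jet c 2 t x * cnj (jet c 0 t x) + 2 * jet c 1 t x * jet c 1 t x * cnj (jet c 1 t x)
          + 2 * jet c 0 t x * jet c 2 t x * cnj (jet c 1 t x) + jet c 0 t x * cnj (jet c 2 t x) * jet c 1 t x
          + jet c 0 t x * cnj (jet c 0 t x) * jet c 3 t x)) (at t within I)"
proof -
  note M = M[rule_format] and C = C[rule_format]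
  have dec: "br k ^ 8 * cmod (c t k) \<le> M" if "t \<in> I" for t k
    using hb_pointwise[OF M[OF that], of k] wt_nat[of 8 k] by simp
  have w: "w1 ((Dx ^^ j) (c t)) (M * 4)" if "t \<in> I" "j \<le> 5" for j t
    by (rule decay_w1, rule decay_Dx_pow[OF dec[OF that(1)]]) (use that in auto)
  have wn: "w1 ((Dx ^^ j) (nl (c t))) (C * 4)" if "t \<in> I" "j \<le> 1" for j t
    by (rule decay_w1, rule decay_Dx_pow[OF C[OF that(1)]]) (use that in auto)
  have an: "a1 ((Dx ^^ j) (nl (c t))) (C * 4)" if t: "t \<in> I" and j: "j \<le> 2" for j t
  proof (cases j)
    case 0 thus ?thesis using w1_a1[OF wn[OF t, of 0]] by simp
  next
    case (Suc i) thus ?thesis using w1_Dx[OF wn[OF t, of i]] j by simp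
  qed
  show Ux: "(jet c j t has_vector_derivative jet c (Suc j) t x) (at x)" if "t \<in> I" "j \<le> 5" for j t x
    unfolding jet_def using ser_deriv[OF w[OF that]] by simp
  have M0: "0 \<le> M" if "t \<in> I" for t using hb_nonneg[OF M[OF that]] .
  have C0: "0 \<le> C" if "t \<in> I" for t using order_trans[OF _ C[OF that, of 0]] by simp
  have cc: "continuous_on I (\<lambda>t. c t k)" for k
    unfolding continuous_on_eq_continuous_within using asolD[OF c] has_vector_derivative_continuous by blast
  show "continuous_on (I \<times> UNIV) (\<lambda>(t, x). jet c j t x)" if j: "j \<le> 5" for j
  proof (cases "I = {}")
    case False
    then obtain t0 where t0: "t0 \<in> I" by blast
    show ?thesis unfolding jet_def ser_def case_prod_beta
    proof (rule series_continuous[OF inverse_br_squared_summable[OF M0[OF t0]]])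
      show "continuous_on (I \<times> UNIV) (\<lambda>p. (Dx ^^ j) (c (fst p)) k * cis (of_int k * snd p))" for k
        unfolding Dx_pow
        by (intro continuous_intros continuous_on_compose2[OF cc continuous_on_fst[OF continuous_on_id]]) auto
      show "cmod ((Dx ^^ j) (c (fst p)) k * cis (of_int k * snd p)) \<le> M * (inverse (br k))\<^sup>2"
        if p: "p \<in> I \<times> UNIV" for p k
      proof -
        have "cmod ((Dx ^^ j) (c (fst p)) k) \<le> M * (inverse (br k))\<^sup>2"
          by (rule decay_bound, rule decay_Dx_pow[OF dec]) (use p j in auto)
        thus ?thesis by (simp add: norm_mult)
      qed
    qed
  qed simp
  have Ut: "((\<lambda>t. jet c j t x) has_vector_derivative
      - jet c (j + 3) t x + 6 * ser ((Dx ^^ j) (nl (c t))) x) (at t within I)" if t: "t \<in> I" and j: "j \<le> 2" for j t x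
  proof -
    define d where "d t k = - (Dx ^^ (j + 3)) (c t) k + 6 * (Dx ^^ j) (nl (c t)) k" for t k
    have "((\<lambda>t. \<Sum>\<^sub>\<infinity>k. (Dx ^^ j) (c t) k * cis (of_int k * x)) has_vector_derivative
        (\<Sum>\<^sub>\<infinity>k. d t k * cis (of_int k * x))) (at t within I)"
    proof (rule series_deriv[OF _ t inverse_br_squared_summable[of "M + 6 * C"]])
      show "convex I" using I by (simp add: is_interval_convex_1)
      show "0 \<le> M + 6 * C" using M0[OF t] C0[OF t] by simp
      fix k r assume r: "r \<in> I"
      have "((\<lambda>t. (\<i> * of_int k) ^ j * c t k * cis (of_int k * x)) has_vector_derivative
         (\<i> * of_int k) ^ j * (\<i> * of_int k ^ 3 * c r k + 6 * nl (c r) k + 0) * cis (of_int k * x)) (at r within I)"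
        by (intro has_vector_derivative_mult_left has_vector_derivative_mult_right asolD[OF c r])
      moreover have "(\<i> * of_int k) ^ j * (\<i> * of_int k ^ 3 * c r k + 6 * nl (c r) k + 0) = d r k"
      proof -
        \<comment> \<open>The sign change that identifies the term with \<open>i k^3\<close> on the
          Fourier side with minus the third x-derivative.\<close>
        have "(\<i> * of_int k) ^ 3 = - (\<i> * of_int k ^ 3)"
        proof -
          have "\<i> ^ 3 = - \<i>" by (simp add: power3_eq_cube)
          thus ?thesis by (simp add: power_mult_distrib)
        qed
        hence "(\<i> * of_int k) ^ (j + 3) = (\<i> * of_int k) ^ j * (- (\<i> * of_int k ^ 3))"
          by (simp only: power_add)
        thus ?thesis unfolding d_def Dx_pow by (simp add: algebra_simps)
      qed
      ultimately show "((\<lambda>t. (Dx ^^ j) (c t) k * cis (of_int k * x)) has_vector_derivative d r k * cis (of_int k * x)) (at r within I)"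
        unfolding Dx_pow by simp
      have 1: "cmod ((Dx ^^ i) (c r) k) \<le> M * (inverse (br k))\<^sup>2" if "i \<le> 5" for i
        by (rule decay_bound, rule decay_Dx_pow[OF dec[OF r]]) (use that in auto)
      have 2: "cmod ((Dx ^^ j) (nl (c r)) k) \<le> C * (inverse (br k))\<^sup>2"
        by (rule decay_bound, rule decay_Dx_pow[OF C[OF r]]) (use j in auto)
      have le: "M * (inverse (br k))\<^sup>2 \<le> (M + 6 * C) * (inverse (br k))\<^sup>2"
        using C0[OF r] by (intro mult_right_mono) auto
      show "cmod ((Dx ^^ j) (c r) k * cis (of_int k * x)) \<le> (M + 6 * C) * (inverse (br k))\<^sup>2"
        unfolding norm_mult norm_cis mult_1_right by (rule order_trans[OF 1 le]) (use j in simp)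
      have "cmod (d r k) \<le> cmod ((Dx ^^ (j + 3)) (c r) k) + 6 * cmod ((Dx ^^ j) (nl (c r)) k)"
        unfolding d_def using norm_triangle_ineq[of "- (Dx ^^ (j + 3)) (c r) k" "6 * (Dx ^^ j) (nl (c r)) k"]
        by (simp add: norm_mult)
      also have "\<dots> \<le> M * (inverse (br k))\<^sup>2 + 6 * (C * (inverse (br k))\<^sup>2)"
        using 1[of "j + 3"] 2 j by (intro add_mono mult_left_mono) auto
      finally show "cmod (d r k * cis (of_int k * x)) \<le> (M + 6 * C) * (inverse (br k))\<^sup>2"
        by (simp add: norm_mult algebra_simps)
    qed
    moreover have "(\<Sum>\<^sub>\<infinity>k. d t k * cis (of_int k * x)) = - jet c (j + 3) t x + 6 * ser ((Dx ^^ j) (nl (c t))) x"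
      using ser_add_scaled[OF w1_a1[OF w[OF t, of "j + 3"]] an[OF t j], of x] j
      by (simp add: ser_def jet_def d_def)
    ultimately show ?thesis by (simp add: jet_def ser_def)
  qed
  have U0x: "ser (nl (c t)) x = jet c 0 t x * cnj (jet c 0 t x) * jet c 1 t x" if "t \<in> I" for t x
    using ser_nl[OF w[OF that, of 0], of x] by (simp add: jet_def)
  have U': "(jet c 0 t has_vector_derivative jet c 1 t x) (at x)" "(jet c 1 t has_vector_derivative jet c 2 t x) (at x)"
      "(jet c 2 t has_vector_derivative jet c 3 t x) (at x)" if "t \<in> I" for t x
    using Ux[OF that, of 0 x] Ux[OF that, of 1 x] Ux[OF that, of 2 x] by (simp_all add: numeral_2_eq_2 numeral_3_eq_3)
  note V' = U'[THEN has_vector_derivative_cnj]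
  have d1: "((\<lambda>x. jet c 0 t x * cnj (jet c 0 t x) * jet c 1 t x) has_vector_derivative
      jet c 1 t x * cnj (jet c 0 t x) * jet c 1 t x + jet c 0 t x * cnj (jet c 1 t x) * jet c 1 t x + jet c 0 t x * cnj (jet c 0 t x) * jet c 2 t x) (at x)"
    if t: "t \<in> I" for t x
    by (rule has_vector_derivative_eq_rhs, (rule has_vector_derivative_mult U'[OF t] V'[OF t])+, algebra)
  \<comment> \<open>The series of the differentiated coefficients and the product rule expression
    are derivatives of the same function, hence equal; this avoids convolution identities.\<close>
  have N1: "ser (Dx (nl (c t))) x = jet c 1 t x * cnj (jet c 0 t x) * jet c 1 t x + jet c 0 t x * cnj (jet c 1 t x) * jet c 1 t x
      + jet c 0 t x * cnj (jet c 0 t x) * jet c 2 t x" if t: "t \<in> I" for t x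
  proof (rule vector_derivative_unique[OF _ d1[OF t]])
    have "ser (nl (c t)) = (\<lambda>x. jet c 0 t x * cnj (jet c 0 t x) * jet c 1 t x)" using U0x[OF t] by blast
    thus "((\<lambda>x. jet c 0 t x * cnj (jet c 0 t x) * jet c 1 t x) has_vector_derivative ser (Dx (nl (c t))) x) (at x)"
      using ser_deriv[OF wn[OF t, of 0], of x UNIV] by simp
  qed
  have d2: "((\<lambda>x. jet c 1 t x * cnj (jet c 0 t x) * jet c 1 t x + jet c 0 t x * cnj (jet c 1 t x) * jet c 1 t x + jet c 0 t x * cnj (jet c 0 t x) * jet c 2 t x)
      has_vector_derivative
        3 * jet c 1 t x * jet c 2 t x * cnj (jet c 0 t x) + 2 * jet c 1 t x * jet c 1 t x * cnj (jet c 1 t x)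
          + 2 * jet c 0 t x * jet c 2 t x * cnj (jet c 1 t x) + jet c 0 t x * cnj (jet c 2 t x) * jet c 1 t x
          + jet c 0 t x * cnj (jet c 0 t x) * jet c 3 t x) (at x)" if t: "t \<in> I" for t x
    by (rule has_vector_derivative_eq_rhs,
        (rule has_vector_derivative_add has_vector_derivative_mult U'[OF t] V'[OF t])+, algebra)
  have N2: "ser (Dx (Dx (nl (c t)))) x = 3 * jet c 1 t x * jet c 2 t x * cnj (jet c 0 t x) + 2 * jet c 1 t x * jet c 1 t x * cnj (jet c 1 t x)
          + 2 * jet c 0 t x * jet c 2 t x * cnj (jet c 1 t x) + jet c 0 t x * cnj (jet c 2 t x) * jet c 1 t x
          + jet c 0 t x * cnj (jet c 0 t x) * jet c 3 t x" if t: "t \<in> I" for t x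
  proof (rule vector_derivative_unique[OF _ d2[OF t]])
    have "ser (Dx (nl (c t))) = (\<lambda>x. jet c 1 t x * cnj (jet c 0 t x) * jet c 1 t x + jet c 0 t x * cnj (jet c 1 t x) * jet c 1 t x
       + jet c 0 t x * cnj (jet c 0 t x) * jet c 2 t x)" using N1[OF t] by blast
    thus "((\<lambda>x. jet c 1 t x * cnj (jet c 0 t x) * jet c 1 t x + jet c 0 t x * cnj (jet c 1 t x) * jet c 1 t x + jet c 0 t x * cnj (jet c 0 t x) * jet c 2 t x)
       has_vector_derivative ser (Dx (Dx (nl (c t)))) x) (at x)"
      using ser_deriv[OF wn[OF t, of 1], of x UNIV] by simp
  qed
  fix t x assume t: "t \<in> I"
  show "((\<lambda>t. jet c 0 t x) has_vector_derivative
        - jet c 3 t x + 6 * (jet c 0 t x * cnj (jet c 0 t x) * jet c 1 t x)) (at t within I)"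
    using Ut[OF t, of 0 x] U0x[OF t, of x] by simp
  show "((\<lambda>t. jet c 1 t x) has_vector_derivative
        - jet c 4 t x + 6 * (jet c 1 t x * cnj (jet c 0 t x) * jet c 1 t x + jet c 0 t x * cnj (jet c 1 t x) * jet c 1 t x
          + jet c 0 t x * cnj (jet c 0 t x) * jet c 2 t x)) (at t within I)"
    using Ut[OF t, of 1 x] N1[OF t, of x] by simp
  show "((\<lambda>t. jet c 2 t x) has_vector_derivative
        - jet c 5 t x + 6 * (3 * jet c 1 t x * jet c 2 t x * cnj (jet c 0 t x) + 2 * jet c 1 t x * jet c 1 t x * cnj (jet c 1 t x)
          + 2 * jet c 0 t x * jet c 2 t x * cnj (jet c 1 t x) + jet c 0 t x * cnj (jet c 2 t x) * jet c 1 t x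
          + jet c 0 t x * cnj (jet c 0 t x) * jet c 3 t x)) (at t within I)"
    using Ut[OF t, of 2 x] N2[OF t, of x] by (simp add: numeral_2_eq_2)
qed

text \<open>In the last factor, \<open>2 * K^2\<close> collects the initial mass and the initial
  second derivative. The other terms are \<open>10 * (2 * K)^4 + 2 * (2 * K)^6\<close>, the lower
  order part of the energy with u and u_x bounded by \<open>2 * K\<close>. The 8 comes from (1 +
  x)^4 being at most 8 (1 + x^4).\<close>

definition apriori :: "real \<Rightarrow> real" where
  "apriori K = sqrt (8 * (2 * K\<^sup>2 + 160 * K ^ 4 + 128 * K ^ 6))"

text \<open>The only term without a sign is twice the real part of \<open>u0^2 * cnj u1^2\<close>.
  It is at most 2 |u0|^2 |u1|^2 in modulus, well below the 8 |u0|^2 |u1|^2 present. So the energy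
  dominates the second derivative, and from above 8 + 2 = 10.\<close>

lemma edens_bounds:
  "(cmod u2)\<^sup>2 \<le> Re (edens u0 u1 u2 (cnj u0) (cnj u1) (cnj u2))"
  "Re (edens u0 u1 u2 (cnj u0) (cnj u1) (cnj u2)) \<le> (cmod u2)\<^sup>2 + 10 * (cmod u0)\<^sup>2 * (cmod u1)\<^sup>2 + 2 * cmod u0 ^ 6"
proof -
  define Z where "Z = u0 * u0 * cnj u1 * cnj u1"
  define p where "p = Re Z"
  have sq: "z * cnj z = of_real ((cmod z)\<^sup>2)" for z by (rule complex_norm_square[symmetric])
  have "edens u0 u1 u2 (cnj u0) (cnj u1) (cnj u2) = u2 * cnj u2 + 8 * ((u0 * cnj u0) * (u1 * cnj u1))
     + 2 * (u0 * cnj u0) * ((u0 * cnj u0) * (u0 * cnj u0)) + (Z + cnj Z)"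
    unfolding edens_def Z_def by (simp add: algebra_simps)
  also have "\<dots> = of_real ((cmod u2)\<^sup>2 + 8 * ((cmod u0)\<^sup>2 * (cmod u1)\<^sup>2) + 2 * (cmod u0)\<^sup>2 * ((cmod u0)\<^sup>2 * (cmod u0)\<^sup>2))
     + (Z + cnj Z)"
    unfolding sq by simp
  finally have eq: "Re (edens u0 u1 u2 (cnj u0) (cnj u1) (cnj u2)) =
     (cmod u2)\<^sup>2 + 8 * ((cmod u0)\<^sup>2 * (cmod u1)\<^sup>2) + 2 * (cmod u0)\<^sup>2 * ((cmod u0)\<^sup>2 * (cmod u0)\<^sup>2) + 2 * p"
    unfolding p_def by (simp only: plus_complex.sel Re_complex_of_real cnj.sel)
  have "\<bar>p\<bar> \<le> cmod (u0 * u0 * cnj u1 * cnj u1)" unfolding p_def Z_def by (rule abs_Re_le_cmod)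
  also have "\<dots> = (cmod u0)\<^sup>2 * (cmod u1)\<^sup>2" by (simp add: norm_mult power2_eq_square)
  finally have p: "\<bar>p\<bar> \<le> (cmod u0)\<^sup>2 * (cmod u1)\<^sup>2" .
  have nn: "0 \<le> (cmod u0)\<^sup>2 * (cmod u1)\<^sup>2" "0 \<le> 2 * (cmod u0)\<^sup>2 * ((cmod u0)\<^sup>2 * (cmod u0)\<^sup>2)" by auto
  show "(cmod u2)\<^sup>2 \<le> Re (edens u0 u1 u2 (cnj u0) (cnj u1) (cnj u2))"
    unfolding eq using p nn by linarith
  have "2 * (cmod u0)\<^sup>2 * ((cmod u0)\<^sup>2 * (cmod u0)\<^sup>2) = 2 * cmod u0 ^ 6" by (simp add: power2_eq_square eval_nat_numeral)
  thus "Re (edens u0 u1 u2 (cnj u0) (cnj u1) (cnj u2)) \<le> (cmod u2)\<^sup>2 + 10 * (cmod u0)\<^sup>2 * (cmod u1)\<^sup>2 + 2 * cmod u0 ^ 6"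
    unfolding eq using p nn by linarith
qed

text \<open>The H^8 bound \<open>M\<close> justifies differentiating the energy under the integral,
  but the conclusion depends on \<open>K\<close> alone. That makes the bound independent of the
  length of the interval.\<close>

lemma H2_conservation:
  assumes I: "is_interval I" "a \<in> I" "t \<in> I" and c: "asol I (\<lambda>_ _. 0) c"
    and M: "\<And>t. t \<in> I \<Longrightarrow> hb 8 (c t) M" and K: "hb 2 (c a) K"
  shows "hb 2 (c t) (apriori K)"
proof -
  obtain C where C: "\<And>c k. hb 8 c M \<Longrightarrow> br k ^ 4 * cmod (nl c k) \<le> C" using nl_decay[of M] by blast
  have "\<forall>t\<in>I. hb 8 (c t) M" "\<forall>t\<in>I. \<forall>k. br k ^ 4 * cmod (nl (c t) k) \<le> C" using M C[OF M] by auto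
  note jets = smooth_solution_jets[OF I(1) c this]
  have K0: "0 \<le> K" by (rule hb_nonneg[OF K])
  have cI: "convex I" using I(1) by (simp add: is_interval_convex_1)
  have X: "(jet c 0 r has_vector_derivative jet c 1 r x) (at x)" "(jet c 1 r has_vector_derivative jet c 2 r x) (at x)"
      "(jet c 2 r has_vector_derivative jet c 3 r x) (at x)" "(jet c 3 r has_vector_derivative jet c 4 r x) (at x)"
      "(jet c 4 r has_vector_derivative jet c 5 r x) (at x)" if "r \<in> I" for r x
    using jets(1)[OF that, of 0 x] jets(1)[OF that, of 1 x] jets(1)[OF that, of 2 x] jets(1)[OF that, of 3 x] jets(1)[OF that, of 4 x]
    by (simp_all add: eval_nat_numeral)
  note X' = X[THEN has_vector_derivative_cnj]
  note T = jets(3-5)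
  have cnj_rhs: "((\<lambda>t. cnj (f t)) has_vector_derivative z) (at r within S)"
    if "(f has_vector_derivative y) (at r within S)" "cnj y = z" for f :: "real \<Rightarrow> complex" and y z r S
    using has_vector_derivative_cnj[OF that(1)] that(2) by simp
  have T1': "((\<lambda>t. cnj (jet c 0 t x)) has_vector_derivative - cnj (jet c 3 r x) + 6 * (jet c 0 r x * cnj (jet c 0 r x) * cnj (jet c 1 r x))) (at r within I)"
    if r: "r \<in> I" for r x
    by (rule cnj_rhs[OF T(1)[OF r]]) (simp add: mult_ac)
  have T2': "((\<lambda>t. cnj (jet c 1 t x)) has_vector_derivative - cnj (jet c 4 r x) + 6 * (cnj (jet c 1 r x) * jet c 0 r x * cnj (jet c 1 r x)
        + cnj (jet c 0 r x) * jet c 1 r x * cnj (jet c 1 r x) + cnj (jet c 0 r x) * jet c 0 r x * cnj (jet c 2 r x))) (at r within I)"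
    if r: "r \<in> I" for r x
    by (rule cnj_rhs[OF T(2)[OF r]]) (simp add: mult_ac)
  have T3': "((\<lambda>t. cnj (jet c 2 t x)) has_vector_derivative - cnj (jet c 5 r x) + 6 * (3 * cnj (jet c 1 r x) * cnj (jet c 2 r x) * jet c 0 r x
        + 2 * cnj (jet c 1 r x) * cnj (jet c 1 r x) * jet c 1 r x + 2 * cnj (jet c 0 r x) * cnj (jet c 2 r x) * jet c 1 r x
        + cnj (jet c 0 r x) * jet c 2 r x * cnj (jet c 1 r x) + cnj (jet c 0 r x) * jet c 0 r x * cnj (jet c 3 r x))) (at r within I)"
    if r: "r \<in> I" for r x
    by (rule cnj_rhs[OF T(3)[OF r]]) (simp add: mult_ac)
  note T' = T1' T2' T3'
  have Uc: "continuous_on (I \<times> {0..2 * pi}) (\<lambda>p. jet c j (fst p) (snd p))" if "j \<le> 5" for j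
    using continuous_on_subset[OF jets(2)[OF that], of "I \<times> {0..2 * pi}"] by (simp add: case_prod_beta Sigma_mono)
  have Ux: "continuous_on {0..2 * pi} (jet c j r)" if "r \<in> I" "j \<le> 5" for j r
    by (intro continuous_at_imp_continuous_on ballI has_vector_derivative_continuous[OF jets(1)[OF that]])
  have per: "jet c j r (2 * pi) = jet c j r 0" for j r
    unfolding jet_def using ser_periodic[of _ 0] by simp
  have a1c: "a1 (c r) (2 * (M))" "a1 (Dx (c r)) (2 * M)" "a1 (Dx (Dx (c r))) (2 * M)" if "r \<in> I" for r
  proof -
    have w: "w1 (c r) (2 * M)" by (rule hb_w1[OF hb_mono[OF M[OF that]]]) auto
    thus "a1 (c r) (2 * M)" "a1 (Dx (c r)) (2 * M)" by (rule w1_a1, rule w1_Dx)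
    have "hb 2 (Dx (c r)) M"
      using hb_mono[OF M[OF that], of 3 M] unfolding hb_def
      by (simp, elim b2_mono)
         (auto simp: abs_mult cmod_Dx wt_nat[of 2, simplified] wt_nat[of 3, simplified] power_Suc2[of _ 2, simplified]
          mult.assoc intro!: mult_left_mono mult_right_mono abs_le_br)
    thus "a1 (Dx (Dx (c r))) (2 * M)" by (rule w1_Dx[OF hb_w1])
  qed
  have mass: "Re (gg (c t) 0) \<le> K\<^sup>2"
  proof -
    have "integral {0..2 * pi} (\<lambda>x. jet c 0 t x * cnj (jet c 0 t x)) = integral {0..2 * pi} (\<lambda>x. jet c 0 a x * cnj (jet c 0 a x))"
    proof (rule conserved_integral[OF cI I(2,3), where
        e' = "\<lambda>t x. jet c 0 t x * (- cnj (jet c 3 t x) + 6 * (jet c 0 t x * cnj (jet c 0 t x) * cnj (jet c 1 t x)))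
           + (- jet c 3 t x + 6 * (jet c 0 t x * cnj (jet c 0 t x) * jet c 1 t x)) * cnj (jet c 0 t x)" and
        Q = "\<lambda>t x. (- 1) * (jet c 0 t x * cnj (jet c 2 t x)) + jet c 1 t x * cnj (jet c 1 t x) + (- 1) * (jet c 2 t x * cnj (jet c 0 t x))
           + 3 * (jet c 0 t x * jet c 0 t x * cnj (jet c 0 t x) * cnj (jet c 0 t x))"])
      fix r x assume r: "r \<in> I"
      show "((\<lambda>t. jet c 0 t x * cnj (jet c 0 t x)) has_vector_derivative
         jet c 0 r x * (- cnj (jet c 3 r x) + 6 * (jet c 0 r x * cnj (jet c 0 r x) * cnj (jet c 1 r x)))
           + (- jet c 3 r x + 6 * (jet c 0 r x * cnj (jet c 0 r x) * jet c 1 r x)) * cnj (jet c 0 r x)) (at r within I)"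
        by (rule has_vector_derivative_mult[OF T(1)[OF r] T'(1)[OF r]])
      show "((\<lambda>x. (- 1) * (jet c 0 r x * cnj (jet c 2 r x)) + jet c 1 r x * cnj (jet c 1 r x) + (- 1) * (jet c 2 r x * cnj (jet c 0 r x))
           + 3 * (jet c 0 r x * jet c 0 r x * cnj (jet c 0 r x) * cnj (jet c 0 r x))) has_vector_derivative
         jet c 0 r x * (- cnj (jet c 3 r x) + 6 * (jet c 0 r x * cnj (jet c 0 r x) * cnj (jet c 1 r x)))
           + (- jet c 3 r x + 6 * (jet c 0 r x * cnj (jet c 0 r x) * jet c 1 r x)) * cnj (jet c 0 r x)) (at x)"
        by (rule has_vector_derivative_eq_rhs,
            (rule has_vector_derivative_add has_vector_derivative_mult has_vector_derivative_const X[OF r] X'[OF r])+, algebra)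
    next
      fix r assume r: "r \<in> I"
      show "continuous_on {0..2 * pi} (\<lambda>x. jet c 0 r x * cnj (jet c 0 r x))" by (intro continuous_intros Ux r) simp_all
    next
      show "continuous_on (I \<times> {0..2 * pi}) (\<lambda>(t, x). jet c 0 t x * (- cnj (jet c 3 t x) + 6 * (jet c 0 t x * cnj (jet c 0 t x) * cnj (jet c 1 t x)))
           + (- jet c 3 t x + 6 * (jet c 0 t x * cnj (jet c 0 t x) * jet c 1 t x)) * cnj (jet c 0 t x))"
        unfolding case_prod_beta by (intro continuous_intros Uc) simp_all
    qed (simp add: per)
    moreover have "integral {0..2 * pi} (\<lambda>x. jet c 0 r x * cnj (jet c 0 r x)) = 2 * of_real pi * gg (c r) 0" if "r \<in> I" for r
      using integral_unique[OF ser_norm_squared_integral[OF a1c(1)[OF that]]] by (simp add: jet_def)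
    ultimately have "gg (c t) 0 = gg (c a) 0" using I by simp
    thus ?thesis using gg_0_le[OF a1c(1)[OF I(2)] hb_mono[OF K, of 0]] by simp
  qed
  define e where "e t x = edens (jet c 0 t x) (jet c 1 t x) (jet c 2 t x) (cnj (jet c 0 t x)) (cnj (jet c 1 t x)) (cnj (jet c 2 t x))" for t x
  have ec: "continuous_on {0..2 * pi} (e r)" if r: "r \<in> I" for r
    unfolding e_def edens_def by (intro continuous_intros Ux r) simp_all
  have E: "integral {0..2 * pi} (e t) = integral {0..2 * pi} (e a)"
  proof (rule conserved_integral[OF cI I(2,3), where
      e' = "\<lambda>t x. flux_x (jet c 0 t x) (jet c 1 t x) (jet c 2 t x) (jet c 3 t x) (jet c 4 t x) (jet c 5 t x)
          (cnj (jet c 0 t x)) (cnj (jet c 1 t x)) (cnj (jet c 2 t x)) (cnj (jet c 3 t x)) (cnj (jet c 4 t x)) (cnj (jet c 5 t x))" and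
      Q = "\<lambda>t x. flux (jet c 0 t x) (jet c 1 t x) (jet c 2 t x) (jet c 3 t x) (jet c 4 t x)
          (cnj (jet c 0 t x)) (cnj (jet c 1 t x)) (cnj (jet c 2 t x)) (cnj (jet c 3 t x)) (cnj (jet c 4 t x))"])
    fix r x assume r: "r \<in> I"
    show "((\<lambda>t. e t x) has_vector_derivative flux_x (jet c 0 r x) (jet c 1 r x) (jet c 2 r x) (jet c 3 r x) (jet c 4 r x) (jet c 5 r x)
          (cnj (jet c 0 r x)) (cnj (jet c 1 r x)) (cnj (jet c 2 r x)) (cnj (jet c 3 r x)) (cnj (jet c 4 r x)) (cnj (jet c 5 r x))) (at r within I)"
      unfolding e_def edens_t_eq_flux_x[symmetric]
      by (rule edens_deriv[OF T(1)[OF r] T(2)[OF r] T(3)[OF r] T'(1)[OF r] T'(2)[OF r] T'(3)[OF r]])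
    show "((\<lambda>x. flux (jet c 0 r x) (jet c 1 r x) (jet c 2 r x) (jet c 3 r x) (jet c 4 r x)
          (cnj (jet c 0 r x)) (cnj (jet c 1 r x)) (cnj (jet c 2 r x)) (cnj (jet c 3 r x)) (cnj (jet c 4 r x))) has_vector_derivative
        flux_x (jet c 0 r x) (jet c 1 r x) (jet c 2 r x) (jet c 3 r x) (jet c 4 r x) (jet c 5 r x)
          (cnj (jet c 0 r x)) (cnj (jet c 1 r x)) (cnj (jet c 2 r x)) (cnj (jet c 3 r x)) (cnj (jet c 4 r x)) (cnj (jet c 5 r x))) (at x)"
      by (rule flux_deriv[OF X[OF r] X'[OF r]])
  next
    show "continuous_on (I \<times> {0..2 * pi}) (\<lambda>(t, x). flux_x (jet c 0 t x) (jet c 1 t x) (jet c 2 t x) (jet c 3 t x) (jet c 4 t x) (jet c 5 t x)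
          (cnj (jet c 0 t x)) (cnj (jet c 1 t x)) (cnj (jet c 2 t x)) (cnj (jet c 3 t x)) (cnj (jet c 4 t x)) (cnj (jet c 5 t x)))"
      unfolding case_prod_beta flux_x_def by (intro continuous_intros Uc) simp_all
  qed (simp_all add: per ec)
  have u2: "((\<lambda>x. (cmod (jet c 2 r x))\<^sup>2) has_integral (2 * pi * Re (gg (Dx (Dx (c r))) 0))) {0..2 * pi}" if r: "r \<in> I" for r
  proof -
    have "((\<lambda>x. Re (jet c 2 r x * cnj (jet c 2 r x))) has_integral Re (2 * of_real pi * gg (Dx (Dx (c r))) 0)) {0..2 * pi}"
      using has_integral_linear[OF ser_norm_squared_integral[OF a1c(3)[OF r]] bounded_linear_Re]
      by (simp add: o_def jet_def numeral_2_eq_2)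
    thus ?thesis by (simp add: complex_norm_square[symmetric] mult.assoc flip: of_real_power)
  qed
  have er: "((\<lambda>x. Re (e r x)) has_integral Re (integral {0..2 * pi} (e r))) {0..2 * pi}" if r: "r \<in> I" for r
    using has_integral_linear[OF integrable_integral[OF integrable_continuous_real[OF ec[OF r]]] bounded_linear_Re]
    by (simp add: o_def)
  have low: "2 * pi * Re (gg (Dx (Dx (c t))) 0) \<le> Re (integral {0..2 * pi} (e t))"
    by (rule has_integral_le[OF u2[OF I(3)] er[OF I(3)]]) (simp add: e_def edens_bounds(1))
  define B where "B = 10 * (2 * K)\<^sup>2 * (2 * K)\<^sup>2 + 2 * (2 * K) ^ 6"
  have up: "Re (integral {0..2 * pi} (e a)) \<le> 2 * pi * Re (gg (Dx (Dx (c a))) 0) + 2 * pi * B"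
  proof -
    have w: "w1 (c a) (2 * K)" by (rule hb_w1[OF K])
    have 0: "cmod (jet c 0 a x) \<le> 2 * K" "cmod (jet c 1 a x) \<le> 2 * K" for x
      using ser_bound[OF w1_a1[OF w]] ser_bound[OF w1_Dx[OF w]] by (simp_all add: jet_def)
    have le: "Re (e a x) \<le> (cmod (jet c 2 a x))\<^sup>2 + B" for x
    proof -
      have "10 * (cmod (jet c 0 a x))\<^sup>2 * (cmod (jet c 1 a x))\<^sup>2 + 2 * cmod (jet c 0 a x) ^ 6 \<le> B"
        unfolding B_def by (intro add_mono mult_mono power_mono 0) auto
      thus ?thesis
        using edens_bounds(2)[where ?u0.0 = "jet c 0 a x" and ?u1.0 = "jet c 1 a x" and ?u2.0 = "jet c 2 a x"]
        unfolding e_def by linarith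
    qed
    have "((\<lambda>x. B) has_integral (2 * pi * B)) {0..2 * pi}"
      using has_integral_const_real[of B 0 "2 * pi"] by simp
    from has_integral_le[OF er[OF I(2)] has_integral_add[OF u2[OF I(2)] this] le] show ?thesis .
  qed
  have D2: "Re (gg (Dx (Dx (c a))) 0) \<le> K\<^sup>2"
  proof (rule gg_0_le[OF a1c(3)[OF I(2)]])
    show "hb 0 (Dx (Dx (c a))) K"
      using K unfolding hb_def
    proof (rule b2_mono)
      fix k
      have "\<bar>real_of_int k\<bar> * \<bar>real_of_int k\<bar> \<le> br k * br k" by (intro mult_mono abs_le_br) auto
      from mult_right_mono[OF this, of "cmod (c a k)"]
      show "\<bar>wt 0 k * cmod (Dx (Dx (c a)) k)\<bar> \<le> \<bar>wt 2 k * cmod (c a k)\<bar>"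
        by (simp add: cmod_Dx wt_2 power2_eq_square mult.assoc)
    qed simp
  qed
  have top: "Re (gg (Dx (Dx (c t))) 0) \<le> K\<^sup>2 + B"
  proof -
    have "2 * pi * Re (gg (Dx (Dx (c t))) 0) \<le> 2 * pi * (Re (gg (Dx (Dx (c a))) 0) + B)"
      using low up unfolding E by (simp only: distrib_left)
    hence "Re (gg (Dx (Dx (c t))) 0) \<le> Re (gg (Dx (Dx (c a))) 0) + B"
      by (rule mult_left_le_imp_le) simp
    thus ?thesis using D2 by simp
  qed
  show ?thesis unfolding hb_def
  proof (rule b2_I)
    show "0 \<le> apriori K" using K0 by (simp add: apriori_def)
    fix F :: "int set" assume F: "finite F"
    have "(\<Sum>k\<in>F. (wt 2 k * cmod (c t k))\<^sup>2) \<le> (\<Sum>k\<in>F. 8 * ((cmod (c t k))\<^sup>2 + (cmod (Dx (Dx (c t)) k))\<^sup>2))"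
    proof (rule sum_mono)
      fix k
      define x where "x = \<bar>real_of_int k\<bar>"
      have "(1 + x)\<^sup>2 \<le> 2 * (1 + x\<^sup>2)" using zero_le_power2[of "x - 1"] by (simp add: power2_eq_square algebra_simps)
      hence "((1 + x)\<^sup>2)\<^sup>2 \<le> (2 * (1 + x\<^sup>2))\<^sup>2" by (intro power_mono) auto
      also have "\<dots> \<le> 8 * (1 + (x\<^sup>2)\<^sup>2)" using zero_le_power2[of "x\<^sup>2 - 1"] by (simp add: power2_eq_square algebra_simps)
      finally have "((1 + x)\<^sup>2)\<^sup>2 * (cmod (c t k))\<^sup>2 \<le> 8 * (1 + (x\<^sup>2)\<^sup>2) * (cmod (c t k))\<^sup>2" by (intro mult_right_mono) auto
      thus "(wt 2 k * cmod (c t k))\<^sup>2 \<le> 8 * ((cmod (c t k))\<^sup>2 + (cmod (Dx (Dx (c t)) k))\<^sup>2)"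
        by (simp add: wt_2 br_def cmod_Dx x_def[symmetric] power_mult_distrib power2_eq_square algebra_simps)
    qed
    also have "\<dots> = 8 * ((\<Sum>k\<in>F. (cmod (c t k))\<^sup>2) + (\<Sum>k\<in>F. (cmod (Dx (Dx (c t)) k))\<^sup>2))"
      by (simp only: sum_distrib_left[symmetric] sum.distrib)
    also have "\<dots> \<le> 8 * (K\<^sup>2 + (K\<^sup>2 + B))"
      by (intro mult_left_mono add_mono order_trans[OF gg_0_sum[OF a1c(1)[OF I(3)] F] mass]
          order_trans[OF gg_0_sum[OF a1c(3)[OF I(3)] F] top]) simp
    also have "\<dots> = 8 * (2 * K\<^sup>2 + 160 * K ^ 4 + 128 * K ^ 6)"
      by (simp add: B_def power_mult_distrib power_add[symmetric] mult.assoc flip: power2_eq_square)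
    also have "\<dots> = (apriori K)\<^sup>2" using K0 by (simp add: apriori_def)
    finally show "(\<Sum>k\<in>F. (wt 2 k * cmod (c t k))\<^sup>2) \<le> (apriori K)\<^sup>2" .
  qed
qed

section \<open>Global solutions\<close>

definition trunc :: "nat \<Rightarrow> (int \<Rightarrow> complex) \<Rightarrow> int \<Rightarrow> complex" where
  "trunc n c k = (if k \<in> seg n then c k else 0)"

lemma hb_trunc: "hb s c M \<Longrightarrow> hb s (trunc n c) M"
  unfolding hb_def by (erule b2_mono) (auto simp: trunc_def)

lemma hb_trunc_ex: "\<exists>M. hb s (trunc n c) M"
  using hb_finite_support[of "seg n" "trunc n c" s] by (auto simp: trunc_def)

lemma local_existence_at:
  assumes K: "hb 2 c0 K" "0 < K"
  shows "\<exists>c. c a = c0 \<and> asol {a - lifespan K..a + lifespan K} (\<lambda>_ _. 0) c \<and>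
    (\<forall>t \<in> {a - lifespan K..a + lifespan K}. hb 2 (c t) (2 * K)) \<and>
    (\<forall>s M t. 1 \<le> s \<longrightarrow> hb s c0 M \<longrightarrow> t \<in> {a - lifespan K..a + lifespan K} \<longrightarrow>
       hb s (c t) (M * exp (growth s K * \<bar>t - a\<bar>)))"
proof -
  obtain c where c: "c 0 = c0" "asol {- lifespan K..lifespan K} (\<lambda>_ _. 0) c"
    "\<And>t. t \<in> {- lifespan K..lifespan K} \<Longrightarrow> hb 2 (c t) (2 * K)"
    "\<And>s M t. 1 \<le> s \<Longrightarrow> hb s c0 M \<Longrightarrow> t \<in> {- lifespan K..lifespan K} \<Longrightarrow> hb s (c t) (M * exp (growth s K * \<bar>t\<bar>))"
    using local_existence[OF K] by blast
  have im: "(\<lambda>t. t + a) ` {- lifespan K..lifespan K} = {a - lifespan K..a + lifespan K}"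
    by (simp add: add.commute)
  have "asol {a - lifespan K..a + lifespan K} (\<lambda>_ _. 0) (\<lambda>t. c (t - a))"
    using asol_shift[OF c(2), of a] unfolding im .
  moreover have "t - a \<in> {- lifespan K..lifespan K}" if "t \<in> {a - lifespan K..a + lifespan K}" for t
    using that by auto
  ultimately show ?thesis using c by (intro exI[of _ "\<lambda>t. c (t - a)"]) simp
qed

lemma growth_nonneg: "0 \<le> s \<Longrightarrow> 0 \<le> growth s K"
  using Ces_pos[of s] by (simp add: growth_def)

lemma apriori_ge: "0 \<le> K \<Longrightarrow> K \<le> apriori K"
proof -
  assume "0 \<le> K"
  have "K\<^sup>2 \<le> 8 * (2 * K\<^sup>2 + 160 * K ^ 4 + 128 * K ^ 6)"
  proof -
    have "8 * (2 * K\<^sup>2 + 160 * K ^ 4 + 128 * K ^ 6) = K\<^sup>2 + (15 * K\<^sup>2 + 1280 * K ^ 4 + 1024 * K ^ 6)" by simp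
    moreover have "0 \<le> 15 * K\<^sup>2 + 1280 * K ^ 4 + 1024 * K ^ 6" using \<open>0 \<le> K\<close> by simp
    ultimately show ?thesis by simp
  qed
  thus ?thesis unfolding apriori_def by (rule real_le_rsqrt)
qed

text \<open>Every step has the same length, because conservation keeps the H^2 norm below
  \<open>apriori K\<close> at all restart times. The exponential bounds multiply along the steps to
  one exponential in \<open>|t|\<close>, since the distances travelled add up.\<close>

lemma smooth_global:
  assumes K: "hb 2 c0 K" "0 < K" and M8: "hb 8 c0 M8" and s: "1 \<le> s" and M: "hb s c0 M"
  shows "\<exists>c. c 0 = c0 \<and> asol {- (real m * lifespan (apriori K))..real m * lifespan (apriori K)} (\<lambda>_ _. 0) c \<and>
    (\<forall>t\<in>{- (real m * lifespan (apriori K))..real m * lifespan (apriori K)}.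
       hb 2 (c t) (apriori K) \<and> hb 8 (c t) (M8 * exp (growth 8 (apriori K) * \<bar>t\<bar>)) \<and>
       hb s (c t) (M * exp (growth s (apriori K) * \<bar>t\<bar>)))"
proof (induction m)
  case 0
  have "asol {0..0} (\<lambda>_ _. 0) (\<lambda>_. c0)"
    unfolding asol_def by (simp add: has_vector_derivative_def has_derivative_within_singleton_iff bounded_linear_scaleR_left)
  thus ?case using M8 M hb_mono[OF K(1) order_refl apriori_ge] K(2) by (intro exI[of _ "\<lambda>_. c0"]) simp
next
  case (Suc m)
  define A where "A = apriori K"
  define T where "T = lifespan A"
  define R where "R = real m * T"
  have A0: "0 < A" using apriori_ge[of K] K(2) by (simp add: A_def)
  have T0: "0 < T" unfolding T_def by (rule lifespan_pos[OF A0])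
  have R0: "0 \<le> R" using T0 by (simp add: R_def)
  obtain c where c: "c 0 = c0" "asol {- R..R} (\<lambda>_ _. 0) c"
    and cA: "\<And>t. t \<in> {- R..R} \<Longrightarrow> hb 2 (c t) A"
    and c8: "\<And>t. t \<in> {- R..R} \<Longrightarrow> hb 8 (c t) (M8 * exp (growth 8 A * \<bar>t\<bar>))"
    and cs: "\<And>t. t \<in> {- R..R} \<Longrightarrow> hb s (c t) (M * exp (growth s A * \<bar>t\<bar>))"
    using Suc unfolding A_def R_def T_def by blast
  obtain d where d: "d R = c R" "asol {R - T..R + T} (\<lambda>_ _. 0) d"
    and ds: "\<And>s M t. 1 \<le> s \<Longrightarrow> hb s (c R) M \<Longrightarrow> t \<in> {R - T..R + T} \<Longrightarrow> hb s (d t) (M * exp (growth s A * \<bar>t - R\<bar>))"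
    using local_existence_at[OF cA[of R] A0, of R] R0 unfolding T_def by auto
  obtain l where l: "l (- R) = c (- R)" "asol {- R - T..- R + T} (\<lambda>_ _. 0) l"
    and ls: "\<And>s M t. 1 \<le> s \<Longrightarrow> hb s (c (- R)) M \<Longrightarrow> t \<in> {- R - T..- R + T} \<Longrightarrow> hb s (l t) (M * exp (growth s A * \<bar>t + R\<bar>))"
    using local_existence_at[OF cA[of "- R"] A0, of "- R"] R0 unfolding T_def by auto
  define f where "f t = (if t \<in> {- R..R} then c t else d t)" for t
  define g where "g t = (if t \<in> {- R - T..- R} then l t else f t)" for t
  have f: "asol {- R..R + T} (\<lambda>_ _. 0) f" unfolding f_def
    by (rule asol_glue[OF c(2) asol_subset[OF d(2)]]) (use d(1) R0 T0 in auto)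
  have g: "asol {- R - T..R + T} (\<lambda>_ _. 0) g" unfolding g_def
    by (rule asol_glue[OF asol_subset[OF l(2)] f]) (use l(1) R0 T0 in \<open>auto simp: f_def\<close>)
  have gs: "hb r (g t) (N * exp (growth r A * \<bar>t\<bar>))"
    if r: "1 \<le> r" and N: "\<And>t. t \<in> {- R..R} \<Longrightarrow> hb r (c t) (N * exp (growth r A * \<bar>t\<bar>))" and t: "t \<in> {- R - T..R + T}" for r N t
  proof -
    consider "t \<in> {- R - T..- R}" | "t \<in> {- R..R}" "t \<notin> {- R - T..- R}" | "t \<in> {R<..R + T}" using t R0 by force
    thus ?thesis
    proof cases
      case 1
      have "hb r (l t) (N * exp (growth r A * \<bar>- R\<bar>) * exp (growth r A * \<bar>t + R\<bar>))"
        by (rule ls[OF r N]) (use 1 T0 R0 in auto)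
      moreover have "\<bar>- R\<bar> + \<bar>t + R\<bar> = \<bar>t\<bar>" using 1 R0 by auto
      ultimately have "hb r (l t) (N * exp (growth r A * \<bar>t\<bar>))"
        by (simp only: mult.assoc exp_add[symmetric] distrib_left[symmetric])
      thus ?thesis using 1 by (simp add: g_def)
    next
      case 2
      thus ?thesis using N by (auto simp: g_def f_def)
    next
      case 3
      have "hb r (d t) (N * exp (growth r A * \<bar>R\<bar>) * exp (growth r A * \<bar>t - R\<bar>))"
        by (rule ds[OF r N]) (use 3 T0 R0 in auto)
      moreover have "\<bar>R\<bar> + \<bar>t - R\<bar> = \<bar>t\<bar>" using 3 R0 by auto
      ultimately have "hb r (d t) (N * exp (growth r A * \<bar>t\<bar>))"
        by (simp only: mult.assoc exp_add[symmetric] distrib_left[symmetric])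
      thus ?thesis using 3 R0 by (auto simp: g_def f_def)
    qed
  qed
  have g0: "g 0 = c0" using c(1) l(1) R0 by (auto simp: g_def f_def)
  have g8: "hb 8 (g t) (M8 * exp (growth 8 A * (R + T)))" if t: "t \<in> {- R - T..R + T}" for t
  proof (rule hb_mono[OF gs[OF _ c8 t]])
    have "\<bar>t\<bar> \<le> R + T" using t by auto
    thus "M8 * exp (growth 8 A * \<bar>t\<bar>) \<le> M8 * exp (growth 8 A * (R + T))"
      using hb_nonneg[OF M8] growth_nonneg[of 8 A] by (intro mult_left_mono) (auto intro: mult_left_mono)
  qed auto
  \<comment> \<open>The local theory alone gives only \<open>2 * A\<close> on the new pieces.
    Conservation counted from time 0, now justified by the H^8 bound, restores \<open>A\<close> and
    stops the bound from deteriorating with each step.\<close>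
  have gA: "hb 2 (g t) A" if t: "t \<in> {- R - T..R + T}" for t
    unfolding A_def
    by (rule H2_conservation[of "{- R - T..R + T}" 0 t g, OF _ _ t g g8]) (use K(1) g0 R0 T0 in \<open>auto simp: is_interval_cc\<close>)
  have e: "{- (real (Suc m) * T)..real (Suc m) * T} = {- R - T..R + T}"
    by (simp add: R_def algebra_simps)
  show ?case unfolding A_def[symmetric] T_def[symmetric] e
    using g g0 gA gs[OF _ c8] gs[OF s cs] by (intro exI[of _ g]) auto
qed

text \<open>Global solutions with finitely many initial modes keep every regularity and are bounded in
  \<open>H\<^sup>2\<close> by conservation; rough data are reached by truncating the initial data.\<close>

lemma rough_global_interval:
  assumes K: "hb 2 c0 K" "0 < K" and s: "2 \<le> s" and M: "hb s c0 M"
  shows "\<exists>c. c 0 = c0 \<and> asol {- real m..real m} (\<lambda>_ _. 0) c \<and>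
    (\<forall>t\<in>{- real m..real m}. hb 2 (c t) (apriori K) \<and> hb s (c t) (M * exp (growth s (apriori K) * \<bar>t\<bar>)))"
proof -
  define A where "A = apriori K"
  have A0: "0 < A" using apriori_ge[of K] K(2) by (simp add: A_def)
  obtain N :: nat where N: "real m < real N * lifespan A"
    using reals_Archimedean3[OF lifespan_pos[OF A0]] by blast
  define I where "I = {- real m..real m}"
  define P where "P n c \<longleftrightarrow> c 0 = trunc n c0 \<and> asol I (\<lambda>_ _. 0) c \<and>
    (\<forall>t\<in>I. hb 2 (c t) A \<and> hb s (c t) (M * exp (growth s A * \<bar>t\<bar>)))" for n c
  have "\<exists>c. P n c" for n
  proof -
    obtain M8 where M8: "hb 8 (trunc n c0) M8" using hb_trunc_ex by blast
    obtain c where c: "c 0 = trunc n c0" "asol {- (real N * lifespan A)..real N * lifespan A} (\<lambda>_ _. 0) c"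
      "\<forall>t\<in>{- (real N * lifespan A)..real N * lifespan A}.
       hb 2 (c t) A \<and> hb 8 (c t) (M8 * exp (growth 8 A * \<bar>t\<bar>)) \<and> hb s (c t) (M * exp (growth s A * \<bar>t\<bar>))"
      using smooth_global[of "trunc n c0" K M8 s M N, OF hb_trunc[OF K(1)] K(2) M8 _ hb_trunc[OF M]] s
      unfolding A_def by auto
    have sub: "I \<subseteq> {- (real N * lifespan A)..real N * lifespan A}" using N by (auto simp: I_def)
    show ?thesis using c(1,3) asol_subset[OF c(2) sub] sub unfolding P_def by blast
  qed
  hence "\<exists>c. \<forall>n. P n (c n)" by (intro choice allI)
  then obtain c where "\<And>n. P n (c n)" by blast
  hence c: "\<And>n. c n 0 = trunc n c0" "\<And>n. asol I (\<lambda>_ _. 0) (c n)" "\<And>n t. t \<in> I \<Longrightarrow> hb 2 (c n t) A"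
    "\<And>n t. t \<in> I \<Longrightarrow> hb s (c n t) (M * exp (growth s A * \<bar>t\<bar>))"
    unfolding P_def by blast+
  have "\<exists>c'. c' 0 = c0 \<and> asol I (\<lambda>_ _. 0) c' \<and> (\<forall>t\<in>I. \<forall>k. (\<lambda>n. c n t k) \<longlonglongrightarrow> c' t k)"
  proof (rule approximation_limit[where T = "real m" and K = A and \<epsilon> = "\<lambda>_. 0" and D = "\<lambda>n. K / (real n + 1)"])
    show "is_interval I" "0 \<in> I" "\<And>t. t \<in> I \<Longrightarrow> \<bar>t\<bar> \<le> real m" by (auto simp: I_def is_interval_cc)
    show "asol I (\<lambda>_ _. 0) (c n)" for n by (rule c(2))
    show "hb 2 (c n t) A" if "t \<in> I" for n t by (rule c(3)[OF that])
    show "(\<lambda>n. K / (real n + 1)) \<longlonglongrightarrow> 0" by (rule over_Suc_tendsto_0)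
    show "hb 0 (\<lambda>k. c n 0 k - c0 k) (K / (real n + 1))" for n
    proof -
      have "hb 0 (\<lambda>k. if k \<in> seg n then 0 else c0 k) (K / (real n + 1))"
        by (rule hb_tail) (rule hb_mono[OF K(1)], auto)
      thus ?thesis unfolding hb_def by (rule b2_mono) (auto simp: c(1) trunc_def)
    qed
  qed (auto simp: hb_zero)
  then obtain c' where c': "c' 0 = c0" "asol I (\<lambda>_ _. 0) c'" "\<And>t k. t \<in> I \<Longrightarrow> (\<lambda>n. c n t k) \<longlonglongrightarrow> c' t k" by blast
  have "hb 2 (c' t) A" if "t \<in> I" for t
    by (rule hb_limit[OF c(3)[OF that] tendsto_const c'(3)[OF that]])
  moreover have "hb s (c' t) (M * exp (growth s A * \<bar>t\<bar>))" if "t \<in> I" for t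
    by (rule hb_limit[OF c(4)[OF that] tendsto_const c'(3)[OF that]])
  ultimately show ?thesis using c'(1,2) unfolding I_def A_def by blast
qed

lemma global_existence:
  assumes K: "hb 2 c0 K" "0 < K" and s: "2 \<le> s" and M: "hb s c0 M"
  shows "\<exists>c. c 0 = c0 \<and> asol UNIV (\<lambda>_ _. 0) c \<and>
    (\<forall>t. hb 2 (c t) (apriori K) \<and> hb s (c t) (M * exp (growth s (apriori K) * \<bar>t\<bar>)))"
proof -
  define A where "A = apriori K"
  define P where "P m c \<longleftrightarrow> c 0 = c0 \<and> asol {- real m..real m} (\<lambda>_ _. 0) c \<and>
    (\<forall>t\<in>{- real m..real m}. hb 2 (c t) A \<and> hb s (c t) (M * exp (growth s A * \<bar>t\<bar>)))" for m :: nat and c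
  have "\<exists>c. \<forall>m. P m (c m)"
    by (intro choice allI) (use rough_global_interval[OF assms] in \<open>auto simp: P_def A_def\<close>)
  then obtain c where "\<And>m. P m (c m)" by blast
  hence c: "\<And>m. c m 0 = c0" "\<And>m. asol {- real m..real m} (\<lambda>_ _. 0) (c m)"
     "\<And>m t. t \<in> {- real m..real m} \<Longrightarrow> hb 2 (c m t) A"
     "\<And>m t. t \<in> {- real m..real m} \<Longrightarrow> hb s (c m t) (M * exp (growth s A * \<bar>t\<bar>))"
    unfolding P_def by blast+
  have eq: "c m t = c n t" if "t \<in> {- real m..real m}" "m \<le> n" for m n t
  proof (rule uniqueness[of "{- real m..real m}" 0 t])
    show "asol {- real m..real m} (\<lambda>_ _. 0) (c n)" by (rule asol_subset[OF c(2)]) (use that in auto)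
    show "hb 2 (c n r) A" if "r \<in> {- real m..real m}" for r by (rule c(3)) (use that \<open>m \<le> n\<close> in auto)
  qed (use that c in \<open>auto simp: is_interval_cc\<close>)
  \<comment> \<open>The added 1 puts \<open>t\<close> strictly inside the interval, so that the
    derivative within the interval is the full derivative.\<close>
  define N where "N t = nat \<lceil>\<bar>t\<bar>\<rceil> + 1" for t :: real
  have N: "\<bar>t\<bar> < real (N t)" for t unfolding N_def by linarith
  define u where "u t = c (N t) t" for t
  have u: "u r = c n r" if "r \<in> {- real n..real n}" for r n
  proof (cases "N r \<le> n")
    case True
    thus ?thesis unfolding u_def by (intro eq) (use N[of r] in auto)
  next
    case False
    thus ?thesis unfolding u_def by (intro eq[symmetric] that) auto
  qed
  have "asol UNIV (\<lambda>_ _. 0) u"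
    unfolding asol_def
  proof (intro ballI allI)
    fix t :: real and k :: int
    define n where "n = N t"
    have t: "t \<in> {- real n<..<real n}" using N[of t] by (auto simp: n_def)
    have "((\<lambda>r. c n r k) has_vector_derivative (\<i> * of_int k ^ 3 * c n t k + 6 * nl (c n t) k + 0)) (at t within {- real n..real n})"
      by (rule asolD[OF c(2)]) (use t in auto)
    hence "((\<lambda>r. c n r k) has_vector_derivative (\<i> * of_int k ^ 3 * c n t k + 6 * nl (c n t) k + 0)) (at t)"
      by (subst (asm) at_within_interior) (use t in auto)
    hence "((\<lambda>r. u r k) has_vector_derivative (\<i> * of_int k ^ 3 * c n t k + 6 * nl (c n t) k + 0)) (at t)"
      by (rule has_vector_derivative_transform_within_open[OF _ _ t]) (simp_all add: u[of _ n])
    moreover have "u t = c n t" using t by (intro u) auto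
    ultimately show "((\<lambda>r. u r k) has_vector_derivative (\<i> * of_int k ^ 3 * u t k + 6 * nl (u t) k + 0)) (at t within UNIV)" by simp
  qed
  moreover have "hb 2 (u t) A \<and> hb s (u t) (M * exp (growth s A * \<bar>t\<bar>))" for t
    unfolding u_def using N[of t] by (intro conjI c(3,4)) auto
  moreover have "u 0 = c0" by (simp add: u_def c)
  ultimately show ?thesis unfolding A_def by blast
qed

text \<open>Restarting at \<open>a\<close> bounds the norm near \<open>a\<close> by a quantity that tends to the norm at \<open>a\<close>;
  together with the continuity of the single modes this gives continuity in norm.\<close>

lemma solution_continuous:
  assumes c: "asol UNIV (\<lambda>_ _. 0) c" and A: "\<And>t. hb 2 (c t) A" "0 < A" and s: "2 \<le> s" and M: "hb s (c a) M"
    and le: "\<And>e. 0 < e \<Longrightarrow> \<exists>F. finite F \<and> M\<^sup>2 - e < (\<Sum>k\<in>F. (wt s k * cmod (c a k))\<^sup>2)" and e: "0 < e"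
  shows "\<forall>\<^sub>F t in at a. hb s (\<lambda>k. c t k - c a k) e"
proof -
  define T where "T = lifespan A"
  have T0: "0 < T" unfolding T_def by (rule lifespan_pos[OF A(2)])
  define G where "G = growth s A"
  obtain d where d: "d a = c a" "asol {a - T..a + T} (\<lambda>_ _. 0) d"
    and d2: "\<And>t. t \<in> {a - T..a + T} \<Longrightarrow> hb 2 (d t) (2 * A)"
    and ds: "\<And>t. t \<in> {a - T..a + T} \<Longrightarrow> hb s (d t) (M * exp (G * \<bar>t - a\<bar>))"
    using local_existence_at[OF A, of a a] s M unfolding T_def G_def by auto
  have cd: "c t = d t" if "t \<in> {a - T..a + T}" for t
  proof (rule uniqueness[of "{a - T..a + T}" a t])
    show "asol {a - T..a + T} (\<lambda>_ _. 0) c" by (rule asol_subset[OF c]) simp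
    show "hb 2 (c r) (2 * A)" for r by (rule hb_mono[OF A(1)]) (use A(2) in auto)
  qed (use that d d2 T0 in \<open>auto simp: is_interval_cc\<close>)
  have M0: "0 \<le> M" by (rule hb_nonneg[OF M])
  \<comment> \<open>Each of the two tails outside \<open>F\<close> has square sum at most
    \<open>2 * \<delta>\<close>, so the difference has at most 4 + 4 + 1 times
    \<open>\<delta>\<close>, below \<open>e^2\<close>.\<close>
  define \<delta> where "\<delta> = e\<^sup>2 / 16"
  have \<delta>: "0 < \<delta>" using e by (simp add: \<delta>_def)
  obtain F where F: "finite F" "M\<^sup>2 - \<delta> < (\<Sum>k\<in>F. (wt s k * cmod (c a k))\<^sup>2)" using le[OF \<delta>] by blast
  have ct: "((\<lambda>t. c t k) \<longlongrightarrow> c a k) (at a)" for k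
    by (rule has_vector_derivative_continuous[OF asolD[OF c UNIV_I[of a]], unfolded continuous_within])
  have "((\<lambda>t. (M * exp (G * \<bar>t - a\<bar>))\<^sup>2) \<longlongrightarrow> (M * exp (G * \<bar>a - a\<bar>))\<^sup>2) (at a)"
    by (intro tendsto_intros)
  hence 1: "\<forall>\<^sub>F t in at a. (M * exp (G * \<bar>t - a\<bar>))\<^sup>2 < M\<^sup>2 + \<delta>" using \<delta> by (intro order_tendstoD) auto
  have "((\<lambda>t. \<Sum>k\<in>F. (wt s k * cmod (c t k))\<^sup>2) \<longlongrightarrow> (\<Sum>k\<in>F. (wt s k * cmod (c a k))\<^sup>2)) (at a)"
    by (intro tendsto_intros ct)
  hence 2: "\<forall>\<^sub>F t in at a. M\<^sup>2 - \<delta> < (\<Sum>k\<in>F. (wt s k * cmod (c t k))\<^sup>2)" using F(2) by (intro order_tendstoD)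
  have "((\<lambda>t. \<Sum>k\<in>F. (wt s k * cmod (c t k - c a k))\<^sup>2) \<longlongrightarrow> (\<Sum>k\<in>F. (wt s k * cmod (c a k - c a k))\<^sup>2)) (at a)"
    by (intro tendsto_intros ct)
  hence 3: "\<forall>\<^sub>F t in at a. (\<Sum>k\<in>F. (wt s k * cmod (c t k - c a k))\<^sup>2) < \<delta>" using \<delta> by (intro order_tendstoD) auto
  have 4: "\<forall>\<^sub>F t in at a. t \<in> {a - T<..<a + T}"
    by (rule eventually_at_in_open') (use T0 in auto)
  from 1 2 3 4 show ?thesis
  proof eventually_elim
    case (elim t)
    have ts: "hb s (c t) (M * exp (G * \<bar>t - a\<bar>))" using ds[of t] cd[of t] elim(4) by simp
    show ?case unfolding hb_def
    proof (rule b2_I)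
      show "0 \<le> e" using e by simp
      fix H :: "int set" assume H: "finite H"
      have tail: "(\<Sum>k\<in>H - F. (wt s k * cmod (x k))\<^sup>2) \<le> 2 * \<delta>"
        if "hb s x L" "L\<^sup>2 \<le> M\<^sup>2 + \<delta>" "M\<^sup>2 - \<delta> < (\<Sum>k\<in>F. (wt s k * cmod (x k))\<^sup>2)" for x L
      proof -
        have "(\<Sum>k\<in>H - F. (wt s k * cmod (x k))\<^sup>2) + (\<Sum>k\<in>F. (wt s k * cmod (x k))\<^sup>2) = (\<Sum>k\<in>H \<union> F. (wt s k * cmod (x k))\<^sup>2)"
          using H F(1) by (subst sum.union_disjoint[symmetric]) auto
        also have "\<dots> \<le> L\<^sup>2" using that(1) H F(1) by (intro b2_sum) (auto simp: hb_def)
        finally show ?thesis using that by linarith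
      qed
      have "(\<Sum>k\<in>H. (wt s k * cmod (c t k - c a k))\<^sup>2) \<le> (\<Sum>k\<in>(H - F) \<union> F. (wt s k * cmod (c t k - c a k))\<^sup>2)"
        using H F(1) by (intro sum_mono2) auto
      also have "\<dots> = (\<Sum>k\<in>H - F. (wt s k * cmod (c t k - c a k))\<^sup>2) + (\<Sum>k\<in>F. (wt s k * cmod (c t k - c a k))\<^sup>2)"
        using H F(1) by (subst sum.union_disjoint) auto
      also have "(\<Sum>k\<in>H - F. (wt s k * cmod (c t k - c a k))\<^sup>2) \<le>
          (\<Sum>k\<in>H - F. 2 * (wt s k * cmod (c t k))\<^sup>2 + 2 * (wt s k * cmod (c a k))\<^sup>2)"
      proof (rule sum_mono)
        fix k
        have "(wt s k * cmod (c t k - c a k))\<^sup>2 \<le> (wt s k * cmod (c t k) + wt s k * cmod (c a k))\<^sup>2"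
          unfolding distrib_left[symmetric] by (intro power_mono mult_left_mono norm_triangle_ineq4) auto
        also have "\<dots> \<le> 2 * (wt s k * cmod (c t k))\<^sup>2 + 2 * (wt s k * cmod (c a k))\<^sup>2"
          using zero_le_power2[of "wt s k * cmod (c t k) - wt s k * cmod (c a k)"]
          unfolding power2_sum power2_diff by linarith
        finally show "(wt s k * cmod (c t k - c a k))\<^sup>2 \<le> \<dots>" .
      qed
      also have "\<dots> = 2 * (\<Sum>k\<in>H - F. (wt s k * cmod (c t k))\<^sup>2) + 2 * (\<Sum>k\<in>H - F. (wt s k * cmod (c a k))\<^sup>2)"
        by (simp only: sum.distrib sum_distrib_left)
      finally have "(\<Sum>k\<in>H. (wt s k * cmod (c t k - c a k))\<^sup>2) \<le> 4 * \<delta> + 4 * \<delta> + \<delta>"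
        using tail[OF ts] tail[OF M] elim F(2) \<delta> by linarith
      also have "\<dots> \<le> e\<^sup>2" by (simp add: \<delta>_def)
      finally show "(\<Sum>k\<in>H. (wt s k * cmod (c t k - c a k))\<^sup>2) \<le> e\<^sup>2" .
    qed
  qed
qed

section \<open>Fourier coefficients on the torus\<close>

abbreviation MT :: "real measure" where "MT \<equiv> lebesgue_on {0..2 * pi}"

lemma set_integrable_MT:
  fixes f :: "real \<Rightarrow> 'a::euclidean_space"
  shows "set_integrable lebesgue {0..2 * pi} f \<longleftrightarrow> integrable MT f"
  by (subst integrable_restrict_space) (auto simp: set_integrable_def)

lemma set_lint_MT:
  fixes f :: "real \<Rightarrow> 'a::euclidean_space"
  shows "(LINT x:{0..2 * pi}|lebesgue. f x) = integral\<^sup>L MT f"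
  by (subst integral_restrict_space) (auto simp: set_lebesgue_integral_def)

lemma finite_MT: "finite_measure MT"
  by (rule finite_measure_lebesgue_on) simp

lemma measure_MT: "measure MT (space MT) = 2 * pi"
  by (simp add: measure_restrict_space)

lemma continuous_lebesgue_measurable:
  fixes f :: "real \<Rightarrow> 'a::euclidean_space"
  assumes "continuous_on UNIV f" shows "f \<in> borel_measurable lebesgue"
  by (rule measurable_completion) (use assms in \<open>simp add: borel_measurable_continuous_onI\<close>)

lemma continuous_MT:
  fixes f :: "real \<Rightarrow> 'a::euclidean_space"
  assumes "continuous_on UNIV f"
  shows "integrable MT f" "integral\<^sup>L MT f = integral {0..2 * pi} f"
proof -
  have s: "set_integrable lebesgue {0..2 * pi} f"
    by (rule absolutely_integrable_continuous_real[OF continuous_on_subset[OF assms]]) simp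
  thus "integrable MT f" by (simp add: set_integrable_MT)
  show "integral\<^sup>L MT f = integral {0..2 * pi} f"
    using set_lebesgue_integral_eq_integral(2)[OF s] by (simp add: set_lint_MT)
qed

lemma MT_measurable: "f \<in> borel_measurable lebesgue \<Longrightarrow> f \<in> borel_measurable MT"
  by (rule measurable_restrict_space1)

lemma MT_integrable_mult:
  fixes f h :: "real \<Rightarrow> complex"
  assumes "integrable MT f" "h \<in> borel_measurable MT" "\<And>x. x \<in> {0..2 * pi} \<Longrightarrow> cmod (h x) \<le> B"
  shows "integrable MT (\<lambda>x. f x * h x)"
proof (rule Bochner_Integration.integrable_bound)
  show "integrable MT (\<lambda>x. B * norm (f x))" using assms(1) by simp
  show "(\<lambda>x. f x * h x) \<in> borel_measurable MT" using assms by measurable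
  show "AE x in MT. norm (f x * h x) \<le> norm (B * norm (f x))"
  proof (rule AE_I2)
    fix x assume "x \<in> space MT"
    hence "cmod (h x) \<le> \<bar>B\<bar>" using assms(3)[of x] by simp
    thus "norm (f x * h x) \<le> norm (B * norm (f x))"
      using mult_left_mono[of "cmod (h x)" "\<bar>B\<bar>" "cmod (f x)"] by (simp add: norm_mult abs_mult mult.commute)
  qed
qed

lemma cis_continuous: "continuous_on S (\<lambda>x. cis (r * x))"
  by (intro continuous_intros)

lemma MT_integrable_cis: "integrable MT f \<Longrightarrow> integrable MT (\<lambda>x. f x * cis (r * x))"
  by (rule MT_integrable_mult[of _ _ 1]) (auto intro: MT_measurable continuous_lebesgue_measurable cis_continuous)

lemma fourier_coeff_MT:
  "fourier_coeff f k = of_real (1 / (2 * pi)) * integral\<^sup>L MT (\<lambda>x. f x * cis (of_int (- k) * x))"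
  unfolding fourier_coeff_def set_lint_MT by (simp add: cis_conv_exp mult_ac)

lemma fourier_coeff_integral:
  "integral\<^sup>L MT (\<lambda>x. f x * cis (of_int k * x)) = 2 * of_real pi * fourier_coeff f (- k)"
  by (simp add: fourier_coeff_MT)

lemma ser_shift: "ser c x * cis (of_int k * x) = ser (\<lambda>j. c (j - k)) x"
proof -
  have "ser c x * cis (of_int k * x) = (\<Sum>\<^sub>\<infinity>j. c j * cis (of_int j * x) * cis (of_int k * x))"
    unfolding ser_def by (rule infsum_cmult_left'[symmetric])
  also have "\<dots> = ser (\<lambda>j. c (j - k)) x" unfolding ser_def
    by (rule infsum_reindex_bij_witness[of _ "\<lambda>j. j - k" "\<lambda>j. j + k"])
       (auto simp: mult.assoc cis_mult algebra_simps)
  finally show ?thesis .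
qed

lemma a1_shift: assumes "a1 c A" shows "a1 (\<lambda>j. c (j - k)) A"
  using b1_minus[OF b1_reflect[of "\<lambda>j. cmod (c j)" A "- k"]] assms
  by (simp add: a1_def)

lemma ser_MT:
  assumes "a1 c A" shows "integrable MT (ser c)" "integral\<^sup>L MT (ser c) = 2 * of_real pi * c 0"
  using continuous_MT[OF ser_continuous[OF assms]] integral_unique[OF ser_integral[OF assms]] by simp_all

lemma fourier_coeff_ser: assumes "a1 c A" shows "fourier_coeff (ser c) k = c k"
  unfolding fourier_coeff_MT ser_shift ser_MT(2)[OF a1_shift[OF assms]] by simp

lemma ser_L1: "a1 c A \<Longrightarrow> ser c \<in> L1_torus"
  by (simp add: L1_torus_def periodic_def ser_periodic set_integrable_MT ser_MT(1)
      continuous_lebesgue_measurable ser_continuous)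

lemma ser_L2: assumes "a1 c A" shows "ser c \<in> L2_torus"
  using continuous_MT(1)[of "\<lambda>x. (cmod (ser c x))\<^sup>2"] assms
  by (simp add: L2_torus_def periodic_def ser_periodic set_integrable_MT
      continuous_lebesgue_measurable ser_continuous continuous_intros)

lemma L2_MT: "f \<in> L2_torus \<longleftrightarrow> periodic f \<and> f \<in> borel_measurable lebesgue \<and> integrable MT (\<lambda>x. (cmod (f x))\<^sup>2)"
  by (simp add: L2_torus_def set_integrable_MT)

lemma L1_MT: "f \<in> L1_torus \<longleftrightarrow> periodic f \<and> f \<in> borel_measurable lebesgue \<and> integrable MT f"
  by (simp add: L1_torus_def set_integrable_MT)

lemma L2_L1: assumes "f \<in> L2_torus" shows "f \<in> L1_torus"
proof -
  have f: "f \<in> borel_measurable lebesgue" "integrable MT (\<lambda>x. (cmod (f x))\<^sup>2)" "periodic f"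
    using assms by (auto simp: L2_MT)
  have "integrable MT f"
  proof (rule Bochner_Integration.integrable_bound)
    show "integrable MT (\<lambda>x. 1 + (cmod (f x))\<^sup>2)"
      using f(2) finite_measure.integrable_const[OF finite_MT] by (intro Bochner_Integration.integrable_add)
    show "f \<in> borel_measurable MT" by (rule MT_measurable[OF f(1)])
    have "cmod (f x) \<le> 1 + (cmod (f x))\<^sup>2" for x
    proof -
      have "2 * cmod (f x) \<le> 1 + (cmod (f x))\<^sup>2"
        using zero_le_power2[of "cmod (f x) - 1"] by (simp add: power2_eq_square algebra_simps)
      thus ?thesis using norm_ge_zero[of "f x"] by linarith
    qed
    thus "AE x in MT. norm (f x) \<le> norm (1 + (cmod (f x))\<^sup>2)" by simp
  qed
  thus ?thesis using f by (simp add: L1_MT)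
qed

text \<open>Every point of disagreement is a translate by a multiple of the period of one in the
  fundamental interval, and countably many translates of a null set form a null set.\<close>

lemma periodic_AE:
  assumes "periodic f" "periodic g" "AE x in MT. f x = g x"
  shows "AE x in lebesgue. f x = g x"
proof -
  have "AE x in lebesgue. x \<in> {0..2 * pi} \<longrightarrow> f x = g x"
    using assms(3) by (simp add: AE_restrict_space_iff)
  then obtain N where N: "{x \<in> space lebesgue. \<not> (x \<in> {0..2 * pi} \<longrightarrow> f x = g x)} \<subseteq> N" "N \<in> null_sets lebesgue"
    by (rule AE_E3) auto
  have N0: "negligible N" using N(2) by (simp add: negligible_iff_null_sets)
  have per: "h (x + 2 * pi * of_int k) = h x" if h: "periodic h" for h :: "real \<Rightarrow> complex" and x and k :: int
  proof -
    have *: "h (x + 2 * pi * of_nat n) = h x" for n x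
    proof (induction n)
      case (Suc n)
      have "x + 2 * pi * of_nat (Suc n) = (x + 2 * pi * of_nat n) + 2 * pi" by (simp add: algebra_simps)
      moreover have "h (x + 2 * pi * of_nat n + 2 * pi) = h (x + 2 * pi * of_nat n)"
        using h unfolding periodic_def by blast
      ultimately show ?case using Suc by (simp only:)
    qed simp
    show ?thesis
    proof (cases "0 \<le> k")
      case True thus ?thesis using *[of x "nat k"] by simp
    next
      case False thus ?thesis using *[of "x + 2 * pi * of_int k" "nat (- k)"] by simp
    qed
  qed
  have "negligible (\<Union>k::int. (+) (2 * pi * of_int k) ` N)"
    using negligible_countable_Union[of "range (\<lambda>k::int. (+) (2 * pi * of_int k) ` N)"] N0
    by (auto intro: negligible_translation)
  moreover have "x \<in> (\<Union>k::int. (+) (2 * pi * of_int k) ` N)" if x: "f x \<noteq> g x" for x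
  proof -
    define k where "k = \<lfloor>x / (2 * pi)\<rfloor>"
    define y where "y = x + 2 * pi * of_int (- k)"
    have k: "of_int k \<le> x / (2 * pi)" "x / (2 * pi) < of_int k + 1" unfolding k_def by linarith+
    have "0 \<le> y" "y \<le> 2 * pi" using k by (auto simp: y_def field_simps)
    moreover have "f y \<noteq> g y" unfolding y_def using x per[OF assms(1)] per[OF assms(2)] by metis
    ultimately have "y \<in> N" using N(1) by auto
    moreover have "x = 2 * pi * of_int k + y" by (simp add: y_def)
    ultimately show ?thesis by blast
  qed
  ultimately have "(\<Union>k::int. (+) (2 * pi * of_int k) ` N) \<in> null_sets lebesgue"
    "{x. f x \<noteq> g x} \<subseteq> (\<Union>k::int. (+) (2 * pi * of_int k) ` N)"
    by (auto simp: negligible_iff_null_sets)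
  thus ?thesis by (intro AE_I') auto
qed

lemma AE_MT: "AE x in lebesgue. P x \<Longrightarrow> AE x in MT. P x"
  by (auto simp: AE_restrict_space_iff elim: eventually_mono)

lemma fourier_coeff_cong_AE:
  assumes "f \<in> borel_measurable lebesgue" "g \<in> borel_measurable lebesgue" "AE x in MT. f x = g x"
  shows "fourier_coeff f k = fourier_coeff g k"
proof -
  have "integral\<^sup>L MT (\<lambda>x. f x * cis (of_int (- k) * x)) = integral\<^sup>L MT (\<lambda>x. g x * cis (of_int (- k) * x))"
  proof (rule integral_cong_AE)
    have c: "(\<lambda>x. cis (of_int (- k) * x)) \<in> borel_measurable MT"
      by (intro MT_measurable continuous_lebesgue_measurable cis_continuous)
    show "(\<lambda>x. f x * cis (of_int (- k) * x)) \<in> borel_measurable MT" "(\<lambda>x. g x * cis (of_int (- k) * x)) \<in> borel_measurable MT"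
      by (intro borel_measurable_times MT_measurable[OF assms(1)] MT_measurable[OF assms(2)] c)+
    show "AE x in MT. f x * cis (of_int (- k) * x) = g x * cis (of_int (- k) * x)"
      using assms(3) by (auto elim: eventually_mono)
  qed
  thus ?thesis by (simp only: fourier_coeff_MT)
qed

lemma fourier_coeff_diff:
  assumes "integrable MT f" "integrable MT g"
  shows "fourier_coeff (\<lambda>x. f x - g x) k = fourier_coeff f k - fourier_coeff g k"
  unfolding fourier_coeff_MT left_diff_distrib
    Bochner_Integration.integral_diff[OF MT_integrable_cis[OF assms(1)] MT_integrable_cis[OF assms(2)]]
  by (simp add: right_diff_distrib)

section \<open>Uniqueness of the Fourier coefficients of integrable functions\<close>

definition trigp :: "(real \<Rightarrow> complex) \<Rightarrow> bool" where
  "trigp h \<longleftrightarrow> (\<exists>n c. (\<forall>k. k \<notin> seg n \<longrightarrow> c k = 0) \<and> h = ser c)"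

lemma finite_support_a1: "(\<And>k. k \<notin> seg n \<Longrightarrow> c k = 0) \<Longrightarrow> \<exists>A. a1 c A"
  using hb_finite_support[of "seg n" c 2] hb_w1 w1_a1 by (metis finite_seg)

lemma ser_finite:
  assumes "\<And>k. k \<notin> seg n \<Longrightarrow> c k = 0" shows "ser c x = (\<Sum>k\<in>seg n. c k * cis (of_int k * x))"
proof -
  have "ser c x = (\<Sum>\<^sub>\<infinity>k\<in>seg n. c k * cis (of_int k * x))"
    unfolding ser_def by (rule infsum_cong_neutral) (use assms in auto)
  thus ?thesis by simp
qed

lemma trigp_add: assumes "trigp f" "trigp g" shows "trigp (\<lambda>x. f x + g x)"
proof -
  obtain n a m b where a: "\<And>k. k \<notin> seg n \<Longrightarrow> a k = 0" "f = ser a" and b: "\<And>k. k \<notin> seg m \<Longrightarrow> b k = 0" "g = ser b"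
    using assms unfolding trigp_def by blast
  have s: "seg n \<subseteq> seg (n + m)" "seg m \<subseteq> seg (n + m)" by (auto simp: seg_def)
  have z: "a k = 0" "b k = 0" if "k \<notin> seg (n + m)" for k using a(1) b(1) s that by blast+
  have "ser (\<lambda>k. a k + b k) x = f x + g x" for x
  proof -
    have "ser (\<lambda>k. a k + b k) x = (\<Sum>k\<in>seg (n + m). (a k + b k) * cis (of_int k * x))"
      by (rule ser_finite) (simp add: z)
    also have "\<dots> = f x + g x"
      using ser_finite[of "n + m" a x] ser_finite[of "n + m" b x] z a(2) b(2)
      by (simp add: distrib_right sum.distrib)
    finally show ?thesis .
  qed
  thus ?thesis unfolding trigp_def using z by (intro exI[of _ "n + m"] exI[of _ "\<lambda>k. a k + b k"]) (auto simp: fun_eq_iff)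
qed

lemma trigp_mult: assumes "trigp f" "trigp g" shows "trigp (\<lambda>x. f x * g x)"
proof -
  obtain n a m b where a: "\<And>k. k \<notin> seg n \<Longrightarrow> a k = 0" "f = ser a" and b: "\<And>k. k \<notin> seg m \<Longrightarrow> b k = 0" "g = ser b"
    using assms unfolding trigp_def by blast
  obtain A B where AB: "a1 a A" "a1 b B" using finite_support_a1[of n a] finite_support_a1[of m b] a b by blast
  have "conv a b k = 0" if "k \<notin> seg (n + m)" for k
  proof -
    have "a (k - j) * b j = 0" for j
    proof (cases "j \<in> seg m")
      case True
      hence "k - j \<notin> seg n" using that by (auto simp: seg_def)
      thus ?thesis using a by simp
    qed (use b in simp)
    note zero = this
    show ?thesis unfolding conv_def zero by simp
  qed
  moreover have "(\<lambda>x. f x * g x) = ser (conv a b)" using ser_conv[OF AB] a b by auto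
  ultimately show ?thesis unfolding trigp_def by blast
qed

lemma trigp_mono: "trigp (\<lambda>x. z * cis (of_int k * x))"
proof -
  have "ser (\<lambda>j. if j = k then z else 0) x = z * cis (of_int k * x)" for x
  proof -
    have "ser (\<lambda>j. if j = k then z else 0) x = (\<Sum>\<^sub>\<infinity>j\<in>{k}. z * cis (of_int k * x))"
      unfolding ser_def by (rule infsum_cong_neutral) auto
    thus ?thesis by simp
  qed
  thus ?thesis unfolding trigp_def
    by (intro exI[of _ "nat \<bar>k\<bar>"] exI[of _ "\<lambda>j. if j = k then z else 0"]) (auto simp: seg_def)
qed

text \<open>Transports polynomial approximation on the unit circle to trigonometric polynomials: a
  linear form of \<open>cis x\<close> is a combination of \<open>cos x\<close> and
  \<open>sin x\<close>, and sums and products stay trigonometric.\<close>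

lemma trigp_polynomial:
  assumes "real_polynomial_function p" shows "trigp (\<lambda>x. of_real (p (cis x)))"
  using assms
proof (induction p)
  case (linear f)
  have e: "of_real (f (cis x)) = (of_real (f 1) / 2 + of_real (f \<i>) / (2 * \<i>)) * cis (of_int 1 * x)
     + (of_real (f 1) / 2 - of_real (f \<i>) / (2 * \<i>)) * cis (of_int (- 1) * x)" for x
  proof -
    have "f (cis x) = f (cos x *\<^sub>R 1 + sin x *\<^sub>R \<i>)" by (rule arg_cong[of _ _ f]) (simp add: complex_eq_iff)
    also have "\<dots> = cos x * f 1 + sin x * f \<i>"
      using linear by (simp add: linear_simps)
    finally show ?thesis by (simp add: complex_eq_iff field_simps Re_divide Im_divide power2_eq_square)
  qed
  show ?case unfolding e by (intro trigp_add trigp_mono)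
next
  case (const c)
  show ?case using trigp_mono[of "of_real c" 0] by simp
next
  case (add f g) thus ?case using trigp_add by simp
next
  case (mult f g) thus ?case using trigp_mult by simp
qed

lemma L1_uniqueness_polynomial:
  assumes f: "integrable MT f" and z: "\<And>k. fourier_coeff f k = 0" and h: "trigp h"
  shows "integral\<^sup>L MT (\<lambda>x. f x * h x) = 0"
proof -
  obtain n c where c: "\<And>k. k \<notin> seg n \<Longrightarrow> c k = 0" "h = ser c" using h unfolding trigp_def by blast
  have "(\<lambda>x. f x * h x) = (\<lambda>x. \<Sum>k\<in>seg n. c k * (f x * cis (of_int k * x)))"
    using ser_finite[of n c] c by (intro ext) (simp add: sum_distrib_left mult_ac)
  moreover have "integral\<^sup>L MT (\<lambda>x. \<Sum>k\<in>seg n. c k * (f x * cis (of_int k * x))) =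
      (\<Sum>k\<in>seg n. integral\<^sup>L MT (\<lambda>x. c k * (f x * cis (of_int k * x))))"
    by (rule Bochner_Integration.integral_sum) (intro integrable_mult_right MT_integrable_cis f)
  ultimately show ?thesis by (simp add: fourier_coeff_integral z)
qed

text \<open>Stone-Weierstrass on the circle: replacing \<open>\<phi>\<close> by a polynomial within
  \<open>e\<close> changes the integral by at most \<open>e\<close> times the L^1 norm of
  \<open>f\<close>, and for the polynomial the integral vanishes by
  \<open>L1_uniqueness_polynomial\<close>.\<close>

lemma cis_ge_closed:
  fixes \<phi> :: "complex \<Rightarrow> real"
  assumes f: "integrable MT f" and z: "\<And>k. fourier_coeff f k = 0" and \<phi>: "continuous_on UNIV \<phi>"
  shows "integral\<^sup>L MT (\<lambda>x. f x * of_real (\<phi> (cis x))) = 0"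
proof -
  have c\<phi>: "continuous_on UNIV (\<lambda>x. of_real (\<phi> (cis x)) :: complex)"
    by (intro continuous_intros continuous_on_compose2[OF \<phi>]) auto
  obtain B where B: "\<And>x. \<bar>\<phi> (cis x)\<bar> \<le> B"
  proof -
    have "bounded (\<phi> ` sphere 0 1)"
      by (intro compact_imp_bounded compact_continuous_image continuous_on_subset[OF \<phi>]) auto
    then obtain B where "\<forall>y\<in>sphere 0 1. norm (\<phi> y) \<le> B" unfolding bounded_iff by auto
    thus ?thesis using that[of B] by simp
  qed
  have i\<phi>: "integrable MT (\<lambda>x. f x * of_real (\<phi> (cis x)))"
    by (rule MT_integrable_mult[OF f, of _ B]) (use B in \<open>auto intro: MT_measurable continuous_lebesgue_measurable c\<phi>\<close>)
  have "cmod (integral\<^sup>L MT (\<lambda>x. f x * of_real (\<phi> (cis x)))) \<le> e * integral\<^sup>L MT (\<lambda>x. cmod (f x))" if e: "0 < e" for e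
  proof -
    obtain p where p: "real_polynomial_function p" "\<And>y. y \<in> sphere 0 1 \<Longrightarrow> \<bar>\<phi> y - p y\<bar> < e"
      using Stone_Weierstrass_real_polynomial_function[OF compact_sphere continuous_on_subset[OF \<phi>] e, of 0 1] by blast
    obtain n c where c: "\<And>k. k \<notin> seg n \<Longrightarrow> c k = 0" "(\<lambda>x. of_real (p (cis x))) = ser c"
      using trigp_polynomial[OF p(1)] unfolding trigp_def by blast
    obtain A where A: "a1 c A" using finite_support_a1[of n c] c(1) by blast
    have ip: "integrable MT (\<lambda>x. f x * of_real (p (cis x)))"
      unfolding c(2)[THEN fun_cong]
      by (rule MT_integrable_mult[OF f, of _ A])
         (auto intro: MT_measurable continuous_lebesgue_measurable ser_continuous[OF A] ser_bound[OF A])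
    have "integral\<^sup>L MT (\<lambda>x. f x * of_real (\<phi> (cis x))) = integral\<^sup>L MT (\<lambda>x. f x * of_real (\<phi> (cis x)) - f x * of_real (p (cis x)))"
      using L1_uniqueness_polynomial[OF f z trigp_polynomial[OF p(1)]] Bochner_Integration.integral_diff[OF i\<phi> ip] by simp
    also have "cmod \<dots> \<le> integral\<^sup>L MT (\<lambda>x. cmod (f x * of_real (\<phi> (cis x)) - f x * of_real (p (cis x))))"
      by (rule integral_norm_bound)
    also have "\<dots> \<le> integral\<^sup>L MT (\<lambda>x. e * cmod (f x))"
    proof (rule integral_mono)
      show "integrable MT (\<lambda>x. cmod (f x * of_real (\<phi> (cis x)) - f x * of_real (p (cis x))))"
        by (intro integrable_norm Bochner_Integration.integrable_diff i\<phi> ip)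
      show "integrable MT (\<lambda>x. e * cmod (f x))" using f by simp
      fix x
      have "cmod (f x * of_real (\<phi> (cis x)) - f x * of_real (p (cis x))) = cmod (f x) * \<bar>\<phi> (cis x) - p (cis x)\<bar>"
        by (metis norm_mult norm_of_real of_real_diff right_diff_distrib)
      also have "\<dots> \<le> cmod (f x) * e" using p(2)[of "cis x"] by (intro mult_left_mono) auto
      finally show "cmod (f x * of_real (\<phi> (cis x)) - f x * of_real (p (cis x))) \<le> e * cmod (f x)" by (simp add: mult.commute)
    qed
    finally show ?thesis by simp
  qed
  note le = this
  define Z where "Z = cmod (integral\<^sup>L MT (\<lambda>x. f x * of_real (\<phi> (cis x))))"
  define J where "J = integral\<^sup>L MT (\<lambda>x. cmod (f x))"
  have J: "0 \<le> J" unfolding J_def by simp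
  have "Z \<le> 0"
  proof (rule field_le_epsilon)
    fix d :: real assume d: "0 < d"
    have "0 < d / (J + 1)" using d J by (intro divide_pos_pos) linarith+
    from le[OF this] have "Z \<le> d / (J + 1) * J" by (simp only: Z_def J_def)
    also have "\<dots> \<le> d" using d J by (simp add: field_simps)
    finally show "Z \<le> 0 + d" by simp
  qed
  thus ?thesis by (simp add: Z_def)
qed

text \<open>Tent functions of the distance to an arc are continuous on the circle and decrease to
  its indicator, so dominated convergence extends the vanishing to arcs. The arc must not close up,
  or its preimage would not be an initial segment; hence \<open>b < 2 * pi\<close>.\<close>

lemma L1_uniqueness_arc:
  assumes f: "integrable MT f" and z: "\<And>k. fourier_coeff f k = 0" and b: "0 \<le> b" "b < 2 * pi"
  shows "integral {0..b} f = 0"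
proof -
  define C where "C = cis ` {0..b}"
  have C: "closed C" "C \<noteq> {}" using b unfolding C_def
    by (auto intro!: compact_imp_closed compact_continuous_image continuous_intros)
  define \<phi> where "\<phi> n y = max 0 (1 - real n * infdist y C)" for n y
  have cont: "continuous_on UNIV (\<phi> n)" for n unfolding \<phi>_def by (intro continuous_intros)
  have meas: "(\<lambda>x. f x * of_real (\<phi> n (cis x))) \<in> borel_measurable MT" for n
  proof -
    have "(\<lambda>x. of_real (\<phi> n (cis x)) :: complex) \<in> borel_measurable MT"
      by (intro MT_measurable continuous_lebesgue_measurable continuous_intros continuous_on_compose2[OF cont]) auto
    thus ?thesis using f by measurable
  qed
  have lim: "(\<lambda>n. \<phi> n y) \<longlonglongrightarrow> indicator C y" for y
  proof (cases "y \<in> C")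
    case True
    thus ?thesis by (simp add: \<phi>_def)
  next
    case False
    hence d: "0 < infdist y C" using C by (metis in_closed_iff_infdist_zero infdist_nonneg order_le_less)
    obtain N :: nat where N: "1 < real N * infdist y C" using reals_Archimedean3[OF d] by blast
    have "\<forall>\<^sub>F n in sequentially. \<phi> n y = 0"
    proof (rule eventually_sequentiallyI[of N])
      fix n assume "N \<le> n"
      hence "real N * infdist y C \<le> real n * infdist y C" using d by (intro mult_right_mono) auto
      thus "\<phi> n y = 0" using N by (simp add: \<phi>_def)
    qed
    thus ?thesis using False by (simp add: tendsto_eventually)
  qed
  have lim': "(\<lambda>n. f x * of_real (\<phi> n (cis x))) \<longlonglongrightarrow> f x * of_real (indicator C (cis x))" for x
  proof -
    have "(\<lambda>n. of_real (\<phi> n (cis x)) :: complex) \<longlonglongrightarrow> of_real (indicator C (cis x))"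
      by (rule tendsto_of_real[OF lim])
    from tendsto_mult[OF tendsto_const this] show ?thesis .
  qed
  have mC: "(\<lambda>x. f x * of_real (indicator C (cis x))) \<in> borel_measurable MT"
    by (rule borel_measurable_LIMSEQ_metric[of "\<lambda>n x. f x * of_real (\<phi> n (cis x))", OF meas lim'])
  have "(\<lambda>n. integral\<^sup>L MT (\<lambda>x. f x * of_real (\<phi> n (cis x)))) \<longlonglongrightarrow> integral\<^sup>L MT (\<lambda>x. f x * of_real (indicator C (cis x)))"
  proof (rule integral_dominated_convergence[where w = "\<lambda>x. cmod (f x)"])
    show "AE x in MT. (\<lambda>n. f x * of_real (\<phi> n (cis x))) \<longlonglongrightarrow> f x * of_real (indicator C (cis x))"
      by (rule AE_I2) (rule lim')
    have "\<bar>\<phi> n y\<bar> \<le> 1" for n y unfolding \<phi>_def using infdist_nonneg[of y C] by (auto simp: max_def)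
    thus "AE x in MT. norm (f x * of_real (\<phi> n (cis x))) \<le> cmod (f x)" for n
      by (simp add: norm_mult mult_left_le)
  qed (use mC meas f in auto)
  hence 0: "integral\<^sup>L MT (\<lambda>x. f x * of_real (indicator C (cis x))) = 0"
    unfolding cis_ge_closed[OF f z cont] by (simp add: LIMSEQ_const_iff)
  have ind: "cis x \<in> C \<longleftrightarrow> x \<le> b" if x: "0 \<le> x" "x < 2 * pi" for x
  proof
    assume "cis x \<in> C"
    then obtain y where y: "0 \<le> y" "y \<le> b" "cis x = cis y" unfolding C_def by auto
    have "x = y"
    proof -
      have "sin x = sin y \<and> cos x = cos y" using y(3) by (simp add: complex_eq_iff)
      then obtain k :: int where k: "x = y + 2 * pi * of_int k" using sin_cos_eq_iff[of x y] by (auto simp: mult_ac)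
      have "\<bar>x - y\<bar> < 2 * pi" using x y b by linarith
      hence "2 * pi * \<bar>of_int k\<bar> < 2 * pi * 1" unfolding k by (simp add: abs_mult)
      hence "\<bar>real_of_int k\<bar> < 1" by (subst (asm) mult_less_cancel_left_pos) auto
      hence "k = 0" by linarith
      thus ?thesis using k by simp
    qed
    thus "x \<le> b" using y by simp
  qed (use x in \<open>auto simp: C_def\<close>)
  have si: "set_integrable lebesgue {0..2 * pi} f" using f by (simp add: set_integrable_MT)
  have sib: "set_integrable lebesgue {0..b} f" by (rule set_integrable_subset[OF si]) (use b in auto)
  have "integral {0..b} f = (LINT x:{0..b}|lebesgue. f x)"
    using set_lebesgue_integral_eq_integral(2)[OF sib] by simp
  also have "\<dots> = (LINT x|lebesgue. indicator {0..2 * pi} x *\<^sub>R (f x * of_real (indicator {0..b} x)))"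
    unfolding set_lebesgue_integral_def
    by (intro Bochner_Integration.integral_cong) (use b in \<open>auto simp: indicator_def scaleR_conv_of_real\<close>)
  also have "\<dots> = integral\<^sup>L MT (\<lambda>x. f x * of_real (indicator {0..b} x))"
    by (subst integral_restrict_space) auto
  also have "\<dots> = integral\<^sup>L MT (\<lambda>x. f x * of_real (indicator C (cis x)))"
  proof (rule integral_cong_AE[OF _ mC])
    show "(\<lambda>x. f x * of_real (indicator {0..b} x)) \<in> borel_measurable MT"
    proof (intro borel_measurable_times borel_measurable_integrable[OF f] MT_measurable)
      have [measurable]: "{0..b} \<in> sets lebesgue" by simp
      show "(\<lambda>x. complex_of_real (indicator {0..b} x)) \<in> borel_measurable lebesgue" by measurable
    qed
    \<comment> \<open>At the right endpoint \<open>cis\<close> returns to the start of the arc, so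
      the two indicators disagree at this one point.\<close>
    have "{2 * pi} \<in> null_sets lebesgue" by (simp flip: negligible_iff_null_sets)
    from AE_not_in[OF this] have "AE x in lebesgue. x \<noteq> 2 * pi" by simp
    hence "AE x in MT. x \<noteq> 2 * pi" by (rule AE_MT)
    moreover have "AE x in MT. x \<in> {0..2 * pi}" by (rule AE_I2) simp
    ultimately show "AE x in MT. f x * of_real (indicator {0..b} x) = f x * of_real (indicator C (cis x))"
    proof eventually_elim
      case (elim x)
      thus ?case using ind[of x] by (auto simp: indicator_def)
    qed
  qed
  finally show ?thesis using 0 by simp
qed

text \<open>The indefinite integral of \<open>f\<close> vanishes, so \<open>f\<close> vanishes at
  almost every point by Lebesgue differentiation. The extension \<open>g\<close> by zero is there to
  be integrable on every interval.\<close>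

lemma L1_uniqueness:
  assumes f: "integrable MT f" and z: "\<And>k. fourier_coeff f k = 0"
  shows "AE x in MT. f x = 0"
proof -
  define g where "g x = (if x \<in> {0..2 * pi} then f x else 0)" for x
  have si: "set_integrable lebesgue {0..2 * pi} f" using f by (simp add: set_integrable_MT)
  have gi: "g integrable_on cbox a b" for a b
  proof -
    have "set_integrable lebesgue UNIV g"
      using si by (simp add: set_integrable_def g_def[abs_def] indicator_scaleR_eq_if)
    hence "set_integrable lebesgue (cbox a b) g" by (rule set_integrable_subset) auto
    thus ?thesis by (rule set_lebesgue_integral_eq_integral(1))
  qed
  obtain N where N: "negligible N"
    "\<And>x e. x \<notin> N \<Longrightarrow> 0 < e \<Longrightarrow> \<exists>d>0. \<forall>h. 0 < h \<and> h < d \<longrightarrow>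
       norm (integral (cbox x (x + h *\<^sub>R One)) g /\<^sub>R h ^ DIM(real) - g x) < e"
    using integrable_ccontinuous_explicit[OF gi] by metis
  have zero: "f x = 0" if x: "x \<notin> N" "0 < x" "x < 2 * pi" for x
  proof -
    have "norm (g x) < e" if e: "0 < e" for e
    proof -
      obtain d where d: "0 < d" "\<And>h. 0 < h \<Longrightarrow> h < d \<Longrightarrow> norm (integral (cbox x (x + h *\<^sub>R One)) g /\<^sub>R h ^ DIM(real) - g x) < e"
        using N(2)[OF x(1) e] by blast
      define h where "h = min d (2 * pi - x) / 2"
      have "h \<le> (2 * pi - x) / 2" "h \<le> d / 2" by (simp_all add: h_def)
      moreover have "0 < h" using d(1) x by (simp add: h_def)
      moreover have "(2 * pi - x) / 2 < 2 * pi - x" "d / 2 < d" using x(3) d(1) by (simp_all add: field_simps)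
      ultimately have h: "0 < h" "h < d" "x + h < 2 * pi" by linarith+
      have fi: "f integrable_on {0..x + h}"
        by (rule integrable_on_subinterval[OF set_lebesgue_integral_eq_integral(1)[OF si]]) (use h x in auto)
      have "integral {0..x} f + integral {x..x + h} f = integral {0..x + h} f"
        by (rule Henstock_Kurzweil_Integration.integral_combine[OF _ _ fi]) (use h x in auto)
      hence "integral {x..x + h} f = 0"
        using L1_uniqueness_arc[OF f z, of x] L1_uniqueness_arc[OF f z, of "x + h"] h x by simp
      moreover have "integral {x..x + h} g = integral {x..x + h} f"
        by (rule integral_cong) (use h x in \<open>auto simp: g_def\<close>)
      ultimately show ?thesis using d(2)[OF h(1,2)] by simp
    qed
    from this[of "norm (g x)"] have "g x = 0" by auto
    thus ?thesis using x by (simp add: g_def)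
  qed
  have "negligible (N \<union> {0, 2 * pi})" using N(1) by simp
  hence "AE x in lebesgue. x \<notin> N \<union> {0, 2 * pi}" by (intro AE_not_in) (simp add: negligible_iff_null_sets)
  hence "AE x in MT. x \<notin> N \<union> {0, 2 * pi}" by (rule AE_MT)
  moreover have "AE x in MT. x \<in> {0..2 * pi}" by (rule AE_I2) simp
  ultimately show ?thesis by eventually_elim (rule zero, auto simp: order_le_less)
qed

lemma L1_fourier_unique:
  assumes "f \<in> L1_torus" "g \<in> L1_torus" "\<And>k. fourier_coeff f k = fourier_coeff g k"
  shows "AE x in lebesgue. f x = g x"
proof (rule periodic_AE)
  have i: "integrable MT f" "integrable MT g" and p: "periodic f" "periodic g" using assms by (auto simp: L1_MT)
  show "periodic f" "periodic g" by (fact p)+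
  have "AE x in MT. f x - g x = 0"
    by (rule L1_uniqueness) (use i assms(3) in \<open>auto simp: fourier_coeff_diff\<close>)
  thus "AE x in MT. f x = g x" by simp
qed

section \<open>Bessel's inequality, Riesz-Fischer and Parseval\<close>

lemma bessel_inequality:
  assumes g: "g \<in> L2_torus"
  shows "hb 0 (fourier_coeff g) (L2_norm g / sqrt (2 * pi))"
  unfolding hb0
proof (rule b2_I)
  have N: "(L2_norm g)\<^sup>2 = integral\<^sup>L MT (\<lambda>x. (cmod (g x))\<^sup>2)"
    unfolding L2_norm_def set_lint_MT by simp
  show "0 \<le> L2_norm g / sqrt (2 * pi)" unfolding L2_norm_def set_lint_MT by simp
  fix F :: "int set" assume F: "finite F"
  define d where "d k = (if k \<in> F then fourier_coeff g k else 0)" for k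
  define S where "S = (\<Sum>k\<in>F. (cmod (fourier_coeff g k))\<^sup>2)"
  have i2: "integrable MT (\<lambda>x. (cmod (g x))\<^sup>2)" and i1: "integrable MT g" and gm: "g \<in> borel_measurable MT"
    using g L2_L1[OF g] by (auto simp: L2_MT L1_MT intro: MT_measurable)
  obtain n where n: "F \<subseteq> seg n" using finite_subset_seg[OF F] by blast
  have "d k = 0" if "k \<notin> seg n" for k using that n by (auto simp: d_def)
  then obtain A where A: "a1 d A" using finite_support_a1[of n d] by blast
  have hd: "hb 0 d (sqrt S)"
    using hb_finite_support[of F d 0] F by (simp add: d_def S_def L2_set_def cong: sum.cong)
  have dx: "ser d x = (\<Sum>k\<in>F. fourier_coeff g k * cis (of_int k * x))" for x
  proof -
    have "ser d x = (\<Sum>\<^sub>\<infinity>k\<in>F. fourier_coeff g k * cis (of_int k * x))"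
      unfolding ser_def by (rule infsum_cong_neutral) (auto simp: d_def)
    thus ?thesis using F by simp
  qed
  have cd: "continuous_on UNIV (ser d)" by (rule ser_continuous[OF A])
  have cdx: "cnj (ser d x) = (\<Sum>k\<in>F. cnj (fourier_coeff g k) * cis (of_int (- k) * x))" for x
    unfolding dx by (simp add: cis_cnj)
  have ig: "integrable MT (\<lambda>x. cnj (fourier_coeff g k) * (g x * cis (of_int (- k) * x)))" for k
    by (intro integrable_mult_right MT_integrable_cis i1)
  have gd: "integral\<^sup>L MT (\<lambda>x. g x * cnj (ser d x)) = 2 * of_real pi * of_real S"
    and igd: "integrable MT (\<lambda>x. g x * cnj (ser d x))"
  proof -
    have e: "(\<lambda>x. g x * cnj (ser d x)) = (\<lambda>x. \<Sum>k\<in>F. cnj (fourier_coeff g k) * (g x * cis (of_int (- k) * x)))"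
      unfolding cdx by (simp add: sum_distrib_left mult_ac)
    show "integrable MT (\<lambda>x. g x * cnj (ser d x))" unfolding e by (intro Bochner_Integration.integrable_sum ig)
    have "integral\<^sup>L MT (\<lambda>x. g x * cnj (ser d x)) = (\<Sum>k\<in>F. integral\<^sup>L MT (\<lambda>x. cnj (fourier_coeff g k) * (g x * cis (of_int (- k) * x))))"
      unfolding e by (rule Bochner_Integration.integral_sum) (rule ig)
    also have "\<dots> = (\<Sum>k\<in>F. 2 * of_real pi * of_real ((cmod (fourier_coeff g k))\<^sup>2))"
      unfolding integral_mult_right_zero fourier_coeff_integral complex_norm_square
      by (intro sum.cong) (auto simp: mult_ac)
    finally show "integral\<^sup>L MT (\<lambda>x. g x * cnj (ser d x)) = 2 * of_real pi * of_real S"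
      by (simp only: S_def sum_distrib_left of_real_sum)
  qed
  have dd: "integral\<^sup>L MT (\<lambda>x. (cmod (ser d x))\<^sup>2) \<le> 2 * pi * S" and idd: "integrable MT (\<lambda>x. (cmod (ser d x))\<^sup>2)"
  proof -
    have c: "continuous_on UNIV (\<lambda>x. (cmod (ser d x))\<^sup>2)" by (intro continuous_intros cd)
    show "integrable MT (\<lambda>x. (cmod (ser d x))\<^sup>2)" by (rule continuous_MT(1)[OF c])
    have "((\<lambda>x. Re (ser d x * cnj (ser d x))) has_integral Re (2 * of_real pi * gg d 0)) {0..2 * pi}"
      using has_integral_linear[OF ser_norm_squared_integral[OF A] bounded_linear_Re] by (simp add: o_def)
    hence "integral {0..2 * pi} (\<lambda>x. (cmod (ser d x))\<^sup>2) = 2 * pi * Re (gg d 0)"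
      by (intro integral_unique) (simp add: complex_norm_square[symmetric] mult.assoc flip: of_real_power)
    moreover have "Re (gg d 0) \<le> (sqrt S)\<^sup>2" by (rule gg_0_le[OF A hd])
    moreover have "(sqrt S)\<^sup>2 = S" by (simp add: S_def sum_nonneg)
    ultimately show "integral\<^sup>L MT (\<lambda>x. (cmod (ser d x))\<^sup>2) \<le> 2 * pi * S"
      unfolding continuous_MT(2)[OF c] by simp
  qed
  \<comment> \<open>Expanding the squared distance from \<open>g\<close> to its partial sum over
    \<open>F\<close>: the cross term contributes \<open>- 4 * pi * S\<close> and the last square at
    most \<open>2 * pi * S\<close>.\<close>
  have "0 \<le> integral\<^sup>L MT (\<lambda>x. (cmod (g x - ser d x))\<^sup>2)" by simp
  also have "(\<lambda>x. (cmod (g x - ser d x))\<^sup>2) = (\<lambda>x. (cmod (g x))\<^sup>2 - 2 * Re (g x * cnj (ser d x)) + (cmod (ser d x))\<^sup>2)"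
    unfolding cmod_power2 by (intro ext) (simp add: power2_eq_square algebra_simps)
  also have "integral\<^sup>L MT \<dots> = integral\<^sup>L MT (\<lambda>x. (cmod (g x))\<^sup>2) - 2 * Re (integral\<^sup>L MT (\<lambda>x. g x * cnj (ser d x)))
      + integral\<^sup>L MT (\<lambda>x. (cmod (ser d x))\<^sup>2)"
    using Bochner_Integration.integral_add[OF Bochner_Integration.integrable_diff[OF i2
        integrable_mult_right[OF integrable_Re[OF igd], of 2]] idd]
      Bochner_Integration.integral_diff[OF i2 integrable_mult_right[OF integrable_Re[OF igd], of 2]]
    by (simp only: integral_mult_right_zero integral_Re[OF igd])
  also have "\<dots> \<le> (L2_norm g)\<^sup>2 - 2 * pi * S" unfolding gd N using dd by (simp add: mult_ac)
  finally have "2 * pi * S \<le> (L2_norm g)\<^sup>2" by simp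
  hence "S \<le> (L2_norm g)\<^sup>2 / (2 * pi)" by (simp add: field_simps)
  also have "\<dots> = (L2_norm g / sqrt (2 * pi))\<^sup>2" by (simp add: power_divide)
  finally show "(\<Sum>k\<in>F. (cmod (fourier_coeff g k))\<^sup>2) \<le> (L2_norm g / sqrt (2 * pi))\<^sup>2" by (simp add: S_def)
qed

lemma ser_L2_bound:
  assumes "a1 c A" "hb 0 c K"
  shows "integral\<^sup>L MT (\<lambda>x. (cmod (ser c x))\<^sup>2) \<le> 2 * pi * K\<^sup>2" "integrable MT (\<lambda>x. (cmod (ser c x))\<^sup>2)"
proof -
  have c: "continuous_on UNIV (\<lambda>x. (cmod (ser c x))\<^sup>2)" by (intro continuous_intros ser_continuous[OF assms(1)])
  show "integrable MT (\<lambda>x. (cmod (ser c x))\<^sup>2)" by (rule continuous_MT(1)[OF c])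
  have "((\<lambda>x. Re (ser c x * cnj (ser c x))) has_integral Re (2 * of_real pi * gg c 0)) {0..2 * pi}"
    using has_integral_linear[OF ser_norm_squared_integral[OF assms(1)] bounded_linear_Re] by (simp add: o_def)
  hence "integral {0..2 * pi} (\<lambda>x. (cmod (ser c x))\<^sup>2) = 2 * pi * Re (gg c 0)"
    by (intro integral_unique) (simp add: complex_norm_square[symmetric] mult.assoc flip: of_real_power)
  thus "integral\<^sup>L MT (\<lambda>x. (cmod (ser c x))\<^sup>2) \<le> 2 * pi * K\<^sup>2"
    unfolding continuous_MT(2)[OF c] using gg_0_le[OF assms] by simp
qed

definition cut :: "nat \<Rightarrow> (int \<Rightarrow> complex) \<Rightarrow> int \<Rightarrow> complex" where
  "cut n c k = (if k \<in> seg n then c k else 0)"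

lemma cut_a1: "\<exists>A. a1 (cut n c) A"
  by (rule finite_support_a1[of n]) (simp add: cut_def)

lemma hb0_tail_small:
  assumes d: "hb 0 d D" and e: "0 < e"
  shows "\<exists>n. hb 0 (\<lambda>k. d k - cut n d k) e"
proof -
  have b: "b1 (\<lambda>k. (cmod (d k))\<^sup>2) (D\<^sup>2)" using b2_sum d by (auto simp: b1_def hb0)
  have s: "(\<lambda>k. (cmod (d k))\<^sup>2) summable_on UNIV" by (rule b1_summable[OF b]) simp
  have "\<forall>\<^sub>F n in sequentially. tl_sum (\<lambda>k. (cmod (d k))\<^sup>2) n < e\<^sup>2"
    using tl_sum_tendsto[OF s] e by (intro order_tendstoD) auto
  then obtain n where n: "tl_sum (\<lambda>k. (cmod (d k))\<^sup>2) n < e\<^sup>2" by (auto simp: eventually_sequentially)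
  have "hb 0 (\<lambda>k. d k - cut n d k) e" unfolding hb0
  proof (rule b2_I)
    fix F :: "int set" assume F: "finite F"
    have "(\<Sum>k\<in>F. (cmod (d k - cut n d k))\<^sup>2) = (\<Sum>k\<in>F - seg n. (cmod (d k))\<^sup>2)"
      using F by (intro sum.mono_neutral_cong_right) (auto simp: cut_def)
    also have "\<dots> = (\<Sum>k\<in>F \<union> seg n. (cmod (d k))\<^sup>2) - (\<Sum>k\<in>seg n. (cmod (d k))\<^sup>2)"
      using F sum.union_disjoint[of "F - seg n" "seg n" "\<lambda>k. (cmod (d k))\<^sup>2"] by (simp add: Un_Diff_cancel2 Int_commute)
    also have "(\<Sum>k\<in>F \<union> seg n. (cmod (d k))\<^sup>2) \<le> (\<Sum>\<^sub>\<infinity>k. (cmod (d k))\<^sup>2)"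
      by (rule finite_sum_le_infsum[OF s]) (use F in auto)
    finally show "(\<Sum>k\<in>F. (cmod (d k - cut n d k))\<^sup>2) \<le> e\<^sup>2" using n by (simp add: tl_sum_def)
  qed (use e in simp)
  thus ?thesis by blast
qed

text \<open>Monotone convergence: the integral of the sum of the moduli is finite, hence that sum is
  finite almost everywhere.\<close>

lemma AE_summable_L1:
  fixes h :: "nat \<Rightarrow> real \<Rightarrow> complex"
  assumes i: "\<And>j. integrable M (h j)" and s: "summable (\<lambda>j. integral\<^sup>L M (\<lambda>x. cmod (h j x)))"
  shows "AE x in M. summable (\<lambda>j. cmod (h j x))"
proof -
  have [measurable]: "h j \<in> borel_measurable M" for j using i by simp
  have "(\<integral>\<^sup>+x. (\<Sum>j. ennreal (cmod (h j x))) \<partial>M) = (\<Sum>j. \<integral>\<^sup>+x. ennreal (cmod (h j x)) \<partial>M)"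
    by (rule nn_integral_suminf) measurable
  also have "\<dots> = (\<Sum>j. ennreal (integral\<^sup>L M (\<lambda>x. cmod (h j x))))"
    using i by (intro suminf_cong nn_integral_eq_integral) auto
  also have "\<dots> \<noteq> \<infinity>"
    unfolding infinity_ennreal_def by (rule ennreal_suminf_neq_top[OF s]) simp
  finally have "AE x in M. (\<Sum>j. ennreal (cmod (h j x))) \<noteq> \<infinity>"
    by (rule nn_integral_PInf_AE[rotated]) measurable
  thus ?thesis
  proof (rule eventually_mono)
    fix x assume "(\<Sum>j. ennreal (cmod (h j x))) \<noteq> \<infinity>"
    thus "summable (\<lambda>j. cmod (h j x))" by (intro summable_suminf_not_top) simp_all
  qed
qed

text \<open>Partial sums are taken along a sequence with tails at most \<open>(1/2)^j\<close>. Their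
  increments are then summable in L^1, so they converge almost everywhere to some \<open>g\<close>.
  Fatou's lemma bounds its L^2 norm, and summability in L^1 gives its coefficients.\<close>

lemma riesz_fischer:
  assumes d: "hb 0 d D"
  shows "\<exists>g\<in>L2_torus. (\<forall>k. fourier_coeff g k = d k) \<and> L2_norm g \<le> sqrt (2 * pi) * D"
proof -
  have D0: "0 \<le> D" by (rule hb_nonneg[OF d])
  define \<epsilon> where "\<epsilon> j = (1 / 2 :: real) ^ j" for j :: nat
  have "\<exists>n. \<forall>j. hb 0 (\<lambda>k. d k - cut (n j) d k) (\<epsilon> j)"
    by (intro choice allI hb0_tail_small[OF d]) (simp add: \<epsilon>_def)
  then obtain n where n: "\<And>j. hb 0 (\<lambda>k. d k - cut (n j) d k) (\<epsilon> j)" by blast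
  define S where "S j = ser (cut (n j) d)" for j
  define q where "q j k = cut (n (Suc j)) d k - cut (n j) d k" for j k
  define h where "h j x = S (Suc j) x - S j x" for j x
  have ac: "\<exists>A. a1 (cut m d) A" for m by (rule cut_a1)
  have hq: "h j = ser (q j)" for j
  proof
    fix x
    obtain A B where AB: "a1 (cut (n j) d) A" "a1 (cut (n (Suc j)) d) B" using ac by blast
    have s: "(\<lambda>k. cut (n j) d k * cis (of_int k * x)) summable_on UNIV" "(\<lambda>k. cut (n (Suc j)) d k * cis (of_int k * x)) summable_on UNIV"
      by (rule dominated_summable(2)[OF a1_summable[OF AB(1)]], simp add: norm_mult)
         (rule dominated_summable(2)[OF a1_summable[OF AB(2)]], simp add: norm_mult)
    have "ser (q j) x = (\<Sum>\<^sub>\<infinity>k. cut (n (Suc j)) d k * cis (of_int k * x) + - (cut (n j) d k * cis (of_int k * x)))"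
      unfolding ser_def q_def by (simp add: algebra_simps)
    also have "\<dots> = (\<Sum>\<^sub>\<infinity>k. cut (n (Suc j)) d k * cis (of_int k * x)) + (\<Sum>\<^sub>\<infinity>k. - (cut (n j) d k * cis (of_int k * x)))"
      by (rule infsum_add[OF s(2) summable_on_uminus[THEN iffD2, OF s(1)]])
    finally show "h j x = ser (q j) x" by (simp add: infsum_uminus h_def S_def ser_def)
  qed
  have qa: "\<exists>A. a1 (q j) A" for j
    by (rule finite_support_a1[of "n j + n (Suc j)"]) (auto simp: q_def cut_def seg_def)
  have qh: "hb 0 (q j) (2 * \<epsilon> j)" for j
  proof -
    have "hb 0 (\<lambda>k. (d k - cut (n j) d k) - (d k - cut (n (Suc j)) d k)) (\<epsilon> j + \<epsilon> (Suc j))"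
      by (rule hb_diff[OF n n])
    moreover have "(\<lambda>k. (d k - cut (n j) d k) - (d k - cut (n (Suc j)) d k)) = q j" by (simp add: q_def fun_eq_iff)
    ultimately have "hb 0 (q j) (\<epsilon> j + \<epsilon> (Suc j))" by simp
    thus ?thesis by (rule hb_mono) (simp_all add: \<epsilon>_def)
  qed
  have hi: "integrable MT (h j)" for j unfolding hq using qa ser_MT(1) by blast
  have Si: "integrable MT (S j)" for j unfolding S_def using ac ser_MT(1) by blast
  \<comment> \<open>In place of Cauchy-Schwarz, |h| is at most e/2 + |h|^2 / (2 e) with e standing
    for \<open>\<epsilon> j\<close>. The two parts contribute \<open>pi * e\<close> and
    \<open>4 * pi * e\<close>.\<close>
  have h1: "integral\<^sup>L MT (\<lambda>x. cmod (h j x)) \<le> 5 * pi * \<epsilon> j" for j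
  proof -
    obtain A where A: "a1 (q j) A" using qa by blast
    have e0: "0 < \<epsilon> j" by (simp add: \<epsilon>_def)
    have "integral\<^sup>L MT (\<lambda>x. cmod (h j x)) \<le> integral\<^sup>L MT (\<lambda>x. \<epsilon> j / 2 + (cmod (h j x))\<^sup>2 / (2 * \<epsilon> j))"
    proof (rule integral_mono)
      show "integrable MT (\<lambda>x. cmod (h j x))" using hi by simp
      show "integrable MT (\<lambda>x. \<epsilon> j / 2 + (cmod (h j x))\<^sup>2 / (2 * \<epsilon> j))"
        using ser_L2_bound(2)[OF A qh] finite_measure.integrable_const[OF finite_MT]
        unfolding hq by (intro Bochner_Integration.integrable_add integrable_divide_zero) auto
      fix x
      have "0 \<le> (\<epsilon> j - cmod (h j x))\<^sup>2" by simp
      hence "2 * \<epsilon> j * cmod (h j x) \<le> \<epsilon> j * \<epsilon> j + (cmod (h j x))\<^sup>2" by (simp add: power2_eq_square algebra_simps)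
      thus "cmod (h j x) \<le> \<epsilon> j / 2 + (cmod (h j x))\<^sup>2 / (2 * \<epsilon> j)" using e0 by (simp add: field_simps)
    qed
    also have "\<dots> = \<epsilon> j / 2 * (2 * pi) + integral\<^sup>L MT (\<lambda>x. (cmod (h j x))\<^sup>2) / (2 * \<epsilon> j)"
      using ser_L2_bound(2)[OF A qh] finite_measure.integrable_const[OF finite_MT] measure_MT
      unfolding hq by (subst Bochner_Integration.integral_add) auto
    also have "\<dots> \<le> \<epsilon> j / 2 * (2 * pi) + 2 * pi * (2 * \<epsilon> j)\<^sup>2 / (2 * \<epsilon> j)"
      using ser_L2_bound(1)[OF A qh] e0 unfolding hq by (intro add_left_mono divide_right_mono) auto
    also have "\<dots> = 5 * pi * \<epsilon> j" using e0 by (simp add: power2_eq_square field_simps)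
    finally show ?thesis .
  qed
  have hs: "summable (\<lambda>j. integral\<^sup>L MT (\<lambda>x. cmod (h j x)))"
  proof (rule summable_comparison_test')
    show "summable (\<lambda>j. 5 * pi * \<epsilon> j)" unfolding \<epsilon>_def by (intro summable_mult summable_geometric) simp
    show "norm (integral\<^sup>L MT (\<lambda>x. cmod (h j x))) \<le> 5 * pi * \<epsilon> j" for j using h1[of j] by simp
  qed
  have ae: "AE x in MT. summable (\<lambda>j. cmod (h j x))" by (rule AE_summable_L1[OF hi hs])
  \<comment> \<open>Where the series diverges its value is some default, but one determined by the
    terms; the terms are periodic, so \<open>g\<close> is periodic at every point.\<close>
  define g where "g x = S 0 x + (\<Sum>j. h j x)" for x
  have Sper: "S j (x + 2 * pi) = S j x" for j x by (simp add: S_def ser_periodic)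
  have Sm: "S j \<in> borel_measurable lebesgue" for j
    unfolding S_def using ac ser_continuous continuous_lebesgue_measurable by blast
  have hm: "h j \<in> borel_measurable lebesgue" for j
    unfolding h_def[abs_def] by (intro borel_measurable_diff Sm)
  have gm: "g \<in> borel_measurable lebesgue"
    unfolding g_def[abs_def] by (intro borel_measurable_add Sm borel_measurable_suminf hm)
  have gp: "periodic g" by (simp add: periodic_def g_def h_def Sper)
  have SJ: "S J x = S 0 x + (\<Sum>j<J. h j x)" for J x
    by (induction J) (simp_all add: h_def)
  have gl: "AE x in MT. (\<lambda>J. S J x) \<longlonglongrightarrow> g x"
    using ae
  proof (rule eventually_mono)
    fix x assume "summable (\<lambda>j. cmod (h j x))"
    hence "summable (\<lambda>j. h j x)" by (rule summable_norm_cancel)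
    from tendsto_add[OF tendsto_const summable_LIMSEQ[OF this], of "S 0 x"]
    show "(\<lambda>J. S J x) \<longlonglongrightarrow> g x" unfolding g_def SJ[symmetric] .
  qed
  have Sa: "\<exists>A. a1 (cut (n J) d) A \<and> hb 0 (cut (n J) d) D" for J
    using ac[of "n J"] d unfolding hb0 by (auto simp: cut_def elim!: b2_mono)
  have S2: "(\<integral>\<^sup>+x. ennreal ((cmod (S J x))\<^sup>2) \<partial>MT) \<le> ennreal (2 * pi * D\<^sup>2)" for J
  proof -
    obtain A where A: "a1 (cut (n J) d) A" "hb 0 (cut (n J) d) D" using Sa by blast
    have "(\<integral>\<^sup>+x. ennreal ((cmod (S J x))\<^sup>2) \<partial>MT) = ennreal (integral\<^sup>L MT (\<lambda>x. (cmod (S J x))\<^sup>2))"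
      unfolding S_def by (rule nn_integral_eq_integral[OF ser_L2_bound(2)[OF A]]) simp
    thus ?thesis using ser_L2_bound(1)[OF A] unfolding S_def by (simp add: ennreal_leI)
  qed
  have g2: "(\<integral>\<^sup>+x. ennreal ((cmod (g x))\<^sup>2) \<partial>MT) \<le> ennreal (2 * pi * D\<^sup>2)"
  proof -
    have "(\<integral>\<^sup>+x. ennreal ((cmod (g x))\<^sup>2) \<partial>MT) = (\<integral>\<^sup>+x. liminf (\<lambda>J. ennreal ((cmod (S J x))\<^sup>2)) \<partial>MT)"
    proof (rule nn_integral_cong_AE)
      show "AE x in MT. ennreal ((cmod (g x))\<^sup>2) = liminf (\<lambda>J. ennreal ((cmod (S J x))\<^sup>2))"
        using gl
      proof (rule eventually_mono)
        fix x assume "(\<lambda>J. S J x) \<longlonglongrightarrow> g x"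
        hence "(\<lambda>J. ennreal ((cmod (S J x))\<^sup>2)) \<longlonglongrightarrow> ennreal ((cmod (g x))\<^sup>2)" by (intro tendsto_intros)
        thus "ennreal ((cmod (g x))\<^sup>2) = liminf (\<lambda>J. ennreal ((cmod (S J x))\<^sup>2))"
          by (rule lim_imp_Liminf[OF trivial_limit_sequentially, symmetric])
      qed
    qed
    also have "\<dots> \<le> liminf (\<lambda>J. \<integral>\<^sup>+x. ennreal ((cmod (S J x))\<^sup>2) \<partial>MT)"
      by (rule nn_integral_liminf) (use MT_measurable[OF Sm] in measurable)
    also have "\<dots> \<le> limsup (\<lambda>J. \<integral>\<^sup>+x. ennreal ((cmod (S J x))\<^sup>2) \<partial>MT)" by (rule Liminf_le_Limsup) simp
    also have "\<dots> \<le> ennreal (2 * pi * D\<^sup>2)" by (rule Limsup_bounded) (use S2 in auto)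
    finally show ?thesis .
  qed
  have gm': "(\<lambda>x. (cmod (g x))\<^sup>2) \<in> borel_measurable MT" using MT_measurable[OF gm] by measurable
  have gi: "integrable MT (\<lambda>x. (cmod (g x))\<^sup>2)"
    by (rule integrableI_bounded[OF gm']) (use g2 in \<open>auto simp: order_le_less_trans\<close>)
  have gL2: "g \<in> L2_torus" using gp gm gi by (simp add: L2_MT)
  have norm: "L2_norm g \<le> sqrt (2 * pi) * D"
  proof -
    have "ennreal (integral\<^sup>L MT (\<lambda>x. (cmod (g x))\<^sup>2)) \<le> ennreal (2 * pi * D\<^sup>2)"
      using g2 nn_integral_eq_integral[OF gi] by simp
    hence "integral\<^sup>L MT (\<lambda>x. (cmod (g x))\<^sup>2) \<le> 2 * pi * D\<^sup>2" by (simp add: ennreal_le_iff)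
    hence "L2_norm g \<le> sqrt (2 * pi * D\<^sup>2)" unfolding L2_norm_def set_lint_MT by (rule real_sqrt_le_mono)
    thus ?thesis using D0 by (simp add: real_sqrt_mult)
  qed
  have coeff: "fourier_coeff g k = d k" for k
  proof -
    define e where "e x = cis (of_int (- k) * x)" for x
    have he: "integrable MT (\<lambda>x. h j x * e x)" for j unfolding e_def by (rule MT_integrable_cis[OF hi])
    have ae': "AE x in MT. summable (\<lambda>j. norm (h j x * e x))" using ae by (simp add: norm_mult e_def)
    have hs': "summable (\<lambda>j. integral\<^sup>L MT (\<lambda>x. norm (h j x * e x)))" using hs by (simp add: norm_mult e_def)
    have sm: "(\<lambda>j. integral\<^sup>L MT (\<lambda>x. h j x * e x)) sums integral\<^sup>L MT (\<lambda>x. \<Sum>j. h j x * e x)"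
      by (rule sums_integral[OF he ae' hs'])
    have eq: "integral\<^sup>L MT (\<lambda>x. g x * e x) = integral\<^sup>L MT (\<lambda>x. S 0 x * e x) + integral\<^sup>L MT (\<lambda>x. \<Sum>j. h j x * e x)"
    proof -
      have "integral\<^sup>L MT (\<lambda>x. g x * e x) = integral\<^sup>L MT (\<lambda>x. S 0 x * e x + (\<Sum>j. h j x * e x))"
      proof (rule integral_cong_AE)
        have [measurable]: "e \<in> borel_measurable MT" unfolding e_def[abs_def]
          by (intro MT_measurable continuous_lebesgue_measurable cis_continuous)
        note [measurable] = MT_measurable[OF gm] MT_measurable[OF Sm] MT_measurable[OF hm]
        show "(\<lambda>x. g x * e x) \<in> borel_measurable MT" "(\<lambda>x. S 0 x * e x + (\<Sum>j. h j x * e x)) \<in> borel_measurable MT"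
          by measurable
        show "AE x in MT. g x * e x = S 0 x * e x + (\<Sum>j. h j x * e x)"
          using ae
        proof (rule eventually_mono)
          fix x assume "summable (\<lambda>j. cmod (h j x))"
          hence "summable (\<lambda>j. h j x)" by (rule summable_norm_cancel)
          from suminf_mult2[OF this, of "e x"]
          show "g x * e x = S 0 x * e x + (\<Sum>j. h j x * e x)" by (simp add: g_def distrib_right)
        qed
      qed
      also have "\<dots> = integral\<^sup>L MT (\<lambda>x. S 0 x * e x) + integral\<^sup>L MT (\<lambda>x. \<Sum>j. h j x * e x)"
      proof (rule Bochner_Integration.integral_add)
        show "integrable MT (\<lambda>x. S 0 x * e x)" unfolding e_def by (rule MT_integrable_cis[OF Si])
        show "integrable MT (\<lambda>x. \<Sum>j. h j x * e x)" by (rule integrable_suminf[OF he ae' hs'])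
      qed
      finally show ?thesis .
    qed
    have Sk: "integral\<^sup>L MT (\<lambda>x. S J x * e x) = 2 * of_real pi * cut (n J) d k" for J
      using fourier_coeff_integral[of "S J" "- k"] fourier_coeff_ser ac[of "n J"]
      unfolding e_def S_def by (metis minus_minus)
    have part: "(\<Sum>j<J. integral\<^sup>L MT (\<lambda>x. h j x * e x)) = 2 * of_real pi * cut (n J) d k - 2 * of_real pi * cut (n 0) d k" for J
    proof (induction J)
      case (Suc J)
      have "integral\<^sup>L MT (\<lambda>x. h J x * e x) = integral\<^sup>L MT (\<lambda>x. S (Suc J) x * e x) - integral\<^sup>L MT (\<lambda>x. S J x * e x)"
        unfolding h_def left_diff_distrib e_def
        by (rule Bochner_Integration.integral_diff; rule MT_integrable_cis[OF Si])
      thus ?case using Suc by (simp add: Sk)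
    qed simp
    have "(\<lambda>J. cut (n J) d k) \<longlonglongrightarrow> d k"
    proof -
      have "(\<lambda>J. d k - cut (n J) d k) \<longlonglongrightarrow> 0"
      proof (rule Lim_null_comparison)
        show "\<forall>\<^sub>F J in sequentially. norm (d k - cut (n J) d k) \<le> \<epsilon> J" using hb_pointwise0[OF n] by auto
        show "\<epsilon> \<longlonglongrightarrow> 0" unfolding \<epsilon>_def by (intro LIMSEQ_power_zero) simp
      qed
      from tendsto_diff[OF tendsto_const this, of "d k"] show ?thesis by simp
    qed
    hence "(\<lambda>J. \<Sum>j<J. integral\<^sup>L MT (\<lambda>x. h j x * e x)) \<longlonglongrightarrow> 2 * of_real pi * d k - 2 * of_real pi * cut (n 0) d k"
      unfolding part by (intro tendsto_intros)
    hence "integral\<^sup>L MT (\<lambda>x. \<Sum>j. h j x * e x) = 2 * of_real pi * d k - 2 * of_real pi * cut (n 0) d k"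
      using sm unfolding sums_def by (rule LIMSEQ_unique[rotated])
    hence "integral\<^sup>L MT (\<lambda>x. g x * e x) = 2 * of_real pi * d k" by (simp add: eq Sk)
    thus ?thesis by (simp add: fourier_coeff_MT e_def)
  qed
  show ?thesis using gL2 coeff norm by blast
qed

text \<open>\<open>riesz_fischer\<close> gives a function with the same coefficients and the wanted
  norm; by uniqueness of coefficients it is \<open>g\<close> almost everywhere.\<close>

lemma parseval_upper:
  assumes g: "g \<in> L2_torus" and d: "hb 0 (fourier_coeff g) D"
  shows "L2_norm g \<le> sqrt (2 * pi) * D"
proof -
  obtain f where f: "f \<in> L2_torus" "\<And>k. fourier_coeff f k = fourier_coeff g k" "L2_norm f \<le> sqrt (2 * pi) * D"
    using riesz_fischer[OF d] by blast
  have "AE x in lebesgue. f x = g x" by (rule L1_fourier_unique[OF L2_L1[OF f(1)] L2_L1[OF g] f(2)])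
  hence ae: "AE x in MT. f x = g x" by (rule AE_MT)
  have m: "f \<in> borel_measurable MT" "g \<in> borel_measurable MT"
    using f(1) g by (auto simp: L2_MT intro: MT_measurable)
  have "integral\<^sup>L MT (\<lambda>x. (cmod (f x))\<^sup>2) = integral\<^sup>L MT (\<lambda>x. (cmod (g x))\<^sup>2)"
  proof (rule integral_cong_AE)
    show "AE x in MT. (cmod (f x))\<^sup>2 = (cmod (g x))\<^sup>2" using ae by (rule eventually_mono) simp
  qed (use m in measurable)
  thus ?thesis using f(3) by (simp add: L2_norm_def set_lint_MT)
qed

section \<open>Sobolev norms as weighted bounds on Fourier coefficients\<close>

definition jw :: "real \<Rightarrow> int \<Rightarrow> real" where "jw s m = (1 + (of_int m)\<^sup>2) powr (s / 2)"

text \<open>The two weights are equivalent since 1 + m^2 is at most (1 + |m|)^2, which is at most 2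
  (1 + m^2). The factor \<open>2 powr (s / 2)\<close> reappears in every passage from Sobolev norms
  to \<open>hb\<close>.\<close>

lemma jw_bounds:
  assumes "0 \<le> s" shows "0 < jw s m" "jw s m \<le> wt s m" "wt s m \<le> 2 powr (s / 2) * jw s m"
proof -
  have b: "(br m)\<^sup>2 powr (s / 2) = wt s m"
    by (simp add: wt_def powr_powr flip: powr_numeral)
  have m: "0 < 1 + (real_of_int m)\<^sup>2" by (rule add_pos_nonneg) auto
  show "0 < jw s m" using m by (simp add: jw_def)
  have "1 + (real_of_int m)\<^sup>2 \<le> (br m)\<^sup>2" by (simp add: br_def power2_eq_square algebra_simps abs_mult_self_eq)
  thus "jw s m \<le> wt s m" unfolding b[symmetric] jw_def using assms m by (intro powr_mono2) auto
  have "(br m)\<^sup>2 \<le> 2 * (1 + (real_of_int m)\<^sup>2)"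
    using zero_le_power2[of "\<bar>real_of_int m\<bar> - 1"] by (simp add: br_def power2_eq_square algebra_simps abs_mult_self_eq)
  hence "wt s m \<le> (2 * (1 + (real_of_int m)\<^sup>2)) powr (s / 2)"
    unfolding b[symmetric] using assms by (intro powr_mono2) auto
  also have "\<dots> = 2 powr (s / 2) * (1 + (real_of_int m)\<^sup>2) powr (s / 2)" by (rule powr_mult)
  finally show "wt s m \<le> 2 powr (s / 2) * jw s m" by (simp only: jw_def)
qed

lemma is_bessel_potential_jw:
  "is_bessel_potential s f g \<longleftrightarrow> g \<in> L2_torus \<and> (\<forall>m. fourier_coeff g m = of_real (jw s m) * fourier_coeff f m)"
  by (simp add: is_bessel_potential_def jw_def)

text \<open>\<open>riesz_fischer\<close> provides some Bessel potential. The one selected by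
  \<open>bessel_potential\<close> may be another, but it has the same coefficients, and
  \<open>parseval_upper\<close> bounds its norm through these.\<close>

lemma sobolev_upper:
  assumes s: "0 \<le> s" and f: "f \<in> L2_torus" and D: "hb s (fourier_coeff f) D"
  shows "f \<in> sobolev s" "sobolev_norm s f \<le> sqrt (2 * pi) * D"
proof -
  have h: "hb 0 (\<lambda>m. of_real (jw s m) * fourier_coeff f m) D"
    using D unfolding hb_def
    by (rule b2_mono) (use jw_bounds[OF s] in \<open>auto simp: norm_mult abs_mult mult_right_mono less_imp_le abs_of_pos\<close>)
  have ex: "\<exists>g. is_bessel_potential s f g"
    using riesz_fischer[OF h] unfolding is_bessel_potential_jw by blast
  thus "f \<in> sobolev s" using f by (simp add: sobolev_def)
  have g: "is_bessel_potential s f (bessel_potential s f)"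
    unfolding bessel_potential_def by (rule someI_ex[OF ex])
  hence gk: "fourier_coeff (bessel_potential s f) = (\<lambda>m. of_real (jw s m) * fourier_coeff f m)"
    by (simp add: is_bessel_potential_jw fun_eq_iff)
  have "hb 0 (fourier_coeff (bessel_potential s f)) D" unfolding gk by (rule h)
  moreover have "bessel_potential s f \<in> L2_torus" using g by (simp add: is_bessel_potential_def)
  ultimately show "sobolev_norm s f \<le> sqrt (2 * pi) * D"
    unfolding sobolev_norm_def by (intro parseval_upper)
qed

lemma sobolev_lower:
  assumes s: "0 \<le> s" and f: "f \<in> sobolev s"
  shows "hb s (fourier_coeff f) (2 powr (s / 2) * (sobolev_norm s f / sqrt (2 * pi)))"
proof -
  have ex: "\<exists>g. is_bessel_potential s f g" using f by (simp add: sobolev_def)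
  have g: "is_bessel_potential s f (bessel_potential s f)"
    unfolding bessel_potential_def by (rule someI_ex[OF ex])
  define G where "G = fourier_coeff (bessel_potential s f)"
  have "hb 0 G (sobolev_norm s f / sqrt (2 * pi))"
    unfolding G_def sobolev_norm_def using g by (intro bessel_inequality) (auto simp: is_bessel_potential_def)
  hence "b2 (\<lambda>k. 2 powr (s / 2) * cmod (G k)) (2 powr (s / 2) * (sobolev_norm s f / sqrt (2 * pi)))"
    unfolding hb0 by (rule b2_cmult) simp
  thus ?thesis unfolding hb_def
  proof (rule b2_mono)
    fix k
    have "cmod (G k) = jw s k * cmod (fourier_coeff f k)"
      using g jw_bounds(1)[OF s, of k] by (simp add: G_def is_bessel_potential_jw norm_mult)
    moreover have "wt s k * cmod (fourier_coeff f k) \<le> 2 powr (s / 2) * jw s k * cmod (fourier_coeff f k)"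
      by (intro mult_right_mono jw_bounds s) auto
    ultimately show "\<bar>wt s k * cmod (fourier_coeff f k)\<bar> \<le> \<bar>2 powr (s / 2) * cmod (G k)\<bar>"
      using jw_bounds(1)[OF s, of k] by (simp add: abs_mult mult.assoc)
  qed simp
qed

section \<open>Strong solutions\<close>

text \<open>Equals \<open>2 * pi\<close> times the Fourier coefficient of \<open>\<phi>\<close> at
  \<open>- k\<close>, because the pairing is bilinear. Every distribution met below is a series of
  its coefficients against \<open>pk \<phi>\<close>.\<close>

definition pk :: "(real \<Rightarrow> complex) \<Rightarrow> int \<Rightarrow> complex" where
  "pk \<phi> k = pairing (\<lambda>x. cis (of_int k * x)) \<phi>"

lemma pairing_MT: "pairing f \<phi> = integral\<^sup>L MT (\<lambda>x. f x * \<phi> x)"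
  by (simp add: pairing_def set_lint_MT)

lemma integration_by_parts_periodic:
  fixes f g f' g' :: "real \<Rightarrow> complex"
  assumes f: "\<And>x. (f has_vector_derivative f' x) (at x)" and g: "\<And>x. (g has_vector_derivative g' x) (at x)"
    and c: "continuous_on UNIV f'" "continuous_on UNIV g'" and p: "periodic f" "periodic g"
  shows "integral\<^sup>L MT (\<lambda>x. f x * g' x) = - integral\<^sup>L MT (\<lambda>x. f' x * g x)"
proof -
  have cf: "continuous_on UNIV f" "continuous_on UNIV g"
    using f g by (auto intro!: continuous_at_imp_continuous_on has_vector_derivative_continuous)
  have per: "f (2 * pi) = f 0" "g (2 * pi) = g 0" using p unfolding periodic_def by (metis add_0)+
  have "((\<lambda>x. f x * g' x + f' x * g x) has_integral (f (2 * pi) * g (2 * pi) - f 0 * g 0)) {0..2 * pi}"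
    by (rule fundamental_theorem_of_calculus)
       (auto intro!: has_vector_derivative_at_within[OF has_vector_derivative_mult[OF f g]])
  hence 0: "integral {0..2 * pi} (\<lambda>x. f x * g' x + f' x * g x) = 0" by (simp add: per integral_unique)
  have i1: "integrable MT (\<lambda>x. f x * g' x)" and i2: "integrable MT (\<lambda>x. f' x * g x)"
    by (intro continuous_MT continuous_intros c cf)+
  have "integral\<^sup>L MT (\<lambda>x. f x * g' x + f' x * g x) = 0"
    using continuous_MT(2)[of "\<lambda>x. f x * g' x + f' x * g x"] 0 c cf by (simp add: continuous_intros)
  thus ?thesis using Bochner_Integration.integral_add[OF i1 i2] by (simp add: eq_neg_iff_add_eq_0)
qed

lemma test_function_derivatives:
  assumes "test_function \<phi>"
  obtains D where "D 0 = \<phi>" "\<And>n x. (D n has_vector_derivative D (Suc n) x) (at x)"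
    "\<And>n. continuous_on UNIV (D n)" "\<And>n. periodic (D n)"
proof -
  obtain D where D: "D 0 = \<phi>" "\<And>n x. (D n has_vector_derivative D (Suc n) x) (at x)"
    using assms unfolding test_function_def by blast
  have "continuous_on UNIV (D n)" for n
    using D(2) by (auto intro!: continuous_at_imp_continuous_on has_vector_derivative_continuous)
  moreover have "periodic (D n)" for n
  proof (induction n)
    case 0 show ?case using assms D(1) by (simp add: test_function_def)
  next
    case (Suc n)
    have "D (Suc n) (x + 2 * pi) = D (Suc n) x" for x
    proof -
      have 1: "((\<lambda>x. x + 2 * pi) has_vector_derivative 1) (at x within UNIV)"
        by (auto intro!: derivative_eq_intros simp: has_real_derivative_iff_has_vector_derivative[symmetric])
      have "(D n has_vector_derivative D (Suc n) (x + 2 * pi)) (at (x + 2 * pi) within (\<lambda>x. x + 2 * pi) ` UNIV)"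
        by (rule has_vector_derivative_at_within[OF D(2)])
      from vector_diff_chain_within[OF 1 this]
      have "((\<lambda>x. D n (x + 2 * pi)) has_vector_derivative D (Suc n) (x + 2 * pi)) (at x)" by (simp add: o_def)
      moreover have "(\<lambda>x. D n (x + 2 * pi)) = D n" using Suc by (auto simp: periodic_def)
      ultimately show ?thesis using D(2)[of n x] by (metis vector_derivative_at)
    qed
    thus ?case by (simp add: periodic_def)
  qed
  ultimately show ?thesis using that D by blast
qed

lemma continuous_periodic_integral_bound:
  fixes h :: "real \<Rightarrow> complex"
  assumes "continuous_on UNIV h"
  obtains B where "0 \<le> B" "\<And>x. x \<in> {0..2 * pi} \<Longrightarrow> cmod (h x) \<le> B"
proof -
  have "bounded (h ` {0..2 * pi})"
    by (intro compact_imp_bounded compact_continuous_image continuous_on_subset[OF assms]) auto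
  then obtain B where "\<forall>y\<in>h ` {0..2 * pi}. norm y \<le> B" unfolding bounded_iff by auto
  hence B: "\<And>x. x \<in> {0..2 * pi} \<Longrightarrow> cmod (h x) \<le> B" by auto
  have "0 \<le> B" using B[of 0] by (simp add: order_trans[OF norm_ge_zero])
  thus ?thesis using B that by blast
qed

lemma MT_integral_norm_le:
  fixes h :: "real \<Rightarrow> complex"
  assumes "integrable MT h" "\<And>x. x \<in> {0..2 * pi} \<Longrightarrow> cmod (h x) \<le> B"
  shows "cmod (integral\<^sup>L MT h) \<le> 2 * pi * B"
proof -
  have "cmod (integral\<^sup>L MT h) \<le> integral\<^sup>L MT (\<lambda>x. cmod (h x))" by (rule integral_norm_bound)
  also have "\<dots> \<le> integral\<^sup>L MT (\<lambda>x. B)"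
    by (rule integral_mono) (use assms finite_measure.integrable_const[OF finite_MT] in auto)
  also have "\<dots> = 2 * pi * B" using measure_MT by simp
  finally show ?thesis .
qed

lemma cis_periodic: "periodic (\<lambda>x. cis (of_int k * x))"
  unfolding periodic_def using cis_period by blast

lemma pk_derivative:
  assumes f: "\<And>x. (f has_vector_derivative f' x) (at x)" and c: "continuous_on UNIV f'" and p: "periodic f"
  shows "pk f' k = - (\<i> * of_int k) * pk f k"
proof -
  have d: "((\<lambda>x. cis (of_int k * x)) has_vector_derivative \<i> * of_int k * cis (of_int k * x)) (at x)" for x
    using cis_deriv[of "of_int k" x UNIV] by simp
  have "pk f' k = - integral\<^sup>L MT (\<lambda>x. (\<i> * of_int k * cis (of_int k * x)) * f x)"
    unfolding pk_def pairing_MT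
    by (rule integration_by_parts_periodic[OF d f]) (intro continuous_intros c cis_periodic p)+
  also have "\<dots> = - (\<i> * of_int k) * pk f k"
    unfolding pk_def pairing_MT by (simp add: mult.assoc)
  finally show ?thesis .
qed

text \<open>Two integrations by parts give decay like 1/k^2, which is already summable against
  bounded coefficients.\<close>

lemma pk_decay:
  assumes "test_function \<phi>" shows "\<exists>C\<ge>0. \<forall>k. cmod (pk \<phi> k) \<le> C * (inverse (br k))\<^sup>2"
proof -
  obtain D where D: "D 0 = \<phi>" "\<And>n x. (D n has_vector_derivative D (Suc n) x) (at x)"
    "\<And>n. continuous_on UNIV (D n)" "\<And>n. periodic (D n)" using test_function_derivatives[OF assms] by blast
  obtain B0 where B0: "0 \<le> B0" "\<And>x. x \<in> {0..2 * pi} \<Longrightarrow> cmod (D 0 x) \<le> B0"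
    using continuous_periodic_integral_bound[OF D(3)] by blast
  obtain B2 where B2: "0 \<le> B2" "\<And>x. x \<in> {0..2 * pi} \<Longrightarrow> cmod (D 2 x) \<le> B2"
    using continuous_periodic_integral_bound[OF D(3)] by blast
  have i: "integrable MT (\<lambda>x. cis (of_int k * x) * D n x)" for n k
    by (intro continuous_MT(1) continuous_intros D)
  have k0: "cmod (pk (D 0) k) \<le> 2 * pi * B0" for k
    unfolding pk_def pairing_MT by (rule MT_integral_norm_le[OF i]) (simp add: norm_mult B0)
  have k2: "cmod (pk (D 2) k) \<le> 2 * pi * B2" for k
    unfolding pk_def pairing_MT by (rule MT_integral_norm_le[OF i]) (simp add: norm_mult B2)
  have "pk (D 2) k = - (\<i> * of_int k) * (- (\<i> * of_int k) * pk (D 0) k)" for k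
    using pk_derivative[of "D 1" "D 2" k] pk_derivative[of "D 0" "D 1" k] D(2)[of 0] D(2)[of 1] D(3,4)
    by (simp add: numeral_2_eq_2)
  hence sq: "cmod (pk (D 2) k) = \<bar>real_of_int k\<bar>\<^sup>2 * cmod (pk (D 0) k)" for k
    by (simp add: norm_mult power2_eq_square)
  have "cmod (pk \<phi> k) \<le> (2 * (2 * pi * B0 + 2 * pi * B2)) * (inverse (br k))\<^sup>2" for k
  proof -
    have "(br k)\<^sup>2 \<le> 2 * (1 + \<bar>real_of_int k\<bar>\<^sup>2)"
      using zero_le_power2[of "\<bar>real_of_int k\<bar> - 1"] by (simp add: br_def power2_eq_square algebra_simps)
    hence "(br k)\<^sup>2 * cmod (pk \<phi> k) \<le> 2 * (1 + \<bar>real_of_int k\<bar>\<^sup>2) * cmod (pk \<phi> k)" by (intro mult_right_mono) auto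
    also have "\<dots> = 2 * (cmod (pk (D 0) k) + cmod (pk (D 2) k))" by (simp only: sq D(1)) (simp add: algebra_simps)
    also have "\<dots> \<le> 2 * (2 * pi * B0 + 2 * pi * B2)" using k0[of k] k2[of k] by (intro mult_left_mono add_mono) auto
    finally have "(inverse (br k))\<^sup>2 * ((br k)\<^sup>2 * cmod (pk \<phi> k)) \<le> (inverse (br k))\<^sup>2 * (2 * (2 * pi * B0 + 2 * pi * B2))"
      by (intro mult_left_mono) auto
    also have "(inverse (br k))\<^sup>2 * ((br k)\<^sup>2 * cmod (pk \<phi> k)) = (inverse (br k) * br k)\<^sup>2 * cmod (pk \<phi> k)"
      by (simp only: power_mult_distrib mult_ac)
    finally show ?thesis by (simp add: mult.commute)
  qed
  thus ?thesis using B0(1) B2(1) by (intro exI[of _ "2 * (2 * pi * B0 + 2 * pi * B2)"]) auto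
qed

lemma pairing_ser:
  assumes c: "a1 c A" and \<phi>: "continuous_on UNIV \<phi>" and s: "(\<lambda>k. c k * pk \<phi> k) summable_on UNIV"
  shows "pairing (ser c) \<phi> = (\<Sum>\<^sub>\<infinity>k. c k * pk \<phi> k)"
proof -
  obtain B where B: "0 \<le> B" "\<And>x. x \<in> {0..2 * pi} \<Longrightarrow> cmod (\<phi> x) \<le> B"
    using continuous_periodic_integral_bound[OF \<phi>] by blast
  define M where "M k = cmod (c k)" for k
  have M: "M summable_on UNIV" unfolding M_def by (rule a1_summable[OF c])
  have i1: "integrable MT (\<lambda>x. ser c x * \<phi> x)" by (intro continuous_MT(1) continuous_intros ser_continuous[OF c] \<phi>)
  have i2: "integrable MT (\<lambda>x. c k * (cis (of_int k * x) * \<phi> x))" for k by (intro continuous_MT(1) continuous_intros \<phi>)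
  have i3: "integrable MT (\<lambda>x. \<Sum>k\<in>seg n. c k * (cis (of_int k * x) * \<phi> x))" for n
    by (rule Bochner_Integration.integrable_sum[OF i2])
  have le: "cmod (pairing (ser c) \<phi> - (\<Sum>k\<in>seg n. c k * pk \<phi> k)) \<le> 2 * pi * (tl_sum M n * B)" for n
  proof -
    have "(\<Sum>k\<in>seg n. c k * pk \<phi> k) = integral\<^sup>L MT (\<lambda>x. \<Sum>k\<in>seg n. c k * (cis (of_int k * x) * \<phi> x))"
      unfolding pk_def pairing_MT by (subst Bochner_Integration.integral_sum[OF i2]) simp
    hence "pairing (ser c) \<phi> - (\<Sum>k\<in>seg n. c k * pk \<phi> k) =
       integral\<^sup>L MT (\<lambda>x. ser c x * \<phi> x - (\<Sum>k\<in>seg n. c k * (cis (of_int k * x) * \<phi> x)))"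
      unfolding pairing_MT by (simp only: Bochner_Integration.integral_diff[OF i1 i3])
    also have "cmod \<dots> \<le> 2 * pi * (tl_sum M n * B)"
    proof (rule MT_integral_norm_le)
      show "integrable MT (\<lambda>x. ser c x * \<phi> x - (\<Sum>k\<in>seg n. c k * (cis (of_int k * x) * \<phi> x)))"
        by (rule Bochner_Integration.integrable_diff[OF i1 i3])
      fix x :: real assume x: "x \<in> {0..2 * pi}"
      have "ser c x * \<phi> x - (\<Sum>k\<in>seg n. c k * (cis (of_int k * x) * \<phi> x)) =
        (ser c x - (\<Sum>k\<in>seg n. c k * cis (of_int k * x))) * \<phi> x"
        by (simp add: left_diff_distrib sum_distrib_right mult.assoc)
      moreover have "cmod (ser c x - (\<Sum>k\<in>seg n. c k * cis (of_int k * x))) \<le> tl_sum M n"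
        unfolding ser_def by (rule dominated_tail[OF M]) (simp add: M_def norm_mult)
      ultimately show "cmod (ser c x * \<phi> x - (\<Sum>k\<in>seg n. c k * (cis (of_int k * x) * \<phi> x))) \<le> tl_sum M n * B"
        using B(2)[OF x] B(1) by (simp add: norm_mult mult_mono')
    qed
    finally show ?thesis .
  qed
  have "(\<lambda>n. pairing (ser c) \<phi> - (\<Sum>k\<in>seg n. c k * pk \<phi> k)) \<longlonglongrightarrow> 0"
  proof (rule Lim_null_comparison)
    show "\<forall>\<^sub>F n in sequentially. norm (pairing (ser c) \<phi> - (\<Sum>k\<in>seg n. c k * pk \<phi> k)) \<le> 2 * pi * (tl_sum M n * B)"
      using le by simp
    have "(\<lambda>n. 2 * pi * (tl_sum M n * B)) \<longlonglongrightarrow> 2 * pi * (0 * B)" by (intro tendsto_intros tl_sum_tendsto M)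
    thus "(\<lambda>n. 2 * pi * (tl_sum M n * B)) \<longlonglongrightarrow> 0" by simp
  qed
  moreover have "(\<lambda>n. pairing (ser c) \<phi> - (\<Sum>k\<in>seg n. c k * pk \<phi> k)) \<longlonglongrightarrow> pairing (ser c) \<phi> - (\<Sum>\<^sub>\<infinity>k. c k * pk \<phi> k)"
    by (intro tendsto_intros infsum_seg_limit s)
  ultimately show ?thesis using LIMSEQ_unique by fastforce
qed

lemma airy_propagator_pk:
  "airy_propagator t g \<phi> = (\<Sum>\<^sub>\<infinity>k. fourier_coeff g k * cis (t * of_int k ^ 3) * pk \<phi> k)"
proof -
  have "pairing (\<lambda>x. fourier_coeff g k * exp (\<i> * complex_of_real (of_int k * x + t * of_int k ^ 3))) \<phi> =
      fourier_coeff g k * cis (t * of_int k ^ 3) * pk \<phi> k" for k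
  proof -
    have "fourier_coeff g k * exp (\<i> * complex_of_real (of_int k * x + t * of_int k ^ 3)) * \<phi> x =
       (fourier_coeff g k * cis (t * of_int k ^ 3)) * (cis (of_int k * x) * \<phi> x)" for x
      unfolding cis_conv_exp[symmetric] cis_mult[symmetric] by (simp only: mult_ac)
    thus ?thesis unfolding pairing_MT pk_def by (simp only: integral_mult_right_zero)
  qed
  thus ?thesis unfolding airy_propagator_def by simp
qed

lemma test_function_cis: "test_function (\<lambda>x. cis (of_int k * x))"
proof -
  define D where "D n x = (\<i> * of_int k) ^ n * cis (of_int k * x)" for n x
  have "(D n has_vector_derivative D (Suc n) x) (at x)" for n x
    using has_vector_derivative_mult_right[OF cis_deriv[of "of_int k" x UNIV], of "(\<i> * of_int k) ^ n"]
    unfolding D_def by (simp add: mult_ac)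
  moreover have "D 0 = (\<lambda>x. cis (of_int k * x))" by (simp add: D_def fun_eq_iff)
  ultimately show ?thesis unfolding test_function_def using cis_periodic by blast
qed

lemma pairing_cis: "pairing f (\<lambda>x. cis (of_int k * x)) = 2 * of_real pi * fourier_coeff f (- k)"
  unfolding pairing_MT by (rule fourier_coeff_integral)

lemma pk_cis: "pk (\<lambda>x. cis (of_int (- k) * x)) j = (if j = k then 2 * of_real pi else 0)"
proof -
  have e: "ser (\<lambda>i. if i = j then 1 else 0) x = cis (of_int j * x)" for x
  proof -
    have "ser (\<lambda>i. if i = j then 1 else 0) x = (\<Sum>\<^sub>\<infinity>i\<in>{j}. cis (of_int j * x))"
      unfolding ser_def by (rule infsum_cong_neutral) auto
    thus ?thesis by simp
  qed
  obtain A where A: "a1 (\<lambda>i. if i = j then 1 else 0) A"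
    using finite_support_a1[of "nat \<bar>j\<bar>" "\<lambda>i. if i = j then 1 else 0"] by (force simp: seg_def)
  have "pk (\<lambda>x. cis (of_int (- k) * x)) j = 2 * of_real pi * fourier_coeff (ser (\<lambda>i. if i = j then 1 else 0)) k"
    unfolding pk_def e[symmetric] pairing_cis by simp
  thus ?thesis unfolding fourier_coeff_ser[OF A] by simp
qed

lemma infsum_single:
  fixes f :: "int \<Rightarrow> complex"
  shows "(\<Sum>\<^sub>\<infinity>j. f j * (if j = k then z else 0)) = f k * z"
proof -
  have "(\<Sum>\<^sub>\<infinity>j. f j * (if j = k then z else 0)) = (\<Sum>\<^sub>\<infinity>j\<in>{k}. f j * z)"
    by (rule infsum_cong_neutral) auto
  thus ?thesis by simp
qed

lemma airy_propagator_mode: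
  "airy_propagator t g (\<lambda>x. cis (of_int (- k) * x)) = 2 * of_real pi * (fourier_coeff g k * cis (t * of_int k ^ 3))"
  unfolding airy_propagator_pk pk_cis infsum_single by simp

lemma pairing_cong_AE:
  assumes "f \<in> borel_measurable lebesgue" "g \<in> borel_measurable lebesgue" "AE x in lebesgue. f x = g x" "continuous_on UNIV \<phi>"
  shows "pairing f \<phi> = pairing g \<phi>"
  unfolding pairing_MT
proof (rule integral_cong_AE)
  note m = MT_measurable[OF continuous_lebesgue_measurable[OF assms(4)]]
  show "(\<lambda>x. f x * \<phi> x) \<in> borel_measurable MT" "(\<lambda>x. g x * \<phi> x) \<in> borel_measurable MT"
    by (intro borel_measurable_times MT_measurable[OF assms(1)] MT_measurable[OF assms(2)] m)+
  show "AE x in MT. f x * \<phi> x = g x * \<phi> x" using AE_MT[OF assms(3)] by (rule eventually_mono) simp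
qed

text \<open>\<open>weak_deriv\<close> is a choice among functions equal almost everywhere. The
  series of \<open>Dx c\<close> shows that a weak derivative exists; testing the chosen one against
  single modes determines its coefficients, hence its values almost everywhere.\<close>

lemma nonlinearity_coeff:
  assumes f: "f \<in> L2_torus" and K: "hb 2 (fourier_coeff f) K"
  shows "fourier_coeff (nonlinearity f) = nl (fourier_coeff f)"
proof -
  define c where "c = fourier_coeff f"
  have w: "w1 c (2 * K)" unfolding c_def by (rule hb_w1[OF K])
  note a = w1_a1[OF w] and aD = w1_Dx[OF w]
  have fm: "f \<in> borel_measurable lebesgue" using f by (simp add: L2_MT)
  have sm: "ser c \<in> borel_measurable lebesgue" "ser (Dx c) \<in> borel_measurable lebesgue"
    using ser_L1[OF a] ser_L1[OF aD] by (auto simp: L1_MT)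
  have fser: "AE x in lebesgue. f x = ser c x"
    by (rule L1_fourier_unique[OF L2_L1[OF f] ser_L1[OF a]]) (simp only: fourier_coeff_ser[OF a], simp only: c_def)
  have "is_weak_deriv f (ser (Dx c))"
    unfolding is_weak_deriv_def
  proof (intro conjI allI impI ser_L1[OF aD])
    fix \<phi> assume "test_function \<phi>"
    then obtain D where D: "D 0 = \<phi>" "\<And>n x. (D n has_vector_derivative D (Suc n) x) (at x)"
      "\<And>n. continuous_on UNIV (D n)" "\<And>n. periodic (D n)" using test_function_derivatives by blast
    have vd: "(\<lambda>x. vector_derivative \<phi> (at x)) = D 1"
      using D(2)[of 0] D(1) by (auto simp: vector_derivative_at)
    have "pairing f (D 1) = pairing (ser c) (D 1)" by (rule pairing_cong_AE[OF fm sm(1) fser D(3)])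
    also have "\<dots> = - pairing (ser (Dx c)) (D 0)"
      unfolding pairing_MT
      by (rule integration_by_parts_periodic)
         (use D(2)[of 0] D(3,4) ser_deriv[OF w] ser_continuous[OF aD] in \<open>auto simp: periodic_def ser_periodic\<close>)
    finally show "pairing f (\<lambda>x. vector_derivative \<phi> (at x)) = - pairing (ser (Dx c)) \<phi>" by (simp add: vd D(1))
  qed
  hence wd: "is_weak_deriv f (weak_deriv f)" unfolding weak_deriv_def by (rule someI[of "is_weak_deriv f"])
  hence g1: "weak_deriv f \<in> L1_torus" by (simp add: is_weak_deriv_def)
  have gk: "fourier_coeff (weak_deriv f) k = Dx c k" for k
  proof -
    define \<phi> where "\<phi> x = cis (of_int (- k) * x)" for x
    have "vector_derivative \<phi> (at x) = \<i> * of_int (- k) * \<phi> x" for x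
      unfolding \<phi>_def by (rule vector_derivative_at) (use cis_deriv[of "of_int (- k)" x UNIV] in simp)
    moreover have "test_function \<phi>" unfolding \<phi>_def[abs_def] by (rule test_function_cis)
    ultimately have "pairing f (\<lambda>x. \<i> * of_int (- k) * \<phi> x) = - pairing (weak_deriv f) \<phi>"
      using wd unfolding is_weak_deriv_def by (metis (no_types, lifting) ext)
    moreover have "pairing f (\<lambda>x. \<i> * of_int (- k) * \<phi> x) = \<i> * of_int (- k) * pairing f \<phi>"
      unfolding pairing_MT by (subst integral_mult_right_zero[symmetric]) (simp add: mult_ac)
    moreover have "pairing h \<phi> = 2 * of_real pi * fourier_coeff h k" for h
      using pairing_cis[of h "- k"] by (simp add: \<phi>_def[abs_def])
    ultimately show ?thesis by (simp add: Dx_def c_def)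
  qed
  have gser: "AE x in lebesgue. weak_deriv f x = ser (Dx c) x"
    by (rule L1_fourier_unique[OF g1 ser_L1[OF aD]]) (simp add: fourier_coeff_ser[OF aD] gk)
  have an: "a1 (nl c) ((2 * K) * (2 * K) * (2 * K))"
    unfolding nl_def by (rule a1_conv[OF w1_a1[OF w1_gg[OF w]] aD])
  have ae: "AE x in lebesgue. nonlinearity f x = ser (nl c) x"
    using fser gser
  proof eventually_elim
    case (elim x)
    thus ?case unfolding nonlinearity_def ser_nl[OF w] by (simp only: complex_norm_square)
  qed
  have nm: "nonlinearity f \<in> borel_measurable lebesgue"
    unfolding nonlinearity_def using fm g1 by (auto simp: L1_MT)
  show ?thesis
  proof
    fix k
    have "fourier_coeff (nonlinearity f) k = fourier_coeff (ser (nl c)) k"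
      by (rule fourier_coeff_cong_AE[OF nm _ AE_MT[OF ae]]) (use ser_L1[OF an] in \<open>simp add: L1_MT\<close>)
    thus "fourier_coeff (nonlinearity f) k = nl (fourier_coeff f) k"
      unfolding fourier_coeff_ser[OF an] unfolding c_def .
  qed
qed

lemma nl_continuous_at:
  assumes "open S" "t \<in> S" "\<And>r. r \<in> S \<Longrightarrow> hb 2 (c r) K"
    and c: "\<And>e. 0 < e \<Longrightarrow> \<forall>\<^sub>F r in at t. \<forall>k. cmod (c r k - c t k) \<le> e"
  shows "isCont (\<lambda>r. nl (c r) k) t"
proof -
  have "((\<lambda>r. nl (c r) k) \<longlongrightarrow> nl (c t) k) (at t)"
  proof (rule tendstoI)
    fix e :: real assume e: "0 < e"
    define L where "L = 3 * (2 * K)\<^sup>2 * br k + 1"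
    have L: "0 < L" by (simp add: L_def add_nonneg_pos)
    have "\<forall>\<^sub>F r in at t. r \<in> S" using assms(1,2) by (rule eventually_at_in_open')
    moreover have "\<forall>\<^sub>F r in at t. \<forall>k. cmod (c r k - c t k) \<le> e / (2 * L)" by (rule c) (use e L in simp)
    ultimately show "\<forall>\<^sub>F r in at t. dist (nl (c r) k) (nl (c t) k) < e"
    proof eventually_elim
      case (elim r)
      have "cmod (nl (c r) k - nl (c t) k) \<le> 3 * (2 * K)\<^sup>2 * br k * (e / (2 * L))"
        by (rule nl_diff_pointwise[OF hb_w1[OF assms(3)[OF elim(1)]] hb_w1[OF assms(3)[OF assms(2)]]]) (use elim in blast)
      also have "\<dots> \<le> L * (e / (2 * L))" using e L by (intro mult_right_mono) (auto simp: L_def)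
      also have "\<dots> < e" using e L by simp
      finally show ?case by (simp add: dist_norm)
    qed
  qed
  thus ?thesis by (simp add: isCont_def)
qed

lemma ser_diff:
  assumes "a1 c A" "a1 d B" shows "ser (\<lambda>k. c k - d k) x = ser c x - ser d x"
proof -
  have s: "(\<lambda>k. c k * cis (of_int k * x)) summable_on UNIV" if "a1 c A" for c A
    by (rule dominated_summable(2)[OF a1_summable[OF that]]) (simp add: norm_mult)
  have "ser (\<lambda>k. c k - d k) x = (\<Sum>\<^sub>\<infinity>k. c k * cis (of_int k * x) + - (d k * cis (of_int k * x)))"
    unfolding ser_def by (simp add: algebra_simps)
  also have "\<dots> = ser c x + - ser d x" unfolding ser_def infsum_uminus[symmetric]
    by (rule infsum_add[OF s[OF assms(1)] summable_on_uminus[THEN iffD2, OF s[OF assms(2)]]])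
  finally show ?thesis by simp
qed

lemma L2_torus_diff:
  assumes "f \<in> L2_torus" "g \<in> L2_torus" shows "(\<lambda>x. f x - g x) \<in> L2_torus"
proof -
  have f: "f \<in> borel_measurable lebesgue" "integrable MT (\<lambda>x. (cmod (f x))\<^sup>2)" "periodic f"
    and g: "g \<in> borel_measurable lebesgue" "integrable MT (\<lambda>x. (cmod (g x))\<^sup>2)" "periodic g"
    using assms by (auto simp: L2_MT)
  have m: "(\<lambda>x. f x - g x) \<in> borel_measurable lebesgue" by (rule borel_measurable_diff[OF f(1) g(1)])
  have "integrable MT (\<lambda>x. (cmod (f x - g x))\<^sup>2)"
  proof (rule Bochner_Integration.integrable_bound)
    show "integrable MT (\<lambda>x. 2 * (cmod (f x))\<^sup>2 + 2 * (cmod (g x))\<^sup>2)"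
      by (intro Bochner_Integration.integrable_add integrable_mult_right f(2) g(2))
    show "(\<lambda>x. (cmod (f x - g x))\<^sup>2) \<in> borel_measurable MT" using MT_measurable[OF m] by measurable
    have "(cmod (f x - g x))\<^sup>2 \<le> 2 * (cmod (f x))\<^sup>2 + 2 * (cmod (g x))\<^sup>2" for x
    proof -
      have "(cmod (f x - g x))\<^sup>2 \<le> (cmod (f x) + cmod (g x))\<^sup>2" by (intro power_mono norm_triangle_ineq4) auto
      also have "\<dots> \<le> 2 * (cmod (f x))\<^sup>2 + 2 * (cmod (g x))\<^sup>2"
        using zero_le_power2[of "cmod (f x) - cmod (g x)"] unfolding power2_sum power2_diff by linarith
      finally show ?thesis .
    qed
    thus "AE x in MT. norm ((cmod (f x - g x))\<^sup>2) \<le> norm (2 * (cmod (f x))\<^sup>2 + 2 * (cmod (g x))\<^sup>2)"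
      by (intro always_eventually allI) simp
  qed
  thus ?thesis using m f(3) g(3) by (simp add: L2_MT periodic_def)
qed

lemma hb_a1: "hb s c M \<Longrightarrow> 2 \<le> s \<Longrightarrow> a1 c (2 * M)"
  by (rule w1_a1[OF hb_w1[OF hb_mono[OF _ _ order_refl]]])

lemma sobolev_ser:
  assumes "2 \<le> s" "hb s c M"
  shows "ser c \<in> sobolev s" "sobolev_norm s (ser c) \<le> sqrt (2 * pi) * M"
proof -
  have a: "a1 c (2 * M)" by (rule hb_a1[OF assms(2,1)])
  have "fourier_coeff (ser c) = c" using fourier_coeff_ser[OF a] by (simp add: fun_eq_iff)
  hence h: "hb s (fourier_coeff (ser c)) M" using assms(2) by simp
  have s: "0 \<le> s" using assms(1) by simp
  show "ser c \<in> sobolev s" "sobolev_norm s (ser c) \<le> sqrt (2 * pi) * M"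
    by (rule sobolev_upper[OF s ser_L2[OF a] h])+
qed

lemma sobolev_norm_nonneg: "0 \<le> sobolev_norm s f"
  unfolding sobolev_norm_def L2_norm_def set_lint_MT by simp

text \<open>Replaces a bound by the norm itself, the supremum over finite sets.
  \<open>solution_continuous\<close> needs a bound that finite sums nearly attain.\<close>

lemma hb_sharp:
  assumes "hb s c M"
  obtains L where "hb s c L" "\<And>e. 0 < e \<Longrightarrow> \<exists>F. finite F \<and> L\<^sup>2 - e < (\<Sum>k\<in>F. (wt s k * cmod (c k))\<^sup>2)"
proof -
  define q where "q F = (\<Sum>k\<in>F. (wt s k * cmod (c k))\<^sup>2)" for F
  define L where "L = sqrt (SUP F\<in>Collect finite. q F)"
  have bdd: "bdd_above (q ` Collect finite)"
    using b2_sum[OF assms[unfolded hb_def]] by (intro bdd_aboveI[of _ "M\<^sup>2"]) (auto simp: q_def)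
  have le: "q F \<le> (SUP F\<in>Collect finite. q F)" if "finite F" for F
    by (rule cSUP_upper[OF _ bdd]) (use that in simp)
  have 0: "0 \<le> (SUP F\<in>Collect finite. q F)" using le[of "{}"] by (simp add: q_def)
  have L2: "L\<^sup>2 = (SUP F\<in>Collect finite. q F)" unfolding L_def using 0 by simp
  have "hb s c L" unfolding hb_def
  proof (rule b2_I)
    show "0 \<le> L" unfolding L_def using 0 by simp
    show "(\<Sum>k\<in>F. (wt s k * cmod (c k))\<^sup>2) \<le> L\<^sup>2" if "finite F" for F
      using le[OF that] unfolding L2 by (simp add: q_def)
  qed
  moreover have "\<exists>F. finite F \<and> L\<^sup>2 - e < (\<Sum>k\<in>F. (wt s k * cmod (c k))\<^sup>2)" if e: "0 < e" for e
  proof -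
    have "L\<^sup>2 - e < (SUP F\<in>Collect finite. q F)" using e by (simp add: L2)
    then obtain F where "F \<in> Collect finite" "L\<^sup>2 - e < q F"
      using less_cSUP_iff[OF _ bdd] by blast
    thus ?thesis by (auto simp: q_def)
  qed
  ultimately show ?thesis using that by blast
qed

section \<open>From solutions of the mode system to strong solutions\<close>

lemma airy_phase_deriv:
  "((\<lambda>r. cis ((t - r) * of_int k ^ 3)) has_vector_derivative - (\<i> * of_int k ^ 3) * cis ((t - r) * of_int k ^ 3)) (at r)"
proof -
  have e: "cis ((t - r) * of_int k ^ 3) = cis (t * of_int k ^ 3) * cis (- (of_int k ^ 3) * r)" for r
    by (simp add: cis_mult algebra_simps)
  show ?thesis unfolding e
    by (rule has_vector_derivative_eq_rhs[OF has_vector_derivative_mult_right[OF cis_deriv]]) (simp add: mult_ac)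
qed

lemma asol_norm_continuous:
  assumes c: "asol UNIV (\<lambda>_ _. 0) c" and A: "\<And>t. hb 2 (c t) A" "0 < A" and s: "2 \<le> s" and M: "hb s (c a) M"
    and e: "0 < e"
  shows "\<forall>\<^sub>F t in at a. hb s (\<lambda>k. c t k - c a k) e"
proof -
  obtain L where L: "hb s (c a) L" "\<And>e. 0 < e \<Longrightarrow> \<exists>F. finite F \<and> L\<^sup>2 - e < (\<Sum>k\<in>F. (wt s k * cmod (c a k))\<^sup>2)"
    using hb_sharp[OF M] by blast
  show ?thesis by (rule solution_continuous[OF c A s L(1) L(2) e])
qed

text \<open>The terms \<open>f k r\<close> transport the solution at time \<open>r\<close> to time
  \<open>t\<close> by the linear flow. The dispersive parts cancel in their derivative, leaving
  \<open>6 * g k r\<close>, and the Duhamel formula is the fundamental theorem of calculus for their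
  sum \<open>H\<close> between 0 and \<open>t\<close>.\<close>

lemma ser_duhamel:
  assumes s: "2 \<le> s" and c: "asol UNIV (\<lambda>_ _. 0) c" and A: "\<And>t. hb 2 (c t) A" "0 < A"
    and c0: "c 0 = fourier_coeff u0" and \<phi>: "test_function \<phi>"
  shows "pairing (ser (c t)) \<phi> = airy_propagator t u0 \<phi> +
    6 * (LBINT r=ereal 0..ereal t. airy_propagator (t - r) (nonlinearity (ser (c r))) \<phi>)"
proof -
  obtain C where C: "0 \<le> C" "\<And>k. cmod (pk \<phi> k) \<le> C * (inverse (br k))\<^sup>2" using pk_decay[OF \<phi>] by blast
  have c\<phi>: "continuous_on UNIV \<phi>" by (rule test_function_derivatives[OF \<phi>]) metis
  define f where "f k r = c r k * cis ((t - r) * of_int k ^ 3) * pk \<phi> k" for k r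
  define g where "g k r = nl (c r) k * cis ((t - r) * of_int k ^ 3) * pk \<phi> k" for k r
  \<comment> \<open>One constant for both series: the modes are at most \<open>A\<close>, and six
    times the nonlinearity is at most \<open>6 * 4 * A^3\<close> by \<open>nl_hb1\<close>.\<close>
  define B where "B = A + 24 * A ^ 3"
  define M where "M k = B * C * (inverse (br k))\<^sup>2" for k
  have B0: "0 \<le> B" using A(2) by (simp add: B_def)
  have M: "M summable_on UNIV" unfolding M_def using B0 C(1) by (intro inverse_br_squared_summable) simp
  have cA: "cmod (c r k) \<le> B" for r k using hb_pointwise0[OF A(1), of r k] A(2) by (simp add: B_def add_increasing2)
  have nA: "6 * cmod (nl (c r) k) \<le> B" for r k
    using hb_pointwise0[OF nl_hb1[OF A(1)], of r k] A(2) by (simp add: B_def)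
  have bd: "z * cmod (pk \<phi> k) \<le> M k" if "0 \<le> z" "z \<le> B" for z k
    using mult_mono[OF that(2) C(2)[of k] B0] by (simp add: M_def mult.assoc)
  have fM: "cmod (f k r) \<le> M k" for k r
    unfolding f_def norm_mult norm_cis mult_1_right by (rule bd[OF norm_ge_zero cA])
  have gM: "cmod (6 * g k r) \<le> M k" for k r
    using bd[OF _ nA, of r k k] by (simp add: g_def norm_mult)
  have gM': "cmod (g k r) \<le> M k" for k r
  proof -
    have "cmod (6 * g k r) = 6 * cmod (g k r)" by (simp add: norm_mult)
    thus ?thesis using gM[of k r] norm_ge_zero[of "g k r"] by linarith
  qed
  have d: "(f k has_vector_derivative 6 * g k r) (at r)" for k r
  proof -
    have "((\<lambda>r. c r k * cis ((t - r) * of_int k ^ 3) * pk \<phi> k) has_vector_derivative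
      (c r k * (- (\<i> * of_int k ^ 3) * cis ((t - r) * of_int k ^ 3)) +
       (\<i> * of_int k ^ 3 * c r k + 6 * nl (c r) k + 0) * cis ((t - r) * of_int k ^ 3)) * pk \<phi> k) (at r)"
      by (rule has_vector_derivative_mult_left[OF has_vector_derivative_mult[OF asolD[OF c UNIV_I] airy_phase_deriv]])
    moreover have "(c r k * (- (\<i> * of_int k ^ 3) * cis ((t - r) * of_int k ^ 3)) +
       (\<i> * of_int k ^ 3 * c r k + 6 * nl (c r) k + 0) * cis ((t - r) * of_int k ^ 3)) * pk \<phi> k = 6 * g k r"
      unfolding g_def by algebra
    ultimately show ?thesis unfolding f_def by simp
  qed
  define H where "H r = (\<Sum>\<^sub>\<infinity>k. f k r)" for r
  define G where "G r = (\<Sum>\<^sub>\<infinity>k. g k r)" for r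
  have Hd: "(H has_vector_derivative 6 * G r) (at r)" for r
  proof -
    have "((\<lambda>r. \<Sum>\<^sub>\<infinity>k. f k r) has_vector_derivative (\<Sum>\<^sub>\<infinity>k. 6 * g k r)) (at r within UNIV)"
      by (rule series_deriv[where M = M, OF convex_UNIV UNIV_I M]) (rule d fM gM)+
    thus ?thesis unfolding H_def G_def infsum_cmult_right' by simp
  qed
  have nlc: "isCont (\<lambda>r. nl (c r) k) r" for k r
  proof (rule nl_continuous_at[OF open_UNIV UNIV_I A(1)])
    fix e :: real assume "0 < e"
    from asol_norm_continuous[OF c A order_refl A(1) this]
    show "\<forall>\<^sub>F q in at r. \<forall>k. cmod (c q k - c r k) \<le> e"
      by (rule eventually_mono) (use hb_pointwise0 in fastforce)
  qed
  have Gc: "continuous_on UNIV G" unfolding G_def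
  proof (rule series_continuous[OF M])
    show "continuous_on UNIV (g k)" for k
      unfolding g_def[abs_def]
      by (intro continuous_intros continuous_at_imp_continuous_on ballI nlc)
  qed (rule gM')
  have airy: "airy_propagator (t - r) (nonlinearity (ser (c r))) \<phi> = G r" for r
  proof -
    have a: "a1 (c r) (2 * A)" by (rule hb_a1[OF A(1) order_refl])
    have e: "fourier_coeff (ser (c r)) = c r" using fourier_coeff_ser[OF a] by (simp add: fun_eq_iff)
    have "fourier_coeff (nonlinearity (ser (c r))) = nl (fourier_coeff (ser (c r)))"
      by (rule nonlinearity_coeff[OF ser_L2[OF a]]) (unfold e, rule A(1))
    hence "fourier_coeff (nonlinearity (ser (c r))) = nl (c r)" unfolding e .
    thus ?thesis unfolding airy_propagator_pk by (simp add: G_def g_def)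
  qed
  have "(LBINT r=ereal 0..ereal t. G r) = (1 / 6) * H t - (1 / 6) * H 0"
  proof (rule interval_integral_FTC_finite)
    show "continuous_on {min 0 t..max 0 t} G" by (rule continuous_on_subset[OF Gc]) simp
    have "((\<lambda>r. (1 / 6) * H r) has_vector_derivative (1 / 6) * (6 * G r)) (at r)" for r
      by (rule has_vector_derivative_mult_right[OF Hd])
    thus "((\<lambda>r. (1 / 6) * H r) has_vector_derivative G r) (at r within {min 0 t..max 0 t})" for r
      by (simp add: has_vector_derivative_at_within)
  qed
  hence I: "6 * (LBINT r=ereal 0..ereal t. G r) = H t - H 0" by (simp only:) (simp add: algebra_simps)
  have "H 0 = airy_propagator t u0 \<phi>" unfolding airy_propagator_pk H_def f_def c0 by simp
  moreover have "H t = pairing (ser (c t)) \<phi>"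
  proof -
    have e: "f k t = c t k * pk \<phi> k" for k by (simp add: f_def)
    have "(\<lambda>k. f k t) summable_on UNIV" by (rule dominated_summable(2)[OF M fM])
    from pairing_ser[OF hb_a1[OF A(1) order_refl] c\<phi> this[unfolded e]]
    show ?thesis unfolding H_def e by simp
  qed
  ultimately show ?thesis unfolding airy I by simp
qed

lemma strong_solution_ser:
  assumes s: "2 \<le> s" and c: "asol UNIV (\<lambda>_ _. 0) c" and A: "\<And>t. hb 2 (c t) A" "0 < A"
    and M: "\<And>t. hb s (c t) (M t)" and c0: "c 0 = fourier_coeff u0"
  shows "strong_solution s UNIV u0 (\<lambda>t. ser (c t))"
proof -
  have "((\<lambda>t. sobolev_norm s (\<lambda>x. ser (c t) x - ser (c a) x)) \<longlongrightarrow> 0) (at a)" for a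
  proof (rule tendstoI)
    fix e :: real assume e: "0 < e"
    define \<epsilon> where "\<epsilon> = e / (2 * sqrt (2 * pi))"
    have "0 < \<epsilon>" using e by (simp add: \<epsilon>_def)
    from asol_norm_continuous[OF c A s M this]
    show "\<forall>\<^sub>F t in at a. dist (sobolev_norm s (\<lambda>x. ser (c t) x - ser (c a) x)) 0 < e"
    proof (rule eventually_mono)
      fix t assume h: "hb s (\<lambda>k. c t k - c a k) \<epsilon>"
      have "(\<lambda>x. ser (c t) x - ser (c a) x) = ser (\<lambda>k. c t k - c a k)"
        using ser_diff[OF hb_a1[OF M s] hb_a1[OF M s], of t a] by (simp add: fun_eq_iff)
      hence "sobolev_norm s (\<lambda>x. ser (c t) x - ser (c a) x) \<le> sqrt (2 * pi) * \<epsilon>" using sobolev_ser(2)[OF s h] by simp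
      also have "\<dots> < e" using e by (simp add: \<epsilon>_def)
      finally show "dist (sobolev_norm s (\<lambda>x. ser (c t) x - ser (c a) x)) 0 < e"
        using sobolev_norm_nonneg by (simp add: dist_real_def)
    qed
  qed
  moreover have "ser (c t) \<in> sobolev s" for t by (rule sobolev_ser(1)[OF s M])
  moreover note ser_duhamel[OF s c A c0]
  ultimately show ?thesis unfolding strong_solution_def continuous_into_sobolev_def
    using s by (intro conjI ballI allI impI) auto
qed

section \<open>From strong solutions to solutions of the mode system\<close>

lemma local_bound_compact:
  assumes "compact S" and ex: "\<And>t. \<exists>U K. open U \<and> t \<in> U \<and> (\<forall>r\<in>U. hb s (c r) K)"
  obtains K where "\<And>r. r \<in> S \<Longrightarrow> hb s (c r) K"
proof -
  have "\<exists>p. \<forall>t. open (fst (p t)) \<and> t \<in> fst (p t) \<and> (\<forall>r\<in>fst (p t). hb s (c r) (snd (p t)))"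
    by (intro choice allI) (use ex in simp)
  then obtain p where p: "\<And>t. open (fst (p t))" "\<And>t. t \<in> fst (p t)" "\<And>t r. r \<in> fst (p t) \<Longrightarrow> hb s (c r) (snd (p t))"
    by blast
  obtain D where D: "finite D" "S \<subseteq> (\<Union>t\<in>D. fst (p t))"
    using compactE_image[OF assms(1), of S "\<lambda>t. fst (p t)"] p(1,2) by (metis UN_I subsetI)
  have "hb s (c r) (\<Sum>t\<in>D. snd (p t))" if rS: "r \<in> S" for r
  proof -
    obtain t where t: "t \<in> D" "r \<in> fst (p t)" using D(2) rS by blast
    show ?thesis
    proof (rule hb_mono[OF p(3)[OF t(2)] order_refl])
      show "snd (p t) \<le> (\<Sum>t\<in>D. snd (p t))"
        by (rule member_le_sum[OF t(1) _ D(1)]) (rule hb_nonneg[OF p(3)[OF p(2)]])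
    qed
  qed
  thus ?thesis using that by blast
qed

lemma continuous_into_sobolev_coeff:
  assumes s: "0 \<le> s" and v: "continuous_into_sobolev s UNIV v" and e: "0 < e"
  shows "\<forall>\<^sub>F r in at t. hb s (\<lambda>k. fourier_coeff (v r) k - fourier_coeff (v t) k) e"
proof -
  have vs: "v r \<in> sobolev s" for r using v by (simp add: continuous_into_sobolev_def)
  hence vL: "v r \<in> L2_torus" for r by (simp add: sobolev_def)
  have vi: "integrable MT (v r)" for r using L2_L1[OF vL] by (simp add: L1_MT)
  define N where "N r = sobolev_norm s (\<lambda>x. v r x - v t x)" for r
  have cd: "fourier_coeff (\<lambda>x. v r x - v t x) = (\<lambda>k. fourier_coeff (v r) k - fourier_coeff (v t) k)" for r
    using fourier_coeff_diff[OF vi vi] by (simp add: fun_eq_iff)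
  \<comment> \<open>The Sobolev norm controls coefficients for members of the space only, being
    defined through a choice of Bessel potential; so membership of the difference comes
    first.\<close>
  have ds: "(\<lambda>x. v r x - v t x) \<in> sobolev s" for r
  proof (rule sobolev_upper(1)[OF s L2_torus_diff[OF vL vL]])
    show "hb s (fourier_coeff (\<lambda>x. v r x - v t x))
       (2 powr (s / 2) * (sobolev_norm s (v r) / sqrt (2 * pi)) + 2 powr (s / 2) * (sobolev_norm s (v t) / sqrt (2 * pi)))"
      unfolding cd by (rule hb_diff[OF sobolev_lower[OF s vs] sobolev_lower[OF s vs]])
  qed
  have N: "hb s (\<lambda>k. fourier_coeff (v r) k - fourier_coeff (v t) k) (2 powr (s / 2) * (N r / sqrt (2 * pi)))" for r
    using sobolev_lower[OF s ds[of r]] unfolding cd N_def .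
  have "(N \<longlongrightarrow> 0) (at t)" using v unfolding N_def continuous_into_sobolev_def by simp
  hence "((\<lambda>r. 2 powr (s / 2) * (N r / sqrt (2 * pi))) \<longlongrightarrow> 2 powr (s / 2) * (0 / sqrt (2 * pi))) (at t)"
    by (intro tendsto_intros) simp_all
  hence "\<forall>\<^sub>F r in at t. 2 powr (s / 2) * (N r / sqrt (2 * pi)) < e" using e by (intro order_tendstoD) auto
  thus ?thesis by (rule eventually_mono) (rule hb_mono[OF N order_refl], simp)
qed

text \<open>Testing the Duhamel formula against a single mode gives the integrated Fourier side equation.\<close>

lemma strong_solution_modes:
  assumes s: "2 \<le> s" and v: "strong_solution s UNIV u0 v"
  shows "asol UNIV (\<lambda>_ _. 0) (\<lambda>t. fourier_coeff (v t))" "fourier_coeff (v 0) = fourier_coeff u0"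
    "\<exists>K. \<forall>r\<in>{a..b}. hb 2 (fourier_coeff (v r)) K"
proof -
  define c where "c t = fourier_coeff (v t)" for t
  have vc: "continuous_into_sobolev s UNIV v" using v by (simp add: strong_solution_def)
  have vs: "v r \<in> sobolev s" for r using vc by (simp add: continuous_into_sobolev_def)
  have s0: "0 \<le> s" using s by simp
  have vL: "v r \<in> L2_torus" for r using vs[of r] by (simp add: sobolev_def)
  have cs: "\<exists>M. hb s (c r) M" for r unfolding c_def using sobolev_lower[OF s0 vs] by blast
  have near: "\<forall>\<^sub>F r in at t. hb s (\<lambda>k. c r k - c t k) e" if "0 < e" for t e
    unfolding c_def by (rule continuous_into_sobolev_coeff[OF s0 vc that])
  have loc: "\<exists>U K. open U \<and> t \<in> U \<and> (\<forall>r\<in>U. hb 2 (c r) K)" for t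
  proof -
    obtain M where M: "hb s (c t) M" using cs by blast
    obtain U where U: "open U" "t \<in> U" "\<And>r. r \<in> U \<Longrightarrow> r \<noteq> t \<Longrightarrow> hb s (\<lambda>k. c r k - c t k) 1"
      using near[OF zero_less_one, of t] unfolding eventually_at_topological by blast
    have "hb 2 (c r) (1 + M)" if "r \<in> U" for r
    proof (cases "r = t")
      case True
      thus ?thesis using hb_mono[OF M s, of "1 + M"] by simp
    next
      case False
      have "hb s (c r) (1 + M)"
        by (rule hb_triangle[OF U(3)[OF that False] M]) (metis norm_triangle_sub add.commute)
      thus ?thesis by (rule hb_mono[OF _ s order_refl])
    qed
    thus ?thesis using U by blast
  qed
  obtain K where "\<And>r. r \<in> {a..b} \<Longrightarrow> hb 2 (c r) K" by (rule local_bound_compact[OF compact_Icc loc]) blast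
  thus "\<exists>K. \<forall>r\<in>{a..b}. hb 2 (fourier_coeff (v r)) K" unfolding c_def by blast
  have nlc: "isCont (\<lambda>r. nl (c r) k) t" for k t
  proof -
    obtain U K where U: "open U" "t \<in> U" "\<And>r. r \<in> U \<Longrightarrow> hb 2 (c r) K" using loc[of t] by blast
    show ?thesis
    proof (rule nl_continuous_at[OF U])
      fix e :: real assume "0 < e"
      from near[OF this] show "\<forall>\<^sub>F q in at t. \<forall>k. cmod (c q k - c t k) \<le> e"
        by (rule eventually_mono) (use hb_pointwise0[OF _ s0] in fastforce)
    qed
  qed
  \<comment> \<open>The phase depending on \<open>t\<close> is pulled out of the Duhamel integral,
    so that the integrand \<open>J k\<close> no longer depends on \<open>t\<close> and the product
    rule gives the mode equation.\<close>
  define J where "J k r = nl (c r) k * cis (- (of_int k ^ 3) * r)" for k r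
  have Jc: "continuous_on UNIV (J k)" for k
    unfolding J_def[abs_def] by (intro continuous_intros continuous_at_imp_continuous_on ballI nlc)
  have J0: "oint (J k) 0 = 0" for k by (simp add: oint_def)
  have mode: "c t k = cis (of_int k ^ 3 * t) * (fourier_coeff u0 k + 6 * oint (J k) t)" for t k
  proof -
    have nlf: "fourier_coeff (nonlinearity (v r)) = nl (c r)" for r
    proof -
      obtain K where "hb 2 (c r) K" using loc[of r] by blast
      thus ?thesis unfolding c_def by (rule nonlinearity_coeff[OF vL])
    qed
    define z where "z = 2 * of_real pi * cis (t * of_int k ^ 3)"
    have ph: "cis ((t - r) * of_int k ^ 3) = cis (t * of_int k ^ 3) * cis (- (of_int k ^ 3) * r)" for r
      by (simp add: cis_mult algebra_simps)
    have ai: "airy_propagator (t - r) (nonlinearity (v r)) (\<lambda>x. cis (of_int (- k) * x)) = z * J k r" for r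
      unfolding airy_propagator_mode nlf ph J_def z_def by (simp only: mult_ac)
    have "pairing (v t) (\<lambda>x. cis (of_int (- k) * x)) = airy_propagator t u0 (\<lambda>x. cis (of_int (- k) * x)) +
        6 * (LBINT r=ereal 0..ereal t. airy_propagator (t - r) (nonlinearity (v r)) (\<lambda>x. cis (of_int (- k) * x)))"
      using v test_function_cis[of "- k"] unfolding strong_solution_def by blast
    hence 1: "2 * of_real pi * c t k = 2 * of_real pi * (fourier_coeff u0 k * cis (t * of_int k ^ 3)) +
        6 * (LBINT r=ereal 0..ereal t. z * J k r)"
      unfolding ai unfolding airy_propagator_mode pairing_cis c_def by (simp only: minus_minus)
    have "(LBINT r=ereal 0..ereal t. z * J k r) = z * oint (J k) t - z * oint (J k) 0"
    proof (rule interval_integral_FTC_finite)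
      show "continuous_on {min 0 t..max 0 t} (\<lambda>r. z * J k r)"
        by (intro continuous_on_mult continuous_on_const continuous_on_subset[OF Jc]) simp
      show "((\<lambda>r. z * oint (J k) r) has_vector_derivative z * J k r) (at r within {min 0 t..max 0 t})" for r
        by (rule has_vector_derivative_at_within[OF has_vector_derivative_mult_right[OF oint_deriv[OF Jc]]])
    qed
    hence 2: "(LBINT r=ereal 0..ereal t. z * J k r) = z * oint (J k) t" unfolding J0 by (simp only: mult_zero_right diff_zero)
    have 3: "(2 * complex_of_real pi) * c t k =
       (2 * of_real pi) * (cis (of_int k ^ 3 * t) * (fourier_coeff u0 k + 6 * oint (J k) t))"
      using 1 unfolding 2 unfolding z_def by (simp only:) (simp add: algebra_simps)
    have "2 * complex_of_real pi \<noteq> 0" by simp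
    thus ?thesis using 3 by (simp only: mult_cancel_left) blast
  qed
  show "fourier_coeff (v 0) = fourier_coeff u0"
  proof
    fix k show "fourier_coeff (v 0) k = fourier_coeff u0 k" using mode[of 0 k] by (simp add: c_def J0)
  qed
  have "asol UNIV (\<lambda>_ _. 0) c" unfolding asol_def
  proof (intro ballI allI)
    fix t :: real and k :: int
    define w where "w r = fourier_coeff u0 k + 6 * oint (J k) r" for r
    have "((\<lambda>r. cis (of_int k ^ 3 * r) * w r) has_vector_derivative
      (cis (of_int k ^ 3 * t) * (0 + 6 * J k t) + (\<i> * of_real (of_int k ^ 3) * cis (of_int k ^ 3 * t)) * w t)) (at t)"
      unfolding w_def
      by (intro has_vector_derivative_mult cis_deriv has_vector_derivative_add has_vector_derivative_const
          has_vector_derivative_mult_right oint_deriv[OF Jc])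
    moreover have "cis (of_int k ^ 3 * t) * (0 + 6 * J k t) + (\<i> * of_real (of_int k ^ 3) * cis (of_int k ^ 3 * t)) * w t =
        \<i> * of_int k ^ 3 * c t k + 6 * nl (c t) k + 0"
    proof -
      have "cis (of_int k ^ 3 * t) * J k t = nl (c t) k * (cis (of_int k ^ 3 * t) * cis (- (of_int k ^ 3) * t))"
        by (simp only: J_def mult_ac)
      also have "\<dots> = nl (c t) k" unfolding cis_mult by simp
      finally have a: "cis (of_int k ^ 3 * t) * J k t = nl (c t) k" .
      have b: "cis (of_int k ^ 3 * t) * w t = c t k" unfolding w_def mode[of t k] ..
      have "cis (of_int k ^ 3 * t) * (0 + 6 * J k t) + (\<i> * of_real (of_int k ^ 3) * cis (of_int k ^ 3 * t)) * w t =
         6 * (cis (of_int k ^ 3 * t) * J k t) + \<i> * of_real (of_int k ^ 3) * (cis (of_int k ^ 3 * t) * w t)"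
        by (simp add: algebra_simps)
      thus ?thesis unfolding a b by simp
    qed
    ultimately show "((\<lambda>r. c r k) has_vector_derivative \<i> * of_int k ^ 3 * c t k + 6 * nl (c t) k + 0) (at t within UNIV)"
      unfolding w_def mode[symmetric] by (simp only:)
  qed
  thus "asol UNIV (\<lambda>_ _. 0) (\<lambda>t. fourier_coeff (v t))" unfolding c_def .
qed

theorem corollary1p3:
  fixes s :: real and u0 :: "real \<Rightarrow> complex"
  assumes "s \<ge> 2" and "u0 \<in> sobolev s"
  shows "\<exists>u. strong_solution s UNIV u0 u \<and>
           (\<forall>v. strong_solution s UNIV u0 v \<longrightarrow> (\<forall>t. AE x in lebesgue. v t x = u t x)) \<and>
           (\<exists>C>0. \<forall>t. sobolev_norm s (u t) \<le> C * exp (C * \<bar>t\<bar>))"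
proof -
  have s: "2 \<le> s" and s0: "0 \<le> s" using assms(1) by auto
  obtain M where M: "hb s (fourier_coeff u0) M" using sobolev_lower[OF s0 assms(2)] by blast
  have M0: "0 \<le> M" by (rule hb_nonneg[OF M])
  \<comment> \<open>The added 1 makes \<open>K\<close> positive also for zero data; the lifespan is
    a quotient by \<open>K^2\<close>.\<close>
  define K where "K = M + 1"
  have K: "hb 2 (fourier_coeff u0) K" "0 < K" using hb_mono[OF M s, of K] M0 by (simp_all add: K_def)
  define A where "A = apriori K"
  have A0: "0 < A" using apriori_ge[of K] K(2) by (simp add: A_def)
  define G where "G = growth s A"
  have G0: "0 \<le> G" unfolding G_def by (rule growth_nonneg[OF s0])
  obtain c where c: "c 0 = fourier_coeff u0" "asol UNIV (\<lambda>_ _. 0) c"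
    and cA: "\<And>t. hb 2 (c t) A" and cs: "\<And>t. hb s (c t) (M * exp (G * \<bar>t\<bar>))"
    using global_existence[OF K s M] unfolding A_def G_def by blast
  have sol: "strong_solution s UNIV u0 (\<lambda>t. ser (c t))"
    by (rule strong_solution_ser[OF s c(2) cA A0 cs c(1)])
  have uniq: "AE x in lebesgue. v t x = ser (c t) x" if v: "strong_solution s UNIV u0 v" for v t
  proof -
    \<comment> \<open>The competitor \<open>v\<close> carries H^2 bounds on compact time intervals
      only, so uniqueness is applied on the interval from \<open>- T\<close> to \<open>T\<close>,
      which just reaches \<open>t\<close>.\<close>
    define T where "T = \<bar>t\<bar>"
    note vm = strong_solution_modes[OF s v]
    obtain L where L: "\<And>r. r \<in> {- T..T} \<Longrightarrow> hb 2 (fourier_coeff (v r)) L" using vm(3) by blast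
    have "fourier_coeff (v t) = c t"
    proof (rule uniqueness[where I = "{- T..T}" and a = 0 and K = "max L A" and u = "\<lambda>t. fourier_coeff (v t)" and v = c])
      show "asol {- T..T} (\<lambda>_ _. 0) (\<lambda>t. fourier_coeff (v t))" by (rule asol_subset[OF vm(1)]) simp
      show "asol {- T..T} (\<lambda>_ _. 0) c" by (rule asol_subset[OF c(2)]) simp
      show "hb 2 (fourier_coeff (v r)) (max L A)" if "r \<in> {- T..T}" for r by (rule hb_mono[OF L[OF that]]) auto
      show "hb 2 (c r) (max L A)" for r by (rule hb_mono[OF cA]) auto
      show "fourier_coeff (v 0) = c 0" by (simp only: vm(2) c(1))
    qed (auto simp: T_def is_interval_cc)
    moreover have a: "a1 (c t) (2 * A)" by (rule hb_a1[OF cA order_refl])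
    moreover have "v t \<in> L2_torus"
      using v by (auto simp: strong_solution_def continuous_into_sobolev_def sobolev_def)
    ultimately show ?thesis
      by (intro L1_fourier_unique[OF L2_L1 ser_L1[OF a]]) (simp_all add: fourier_coeff_ser[OF a])
  qed
  \<comment> \<open>A single constant has to dominate both the prefactor and the exponent, and to be
    positive for zero data as well.\<close>
  define C where "C = sqrt (2 * pi) * M + G + 1"
  have C: "sqrt (2 * pi) * M \<le> C" "G \<le> C" "0 < C" using M0 G0 by (auto simp: C_def add_nonneg_pos)
  have "sobolev_norm s (ser (c t)) \<le> C * exp (C * \<bar>t\<bar>)" for t
  proof -
    have "sobolev_norm s (ser (c t)) \<le> (sqrt (2 * pi) * M) * exp (G * \<bar>t\<bar>)"
      using sobolev_ser(2)[OF s cs[of t]] by (simp only: mult.assoc)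
    also have "\<dots> \<le> C * exp (C * \<bar>t\<bar>)"
      using C by (intro mult_mono) (auto intro: mult_right_mono)
    finally show ?thesis .
  qed
  thus ?thesis using sol uniq C(3) by (intro exI[of _ "\<lambda>t. ser (c t)"]) blast
qed

end
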